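(* Let $T>0$, let $(\Omega,\mathcal F,P)$ be a probability space with a filtration $\mathbb F=(\mathcal F_t)_{t\in[0,T]}$ satisfying the usual conditions, and let $B$ be a one-dimensional $\mathbb F$-Brownian motion. Let $a_1,a_2,\rho_1,\rho_2$ be strictly positive constants, and let $\mathcal A$ be the associated operator defined in the context. Let $b,\sigma:\Omega\times[0,T]\times\mathbb R\times\mathbb R\to\mathbb R$ be coefficients for which there is a constant $L>0$ such that, for all $(t,x)\in[0,T]\times\mathbb R$ and all $y,y'\in\mathbb R$, $$|b(t,x,y)-b(t,x,y')|\vee|\sigma(t,x,y)-\sigma(t,x,y')|\le L|y-y'|,\qquad |b(t,x,y)|\vee|\sigma(t,x,y)|\le L(1+|y|).$$ Let $\xi:\mathbb R\to\mathbb R$ be non-random, measurable and bounded. Then there exists a unique mild solution $Y=\{Y(t,x):(t,x)\in[0,T]\times\mathbb R\}$ of the SPDE $$dY(t,x)=\mathcal A Y(t,x)\,dt+b(t,x,Y(t,x))\,dt+\sigma(t,x,Y(t,x))\,dB(t),\quad (t,x)\in[0,T]\times\mathbb R,\qquad Y(0,x)=\xi(x),\quad x\in\mathbb R.$$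
   Context: Operator: $\mathcal A=\frac{1}{2\rho(x)}\frac{d}{dx}\left(a(x)\rho(x)\frac{d}{dx}\right)$ with $a(x)=a_1\mathbf 1_{\{x\le 0\}}+a_2\mathbf 1_{\{x>0\}}$ and $\rho(x)=\rho_1\mathbf 1_{\{x\le 0\}}+\rho_2\mathbf 1_{\{x>0\}}$, where $\frac{d}{dx}$ is the derivative in the distributional sense. Kernel: $G$ is the fundamental solution of the deterministic equation $\partial_t Y=\mathcal A Y$, given explicitly by $$G(t-s,x,z)=\frac{\mathbf 1_{\{t>s\}}}{\sqrt{2\pi(t-s)}}\left(\frac{\mathbf 1_{\{z\le0\}}}{\sqrt{a_1}}+\frac{\mathbf 1_{\{z>0\}}}{\sqrt{a_2}}\right)\left\{\exp\left(-\frac{(h(x)-h(z))^2}{2(t-s)}\right)+\lambda\,\mathrm{sign}(z)\exp\left(-\frac{(|h(x)|+|h(z)|)^2}{2(t-s)}\right)\right\},$$ where $\lambda=\frac{\rho_2\sqrt{a_2}-\rho_1\sqrt{a_1}}{\rho_2\sqrt{a_2}+\rho_1\sqrt{a_1}}$, $h(z)=\frac{z}{\sqrt{a_1}}\mathbf 1_{\{z\le0\}}+\frac{z}{\sqrt{a_2}}\mathbf 1_{\{z>0\}}$, and $\mathrm{sign}(z)=-1$ if $z\le0$, $\mathrm{sign}(z)=1$ if $z>0$. Mild solution: a stochastic process $Y$ satisfying $$Y(t,x)=\int_{\mathbb R}G(t,x,z)\xi(z)\,dz+\int_0^t\int_{\mathbb R}G(t-s,x,z)\,b(s,z,Y(s,z))\,dz\,ds+\int_0^t\int_{\mathbb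 R}G(t-s,x,z)\,\sigma(s,z,Y(s,z))\,dz\,dB_s,$$ where the integral with respect to $dB_s$ is the classical Itô integral with respect to the one-dimensional Brownian motion $B$. Uniqueness is understood in the sense that any two mild solutions are modifications of one another. *)

theory Defs
  imports "HOL-Probability.Probability"
begin

section \<open>Fundamental solution\<close>

definition h_fun :: "real \<Rightarrow> real \<Rightarrow> real \<Rightarrow> real" where
  "h_fun a1 a2 z = z / sqrt a1 * indicator {..0} z + z / sqrt a2 * indicator {0<..} z"

text \<open>Unlike the library's \<^const>\<open>sgn\<close>, this sign is \<open>-1\<close> at the origin.\<close>

definition lsign :: "real \<Rightarrow> real" where
  "lsign z = (if z \<le> 0 then -1 else 1)"

definition lam :: "real \<Rightarrow> real \<Rightarrow> real \<Rightarrow> real \<Rightarrow> real" where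
  "lam a1 a2 \<rho>1 \<rho>2 = (\<rho>2 * sqrt a2 - \<rho>1 * sqrt a1) / (\<rho>2 * sqrt a2 + \<rho>1 * sqrt a1)"

text \<open>
  Fundamental solution of \<open>\<partial>\<^sub>t Y = A Y\<close> for the operator
  \<open>A = 1/(2\<rho>) d/dx (a \<rho> d/dx)\<close>, where \<open>a\<close> and \<open>\<rho>\<close> equal
  \<open>a1\<close>, \<open>\<rho>1\<close> on \<open>x \<le> 0\<close> and \<open>a2\<close>, \<open>\<rho>2\<close> on \<open>x > 0\<close>.
  The first real argument is the elapsed time; the kernel vanishes for nonpositive elapsed time.
\<close>

definition G :: "real \<Rightarrow> real \<Rightarrow> real \<Rightarrow> real \<Rightarrow> real \<Rightarrow> real \<Rightarrow> real \<Rightarrow> real" where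
  "G a1 a2 \<rho>1 \<rho>2 t x z =
     indicator {0<..} t / sqrt (2 * pi * t)
     * (indicator {..0} z / sqrt a1 + indicator {0<..} z / sqrt a2)
     * (exp (- ((h_fun a1 a2 x - h_fun a1 a2 z)\<^sup>2 / (2 * t)))
        + lam a1 a2 \<rho>1 \<rho>2 * lsign z
          * exp (- ((\<bar>h_fun a1 a2 x\<bar> + \<bar>h_fun a1 a2 z\<bar>)\<^sup>2 / (2 * t))))"


section \<open>Filtrations, Brownian motion, progressive measurability\<close>

text \<open>
  Only the \<open>\<sigma>\<close>-algebras \<open>F t\<close> with \<open>0 \<le> t \<le> T\<close> matter,
  which is why the library's locale for filtrations over a whole index type is not used.
\<close>

definition usual_filtration :: "'a measure \<Rightarrow> real \<Rightarrow> (real \<Rightarrow> 'a measure) \<Rightarrow> bool" where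
  "usual_filtration M T F \<longleftrightarrow>
     (\<forall>t\<in>{0..T}. subalgebra M (F t)) \<and>
     (\<forall>s\<in>{0..T}. \<forall>t\<in>{s..T}. sets (F s) \<subseteq> sets (F t)) \<and>
     (\<forall>t\<in>{0..<T}. sets (F t) = (\<Inter>s\<in>{t<..T}. sets (F s))) \<and>
     (\<forall>N\<in>null_sets M. \<forall>A\<subseteq>N. A \<in> sets (F 0))"

definition brownian_motion ::
  "'a measure \<Rightarrow> real \<Rightarrow> (real \<Rightarrow> 'a measure) \<Rightarrow> (real \<Rightarrow> 'a \<Rightarrow> real) \<Rightarrow> bool" where
  "brownian_motion M T F B \<longleftrightarrow>
     (\<forall>t\<in>{0..T}. B t \<in> borel_measurable (F t)) \<and>
     (AE \<omega> in M. B 0 \<omega> = 0) \<and>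
     (AE \<omega> in M. continuous_on {0..T} (\<lambda>t. B t \<omega>)) \<and>
     (\<forall>s t. 0 \<le> s \<and> s < t \<and> t \<le> T \<longrightarrow>
        distributed M lborel (\<lambda>\<omega>. B t \<omega> - B s \<omega>) (normal_density 0 (sqrt (t - s))) \<and>
        prob_space.indep_set M (sets (F s))
          {(\<lambda>\<omega>. B t \<omega> - B s \<omega>) -` A \<inter> space M | A. A \<in> sets borel})"

definition progressive ::
  "real \<Rightarrow> (real \<Rightarrow> 'a measure) \<Rightarrow> (real \<Rightarrow> 'a \<Rightarrow> real) \<Rightarrow> bool" where
  "progressive T F H \<longleftrightarrow>
     (\<forall>t\<in>{0..T}. (\<lambda>(\<omega>, s). H s \<omega>) \<in> borel_measurable (F t \<Otimes>\<^sub>M restrict_space borel {0..t}))"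

definition progressive_field ::
  "real \<Rightarrow> (real \<Rightarrow> 'a measure) \<Rightarrow> (real \<Rightarrow> real \<Rightarrow> 'a \<Rightarrow> real) \<Rightarrow> bool" where
  "progressive_field T F Y \<longleftrightarrow>
     (\<forall>t\<in>{0..T}. (\<lambda>(\<omega>, s, x). Y s x \<omega>)
        \<in> borel_measurable (F t \<Otimes>\<^sub>M restrict_space borel {0..t} \<Otimes>\<^sub>M borel))"

definition progressive_coefficient ::
  "real \<Rightarrow> (real \<Rightarrow> 'a measure) \<Rightarrow> ('a \<Rightarrow> real \<Rightarrow> real \<Rightarrow> real \<Rightarrow> real) \<Rightarrow> bool" where
  "progressive_coefficient T F f \<longleftrightarrow>
     (\<forall>t\<in>{0..T}. (\<lambda>(\<omega>, s, x, y). f \<omega> s x y)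
        \<in> borel_measurable (F t \<Otimes>\<^sub>M restrict_space borel {0..t} \<Otimes>\<^sub>M borel \<Otimes>\<^sub>M borel))"


section \<open>It\^o integral\<close>

definition tendsto_in_prob ::
  "'a measure \<Rightarrow> (nat \<Rightarrow> 'a \<Rightarrow> real) \<Rightarrow> ('a \<Rightarrow> real) \<Rightarrow> bool" where
  "tendsto_in_prob M X Z \<longleftrightarrow>
     (\<forall>\<epsilon>>0. (\<lambda>k. measure M {\<omega>\<in>space M. \<bar>X k \<omega> - Z \<omega>\<bar> > \<epsilon>}) \<longlonglongrightarrow> 0)"

text \<open>
  The triple \<open>n\<close>, \<open>p\<close>, \<open>\<eta>\<close> encodes the simple process that equals \<open>\<eta> i\<close>, bounded and
  measurable with respect to \<open>F (p i)\<close>, on the interval from \<open>p i\<close> (exclusive) to \<open>p (i + 1)\<close>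
  (inclusive), for \<open>i < n\<close>.
\<close>

definition simple_integrand ::
  "'a measure \<Rightarrow> (real \<Rightarrow> 'a measure) \<Rightarrow> real \<Rightarrow> nat \<Rightarrow> (nat \<Rightarrow> real) \<Rightarrow> (nat \<Rightarrow> 'a \<Rightarrow> real) \<Rightarrow> bool" where
  "simple_integrand M F t n p \<eta> \<longleftrightarrow>
     0 \<le> p 0 \<and> (\<forall>i<n. p i \<le> p (Suc i)) \<and> p n \<le> t \<and>
     (\<forall>i<n. \<eta> i \<in> borel_measurable (F (p i)) \<and> (\<exists>C. \<forall>\<omega>\<in>space M. \<bar>\<eta> i \<omega>\<bar> \<le> C))"

definition simple_process ::
  "nat \<Rightarrow> (nat \<Rightarrow> real) \<Rightarrow> (nat \<Rightarrow> 'a \<Rightarrow> real) \<Rightarrow> real \<Rightarrow> 'a \<Rightarrow> real" where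
  "simple_process n p \<eta> s \<omega> = (\<Sum>i<n. \<eta> i \<omega> * indicator {p i<..p (Suc i)} s)"

definition simple_ito ::
  "(real \<Rightarrow> 'a \<Rightarrow> real) \<Rightarrow> nat \<Rightarrow> (nat \<Rightarrow> real) \<Rightarrow> (nat \<Rightarrow> 'a \<Rightarrow> real) \<Rightarrow> 'a \<Rightarrow> real" where
  "simple_ito B n p \<eta> \<omega> = (\<Sum>i<n. \<eta> i \<omega> * (B (p (Suc i)) \<omega> - B (p i) \<omega>))"

text \<open>
  \<open>has_ito_integral M F B t H J\<close>: the random variable \<open>J\<close> is (a version of) the It\^o integral
  of \<open>H\<close> against \<open>B\<close> over \<open>[0, t]\<close>. The integrands are the progressively measurable processes
  with almost surely square integrable paths; \<open>J\<close> is the limit in probability of the elementary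
  integrals of simple processes that approximate \<open>H\<close>. It is determined up to null sets and agrees
  with the \<open>L\<^sup>2\<close> construction when the expectation of \<open>\<integral> H\<^sup>2 ds\<close> is finite.
\<close>

definition has_ito_integral ::
  "'a measure \<Rightarrow> (real \<Rightarrow> 'a measure) \<Rightarrow> (real \<Rightarrow> 'a \<Rightarrow> real) \<Rightarrow> real
     \<Rightarrow> (real \<Rightarrow> 'a \<Rightarrow> real) \<Rightarrow> ('a \<Rightarrow> real) \<Rightarrow> bool" where
  "has_ito_integral M F B t H J \<longleftrightarrow>
     progressive t F H \<and>
     (AE \<omega> in M. set_integrable lborel {0..t} (\<lambda>s. (H s \<omega>)\<^sup>2)) \<and>
     J \<in> borel_measurable M \<and>
     (\<exists>n p \<eta>.
        (\<forall>k. simple_integrand M F t (n k) (p k) (\<eta> k)) \<and>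
        tendsto_in_prob M
          (\<lambda>k \<omega>. LINT s:{0..t}|lborel. (simple_process (n k) (p k) (\<eta> k) s \<omega> - H s \<omega>)\<^sup>2) (\<lambda>\<omega>. 0) \<and>
        tendsto_in_prob M (\<lambda>k. simple_ito B (n k) (p k) (\<eta> k)) J)"


section \<open>Mild solutions\<close>

text \<open>
  For each \<open>t > 0\<close> and \<open>x\<close>, the extended-valued conditions say that the iterated integrals
  against \<open>ds\<close> and \<open>dB\<^sub>s\<close> are well defined: the \<open>dz\<close>-integrals converge absolutely for almost
  every \<open>s\<close> and are integrable, respectively square integrable, in \<open>s\<close>. No moment bound on \<open>Y\<close>
  is imposed. The initial condition is stated separately because the kernel vanishes at \<open>t = 0\<close>,
  so that the integral equation is meaningful only for positive times.
\<close>

definition mild_solution ::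
  "'a measure \<Rightarrow> real \<Rightarrow> (real \<Rightarrow> 'a measure) \<Rightarrow> (real \<Rightarrow> 'a \<Rightarrow> real)
     \<Rightarrow> real \<Rightarrow> real \<Rightarrow> real \<Rightarrow> real
     \<Rightarrow> ('a \<Rightarrow> real \<Rightarrow> real \<Rightarrow> real \<Rightarrow> real) \<Rightarrow> ('a \<Rightarrow> real \<Rightarrow> real \<Rightarrow> real \<Rightarrow> real)
     \<Rightarrow> (real \<Rightarrow> real) \<Rightarrow> (real \<Rightarrow> real \<Rightarrow> 'a \<Rightarrow> real) \<Rightarrow> bool" where
  "mild_solution M T F B a1 a2 \<rho>1 \<rho>2 b \<sigma> \<xi> Y \<longleftrightarrow>
     progressive_field T F Y \<and>
     (\<forall>x. AE \<omega> in M. Y 0 x \<omega> = \<xi> x) \<and>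
     (\<forall>t\<in>{0<..T}. \<forall>x.
        integrable lborel (\<lambda>z. G a1 a2 \<rho>1 \<rho>2 t x z * \<xi> z) \<and>
        (AE \<omega> in M.
          (\<integral>\<^sup>+ s\<in>{0..t}. (\<integral>\<^sup>+ z. ennreal \<bar>G a1 a2 \<rho>1 \<rho>2 (t - s) x z * b \<omega> s z (Y s z \<omega>)\<bar> \<partial>lborel)
             \<partial>lborel) < \<infinity>) \<and>
        (AE \<omega> in M.
          (\<integral>\<^sup>+ s\<in>{0..t}. (\<integral>\<^sup>+ z. ennreal \<bar>G a1 a2 \<rho>1 \<rho>2 (t - s) x z * \<sigma> \<omega> s z (Y s z \<omega>)\<bar> \<partial>lborel)\<^sup>2
             \<partial>lborel) < \<infinity>) \<and>
        (\<exists>J. has_ito_integral M F B t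
               (\<lambda>s \<omega>. LINT z|lborel. G a1 a2 \<rho>1 \<rho>2 (t - s) x z * \<sigma> \<omega> s z (Y s z \<omega>)) J \<and>
             (AE \<omega> in M.
                Y t x \<omega> =
                  (LINT z|lborel. G a1 a2 \<rho>1 \<rho>2 t x z * \<xi> z)
                  + (LINT s:{0..t}|lborel. LINT z|lborel.
                       G a1 a2 \<rho>1 \<rho>2 (t - s) x z * b \<omega> s z (Y s z \<omega>))
                  + J \<omega>)))"

definition modifications ::
  "'a measure \<Rightarrow> real \<Rightarrow> (real \<Rightarrow> real \<Rightarrow> 'a \<Rightarrow> real) \<Rightarrow> (real \<Rightarrow> real \<Rightarrow> 'a \<Rightarrow> real) \<Rightarrow> bool" where
  "modifications M T Y Y' \<longleftrightarrow> (\<forall>t\<in>{0..T}. \<forall>x. AE \<omega> in M. Y t x \<omega> = Y' t x \<omega>)"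

end

theory Submission
  imports Defs
begin

text \<open>
  Existence. The kernel is nonnegative and dominated by a Gaussian in \<open>h\<close>, hence its total mass in \<open>z\<close>
  is bounded uniformly in \<open>t\<close> and \<open>x\<close>. By the It\^o isometry the Picard map is therefore a
  contraction for the supremum over \<open>x\<close> and \<open>t\<close> of \<open>exp (- \<beta> t)\<close> times the second moment. The
  iterates are versions of It\^o integrals that are jointly measurable in \<open>\<omega>\<close>, \<open>t\<close> and \<open>x\<close>, obtained
  as almost sure limits of fast approximations by simple processes.

  Uniqueness. Solutions carry no moment bound, so the differences \<open>D\<close> of the coefficients along two
  solutions are stopped when a clock reaches \<open>n\<close>; the clock accumulates the convolutions of \<open>\<bar>D\<bar>\<close>
  with the kernel at the single point \<open>(T, 0)\<close>, which are finite almost surely. In the weighted space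
  with weight \<open>exp (- (h x)\<^sup>2 / (T - t))\<close> every convolution of \<open>\<bar>D\<bar>\<close> at time \<open>t < T\<close> is controlled by the one at
  \<open>(T, 0)\<close>, because the product of two Gaussians integrates to a Gaussian. This makes the weighted
  second moment of the stopped difference of the solutions integrable over time, and since the kernel
  also acts boundedly between the weighted spaces, Gronwall's lemma makes it vanish. As \<open>n\<close> grows,
  the two solutions agree almost everywhere on \<open>[0, T] \<times> \<real>\<close>, so the right-hand sides of the two
  integral equations agree at every point.
\<close>

section \<open>The It\^o integral of simple processes\<close>

text \<open>Two features of the problem shape the uniqueness proof. Integrability of a solution is
  known only path by path and separately for each \<open>(t, x)\<close>; and the stochastic
  integrals at different \<open>t\<close> have different integrands, so they are not values of one
  process that could be stopped. Both are handled by the locality estimate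
  \<open>ito_localized_bound\<close>: on any event on which the difference of two integrands equals
  a process of finite energy, that energy bounds the difference of the integrals in mean square. The
  weight is the square of a Gaussian of variance \<open>T - t\<close> because a second moment
  contains two kernels, and each has to absorb one Gaussian factor to become the kernel ending at
  \<open>(T, 0)\<close>. The price is a factor of order \<open>(t - s)\<close> to the power -1/2,
  which is integrable in \<open>t\<close>; hence only time integrals of the weighted moment are
  known to be finite beforehand. The Gronwall step then rests on a Schur test in the weighted
  spaces: its two one-sided bounds carry the factors \<open>sqrt ((T - s) / (T - t))\<close> and its
  inverse, which cancel, so the constant does not blow up as \<open>t\<close> approaches
  \<open>T\<close>.\<close>

locale brownian_setup = prob_space M for M :: "'a measure" +
  fixes T :: real and F :: "real \<Rightarrow> 'a measure" and B :: "real \<Rightarrow> 'a \<Rightarrow> real"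
  assumes T_pos: "T > 0"
    and filtration: "usual_filtration M T F"
    and brownian: "brownian_motion M T F B"
begin

lemma subalgebra_F: "t \<in> {0..T} \<Longrightarrow> subalgebra M (F t)"
  using filtration[unfolded usual_filtration_def, THEN conjunct1] by (rule bspec)

lemma space_F: "t \<in> {0..T} \<Longrightarrow> space (F t) = space M"
  using subalgebra_F unfolding subalgebra_def by blast

lemma sets_F_mono: "0 \<le> s \<Longrightarrow> s \<le> t \<Longrightarrow> t \<le> T \<Longrightarrow> sets (F s) \<subseteq> sets (F t)"
  using filtration[unfolded usual_filtration_def, THEN conjunct2, THEN conjunct1] by simp

lemma measurable_F_M: "t \<in> {0..T} \<Longrightarrow> f \<in> measurable (F t) N \<Longrightarrow> f \<in> measurable M N"
  using subalgebra_F measurable_from_subalg by blast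

lemma measurable_F_mono:
  assumes "0 \<le> s" "s \<le> t" "t \<le> T" "f \<in> measurable (F s) N"
  shows "f \<in> measurable (F t) N"
proof -
  have "subalgebra (F t) (F s)"
    using assms space_F[of s] space_F[of t] sets_F_mono[of s t] by (auto simp: subalgebra_def)
  then show ?thesis using assms measurable_from_subalg by blast
qed

lemma B_measurable_F: "t \<in> {0..T} \<Longrightarrow> B t \<in> borel_measurable (F t)"
  using brownian[unfolded brownian_motion_def, THEN conjunct1] by (rule bspec)

lemma B_measurable_M: "0 \<le> t \<Longrightarrow> t \<le> T \<Longrightarrow> B t \<in> borel_measurable M"
  by (rule measurable_F_M[OF _ B_measurable_F]) simp_all

lemma B_measurable_F': "0 \<le> s \<Longrightarrow> s \<le> t \<Longrightarrow> t \<le> T \<Longrightarrow> B s \<in> borel_measurable (F t)"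
  by (rule measurable_F_mono[of s]) (auto intro: B_measurable_F)

lemma increment_distributed:
  "0 \<le> s \<Longrightarrow> s < t \<Longrightarrow> t \<le> T \<Longrightarrow>
    distributed M lborel (\<lambda>\<omega>. B t \<omega> - B s \<omega>) (normal_density 0 (sqrt (t - s)))"
  using brownian[unfolded brownian_motion_def, THEN conjunct2, THEN conjunct2, THEN conjunct2] by simp

text \<open>Brownian motion is given with independence from \<open>F s\<close> in terms of bare
  preimages, while \<open>indep_var\<close> speaks of generated sigma-algebras. The passage works
  because preimages of Borel sets are closed under intersection.\<close>

lemma increment_indep_var:
  assumes "0 \<le> s" "s < t" "t \<le> T" "X \<in> borel_measurable (F s)"
  shows "indep_var borel X borel (\<lambda>\<omega>. B t \<omega> - B s \<omega>)"
proof -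
  let ?D = "\<lambda>\<omega>. B t \<omega> - B s \<omega>"
  let ?P = "{ ?D -` A \<inter> space M | A. A \<in> sets borel}"
  have ind: "indep_set (sets (F s)) ?P"
    using assms by (intro brownian[unfolded brownian_motion_def, THEN conjunct2, THEN conjunct2,
      THEN conjunct2, rule_format, THEN conjunct2]) blast
  have X: "X \<in> borel_measurable M" using assms by (intro measurable_F_M[of s]) auto
  have D: "?D \<in> borel_measurable M"
    using B_measurable_M[of s] B_measurable_M[of t] assms(1-3) by simp
  have "indep_set {X -` A \<inter> space M | A. A \<in> sets borel} ?P"
  proof -
    have "X -` A \<inter> space M \<in> sets (F s)" if "A \<in> sets borel" for A
      using measurable_sets[OF assms(4) that] space_F[of s] assms(1-3) by simp
    then have sub: "{X -` A \<inter> space M | A. A \<in> sets borel} \<subseteq> sets (F s)" by blast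
    show ?thesis
      using ind sub unfolding indep_set_def
      by (elim indep_sets_mono_sets) (auto split: bool.split)
  qed
  moreover have "Int_stable {Z -` A \<inter> space M | A. A \<in> sets (borel :: real measure)}" for Z :: "'a \<Rightarrow> real"
  proof (rule Int_stableI, clarify)
    fix A A' :: "real set" assume "A \<in> sets borel" "A' \<in> sets borel"
    then show "\<exists>A''. Z -` A \<inter> space M \<inter> (Z -` A' \<inter> space M) = Z -` A'' \<inter> space M \<and> A'' \<in> sets borel"
      by (intro exI[of _ "A \<inter> A'"]) auto
  qed
  ultimately show ?thesis
    unfolding indep_var_eq using X D by (intro conjI indep_set_sigma_sets) assumption+
qed

lemma increment_integrable:
  assumes "0 \<le> s" "s < t" "t \<le> T"
  shows "integrable M (\<lambda>\<omega>. B t \<omega> - B s \<omega>)" "expectation (\<lambda>\<omega>. B t \<omega> - B s \<omega>) = 0"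
    "integrable M (\<lambda>\<omega>. (B t \<omega> - B s \<omega>)\<^sup>2)" "expectation (\<lambda>\<omega>. (B t \<omega> - B s \<omega>)\<^sup>2) = t - s"
proof -
  let ?D = "\<lambda>\<omega>. B t \<omega> - B s \<omega>"
  have d: "distributed M lborel ?D (normal_density 0 (sqrt (t - s)))"
    using increment_distributed[OF assms] .
  have p: "sqrt (t - s) > 0" using assms by simp
  show e: "expectation ?D = 0" using normal_distributed_expectation[OF p d] .
  show "expectation (\<lambda>\<omega>. (?D \<omega>)\<^sup>2) = t - s"
    using normal_distributed_variance[OF p d] assms unfolding e by simp
  show "integrable M ?D"
    using distributed_integrable[OF d, of "\<lambda>x. x"] integrable_normal_moment[OF p, of 0 1] by simp
  show "integrable M (\<lambda>\<omega>. (?D \<omega>)\<^sup>2)"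
    using distributed_integrable[OF d, of "\<lambda>x. x^2"] integrable_normal_moment[OF p, of 0 2] by simp
qed

end

lemma simple_process_zero_after:
  assumes "\<forall>i<n. p i \<le> p (Suc i)" "p n < s"
  shows "simple_process n p \<eta> s \<omega> = 0"
proof -
  have "p (Suc i) \<le> p n" if "i < n" for i
    using that assms(1)
  proof (induction n)
    case (Suc n)
    then show ?case by (cases "i = n") (auto intro: order_trans)
  qed simp
  then show ?thesis using assms(2) unfolding simple_process_def
    by (intro sum.neutral) (force simp: indicator_def)
qed

lemma simple_process_measurable[measurable]: "(\<lambda>s. simple_process n p \<eta> s \<omega>) \<in> borel_measurable borel"
  unfolding simple_process_def by (intro borel_measurable_sum borel_measurable_times) auto

text \<open>Distinct cells are disjoint, so the square has no cross terms. The induction peels off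
  the last cell and uses the hypothesis with upper limit \<open>p n\<close>, beyond which the
  shorter process vanishes; hence \<open>t\<close> is left arbitrary.\<close>

lemma simple_process_square_integral:
  assumes "\<forall>i<n. p i \<le> p (Suc i)" "0 \<le> p 0" "p n \<le> t"
  shows "(\<integral>\<^sup>+s\<in>{0..t}. ennreal ((simple_process n p \<eta> s \<omega>)\<^sup>2) \<partial>lborel)
     = ennreal (\<Sum>i<n. (\<eta> i \<omega>)\<^sup>2 * (p (Suc i) - p i))"
  using assms
proof (induction n arbitrary: t)
  case 0
  then show ?case by (simp add: simple_process_def)
next
  case (Suc n)
  have pn: "0 \<le> p n" using Suc(2,3)
  proof -
    have "k \<le> n \<Longrightarrow> 0 \<le> p k" for k
      by (induction k) (use Suc(2,3) in \<open>auto intro: order_trans\<close>)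
    then show ?thesis by simp
  qed
  have le: "p n \<le> p (Suc n)" using Suc by auto
  have *: "ennreal ((simple_process (Suc n) p \<eta> s \<omega>)\<^sup>2) * indicator {0..t} s
      = ennreal ((simple_process n p \<eta> s \<omega>)\<^sup>2) * indicator {0..p n} s
      + ennreal ((\<eta> n \<omega>)\<^sup>2) * indicator {p n<..p (Suc n)} s" for s
  proof (cases "s \<le> p n")
    case True
    then show ?thesis using Suc(4) le by (auto simp: simple_process_def indicator_def)
  next
    case False
    then have "simple_process n p \<eta> s \<omega> = 0"
      by (intro simple_process_zero_after) (use Suc(2) in auto)
    then show ?thesis using False Suc(4) le pn by (auto simp: simple_process_def indicator_def)
  qed
  have "(\<integral>\<^sup>+s\<in>{0..t}. ennreal ((simple_process (Suc n) p \<eta> s \<omega>)\<^sup>2) \<partial>lborel)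
     = (\<integral>\<^sup>+s\<in>{0..p n}. ennreal ((simple_process n p \<eta> s \<omega>)\<^sup>2) \<partial>lborel) +
       (\<integral>\<^sup>+s. ennreal ((\<eta> n \<omega>)\<^sup>2) * indicator {p n<..p (Suc n)} s \<partial>lborel)"
    unfolding * by (rule nn_integral_add) measurable
  also have "(\<integral>\<^sup>+s\<in>{0..p n}. ennreal ((simple_process n p \<eta> s \<omega>)\<^sup>2) \<partial>lborel)
     = ennreal (\<Sum>i<n. (\<eta> i \<omega>)\<^sup>2 * (p (Suc i) - p i))"
    by (rule Suc.IH) (use Suc in auto)
  also have "(\<integral>\<^sup>+s. ennreal ((\<eta> n \<omega>)\<^sup>2) * indicator {p n<..p (Suc n)} s \<partial>lborel)
     = ennreal ((\<eta> n \<omega>)\<^sup>2 * (p (Suc n) - p n))"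
    using le by (subst nn_integral_cmult_indicator) (auto simp: ennreal_mult'')
  finally show ?case
    using Suc(2) by (subst (asm) ennreal_plus[symmetric]) (auto intro!: sum_nonneg)
qed

context brownian_setup
begin

lemma simple_integrand_bounds:
  assumes "simple_integrand M F t n p \<eta>"
  shows "i \<le> j \<Longrightarrow> j \<le> n \<Longrightarrow> p i \<le> p j" "i \<le> n \<Longrightarrow> 0 \<le> p i" "i \<le> n \<Longrightarrow> p i \<le> t"
proof -
  have mono: "i \<le> j \<Longrightarrow> j \<le> n \<Longrightarrow> p i \<le> p j" for i j
  proof (induction j)
    case (Suc j)
    then show ?case using assms unfolding simple_integrand_def
      by (cases "i = Suc j") (auto intro: order_trans[of _ "p j"])
  qed simp
  then show "i \<le> j \<Longrightarrow> j \<le> n \<Longrightarrow> p i \<le> p j" .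
  show "i \<le> n \<Longrightarrow> 0 \<le> p i" using mono[of 0 i] assms unfolding simple_integrand_def by auto
  show "i \<le> n \<Longrightarrow> p i \<le> t" using mono[of i n] assms unfolding simple_integrand_def by auto
qed

text \<open>Induction over the cells. The partial integral times the next coefficient is known at
  the left end of the next cell, hence independent of the centred increment there, and the cross
  term has mean zero. Measurability at \<open>p m\<close> and integrability travel along because
  independence consumes them in the next step.\<close>

lemma simple_ito_isometry_aux:
  assumes "simple_integrand M F t n p \<eta>" "t \<le> T" "m \<le> n"
  shows "simple_ito B m p \<eta> \<in> borel_measurable (F (p m)) \<and>
    integrable M (\<lambda>\<omega>. (simple_ito B m p \<eta> \<omega>)\<^sup>2) \<and>
    expectation (\<lambda>\<omega>. (simple_ito B m p \<eta> \<omega>)\<^sup>2) = expectation (\<lambda>\<omega>. \<Sum>i<m. (\<eta> i \<omega>)\<^sup>2 * (p (Suc i) - p i))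
    \<and> integrable M (\<lambda>\<omega>. \<Sum>i<m. (\<eta> i \<omega>)\<^sup>2 * (p (Suc i) - p i))"
  using assms(3)
proof (induction m)
  case 0
  then show ?case by (simp add: simple_ito_def)
next
  case (Suc m)
  note bnd = simple_integrand_bounds[OF assms(1)]
  let ?I = "simple_ito B m p \<eta>" and ?D = "\<lambda>\<omega>. B (p (Suc m)) \<omega> - B (p m) \<omega>"
  have IH: "?I \<in> borel_measurable (F (p m))" "integrable M (\<lambda>\<omega>. (?I \<omega>)\<^sup>2)"
     "expectation (\<lambda>\<omega>. (?I \<omega>)\<^sup>2) = expectation (\<lambda>\<omega>. \<Sum>i<m. (\<eta> i \<omega>)\<^sup>2 * (p (Suc i) - p i))"
     "integrable M (\<lambda>\<omega>. \<Sum>i<m. (\<eta> i \<omega>)\<^sup>2 * (p (Suc i) - p i))" using Suc by auto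
  have pm: "0 \<le> p m" "p m \<le> p (Suc m)" "p (Suc m) \<le> T"
    using bnd(2)[of m] bnd(1)[of m "Suc m"] bnd(3)[of "Suc m"] Suc(2) assms(2) by auto
  have eta: "\<eta> m \<in> borel_measurable (F (p m))" using assms(1) Suc(2) unfolding simple_integrand_def by auto
  obtain C where C: "\<And>\<omega>. \<omega> \<in> space M \<Longrightarrow> \<bar>\<eta> m \<omega>\<bar> \<le> C"
    using assms(1) Suc(2) unfolding simple_integrand_def by (meson Suc_le_lessD)
  have etaM: "\<eta> m \<in> borel_measurable M" using eta pm by (intro measurable_F_M[of "p m"]) auto
  have IM: "?I \<in> borel_measurable M" using IH(1) pm by (intro measurable_F_M[of "p m"]) auto
  have DM: "?D \<in> borel_measurable M"
    using B_measurable_M[of "p m"] B_measurable_M[of "p (Suc m)"] pm by simp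
  have meas: "simple_ito B (Suc m) p \<eta> \<in> borel_measurable (F (p (Suc m)))"
  proof -
    have "?I \<in> borel_measurable (F (p (Suc m)))" "\<eta> m \<in> borel_measurable (F (p (Suc m)))"
      using IH(1) eta pm by (auto intro: measurable_F_mono)
    moreover have "B (p m) \<in> borel_measurable (F (p (Suc m)))" "B (p (Suc m)) \<in> borel_measurable (F (p (Suc m)))"
      using pm by (auto intro!: B_measurable_F')
    ultimately show ?thesis unfolding simple_ito_def by simp
  qed
  have e2: "integrable M (\<lambda>\<omega>. (\<eta> m \<omega>)\<^sup>2)"
  proof (rule integrable_const_bound[of _ "C\<^sup>2"])
    show "AE \<omega> in M. norm ((\<eta> m \<omega>)\<^sup>2) \<le> C\<^sup>2"
    proof (rule AE_I2)
      fix \<omega> assume "\<omega> \<in> space M"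
      then have "\<bar>\<eta> m \<omega>\<bar>\<^sup>2 \<le> C\<^sup>2" using C by (intro power_mono) auto
      then show "norm ((\<eta> m \<omega>)\<^sup>2) \<le> C\<^sup>2" by simp
    qed
  qed (use etaM in simp)
  have main: "integrable M (\<lambda>\<omega>. ?I \<omega> * \<eta> m \<omega> * ?D \<omega>) \<and> expectation (\<lambda>\<omega>. ?I \<omega> * \<eta> m \<omega> * ?D \<omega>) = 0 \<and>
     integrable M (\<lambda>\<omega>. (\<eta> m \<omega>)\<^sup>2 * (?D \<omega>)\<^sup>2) \<and> expectation (\<lambda>\<omega>. (\<eta> m \<omega>)\<^sup>2 * (?D \<omega>)\<^sup>2) = expectation (\<lambda>\<omega>. (\<eta> m \<omega>)\<^sup>2) * (p (Suc m) - p m)"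
  \<comment> \<open>A cell may have length zero, where all these terms vanish; law and independence
    of increments are available for strictly ordered times only.\<close>
  proof (cases "p m = p (Suc m)")
    case True
    then show ?thesis by simp
  next
    case False
    then have lt: "p m < p (Suc m)" using pm by auto
    note inc = increment_integrable[OF pm(1) lt pm(3)]
    have "(\<lambda>\<omega>. ?I \<omega> * \<eta> m \<omega>) \<in> borel_measurable (F (p m))" using IH(1) eta by simp
    then have i1: "indep_var borel (\<lambda>\<omega>. ?I \<omega> * \<eta> m \<omega>) borel ?D"
      by (rule increment_indep_var[OF pm(1) lt pm(3)])
    have int1: "integrable M (\<lambda>\<omega>. ?I \<omega> * \<eta> m \<omega>)"
    \<comment> \<open>The product of two square integrable factors is dominated by the sum of their
      squares.\<close>
    proof (rule Bochner_Integration.integrable_bound[of M "\<lambda>\<omega>. (?I \<omega>)\<^sup>2 + (\<eta> m \<omega>)\<^sup>2"])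
      show "AE x in M. norm (?I x * \<eta> m x) \<le> norm ((?I x)\<^sup>2 + (\<eta> m x)\<^sup>2)"
      proof (rule AE_I2)
        fix x
        have "2 * \<bar>?I x\<bar> * \<bar>\<eta> m x\<bar> \<le> \<bar>?I x\<bar>\<^sup>2 + \<bar>\<eta> m x\<bar>\<^sup>2" by (rule sum_squares_bound)
        then have "\<bar>?I x\<bar> * \<bar>\<eta> m x\<bar> \<le> (?I x)\<^sup>2 + (\<eta> m x)\<^sup>2"
          using abs_ge_zero[of "?I x"] abs_ge_zero[of "\<eta> m x"] mult_nonneg_nonneg[of "\<bar>?I x\<bar>" "\<bar>\<eta> m x\<bar>"] unfolding power2_abs by linarith
        then show "norm (?I x * \<eta> m x) \<le> norm ((?I x)\<^sup>2 + (\<eta> m x)\<^sup>2)"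
          by (simp add: abs_mult)
      qed
    qed (use IH(2) e2 IM etaM in auto)
    have "(\<lambda>\<omega>. \<eta> m \<omega>) \<in> borel_measurable (F (p m))" using eta by simp
    then have "indep_var borel (\<eta> m) borel ?D" by (rule increment_indep_var[OF pm(1) lt pm(3)])
    then have i2: "indep_var borel (\<lambda>\<omega>. (\<eta> m \<omega>)\<^sup>2) borel (\<lambda>\<omega>. (?D \<omega>)\<^sup>2)"
      using indep_var_compose[of borel "\<eta> m" borel ?D "\<lambda>x. x\<^sup>2" borel "\<lambda>x. x\<^sup>2" borel] by (simp add: comp_def)
    show ?thesis
      using indep_var_lebesgue_integral[OF i1 int1 inc(1)] indep_var_integrable[OF i1 int1 inc(1)]
        indep_var_lebesgue_integral[OF i2 e2 inc(3)] indep_var_integrable[OF i2 e2 inc(3)] inc by simp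
  qed
  have exp: "(simple_ito B (Suc m) p \<eta> \<omega>)\<^sup>2 = (?I \<omega>)\<^sup>2 + 2 * (?I \<omega> * \<eta> m \<omega> * ?D \<omega>) + (\<eta> m \<omega>)\<^sup>2 * (?D \<omega>)\<^sup>2" for \<omega>
    unfolding simple_ito_def by (simp add: power2_eq_square algebra_simps)
  have ii: "integrable M (\<lambda>\<omega>. 2 * (?I \<omega> * \<eta> m \<omega> * ?D \<omega>))" using main by (intro integrable_mult_right) auto
  have "expectation (\<lambda>\<omega>. (simple_ito B (Suc m) p \<eta> \<omega>)\<^sup>2) =
    expectation (\<lambda>\<omega>. (?I \<omega>)\<^sup>2) + expectation (\<lambda>\<omega>. 2 * (?I \<omega> * \<eta> m \<omega> * ?D \<omega>)) + expectation (\<lambda>\<omega>. (\<eta> m \<omega>)\<^sup>2 * (?D \<omega>)\<^sup>2)"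
    unfolding exp using IH(2) main ii by simp
  also have "\<dots> = expectation (\<lambda>\<omega>. \<Sum>i<Suc m. (\<eta> i \<omega>)\<^sup>2 * (p (Suc i) - p i))"
    using main IH(3) IH(4) e2 by simp
  finally have ex: "expectation (\<lambda>\<omega>. (simple_ito B (Suc m) p \<eta> \<omega>)\<^sup>2) = \<dots>" .
  have "integrable M (\<lambda>\<omega>. (simple_ito B (Suc m) p \<eta> \<omega>)\<^sup>2)"
    unfolding exp using IH(2) main ii by auto
  then show ?case using meas ex IH(4) e2 by simp
qed

lemma simple_ito_measurable:
  assumes "simple_integrand M F t n p \<eta>" "t \<le> T"
  shows "simple_ito B n p \<eta> \<in> borel_measurable M"
  using simple_ito_isometry_aux[OF assms order_refl] simple_integrand_bounds(2,3)[OF assms(1), of n] assms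
  by (intro measurable_F_M[of "p n"]) auto

theorem simple_ito_isometry:
  assumes "simple_integrand M F t n p \<eta>" "t \<le> T"
  shows "(\<integral>\<^sup>+\<omega>. ennreal ((simple_ito B n p \<eta> \<omega>)\<^sup>2) \<partial>M)
    = (\<integral>\<^sup>+\<omega>. (\<integral>\<^sup>+s\<in>{0..t}. ennreal ((simple_process n p \<eta> s \<omega>)\<^sup>2) \<partial>lborel) \<partial>M)"
proof -
  note aux = simple_ito_isometry_aux[OF assms order_refl]
  have "(\<integral>\<^sup>+\<omega>. ennreal ((simple_ito B n p \<eta> \<omega>)\<^sup>2) \<partial>M) = ennreal (expectation (\<lambda>\<omega>. (simple_ito B n p \<eta> \<omega>)\<^sup>2))"
    using aux by (intro nn_integral_eq_integral) auto
  also have "\<dots> = ennreal (expectation (\<lambda>\<omega>. \<Sum>i<n. (\<eta> i \<omega>)\<^sup>2 * (p (Suc i) - p i)))" using aux by simp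
  also have "\<dots> = (\<integral>\<^sup>+\<omega>. ennreal (\<Sum>i<n. (\<eta> i \<omega>)\<^sup>2 * (p (Suc i) - p i)) \<partial>M)"
    using aux assms(1) unfolding simple_integrand_def
    by (intro nn_integral_eq_integral[symmetric]) (auto intro!: AE_I2 sum_nonneg)
  also have "\<dots> = (\<integral>\<^sup>+\<omega>. (\<integral>\<^sup>+s\<in>{0..t}. ennreal ((simple_process n p \<eta> s \<omega>)\<^sup>2) \<partial>lborel) \<partial>M)"
    using assms(1) unfolding simple_integrand_def by (simp add: simple_process_square_integral)
  finally show ?thesis .
qed

end

section \<open>Common refinement of two partitions, and linearity of the elementary integral\<close>

lemma grid_increment:
  fixes f :: "real \<Rightarrow> real" and q :: "nat \<Rightarrow> real"
  assumes q: "\<And>i j. i < j \<Longrightarrow> j \<le> m \<Longrightarrow> q i < q j" and ab: "a \<le> b" "b \<le> m"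
  shows "f (q b) - f (q a) = (\<Sum>k<m. if q a \<le> q k \<and> q (Suc k) \<le> q b then f (q (Suc k)) - f (q k) else 0)"
proof -
  have le: "q i \<le> q j \<longleftrightarrow> i \<le> j" if "i \<le> m" "j \<le> m" for i j
    using q[of i j] q[of j i] that by (cases i j rule: linorder_cases) auto
  have "(\<Sum>k<m. if q a \<le> q k \<and> q (Suc k) \<le> q b then f (q (Suc k)) - f (q k) else 0)
      = (\<Sum>k<m. if k \<in> {a..<b} then f (q (Suc k)) - f (q k) else 0)"
    using ab by (intro sum.cong refl) (auto simp: le)
  also have "\<dots> = (\<Sum>k\<in>{..<m} \<inter> {a..<b}. f (q (Suc k)) - f (q k))"
    by (rule sum.inter_restrict[symmetric]) simp
  also have "{..<m} \<inter> {a..<b} = {a..<b}" using ab by auto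
  also have "(\<Sum>k\<in>{a..<b}. f (q (Suc k)) - f (q k)) = f (q b) - f (q a)"
    using ab(1) by (rule sum_Suc_diff'[where f = "\<lambda>k. f (q k)"])
  finally show ?thesis by simp
qed

text \<open>Value of the coarse process on the fine cell from \<open>q k\<close> to
  \<open>q (Suc k)\<close>. For a strictly increasing \<open>q\<close> at most one coarse interval
  contains that cell, so the sum has at most one nonzero term.\<close>

definition refined :: "nat \<Rightarrow> (nat \<Rightarrow> real) \<Rightarrow> (nat \<Rightarrow> 'a \<Rightarrow> real) \<Rightarrow> (nat \<Rightarrow> real) \<Rightarrow> nat \<Rightarrow> 'a \<Rightarrow> real" where
  "refined n p \<eta> q k \<omega> = (\<Sum>i<n. if p i \<le> q k \<and> q (Suc k) \<le> p (Suc i) then \<eta> i \<omega> else 0)"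

text \<open>Telescoping over the fine cells inside each coarse interval. The integrator
  \<open>f\<close> is arbitrary since two choices are used: a Brownian path gives the elementary
  integral, a step function gives the simple process itself.\<close>

lemma refined_sum:
  fixes f :: "real \<Rightarrow> real"
  assumes q: "\<And>i j. i < j \<Longrightarrow> j \<le> m \<Longrightarrow> q i < q j" and p: "\<forall>i<n. p i \<le> p (Suc i)"
    and sub: "p ` {..n} \<subseteq> q ` {..m}"
  shows "(\<Sum>k<m. refined n p \<eta> q k \<omega> * (f (q (Suc k)) - f (q k))) = (\<Sum>i<n. \<eta> i \<omega> * (f (p (Suc i)) - f (p i)))"
proof -
  have "(\<Sum>k<m. refined n p \<eta> q k \<omega> * (f (q (Suc k)) - f (q k)))
     = (\<Sum>i<n. \<Sum>k<m. \<eta> i \<omega> * (if p i \<le> q k \<and> q (Suc k) \<le> p (Suc i) then f (q (Suc k)) - f (q k) else 0))"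
    unfolding refined_def sum_distrib_right by (subst sum.swap) (auto intro!: sum.cong)
  also have "\<dots> = (\<Sum>i<n. \<eta> i \<omega> * (f (p (Suc i)) - f (p i)))"
  proof (rule sum.cong[OF refl])
    fix i assume "i \<in> {..<n}"
    then have i: "p i \<in> p ` {..n}" "p (Suc i) \<in> p ` {..n}" by auto
    obtain a where a: "a \<le> m" "p i = q a" using subsetD[OF sub i(1)] by auto
    obtain b where b: "b \<le> m" "p (Suc i) = q b" using subsetD[OF sub i(2)] by auto
    have "p i \<le> p (Suc i)" using p \<open>i \<in> {..<n}\<close> by simp
    then have "a \<le> b" using q[of b a] a b by (cases "a \<le> b") auto
    show "(\<Sum>k<m. \<eta> i \<omega> * (if p i \<le> q k \<and> q (Suc k) \<le> p (Suc i) then f (q (Suc k)) - f (q k) else 0))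
       = \<eta> i \<omega> * (f (p (Suc i)) - f (p i))"
      unfolding sum_distrib_left[symmetric] a(2) b(2)
      by (subst grid_increment[where f = f, OF q \<open>a \<le> b\<close> b(1)]) simp_all
  qed
  finally show ?thesis .
qed

text \<open>A left-open, right-closed cell contains \<open>s\<close> exactly when the function equal
  to -1 below \<open>s\<close> and 0 from \<open>s\<close> on increases by one across it. So the
  process, too, is a sum of increments to which \<open>refined_sum\<close> applies.\<close>

lemma simple_process_eq:
  assumes "\<forall>i<n. p i \<le> p (Suc i)"
  shows "simple_process n p \<eta> s \<omega> = (\<Sum>i<n. \<eta> i \<omega> * ((\<lambda>r. - of_bool (r < s)) (p (Suc i)) - (\<lambda>r. - of_bool (r < s)) (p i)))"
  unfolding simple_process_def using assms
  by (intro sum.cong refl) (force simp: indicator_def)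

context brownian_setup
begin

text \<open>Adaptedness survives refinement because \<open>\<eta> i\<close> is used only on fine
  cells that start at \<open>p i\<close> or later.\<close>

lemma refine_simple_integrand:
  assumes S: "simple_integrand M F t n p \<eta>" "t \<le> T"
    and q: "\<And>i j. i < j \<Longrightarrow> j \<le> m \<Longrightarrow> q i < q j"
    and sub: "p ` {..n} \<subseteq> q ` {..m}" "q ` {..m} \<subseteq> {0..t}"
  shows "simple_integrand M F t m q (refined n p \<eta> q)"
    and "simple_process m q (refined n p \<eta> q) s \<omega> = simple_process n p \<eta> s \<omega>"
    and "simple_ito B m q (refined n p \<eta> q) \<omega> = simple_ito B n p \<eta> \<omega>"
proof -
  note bnd = simple_integrand_bounds[OF S(1)]
  have p: "\<forall>i<n. p i \<le> p (Suc i)" using S(1) unfolding simple_integrand_def by simp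
  have qm: "\<forall>i<m. q i \<le> q (Suc i)" using q by (simp add: less_imp_le)
  have q0: "0 \<le> q k \<and> q k \<le> t" if "k \<le> m" for k using sub(2) that by auto
  show "simple_process m q (refined n p \<eta> q) s \<omega> = simple_process n p \<eta> s \<omega>"
    unfolding simple_process_eq[OF p] simple_process_eq[OF qm] by (rule refined_sum[OF q p sub(1)])
  show "simple_ito B m q (refined n p \<eta> q) \<omega> = simple_ito B n p \<eta> \<omega>"
    unfolding simple_ito_def by (rule refined_sum[OF q p sub(1), where f = "\<lambda>r. B r \<omega>"])
  have "refined n p \<eta> q k \<in> borel_measurable (F (q k)) \<and> (\<exists>C. \<forall>\<omega>\<in>space M. \<bar>refined n p \<eta> q k \<omega>\<bar> \<le> C)" if k: "k < m" for k
  proof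
    have "(\<lambda>\<omega>. if p i \<le> q k \<and> q (Suc k) \<le> p (Suc i) then \<eta> i \<omega> else 0) \<in> borel_measurable (F (q k))" if i: "i < n" for i
    proof (cases "p i \<le> q k \<and> q (Suc k) \<le> p (Suc i)")
      case True
      have "\<eta> i \<in> borel_measurable (F (p i))" using S(1) i unfolding simple_integrand_def by simp
      then have "\<eta> i \<in> borel_measurable (F (q k))"
        using True bnd(2)[of i] i q0[of k] k S(2) by (intro measurable_F_mono[of "p i" "q k"]) auto
      then show ?thesis using True by simp
    next
      case False
      then show ?thesis by auto
    qed
    then show "refined n p \<eta> q k \<in> borel_measurable (F (q k))"
      unfolding refined_def by (intro borel_measurable_sum) auto
    have "\<forall>i. \<exists>C. i < n \<longrightarrow> (\<forall>\<omega>\<in>space M. \<bar>\<eta> i \<omega>\<bar> \<le> C)" using S(1) unfolding simple_integrand_def by blast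
    then obtain C where C: "\<And>i \<omega>. i < n \<Longrightarrow> \<omega> \<in> space M \<Longrightarrow> \<bar>\<eta> i \<omega>\<bar> \<le> C i" by metis
    have "\<bar>refined n p \<eta> q k \<omega>\<bar> \<le> (\<Sum>i<n. \<bar>C i\<bar>)" if w: "\<omega> \<in> space M" for \<omega>
      unfolding refined_def
    proof (rule order_trans[OF sum_abs], rule sum_mono)
      fix i assume "i \<in> {..<n}"
      then show "\<bar>if p i \<le> q k \<and> q (Suc k) \<le> p (Suc i) then \<eta> i \<omega> else 0\<bar> \<le> \<bar>C i\<bar>"
        using C[of i \<omega>] w by auto
    qed
    then show "\<exists>C. \<forall>\<omega>\<in>space M. \<bar>refined n p \<eta> q k \<omega>\<bar> \<le> C" by blast
  qed
  then show "simple_integrand M F t m q (refined n p \<eta> q)"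
    unfolding simple_integrand_def using q0 qm by auto
qed

text \<open>Simple processes can be subtracted coefficient by coefficient only on a common grid.
  Sorting the union of the two sets of grid points provides one, and removing duplicates makes it
  strictly increasing.\<close>

lemma simple_integrand_diff:
  assumes S: "simple_integrand M F t n p \<eta>" "simple_integrand M F t n' p' \<eta>'" and "t \<le> T"
  obtains m q \<zeta> where "simple_integrand M F t m q \<zeta>"
    "\<And>s \<omega>. simple_process m q \<zeta> s \<omega> = simple_process n p \<eta> s \<omega> - simple_process n' p' \<eta>' s \<omega>"
    "\<And>\<omega>. simple_ito B m q \<zeta> \<omega> = simple_ito B n p \<eta> \<omega> - simple_ito B n' p' \<eta>' \<omega>"
proof -
  define Q where "Q = p ` {..n} \<union> p' ` {..n'}"
  have Q: "finite Q" "Q \<noteq> {}" unfolding Q_def by auto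
  define xs where "xs = sorted_list_of_set Q"
  define q where "q = (\<lambda>k. xs ! k)"
  define m where "m = length xs - 1"
  have xs: "sorted_wrt (<) xs" "set xs = Q" unfolding xs_def using Q by auto
  then have len: "length xs = Suc m" using Q unfolding m_def by (cases xs) auto
  have q: "q i < q j" if "i < j" "j \<le> m" for i j
    unfolding q_def using sorted_wrt_nth_less[OF xs(1) that(1)] len that by simp
  have "q ` {..m} = set xs" unfolding q_def set_conv_nth len by (auto simp: less_Suc_eq_le)
  then have qQ: "q ` {..m} = Q" using xs by simp
  have sub: "p ` {..n} \<subseteq> q ` {..m}" "p' ` {..n'} \<subseteq> q ` {..m}" unfolding qQ Q_def by auto
  have Qt: "q ` {..m} \<subseteq> {0..t}" unfolding qQ Q_def
    using simple_integrand_bounds(2,3)[OF S(1)] simple_integrand_bounds(2,3)[OF S(2)] by auto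
  note r1 = refine_simple_integrand[OF S(1) assms(3) q sub(1) Qt]
  note r2 = refine_simple_integrand[OF S(2) assms(3) q sub(2) Qt]
  define \<zeta> where "\<zeta> = (\<lambda>k \<omega>. refined n p \<eta> q k \<omega> - refined n' p' \<eta>' q k \<omega>)"
  have "\<zeta> k \<in> borel_measurable (F (q k)) \<and> (\<exists>C. \<forall>\<omega>\<in>space M. \<bar>\<zeta> k \<omega>\<bar> \<le> C)" if k: "k < m" for k
  proof
    show "\<zeta> k \<in> borel_measurable (F (q k))"
      unfolding \<zeta>_def using r1(1) r2(1) k by (intro borel_measurable_diff) (auto simp: simple_integrand_def)
    obtain C1 where C1: "\<forall>\<omega>\<in>space M. \<bar>refined n p \<eta> q k \<omega>\<bar> \<le> C1"
      using r1(1) k unfolding simple_integrand_def by blast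
    obtain C2 where C2: "\<forall>\<omega>\<in>space M. \<bar>refined n' p' \<eta>' q k \<omega>\<bar> \<le> C2"
      using r2(1) k unfolding simple_integrand_def by blast
    have "\<bar>\<zeta> k \<omega>\<bar> \<le> C1 + C2" if "\<omega> \<in> space M" for \<omega>
      unfolding \<zeta>_def using C1 C2 that abs_triangle_ineq4 by (meson add_mono order_trans)
    then show "\<exists>C. \<forall>\<omega>\<in>space M. \<bar>\<zeta> k \<omega>\<bar> \<le> C" by blast
  qed
  then have "simple_integrand M F t m q \<zeta>" using r1(1) unfolding simple_integrand_def by simp
  moreover have "simple_process m q \<zeta> s \<omega> = simple_process n p \<eta> s \<omega> - simple_process n' p' \<eta>' s \<omega>" for s \<omega>
  proof -
    have "simple_process m q \<zeta> s \<omega> = simple_process m q (refined n p \<eta> q) s \<omega> - simple_process m q (refined n' p' \<eta>' q) s \<omega>"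
      unfolding simple_process_def \<zeta>_def by (simp only: left_diff_distrib sum_subtractf)
    then show ?thesis by (simp only: r1(2) r2(2))
  qed
  moreover have "simple_ito B m q \<zeta> \<omega> = simple_ito B n p \<eta> \<omega> - simple_ito B n' p' \<eta>' \<omega>" for \<omega>
  proof -
    have "simple_ito B m q \<zeta> \<omega> = simple_ito B m q (refined n p \<eta> q) \<omega> - simple_ito B m q (refined n' p' \<eta>' q) \<omega>"
      unfolding simple_ito_def \<zeta>_def by (simp only: left_diff_distrib sum_subtractf)
    then show ?thesis by (simp only: r1(3) r2(3))
  qed
  ultimately show ?thesis by (rule that)
qed

text \<open>The integrand is switched off as soon as its accumulated square integral would exceed \<open>\<delta>\<close>,
  which makes the isometry applicable without a moment assumption.\<close>

lemma simple_ito_prob_bound: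
  assumes S: "simple_integrand M F t n p \<eta>" "t \<le> T" and A: "A \<in> events" and "\<epsilon> > 0" "\<delta> \<ge> 0"
  shows "prob {\<omega>\<in>A. \<bar>simple_ito B n p \<eta> \<omega>\<bar> > \<epsilon>}
    \<le> \<delta> / \<epsilon>\<^sup>2 + prob {\<omega>\<in>A. (\<Sum>i<n. (\<eta> i \<omega>)\<^sup>2 * (p (Suc i) - p i)) > \<delta>}"
proof -
  note bnd = simple_integrand_bounds[OF S(1)]
  define V where "V = (\<lambda>j \<omega>. \<Sum>i<j. (\<eta> i \<omega>)\<^sup>2 * (p (Suc i) - p i))"
  have eta: "\<eta> i \<in> borel_measurable (F (p j))" if "i \<le> j" "j < n" for i j
  proof (rule measurable_F_mono[of "p i"])
    show "\<eta> i \<in> borel_measurable (F (p i))" using S(1) that unfolding simple_integrand_def by simp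
  qed (use that bnd(1)[of i j] bnd(2)[of i] bnd(3)[of j] S(2) in auto)
  have etaM: "\<eta> i \<in> borel_measurable M" if "i < n" for i
    using eta[of i i] that bnd(2)[of i] bnd(3)[of i] S(2) by (intro measurable_F_M[of "p i"]) auto
  have Vm: "V (Suc j) \<in> borel_measurable (F (p j))" if "j < n" for j
    unfolding V_def using eta that by (intro borel_measurable_sum borel_measurable_times borel_measurable_power) auto
  have VM: "V n \<in> borel_measurable M" unfolding V_def using etaM
    by (intro borel_measurable_sum borel_measurable_times borel_measurable_power) auto
  have Vmono: "V i \<omega> \<le> V j \<omega>" if "i \<le> j" "j \<le> n" for i j \<omega>
    unfolding V_def using that bnd(1)
    by (intro sum_mono2) (auto intro!: mult_nonneg_nonneg simp: bnd(1))
  \<comment> \<open>\<open>V (Suc i)\<close> involves only coefficients up to index \<open>i\<close>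
    and deterministic cell lengths. The decision to switch off is therefore known at the left end
    \<open>p i\<close>, and \<open>\<zeta>\<close> is again adapted.\<close>
  define \<zeta> where "\<zeta> = (\<lambda>i \<omega>. if V (Suc i) \<omega> \<le> \<delta> then \<eta> i \<omega> else 0)"
  have Z: "simple_integrand M F t n p \<zeta>"
    unfolding simple_integrand_def
  proof (intro conjI allI impI)
    fix i assume i: "i < n"
    have [measurable]: "\<eta> i \<in> borel_measurable (F (p i))" "V (Suc i) \<in> borel_measurable (F (p i))"
      using eta[of i i] Vm i by auto
    show "\<zeta> i \<in> borel_measurable (F (p i))" unfolding \<zeta>_def by measurable
    obtain C where "\<forall>\<omega>\<in>space M. \<bar>\<eta> i \<omega>\<bar> \<le> C" using S(1) i unfolding simple_integrand_def by blast
    then show "\<exists>C. \<forall>\<omega>\<in>space M. \<bar>\<zeta> i \<omega>\<bar> \<le> C" unfolding \<zeta>_def by (intro exI[of _ "\<bar>C\<bar>"]) auto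
  qed (use S(1) in \<open>auto simp: simple_integrand_def\<close>)
  \<comment> \<open>Both bounds are carried together: while the switch is on, the truncated sum lies
    below \<open>V (Suc j)\<close> and hence below \<delta>; when it is off, the sum does not
    grow.\<close>
  have Zle: "(\<Sum>i<j. (\<zeta> i \<omega>)\<^sup>2 * (p (Suc i) - p i)) \<le> V j \<omega> \<and> (\<Sum>i<j. (\<zeta> i \<omega>)\<^sup>2 * (p (Suc i) - p i)) \<le> \<delta>" if "j \<le> n" for j \<omega>
    using that
  proof (induction j)
    case 0
    then show ?case using \<open>\<delta> \<ge> 0\<close> by (simp add: V_def)
  next
    case (Suc j)
    have "V (Suc j) \<omega> = V j \<omega> + (\<eta> j \<omega>)\<^sup>2 * (p (Suc j) - p j)" by (simp add: V_def)
    moreover have "V j \<omega> \<le> V (Suc j) \<omega>" using Vmono Suc by simp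
    ultimately show ?case using Suc by (auto simp: \<zeta>_def)
  qed
  let ?I = "simple_ito B n p \<zeta>"
  note aux = simple_ito_isometry_aux[OF Z S(2) order_refl]
  have "expectation (\<lambda>\<omega>. (?I \<omega>)\<^sup>2) \<le> expectation (\<lambda>\<omega>. \<delta>)"
    unfolding conjunct1[OF conjunct2[OF conjunct2[OF aux]]]
    by (rule integral_mono) (use aux Zle in auto)
  then have e: "expectation (\<lambda>\<omega>. (?I \<omega>)\<^sup>2) \<le> \<delta>" by (simp add: prob_space)
  have IM[measurable]: "?I \<in> borel_measurable M" by (rule simple_ito_measurable[OF Z S(2)])
  have IM'[measurable]: "simple_ito B n p \<eta> \<in> borel_measurable M" by (rule simple_ito_measurable[OF S])
  note VM[measurable] A[measurable]
  have "prob {\<omega>\<in>space M. \<bar>?I \<omega>\<bar> > \<epsilon>} \<le> prob {\<omega>\<in>space M. (?I \<omega>)\<^sup>2 \<ge> \<epsilon>\<^sup>2}"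
    using \<open>\<epsilon> > 0\<close> by (intro finite_measure_mono) (auto simp: abs_le_square_iff[symmetric])
  also have "\<dots> \<le> expectation (\<lambda>\<omega>. (?I \<omega>)\<^sup>2) / \<epsilon>\<^sup>2"
    using aux \<open>\<epsilon> > 0\<close> by (intro integral_Markov_inequality_measure[where A = "{}"]) auto
  also have "\<dots> \<le> \<delta> / \<epsilon>\<^sup>2" using e by (intro divide_right_mono) auto
  finally have b: "prob {\<omega>\<in>space M. \<bar>?I \<omega>\<bar> > \<epsilon>} \<le> \<delta> / \<epsilon>\<^sup>2" .
  \<comment> \<open>\<open>V\<close> is monotone, so a final value of at most \<delta> means that no
    term was switched off.\<close>
  have same: "?I \<omega> = simple_ito B n p \<eta> \<omega>" if "V n \<omega> \<le> \<delta>" for \<omega>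
    unfolding simple_ito_def \<zeta>_def using that Vmono[of "Suc _" n]
    by (intro sum.cong refl) (auto, meson Suc_leI Vmono le_refl order_trans)
  have As: "A \<subseteq> space M" using sets.sets_into_space[OF A] .
  have mA: "{\<omega>\<in>A. V n \<omega> > \<delta>} \<in> events"
  proof -
    have "{\<omega>\<in>A. V n \<omega> > \<delta>} = A \<inter> {\<omega>\<in>space M. V n \<omega> > \<delta>}" using As by auto
    then show ?thesis by simp
  qed
  have "prob {\<omega>\<in>A. \<bar>simple_ito B n p \<eta> \<omega>\<bar> > \<epsilon>} \<le> prob ({\<omega>\<in>space M. \<bar>?I \<omega>\<bar> > \<epsilon>} \<union> {\<omega>\<in>A. V n \<omega> > \<delta>})"
    using same As mA by (intro finite_measure_mono) (auto simp: not_less)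
  also have "\<dots> \<le> prob {\<omega>\<in>space M. \<bar>?I \<omega>\<bar> > \<epsilon>} + prob {\<omega>\<in>A. V n \<omega> > \<delta>}"
    by (intro measure_Un_le mA) measurable
  finally show ?thesis using b unfolding V_def by linarith
qed

end

text \<open>Truncating the distance at 1 and restricting it to \<open>A\<close> turns convergence in
  probability into convergence in mean, from which an almost surely convergent subsequence can be
  extracted.\<close>

lemma (in prob_space) tendsto_in_prob_AE_subseq:
  fixes X :: "nat \<Rightarrow> 'a \<Rightarrow> real"
  assumes A[measurable]: "A \<in> events" and [measurable]: "\<And>k. X k \<in> borel_measurable M" "Z \<in> borel_measurable M"
    and lim: "\<And>\<epsilon>. \<epsilon> > 0 \<Longrightarrow> (\<lambda>k. prob {\<omega>\<in>A. \<bar>X k \<omega> - Z \<omega>\<bar> > \<epsilon>}) \<longlonglongrightarrow> 0"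
  obtains r where "strict_mono r" "AE \<omega> in M. \<omega> \<in> A \<longrightarrow> (\<lambda>k. X (r k) \<omega>) \<longlonglongrightarrow> Z \<omega>"
proof -
  define f where "f = (\<lambda>k \<omega>. indicator A \<omega> * min 1 \<bar>X k \<omega> - Z \<omega>\<bar>)"
  have [measurable]: "f k \<in> borel_measurable M" for k unfolding f_def by measurable
  have f01: "0 \<le> f k \<omega>" "f k \<omega> \<le> 1" for k \<omega> unfolding f_def by (auto simp: indicator_def)
  have int: "integrable M (f k)" for k
    by (rule integrable_const_bound[of _ 1]) (use f01 in auto)
  have As: "A \<subseteq> space M" using sets.sets_into_space[OF A] .
  have mk: "{\<omega>\<in>A. \<bar>X k \<omega> - Z \<omega>\<bar> > e} \<in> events" for k e
  proof -
    have "{\<omega>\<in>A. \<bar>X k \<omega> - Z \<omega>\<bar> > e} = A \<inter> {\<omega>\<in>space M. \<bar>X k \<omega> - Z \<omega>\<bar> > e}" using As by auto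
    then show ?thesis by simp
  qed
  have bound: "expectation (f k) \<le> e + prob {\<omega>\<in>A. \<bar>X k \<omega> - Z \<omega>\<bar> > e}" if "e > 0" for k e
  proof -
    have "expectation (f k) \<le> expectation (\<lambda>\<omega>. e + indicator {\<omega>\<in>A. \<bar>X k \<omega> - Z \<omega>\<bar> > e} \<omega>)"
    proof (rule integral_mono[OF int])
      show "integrable M (\<lambda>\<omega>. e + indicator {\<omega>\<in>A. \<bar>X k \<omega> - Z \<omega>\<bar> > e} \<omega>)"
        using mk by (intro integrable_const_bound[of _ "\<bar>e\<bar> + 1"]) (auto intro!: AE_I2 simp: indicator_def)
      show "f k \<omega> \<le> e + indicator {\<omega>\<in>A. \<bar>X k \<omega> - Z \<omega>\<bar> > e} \<omega>" for \<omega>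
        using that by (auto simp: f_def indicator_def)
    qed
    also have "\<dots> = e + prob {\<omega>\<in>A. \<bar>X k \<omega> - Z \<omega>\<bar> > e}"
    proof -
      have "integrable M (indicator {\<omega>\<in>A. \<bar>X k \<omega> - Z \<omega>\<bar> > e} :: 'a \<Rightarrow> real)"
        by (rule integrable_const_bound[of _ 1]) (use mk[of e k] in auto)
      then show ?thesis
        using mk[of e k] by (subst Bochner_Integration.integral_add) (auto simp: prob_space)
    qed
    finally show ?thesis .
  qed
  have L: "(\<lambda>k. expectation (\<lambda>x. norm (f k x))) \<longlonglongrightarrow> 0"
  proof (rule LIMSEQ_I)
    fix e :: real assume e: "e > 0"
    obtain N where N: "\<And>k. k \<ge> N \<Longrightarrow> prob {\<omega>\<in>A. \<bar>X k \<omega> - Z \<omega>\<bar> > e / 2} < e / 2"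
      using LIMSEQ_D[OF lim[of "e/2"], of "e/2"] e by auto
    have "norm (expectation (\<lambda>x. norm (f k x)) - 0) < e" if "k \<ge> N" for k
      using bound[of "e/2" k] N[OF that] e f01 by (simp add: abs_of_nonneg)
    then show "\<exists>N. \<forall>k\<ge>N. norm (expectation (\<lambda>x. norm (f k x)) - 0) < e" by blast
  qed
  obtain r where r: "strict_mono r" "AE x in M. (\<lambda>k. f (r k) x) \<longlonglongrightarrow> 0"
    using tendsto_L1_AE_subseq[OF int L] by blast
  have "AE \<omega> in M. \<omega> \<in> A \<longrightarrow> (\<lambda>k. X (r k) \<omega>) \<longlonglongrightarrow> Z \<omega>"
    using r(2)
  proof eventually_elim
    case (elim \<omega>)
    show ?case
    proof
      assume "\<omega> \<in> A"
      then have l: "(\<lambda>k. min 1 \<bar>X (r k) \<omega> - Z \<omega>\<bar>) \<longlonglongrightarrow> 0" using elim unfolding f_def by simp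
      \<comment> \<open>Once the minimum is below 1 the truncation is inactive.\<close>
      have "eventually (\<lambda>k. min 1 \<bar>X (r k) \<omega> - Z \<omega>\<bar> < 1) sequentially"
        using order_tendstoD(2)[OF l, of 1] by simp
      then have "eventually (\<lambda>k. min 1 \<bar>X (r k) \<omega> - Z \<omega>\<bar> = \<bar>X (r k) \<omega> - Z \<omega>\<bar>) sequentially"
        by eventually_elim auto
      then have "(\<lambda>k. \<bar>X (r k) \<omega> - Z \<omega>\<bar>) \<longlonglongrightarrow> 0" by (rule Lim_transform_eventually[OF l])
      then show "(\<lambda>k. X (r k) \<omega>) \<longlonglongrightarrow> Z \<omega>" by (rule LIM_zero_cancel[OF tendsto_rabs_zero_cancel])
    qed
  qed
  then show ?thesis using that r(1) by blast
qed

section \<open>Approximation by simple processes\<close>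

text \<open>Averages are taken over the preceding cell, so that they are known at the left end point of
  the cell on which they are used.\<close>

definition cell_avg :: "real \<Rightarrow> nat \<Rightarrow> (real \<Rightarrow> real) \<Rightarrow> nat \<Rightarrow> real" where
  "cell_avg t n f i = real n / t * (LINT r:{(real i - 1) * t / n<..real i * t / n}|lborel. f r)"

lemma ennreal_tendsto_0I:
  fixes f :: "'b \<Rightarrow> ennreal"
  assumes "\<And>e::real. e > 0 \<Longrightarrow> eventually (\<lambda>n. f n \<le> ennreal e) net"
  shows "(f \<longlongrightarrow> 0) net"
proof (rule order_tendstoI)
  fix a :: ennreal assume "0 < a"
  then obtain e :: real where e: "0 < e" "ennreal e < a"
  proof (cases a)
    case (real r)
    then show ?thesis using that[of "r / 2"] \<open>0 < a\<close> by (simp add: ennreal_less_iff)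
  next
    case top
    then show ?thesis using that[of 1] by simp
  qed
  show "eventually (\<lambda>n. f n < a) net"
    using assms[OF e(1)] by eventually_elim (use e(2) in \<open>auto intro: le_less_trans\<close>)
qed simp

definition cell_step :: "real \<Rightarrow> nat \<Rightarrow> (real \<Rightarrow> real) \<Rightarrow> real \<Rightarrow> real" where
  "cell_step t n f s = (\<Sum>i<n. cell_avg t n f i * indicator {real i * t / n<..real (Suc i) * t / n} s)"

lemma cell_step_measurable[measurable]: "cell_step t n f \<in> borel_measurable borel"
  unfolding cell_step_def[abs_def] by (intro borel_measurable_sum borel_measurable_times) auto

lemma cell_measure:
  fixes n :: nat
  assumes "t > 0" "n > 0"
  shows "emeasure lborel {(real i - 1) * t / n<..real i * t / n} = ennreal (t / n)"
  using assms by (subst emeasure_lborel_Ioc) (auto simp: field_simps divide_right_mono)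

lemma emeasure_lborel_Ioc_if: "emeasure lborel {a<..b} = (if a \<le> b then ennreal (b - a) else (0::ennreal))"
  by simp

lemma bounded_cell_integrable:
  fixes f :: "real \<Rightarrow> real"
  assumes [measurable]: "f \<in> borel_measurable borel" and "\<And>r. \<bar>f r\<bar> \<le> C"
  shows "set_integrable lborel {a<..b} f"
  unfolding set_integrable_def
  by (rule integrableI_bounded_set[of "{a<..b}" _ _ C])
     (use assms in \<open>auto simp: indicator_def emeasure_lborel_Ioc_if\<close>)

lemma cell_avg_nn_bound:
  fixes f :: "real \<Rightarrow> real" and n :: nat
  assumes t: "t > 0" "n > 0" and f[measurable]: "f \<in> borel_measurable borel" and b: "\<And>r. \<bar>f r\<bar> \<le> C"
  shows "ennreal \<bar>cell_avg t n f i\<bar> * ennreal (t / n)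
    \<le> (\<integral>\<^sup>+r. ennreal \<bar>f r\<bar> * indicator {(real i - 1) * t / n<..real i * t / n} r \<partial>lborel)"
proof -
  let ?c = "{(real i - 1) * t / n<..real i * t / n}"
  have int: "integrable lborel (\<lambda>r. indicator ?c r *\<^sub>R f r)"
    using bounded_cell_integrable[OF f b] unfolding set_integrable_def .
  have "ennreal \<bar>cell_avg t n f i\<bar> * ennreal (t / n) = ennreal \<bar>LINT r:?c|lborel. f r\<bar>"
    using t unfolding cell_avg_def by (subst ennreal_mult'[symmetric]) (auto simp: abs_mult)
  also have "\<dots> \<le> (\<integral>\<^sup>+r. ennreal (norm (indicator ?c r *\<^sub>R f r)) \<partial>lborel)"
    using integral_norm_bound_ennreal[OF int] unfolding set_lebesgue_integral_def by simp
  also have "\<dots> = (\<integral>\<^sup>+r. ennreal \<bar>f r\<bar> * indicator ?c r \<partial>lborel)"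
    by (intro nn_integral_cong) (auto simp: indicator_def)
  finally show ?thesis .
qed

lemma cell_avg_bound:
  fixes f :: "real \<Rightarrow> real" and n :: nat
  assumes t: "t > 0" "n > 0" and f[measurable]: "f \<in> borel_measurable borel" and b: "\<And>r. \<bar>f r\<bar> \<le> C"
  shows "\<bar>cell_avg t n f i\<bar> \<le> C"
proof -
  have C: "0 \<le> C" using b[of 0] by auto
  have "ennreal \<bar>cell_avg t n f i\<bar> * ennreal (t / n)
    \<le> (\<integral>\<^sup>+r. ennreal \<bar>f r\<bar> * indicator {(real i - 1) * t / n<..real i * t / n} r \<partial>lborel)"
    by (rule cell_avg_nn_bound[OF assms])
  also have "\<dots> \<le> (\<integral>\<^sup>+r. ennreal C * indicator {(real i - 1) * t / n<..real i * t / n} r \<partial>lborel)"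
    using b by (intro nn_integral_mono mult_right_mono ennreal_leI) auto
  also have "\<dots> = ennreal C * ennreal (t / n)"
    using cell_measure[OF t, of i] by (simp add: nn_integral_cmult_indicator)
  finally have "ennreal \<bar>cell_avg t n f i\<bar> * ennreal (t / n) \<le> ennreal C * ennreal (t / n)" .
  moreover have "ennreal (\<bar>cell_avg t n f i\<bar> * (t / n)) = ennreal \<bar>cell_avg t n f i\<bar> * ennreal (t / n)"
    "ennreal (C * (t / n)) = ennreal C * ennreal (t / n)" using t C by (intro ennreal_mult; simp)+
  ultimately have "ennreal (\<bar>cell_avg t n f i\<bar> * (t / n)) \<le> ennreal (C * (t / n))" by (simp only:)
  then have "\<bar>cell_avg t n f i\<bar> * (t / n) \<le> C * (t / n)"
    using t C by (subst (asm) ennreal_le_iff) auto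
  then show ?thesis by (rule mult_right_le_imp_le) (use t in simp)
qed

lemma cell_indicator_sum:
  fixes n :: nat
  assumes "t > 0" "n > 0"
  shows "(\<Sum>i<k. indicator {(real i - 1) * t / n<..real i * t / n} r) = (indicator {- t / n<..(real k - 1) * t / n} r :: ennreal)"
proof (induction k)
  case 0
  then show ?case by simp
next
  case (Suc k)
  have "- t / n \<le> (real k - 1) * t / n" "(real k - 1) * t / n \<le> real k * t / n"
    using assms by (auto simp: divide_right_mono field_simps intro!: divide_right_mono)
  then show ?case using Suc by (auto simp: indicator_def)
qed

text \<open>Each average is bounded by the mean of the modulus over the preceding cell, and the
  preceding cells tile an interval. The bound reaches down to \<open>-t\<close> because the first
  cell uses the average over a cell to the left of 0.\<close>

lemma cell_step_contraction:
  fixes f :: "real \<Rightarrow> real" and n :: nat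
  assumes t: "t > 0" "n > 0" and f[measurable]: "f \<in> borel_measurable borel" and b: "\<And>r. \<bar>f r\<bar> \<le> C"
  shows "(\<integral>\<^sup>+s. ennreal \<bar>cell_step t n f s\<bar> \<partial>lborel) \<le> (\<integral>\<^sup>+s\<in>{-t..t}. ennreal \<bar>f s\<bar> \<partial>lborel)"
proof -
  have "(\<integral>\<^sup>+s. ennreal \<bar>cell_step t n f s\<bar> \<partial>lborel)
     \<le> (\<integral>\<^sup>+s. (\<Sum>i<n. ennreal \<bar>cell_avg t n f i\<bar> * indicator {real i * t / n<..real (Suc i) * t / n} s) \<partial>lborel)"
  proof (intro nn_integral_mono)
    fix s
    have "\<bar>cell_step t n f s\<bar> \<le> (\<Sum>i<n. \<bar>cell_avg t n f i * indicator {real i * t / n<..real (Suc i) * t / n} s\<bar>)"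
      unfolding cell_step_def by (rule sum_abs)
    then have "ennreal \<bar>cell_step t n f s\<bar> \<le> ennreal (\<Sum>i<n. \<bar>cell_avg t n f i * indicator {real i * t / n<..real (Suc i) * t / n} s\<bar>)"
      by (rule ennreal_leI)
    also have "\<dots> = (\<Sum>i<n. ennreal \<bar>cell_avg t n f i\<bar> * indicator {real i * t / n<..real (Suc i) * t / n} s)"
    proof -
      have "ennreal \<bar>a * indicator S s\<bar> = ennreal \<bar>a\<bar> * indicator S s" for a :: real and S :: "real set"
        by (simp add: indicator_def)
      then show ?thesis by (subst sum_ennreal[symmetric]) (auto simp del: of_nat_Suc)
    qed
    finally show "ennreal \<bar>cell_step t n f s\<bar> \<le> \<dots>" .
  qed
  also have "\<dots> = (\<Sum>i<n. ennreal \<bar>cell_avg t n f i\<bar> * ennreal (t / n))"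
  proof -
    have "emeasure lborel {real i * t / n<..real (Suc i) * t / n} = ennreal (t / n)" for i
      using cell_measure[OF t, of "Suc i"] by simp
    then show ?thesis by (subst nn_integral_sum) (auto simp: nn_integral_cmult_indicator)
  qed
  also have "\<dots> \<le> (\<Sum>i<n. (\<integral>\<^sup>+r. ennreal \<bar>f r\<bar> * indicator {(real i - 1) * t / n<..real i * t / n} r \<partial>lborel))"
    by (intro sum_mono cell_avg_nn_bound[OF assms])
  also have "\<dots> = (\<integral>\<^sup>+r. ennreal \<bar>f r\<bar> * indicator {- t / n<..(real n - 1) * t / n} r \<partial>lborel)"
    by (subst nn_integral_sum[symmetric]) (auto simp: sum_distrib_left[symmetric] cell_indicator_sum[OF t])
  also have "\<dots> \<le> (\<integral>\<^sup>+s\<in>{-t..t}. ennreal \<bar>f s\<bar> \<partial>lborel)"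
  proof -
    have a: "t \<le> t * real n" using t by (simp add: mult_le_cancel_left1)
    then have "- t \<le> - t / n" "(real n - 1) * t / n \<le> t" using t by (auto simp: field_simps)
    then show ?thesis by (intro nn_integral_mono) (auto simp: indicator_def)
  qed
  finally show ?thesis .
qed

lemma cell_step_on_cell:
  fixes n :: nat
  assumes "t > 0" "n > 0" "i < n" "real i * t / n < s" "s \<le> real (Suc i) * t / n"
  shows "cell_step t n f s = cell_avg t n f i"
proof -
  have "cell_avg t n f j * indicator {real j * t / n<..real (Suc j) * t / n} s = (if j = i then cell_avg t n f i else 0)" for j
  proof (cases j i rule: linorder_cases)
    case less
    then have "real (Suc j) * t / n \<le> real i * t / n" using assms by (intro divide_right_mono mult_right_mono) auto
    then show ?thesis using less assms by auto
  next
    case greater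
    then have "real (Suc i) * t / n \<le> real j * t / n" using assms by (intro divide_right_mono mult_right_mono) auto
    then show ?thesis using greater assms by auto
  qed (use assms in auto)
  then show ?thesis unfolding cell_step_def using assms by simp
qed

lemma cell_exists:
  fixes n :: nat
  assumes "t > 0" "n > 0" "0 < s" "s \<le> t"
  obtains i where "i < n" "real i * t / n < s" "s \<le> real (Suc i) * t / n"
proof -
  \<comment> \<open>Cells are open on the left and closed on the right, hence the ceiling.\<close>
  define c where "c = \<lceil>s * n / t\<rceil>"
  have pos: "s * n / t > 0" using assms by simp
  then have c1: "c \<ge> 1" unfolding c_def by linarith
  have "s * n / t \<le> n" using assms by (simp add: field_simps mult_right_mono)
  then have cn: "c \<le> int n" unfolding c_def by linarith
  define i where "i = nat (c - 1)"
  have ri: "real i = real_of_int c - 1" using c1 unfolding i_def by simp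
  have "i < n" using c1 cn unfolding i_def by linarith
  moreover have "real i * t / n < s"
  proof -
    have "real i < s * n / t" unfolding ri c_def by linarith
    then show ?thesis using assms by (simp add: field_simps)
  qed
  moreover have "s \<le> real (Suc i) * t / n"
  proof -
    have "s * n / t \<le> real (Suc i)" unfolding c_def using ri c_def by linarith
    then show ?thesis using assms by (simp add: field_simps)
  qed
  ultimately show ?thesis using that by blast
qed

lemma cell_step_bound:
  fixes f :: "real \<Rightarrow> real"
  assumes t: "t > 0" and f: "f \<in> borel_measurable borel" and b: "\<And>r. \<bar>f r\<bar> \<le> C"
  shows "\<bar>cell_step t n f s\<bar> \<le> C"
proof (cases "n > 0 \<and> 0 < s \<and> s \<le> t")
  case True
  then obtain i where "i < n" "real i * t / n < s" "s \<le> real (Suc i) * t / n" using cell_exists t by blast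
  then show ?thesis using cell_step_on_cell[of t n i s f] cell_avg_bound[OF t _ f b, of n] True t by simp
next
  case False
  have C: "0 \<le> C" using b[of 0] by auto
  have "indicator {real i * t / n<..real (Suc i) * t / n} s = (0::real)" if "i < n" for i
  proof -
    have "0 \<le> real i * t / n" using t by simp
    moreover have "real (Suc i) * t / n \<le> t"
    proof -
      have "real (Suc i) * t \<le> real n * t" using that t by (intro mult_right_mono) auto
      then show ?thesis using that by (simp add: field_simps)
    qed
    ultimately show ?thesis using False that by (auto simp: indicator_def)
  qed
  then show ?thesis using C unfolding cell_step_def by simp
qed

lemma cell_avg_const:
  fixes n :: nat
  assumes "t > 0" "n > 0"
  shows "cell_avg t n (\<lambda>_. c) i = c"
proof -
  have "measure lborel {(real i - 1) * t / n<..real i * t / n} = t / n"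
    using cell_measure[OF assms, of i] assms by (simp add: measure_def)
  moreover have "{(real i - 1) * t / n<..real i * t / n} \<in> sets lborel" by simp
  moreover have "emeasure lborel {(real i - 1) * t / n<..real i * t / n} < \<infinity>"
    using cell_measure[OF assms, of i] by simp
  ultimately show ?thesis
    unfolding cell_avg_def set_lebesgue_integral_def using assms by simp
qed

lemma cell_step_continuous_tendsto:
  fixes g :: "real \<Rightarrow> real"
  assumes t: "t > 0" and g: "continuous_on UNIV g" and b: "\<And>r. \<bar>g r\<bar> \<le> C" and s: "0 < s" "s \<le> t"
  shows "(\<lambda>n. cell_step t n g s) \<longlonglongrightarrow> g s"
proof (rule LIMSEQ_I)
  fix e :: real assume e: "e > 0"
  have gm[measurable]: "g \<in> borel_measurable borel" using g by (rule borel_measurable_continuous_onI)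
  have "isCont g s" using g by (simp add: continuous_on_eq_continuous_at)
  then obtain d where d: "d > 0" "\<And>r. \<bar>r - s\<bar> < d \<Longrightarrow> \<bar>g r - g s\<bar> < e / 2"
    unfolding continuous_at_eps_delta dist_real_def using e half_gt_zero by metis
  \<comment> \<open>Points of a cell and of its predecessor are less than \<open>2 * t / n\<close>
    apart; \<open>N\<close> makes this smaller than \<open>d\<close>.\<close>
  obtain N :: nat where N: "2 * t / d < N" using reals_Archimedean2 by blast
  have "norm (cell_step t n g s - g s) < e" if n: "n \<ge> Suc N" for n
  proof -
    have n0: "n > 0" using n by simp
    have "real N \<le> real n" using n by simp
    then have "2 * t / d < n" using N by linarith
    then have nd: "2 * t / n < d" using n0 d by (simp add: field_simps)
    obtain i where i: "i < n" "real i * t / n < s" "s \<le> real (Suc i) * t / n" using cell_exists t s n0 by blast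
    let ?c = "{(real i - 1) * t / n<..real i * t / n}"
    \<comment> \<open>The deviation from \<open>g s\<close> is set to 0 far from \<open>s\<close>,
      which yields the global bound that \<open>cell_avg_bound\<close> asks for without changing the
      average.\<close>
    define h where "h = (\<lambda>r. if \<bar>r - s\<bar> < d then g r - g s else 0)"
    have hm: "h \<in> borel_measurable borel" unfolding h_def by measurable
    have hb: "\<bar>h r\<bar> \<le> e / 2" for r using d(2)[of r] e unfolding h_def by auto
    have inc: "\<bar>r - s\<bar> < d" if "r \<in> ?c" for r
    proof -
      have "real (Suc i) * t / n - (real i - 1) * t / n = 2 * t / n" using n0 by (simp add: field_simps)
      then show ?thesis using that i nd by auto
    qed
    have "cell_avg t n g i - g s = cell_avg t n g i - cell_avg t n (\<lambda>_. g s) i"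
      using cell_avg_const[OF t n0] by simp
    also have "\<dots> = real n / t * ((LINT r:?c|lborel. g r) - (LINT r:?c|lborel. g s))"
      unfolding cell_avg_def by (simp add: right_diff_distrib)
    also have "(LINT r:?c|lborel. g r) - (LINT r:?c|lborel. g s) = (LINT r:?c|lborel. g r - g s)"
      by (rule set_integral_diff(2)[symmetric]; rule bounded_cell_integrable[of _ C]) (use b in auto)
    also have "\<dots> = (LINT r:?c|lborel. h r)"
      by (rule set_lebesgue_integral_cong) (use inc in \<open>auto simp: h_def\<close>)
    also have "real n / t * \<dots> = cell_avg t n h i" unfolding cell_avg_def ..
    finally have "\<bar>cell_avg t n g i - g s\<bar> \<le> e / 2" using cell_avg_bound[OF t n0 hm hb] by simp
    then show ?thesis using cell_step_on_cell[OF t n0 i] e by simp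
  qed
  then show "\<exists>no. \<forall>n\<ge>no. norm (cell_step t n g s - g s) < e" by blast
qed

lemma cell_step_diff:
  fixes f g :: "real \<Rightarrow> real"
  assumes "f \<in> borel_measurable borel" "\<And>r. \<bar>f r\<bar> \<le> C" "g \<in> borel_measurable borel" "\<And>r. \<bar>g r\<bar> \<le> C"
  shows "cell_step t n (\<lambda>r. f r - g r) s = cell_step t n f s - cell_step t n g s"
proof -
  have "cell_avg t n (\<lambda>r. f r - g r) i = cell_avg t n f i - cell_avg t n g i" for i
    unfolding cell_avg_def
    by (subst set_integral_diff(2)) (auto intro!: bounded_cell_integrable[of _ C] assms simp: right_diff_distrib)
  then show ?thesis unfolding cell_step_def by (simp add: left_diff_distrib sum_subtractf)
qed

text \<open>Measurable functions on the line are almost everywhere limits of continuous ones;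
  clamping the approximants to the range of \<open>f\<close> restores the uniform bound and keeps
  the limit.\<close>

lemma bounded_borel_continuous_approx:
  fixes f :: "real \<Rightarrow> real"
  assumes f: "f \<in> borel_measurable borel" and b: "\<And>r. \<bar>f r\<bar> \<le> C"
  obtains g where "\<And>k. continuous_on UNIV (g k)" "\<And>k r. \<bar>g k r\<bar> \<le> C"
    "AE r in lborel. (\<lambda>k. g k r) \<longlonglongrightarrow> (f r :: real)"
proof -
  have C: "0 \<le> C" using b[of 0] by auto
  have "f measurable_on UNIV"
    by (rule lebesgue_measurable_imp_measurable_on) (use f in \<open>auto intro: borel_measurable_subalgebra\<close>)
  then obtain N g where g: "negligible N" "\<And>n. continuous_on UNIV (g n)" "\<And>x. x \<notin> N \<Longrightarrow> (\<lambda>n. g n x) \<longlonglongrightarrow> f x"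
    unfolding measurable_on_def by auto
  define h where "h = (\<lambda>k r. max (- C) (min C (g k r)))"
  have "continuous_on UNIV (h k)" for k unfolding h_def by (intro continuous_intros g(2))
  moreover have "\<bar>h k r\<bar> \<le> C" for k r unfolding h_def using C by auto
  moreover have "AE r in lborel. (\<lambda>k. h k r) \<longlonglongrightarrow> f r"
  proof -
    have lim: "(\<lambda>k. h k r) \<longlonglongrightarrow> f r" if "r \<notin> N" for r
    proof -
      have "(\<lambda>k. h k r) \<longlonglongrightarrow> max (- C) (min C (f r))" unfolding h_def by (intro tendsto_intros g(3) that)
      moreover have "max (- C) (min C (f r)) = f r" using b[of r] by auto
      ultimately show ?thesis by simp
    qed
    have "N \<in> null_sets lebesgue" using g(1) by (simp add: negligible_iff_null_sets)
    then have "AE r in lebesgue. r \<notin> N" by (rule AE_not_in)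
    then have "AE r in lebesgue. (\<lambda>k. h k r) \<longlonglongrightarrow> f r" by eventually_elim (rule lim)
    then show ?thesis by (simp add: AE_completion_iff)
  qed
  ultimately show ?thesis using that by blast
qed

text \<open>Density argument: averaging is an L1 contraction, so convergence for continuous
  functions, where it is pointwise, carries over to bounded measurable ones.\<close>

lemma cell_step_L1_tendsto:
  fixes f :: "real \<Rightarrow> real"
  assumes t: "t > 0" and f[measurable]: "f \<in> borel_measurable borel" and b: "\<And>r. \<bar>f r\<bar> \<le> C"
  shows "(\<lambda>n. \<integral>\<^sup>+s\<in>{0..t}. ennreal \<bar>cell_step t n f s - f s\<bar> \<partial>lborel) \<longlonglongrightarrow> 0"
proof -
  have C: "0 \<le> C" using b[of 0] by auto
  obtain g where g: "\<And>k. continuous_on UNIV (g k)" "\<And>k r. \<bar>g k r\<bar> \<le> C"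
    "AE r in lborel. (\<lambda>k. g k r) \<longlonglongrightarrow> f r" using bounded_borel_continuous_approx[OF f b] by blast
  have gm[measurable]: "g k \<in> borel_measurable borel" for k using g(1) by (rule borel_measurable_continuous_onI)
  have fin: "(\<integral>\<^sup>+s. ennreal (2 * C) * indicator {a..b} s \<partial>lborel) < \<infinity>" for a b :: real
    by (subst nn_integral_cmult_indicator) (auto simp: emeasure_lborel_Icc_eq ennreal_mult_less_top)
  have d2: "\<bar>x - y\<bar> \<le> 2 * C" if "\<bar>x\<bar> \<le> C" "\<bar>y\<bar> \<le> C" for x y :: real using that by auto
  have l1: "(\<lambda>k. \<integral>\<^sup>+s\<in>{-t..t}. ennreal \<bar>f s - g k s\<bar> \<partial>lborel) \<longlonglongrightarrow> (\<integral>\<^sup>+s. 0 \<partial>(lborel::real measure))"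
  proof (rule nn_integral_dominated_convergence[where w = "\<lambda>s. ennreal (2 * C) * indicator {-t..t} s"])
    show "AE s in lborel. (\<lambda>k. ennreal \<bar>f s - g k s\<bar> * indicator {- t..t} s) \<longlonglongrightarrow> 0"
      using g(3)
    proof eventually_elim
      case (elim s)
      then have "(\<lambda>k. \<bar>f s - g k s\<bar>) \<longlonglongrightarrow> \<bar>f s - f s\<bar>" by (intro tendsto_intros)
      then have "(\<lambda>k. ennreal \<bar>f s - g k s\<bar>) \<longlonglongrightarrow> ennreal 0" by (intro tendsto_ennrealI) simp
      then show ?case by (cases "s \<in> {-t..t}") auto
    qed
  qed (use fin d2 b g(2) in \<open>auto intro!: AE_I2 mult_right_mono ennreal_leI\<close>)
  have l2: "(\<lambda>n. \<integral>\<^sup>+s\<in>{0..t}. ennreal \<bar>cell_step t n (g k) s - g k s\<bar> \<partial>lborel) \<longlonglongrightarrow> (\<integral>\<^sup>+s. 0 \<partial>(lborel::real measure))" for k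
  proof (rule nn_integral_dominated_convergence[where w = "\<lambda>s. ennreal (2 * C) * indicator {0..t} s"])
    \<comment> \<open>Since cells are open on the left, the step function vanishes at 0 whatever
      \<open>g k\<close> is; this point is discarded as a null set.\<close>
    have "AE s in lborel. s \<noteq> (0::real)" by (rule AE_lborel_singleton)
    then show "AE s in lborel. (\<lambda>n. ennreal \<bar>cell_step t n (g k) s - g k s\<bar> * indicator {0..t} s) \<longlonglongrightarrow> 0"
    proof eventually_elim
      case (elim s)
      show ?case
      proof (cases "s \<in> {0..t}")
        case True
        then have "(\<lambda>n. cell_step t n (g k) s) \<longlonglongrightarrow> g k s"
          using cell_step_continuous_tendsto[OF t g(1) g(2)] elim by auto
        then have "(\<lambda>n. \<bar>cell_step t n (g k) s - g k s\<bar>) \<longlonglongrightarrow> \<bar>g k s - g k s\<bar>" by (intro tendsto_intros)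
        then have "(\<lambda>n. ennreal \<bar>cell_step t n (g k) s - g k s\<bar>) \<longlonglongrightarrow> ennreal 0" by (intro tendsto_ennrealI) simp
        then show ?thesis using True by simp
      qed simp
    qed
  qed (use fin d2 cell_step_bound[OF t gm g(2)] g(2) in \<open>auto intro!: AE_I2 mult_right_mono ennreal_leI\<close>)
  let ?e = "\<lambda>n. \<integral>\<^sup>+s\<in>{0..t}. ennreal \<bar>cell_step t n f s - f s\<bar> \<partial>lborel"
  \<comment> \<open>The error \<open>f - g k\<close> is paid for twice, once directly and once after
    averaging, where the contraction enlarges the interval to \<open>{-t..t}\<close>.\<close>
  have bound: "?e n \<le> 2 * (\<integral>\<^sup>+s\<in>{-t..t}. ennreal \<bar>f s - g k s\<bar> \<partial>lborel)
      + (\<integral>\<^sup>+s\<in>{0..t}. ennreal \<bar>cell_step t n (g k) s - g k s\<bar> \<partial>lborel)" if n: "n > 0" for n k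
  proof -
    let ?d = "\<lambda>r. f r - g k r"
    have split: "cell_step t n f s - f s = cell_step t n ?d s + (cell_step t n (g k) s - g k s) - ?d s" for s
      by (subst cell_step_diff[OF f b gm g(2)]) simp
    have "?e n \<le> (\<integral>\<^sup>+s. ennreal \<bar>cell_step t n ?d s\<bar> + ennreal \<bar>cell_step t n (g k) s - g k s\<bar> * indicator {0..t} s
        + ennreal \<bar>?d s\<bar> * indicator {-t..t} s \<partial>lborel)"
    proof (intro nn_integral_mono)
      fix s
      have "\<bar>cell_step t n f s - f s\<bar> \<le> \<bar>cell_step t n ?d s\<bar> + \<bar>cell_step t n (g k) s - g k s\<bar> + \<bar>?d s\<bar>"
        unfolding split by linarith
      then have "ennreal \<bar>cell_step t n f s - f s\<bar> \<le> ennreal \<bar>cell_step t n ?d s\<bar> + ennreal \<bar>cell_step t n (g k) s - g k s\<bar> + ennreal \<bar>?d s\<bar>"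
        by (simp add: ennreal_plus[symmetric] ennreal_leI del: ennreal_plus)
      then show "ennreal \<bar>cell_step t n f s - f s\<bar> * indicator {0..t} s \<le>
        ennreal \<bar>cell_step t n ?d s\<bar> + ennreal \<bar>cell_step t n (g k) s - g k s\<bar> * indicator {0..t} s
        + ennreal \<bar>?d s\<bar> * indicator {-t..t} s"
        using t by (auto simp: indicator_def)
    qed
    also have "\<dots> = (\<integral>\<^sup>+s. ennreal \<bar>cell_step t n ?d s\<bar> \<partial>lborel)
      + (\<integral>\<^sup>+s\<in>{0..t}. ennreal \<bar>cell_step t n (g k) s - g k s\<bar> \<partial>lborel) + (\<integral>\<^sup>+s\<in>{-t..t}. ennreal \<bar>?d s\<bar> \<partial>lborel)"
      by (simp add: nn_integral_add)
    also have "\<dots> \<le> (\<integral>\<^sup>+s\<in>{-t..t}. ennreal \<bar>?d s\<bar> \<partial>lborel)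
      + (\<integral>\<^sup>+s\<in>{0..t}. ennreal \<bar>cell_step t n (g k) s - g k s\<bar> \<partial>lborel) + (\<integral>\<^sup>+s\<in>{-t..t}. ennreal \<bar>?d s\<bar> \<partial>lborel)"
      by (intro add_mono order_refl cell_step_contraction[OF t n, of _ "2 * C"]) (use d2 b g(2) in auto)
    finally show ?thesis by (simp add: mult_2 ac_simps)
  qed
  show ?thesis
  proof (rule ennreal_tendsto_0I)
    fix e :: real assume e: "0 < e"
    have "eventually (\<lambda>k. (\<integral>\<^sup>+s\<in>{-t..t}. ennreal \<bar>f s - g k s\<bar> \<partial>lborel) < ennreal (e / 4)) sequentially"
      using order_tendstoD(2)[OF l1, of "ennreal (e / 4)"] e by simp
    then obtain k where k: "(\<integral>\<^sup>+s\<in>{-t..t}. ennreal \<bar>f s - g k s\<bar> \<partial>lborel) < ennreal (e / 4)"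
      by (auto dest: eventually_happens)
    have "eventually (\<lambda>n. (\<integral>\<^sup>+s\<in>{0..t}. ennreal \<bar>cell_step t n (g k) s - g k s\<bar> \<partial>lborel) < ennreal (e / 2)) sequentially"
      using order_tendstoD(2)[OF l2, of "ennreal (e / 2)"] e by simp
    then show "eventually (\<lambda>n. ?e n \<le> ennreal e) sequentially"
      using eventually_gt_at_top[of 0]
    proof eventually_elim
      case (elim n)
      have "?e n \<le> 2 * (\<integral>\<^sup>+s\<in>{-t..t}. ennreal \<bar>f s - g k s\<bar> \<partial>lborel)
        + (\<integral>\<^sup>+s\<in>{0..t}. ennreal \<bar>cell_step t n (g k) s - g k s\<bar> \<partial>lborel)" using bound elim by simp
      also have "\<dots> \<le> 2 * ennreal (e / 4) + ennreal (e / 2)" using k elim by (intro add_mono mult_left_mono) auto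
      also have "\<dots> = ennreal e"
        using e by (simp add: mult_2 ennreal_plus[symmetric] del: ennreal_plus)
      finally show ?case .
    qed
  qed
qed

lemma ennreal_square_bound:
  assumes "\<bar>x\<bar> \<le> C" shows "ennreal (x\<^sup>2) \<le> ennreal C * ennreal \<bar>x\<bar>"
proof -
  have "x\<^sup>2 = \<bar>x\<bar> * \<bar>x\<bar>" by (simp add: power2_eq_square)
  also have "\<dots> \<le> C * \<bar>x\<bar>" using assms by (intro mult_right_mono) auto
  finally show ?thesis using assms by (subst ennreal_mult[symmetric]) (auto intro!: ennreal_leI)
qed

text \<open>The difference is bounded by \<open>2 * C\<close>, so its square is at most
  \<open>2 * C\<close> times its modulus and L1 convergence suffices.\<close>

lemma cell_step_L2_tendsto:
  fixes f :: "real \<Rightarrow> real"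
  assumes t: "t > 0" and f[measurable]: "f \<in> borel_measurable borel" and b: "\<And>r. \<bar>f r\<bar> \<le> C"
  shows "(\<lambda>n. \<integral>\<^sup>+s\<in>{0..t}. ennreal ((cell_step t n f s - f s)\<^sup>2) \<partial>lborel) \<longlonglongrightarrow> 0"
proof -
  have "0 \<le> C" using b[of 0] by auto
  then have lim: "(\<lambda>n. ennreal (2 * C) * (\<integral>\<^sup>+s\<in>{0..t}. ennreal \<bar>cell_step t n f s - f s\<bar> \<partial>lborel)) \<longlonglongrightarrow> 0"
    using ennreal_tendsto_cmult[OF _ cell_step_L1_tendsto[OF assms], of "ennreal (2 * C)"] by simp
  show ?thesis
  proof (rule tendsto_sandwich[OF _ _ tendsto_const])
    show "eventually (\<lambda>n. (\<integral>\<^sup>+s\<in>{0..t}. ennreal ((cell_step t n f s - f s)\<^sup>2) \<partial>lborel)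
      \<le> ennreal (2 * C) * (\<integral>\<^sup>+s\<in>{0..t}. ennreal \<bar>cell_step t n f s - f s\<bar> \<partial>lborel)) sequentially"
    proof (intro always_eventually allI)
      fix n
      have "\<bar>cell_step t n f s - f s\<bar> \<le> 2 * C" for s
        using cell_step_bound[OF assms, of n s] b[of s] by linarith
      then have "ennreal ((cell_step t n f s - f s)\<^sup>2) * indicator {0..t} s
          \<le> ennreal (2 * C) * (ennreal \<bar>cell_step t n f s - f s\<bar> * indicator {0..t} s)" for s
        using ennreal_square_bound by (auto simp: indicator_def)
      then show "(\<integral>\<^sup>+s\<in>{0..t}. ennreal ((cell_step t n f s - f s)\<^sup>2) \<partial>lborel)
          \<le> ennreal (2 * C) * (\<integral>\<^sup>+s\<in>{0..t}. ennreal \<bar>cell_step t n f s - f s\<bar> \<partial>lborel)"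
        by (subst nn_integral_cmult[symmetric]) (auto intro!: nn_integral_mono)
    qed
  qed (use lim in auto)
qed

section \<open>Energy of a path, and joint measurability in the random parameter and time\<close>

definition energy :: "real \<Rightarrow> (real \<Rightarrow> real) \<Rightarrow> ennreal" where
  "energy t f = (\<integral>\<^sup>+s\<in>{0..t}. ennreal ((f s)\<^sup>2) \<partial>lborel)"

text \<open>Joint measurability on the time interval, encoded by an indicator on the whole line and
  not by a restricted time space as in \<open>progressive\<close>. Products with
  \<open>lborel\<close>, and thus Tonelli, apply to this form directly.\<close>

definition sections_measurable :: "'a measure \<Rightarrow> real \<Rightarrow> (real \<Rightarrow> 'a \<Rightarrow> real) \<Rightarrow> bool" where
  "sections_measurable N t H \<longleftrightarrow> (\<lambda>(\<omega>, s). indicator {0..t} s * H s \<omega>) \<in> borel_measurable (N \<Otimes>\<^sub>M borel)"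

lemma square_diff_le: "(x - y)\<^sup>2 \<le> 2 * x\<^sup>2 + 2 * (y::real)\<^sup>2"
proof -
  have "2 * x\<^sup>2 + 2 * y\<^sup>2 - (x - y)\<^sup>2 = (x + y)\<^sup>2" by (simp add: power2_eq_square algebra_simps)
  then show ?thesis using zero_le_power2[of "x + y"] by linarith
qed

lemma ennreal_square_diff_le: "ennreal ((x - y)\<^sup>2) \<le> 2 * ennreal (x\<^sup>2) + 2 * ennreal (y\<^sup>2)"
proof -
  have "ennreal ((x - y)\<^sup>2) \<le> ennreal (2 * x\<^sup>2 + 2 * y\<^sup>2)" by (intro ennreal_leI square_diff_le)
  also have "\<dots> = ennreal 2 * ennreal (x\<^sup>2) + ennreal 2 * ennreal (y\<^sup>2)"
    by (subst ennreal_plus, simp, simp, subst (1 2) ennreal_mult, simp_all)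
  finally show ?thesis by simp
qed

lemma energy_eq: "energy t f = (\<integral>\<^sup>+s. ennreal ((indicator {0..t} s * f s)\<^sup>2) \<partial>lborel)"
  unfolding energy_def by (intro nn_integral_cong) (auto simp: indicator_def)

lemma energy_diff_le:
  assumes "(\<lambda>s. indicator {0..t} s * f s) \<in> borel_measurable borel" "(\<lambda>s. indicator {0..t} s * g s) \<in> borel_measurable borel"
  shows "energy t (\<lambda>s. f s - g s) \<le> 2 * energy t f + 2 * energy t g"
proof -
  have "energy t (\<lambda>s. f s - g s) \<le> (\<integral>\<^sup>+s. 2 * ennreal ((indicator {0..t} s * f s)\<^sup>2) + 2 * ennreal ((indicator {0..t} s * g s)\<^sup>2) \<partial>lborel)"
    unfolding energy_eq right_diff_distrib by (intro nn_integral_mono ennreal_square_diff_le)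
  also have "\<dots> = 2 * energy t f + 2 * energy t g"
    using assms unfolding energy_eq by (subst nn_integral_add) (simp_all add: nn_integral_cmult)
  finally show ?thesis .
qed

lemma energy_cong: "(\<And>s. s \<in> {0..t} \<Longrightarrow> f s = g s) \<Longrightarrow> energy t f = energy t g"
  unfolding energy_def by (intro nn_integral_cong) (auto simp: indicator_def)

lemma sections_measurable_section:
  assumes "sections_measurable N t H" "\<omega> \<in> space N"
  shows "(\<lambda>s. indicator {0..t} s * H s \<omega>) \<in> borel_measurable borel"
proof -
  have "(\<lambda>s. (\<lambda>(\<omega>, s). indicator {0..t} s * H s \<omega>) (\<omega>, s)) \<in> borel_measurable borel"
    using assms unfolding sections_measurable_def by (intro measurable_compose[OF measurable_Pair1']) auto
  then show ?thesis by simp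
qed

lemma sections_measurable_energy:
  assumes "sections_measurable N t H"
  shows "(\<lambda>\<omega>. energy t (\<lambda>s. H s \<omega>)) \<in> borel_measurable N"
proof -
  have "(\<lambda>(\<omega>, s). ennreal ((indicator {0..t} s * H s \<omega>)\<^sup>2)) \<in> borel_measurable (N \<Otimes>\<^sub>M lborel)"
  proof -
    have "(\<lambda>z. (case z of (\<omega>, s) \<Rightarrow> indicator {0..t} s * H s \<omega>)) \<in> borel_measurable (N \<Otimes>\<^sub>M lborel)"
      using assms unfolding sections_measurable_def by (simp cong: measurable_cong_sets sets_pair_measure_cong)
    then have "(\<lambda>z. ennreal ((case z of (\<omega>, s) \<Rightarrow> indicator {0..t} s * H s \<omega>)\<^sup>2)) \<in> borel_measurable (N \<Otimes>\<^sub>M lborel)"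
      by measurable
    then show ?thesis by (simp add: case_prod_beta')
  qed
  then show ?thesis unfolding energy_eq
    by (rule lborel.borel_measurable_nn_integral)
qed

lemma sections_measurable_diff:
  assumes "sections_measurable N t H" "sections_measurable N t K"
  shows "sections_measurable N t (\<lambda>s \<omega>. H s \<omega> - K s \<omega>)"
proof -
  have "(\<lambda>z. (case z of (\<omega>, s) \<Rightarrow> indicator {0..t} s * H s \<omega>) - (case z of (\<omega>, s) \<Rightarrow> indicator {0..t} s * K s \<omega>)) \<in> borel_measurable (N \<Otimes>\<^sub>M borel)"
    using assms unfolding sections_measurable_def by (rule borel_measurable_diff)
  then show ?thesis unfolding sections_measurable_def by (simp add: case_prod_beta' right_diff_distrib)
qed

lemma sections_measurable_clamp:
  assumes "sections_measurable N t H"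
  shows "sections_measurable N t (\<lambda>s \<omega>. max (- c) (min c (H s \<omega>)))"
proof -
  have "(\<lambda>z. indicator {0..t} (snd z) * max (- c) (min c (case z of (\<omega>, s) \<Rightarrow> indicator {0..t} s * H s \<omega>))) \<in> borel_measurable (N \<Otimes>\<^sub>M borel)"
    by (intro borel_measurable_times borel_measurable_max borel_measurable_min assms[unfolded sections_measurable_def] borel_measurable_const
          measurable_compose[OF measurable_snd]) simp_all
  then show ?thesis unfolding sections_measurable_def
    by (rule measurable_cong[THEN iffD1, rotated]) (auto simp: indicator_def)
qed

section \<open>Adapted step approximations of progressive processes\<close>

context brownian_setup
begin

text \<open>Extending from the restricted time space to the line is done by clamping time to
  \<open>{0..u}\<close>, which is measurable and is the identity there.\<close>

lemma progressive_sections: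
  assumes "t \<le> T"
  shows "progressive t F H \<longleftrightarrow> (\<forall>u\<in>{0..t}. sections_measurable (F u) u H)"
proof -
  have "(\<lambda>(\<omega>, s). H s \<omega>) \<in> borel_measurable (F u \<Otimes>\<^sub>M restrict_space borel {0..u}) \<longleftrightarrow> sections_measurable (F u) u H"
    if u: "u \<in> {0..t}" for u
  proof
    assume m: "(\<lambda>(\<omega>, s). H s \<omega>) \<in> borel_measurable (F u \<Otimes>\<^sub>M restrict_space borel {0..u})"
    have "(\<lambda>z. (fst z, max 0 (min u (snd z)))) \<in> measurable (F u \<Otimes>\<^sub>M borel) (F u \<Otimes>\<^sub>M restrict_space borel {0..u})"
      using u by (intro measurable_Pair measurable_fst measurable_restrict_space2) auto
    from measurable_compose[OF this m]
    have "(\<lambda>z. H (max 0 (min u (snd z))) (fst z)) \<in> borel_measurable (F u \<Otimes>\<^sub>M borel)" by simp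
    then have "(\<lambda>z. indicator {0..u} (snd z) * H (max 0 (min u (snd z))) (fst z)) \<in> borel_measurable (F u \<Otimes>\<^sub>M borel)"
      by (intro borel_measurable_times measurable_compose[OF measurable_snd]) auto
    then show "sections_measurable (F u) u H" unfolding sections_measurable_def
      by (rule measurable_cong[THEN iffD1, rotated]) (auto simp: indicator_def)
  next
    assume m: "sections_measurable (F u) u H"
    have "(\<lambda>z. (fst z, snd z)) \<in> measurable (F u \<Otimes>\<^sub>M restrict_space borel {0..u}) (F u \<Otimes>\<^sub>M borel)"
      by (intro measurable_Pair measurable_fst measurable_compose[OF measurable_snd measurable_restrict_space1]) auto
    from measurable_compose[OF this m[unfolded sections_measurable_def]]
    have "(\<lambda>z. indicator {0..u} (snd z) * H (snd z) (fst z)) \<in> borel_measurable (F u \<Otimes>\<^sub>M restrict_space borel {0..u})" by simp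
    then show "(\<lambda>(\<omega>, s). H s \<omega>) \<in> borel_measurable (F u \<Otimes>\<^sub>M restrict_space borel {0..u})"
      by (rule measurable_cong[THEN iffD1, rotated]) (auto simp: space_pair_measure)
  qed
  then show ?thesis unfolding progressive_def by simp
qed

lemma sections_measurable_F_M:
  assumes "sections_measurable (F u) t H" "u \<in> {0..T}"
  shows "sections_measurable M t H"
proof -
  have "(\<lambda>z. (fst z, snd z)) \<in> measurable (M \<Otimes>\<^sub>M borel) (F u \<Otimes>\<^sub>M (borel :: real measure))"
    using assms(2) by (intro measurable_Pair measurable_snd measurable_compose[OF measurable_fst] measurable_F_M[of u]) auto
  from measurable_compose[OF this assms(1)[unfolded sections_measurable_def]]
  show ?thesis unfolding sections_measurable_def by (simp add: case_prod_beta')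
qed

lemma progressive_sections_M: "progressive t F H \<Longrightarrow> 0 \<le> t \<Longrightarrow> t \<le> T \<Longrightarrow> sections_measurable M t H"
  using progressive_sections[of t H] by (intro sections_measurable_F_M[of t]) auto

lemma simple_process_sections:
  assumes "simple_integrand M F t n p \<eta>" "t \<le> T"
  shows "sections_measurable M t (simple_process n p \<eta>)"
proof -
  note bnd = simple_integrand_bounds[OF assms(1)]
  have [measurable]: "\<eta> i \<in> borel_measurable M" if "i < n" for i
    using assms bnd(2)[of i] bnd(3)[of i] that unfolding simple_integrand_def
    by (intro measurable_F_M[of "p i"]) auto
  have "(\<lambda>z. indicator {0..t} (snd z) * (\<Sum>i<n. \<eta> i (fst z) * indicator {p i<..p (Suc i)} (snd z))) \<in> borel_measurable (M \<Otimes>\<^sub>M (borel :: real measure))"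
    by (intro borel_measurable_times borel_measurable_sum measurable_compose[OF measurable_snd] measurable_compose[OF measurable_fst]) auto
  then show ?thesis unfolding sections_measurable_def simple_process_def by (simp add: case_prod_beta')
qed

text \<open>One natural number encodes, by pairing, a truncation level and a number of cells. A
  single countable index set is what later permits the approximation to be selected measurably in
  the parameters, as the least index with small error.\<close>

definition approx_cells :: "nat \<Rightarrow> nat" where
  "approx_cells j = snd (prod_decode j)"

definition approx_grid :: "real \<Rightarrow> nat \<Rightarrow> nat \<Rightarrow> real" where
  "approx_grid t j i = real i * t / real (approx_cells j)"

definition clamped :: "real \<Rightarrow> nat \<Rightarrow> (real \<Rightarrow> 'a \<Rightarrow> real) \<Rightarrow> 'a \<Rightarrow> real \<Rightarrow> real" where
  "clamped t m H \<omega> r = indicator {0..t} r * max (- real m) (min (real m) (H r \<omega>))"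

definition approx_value :: "real \<Rightarrow> (real \<Rightarrow> 'a \<Rightarrow> real) \<Rightarrow> nat \<Rightarrow> nat \<Rightarrow> 'a \<Rightarrow> real" where
  "approx_value t H j i \<omega> = cell_avg t (approx_cells j) (clamped t (fst (prod_decode j)) H \<omega>) i"

definition approx_process :: "real \<Rightarrow> (real \<Rightarrow> 'a \<Rightarrow> real) \<Rightarrow> nat \<Rightarrow> real \<Rightarrow> 'a \<Rightarrow> real" where
  "approx_process t H j = simple_process (approx_cells j) (approx_grid t j) (approx_value t H j)"

lemma approx_process_eq:
  "approx_process t H j s \<omega> = cell_step t (approx_cells j) (clamped t (fst (prod_decode j)) H \<omega>) s"
  unfolding approx_process_def simple_process_def cell_step_def approx_grid_def approx_value_def ..

lemma clamped_bound: "\<bar>clamped t m H \<omega> r\<bar> \<le> real m"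
  unfolding clamped_def by (auto simp: indicator_def)

lemma clamped_measurable:
  assumes "sections_measurable N t H" "\<omega> \<in> space N"
  shows "clamped t m H \<omega> \<in> borel_measurable borel"
  using sections_measurable_section[OF sections_measurable_clamp[OF assms(1)] assms(2), of "real m"]
  unfolding clamped_def[abs_def] .

text \<open>The value used on a cell is an average over times before its left end, so progressive
  measurability and integration in time make it measurable there. Boundedness comes from the
  clamping.\<close>

lemma approx_simple_integrand:
  assumes t: "0 < t" "t \<le> T" and H: "progressive t F H"
  shows "simple_integrand M F t (approx_cells j) (approx_grid t j) (approx_value t H j)"
proof -
  let ?n = "approx_cells j" and ?m = "fst (prod_decode j)"
  have grid: "0 \<le> approx_grid t j i \<and> approx_grid t j i \<le> t" if "i \<le> ?n" for i
  proof (cases "?n = 0")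
    \<comment> \<open>The code may prescribe zero cells; division by zero then places every grid
      point at 0.\<close>
    case True
    then show ?thesis using t by (simp add: approx_grid_def)
  next
    case False
    have "real i * t \<le> real ?n * t" using that t by (intro mult_right_mono) auto
    then show ?thesis using False t unfolding approx_grid_def by (simp add: field_simps)
  qed
  have "approx_value t H j i \<in> borel_measurable (F (approx_grid t j i)) \<and>
      (\<exists>C. \<forall>\<omega>\<in>space M. \<bar>approx_value t H j i \<omega>\<bar> \<le> C)" if i: "i < ?n" for i
  proof
    define u where "u = approx_grid t j i"
    have u: "0 \<le> u" "u \<le> t" using grid[of i] i unfolding u_def by auto
    have "sections_measurable (F u) u H" using H u t progressive_sections[of t] by auto
    from sections_measurable_clamp[OF this, of "real ?m"]
    have "(\<lambda>z. indicator {0..u} (snd z) * max (- real ?m) (min (real ?m) (H (snd z) (fst z)))) \<in> borel_measurable (F u \<Otimes>\<^sub>M lborel)"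
      unfolding sections_measurable_def by (simp add: case_prod_beta' cong: measurable_cong_sets sets_pair_measure_cong)
    then have "(\<lambda>z. indicator {(real i - 1) * t / ?n<..real i * t / ?n} (snd z) *\<^sub>R (indicator {0..u} (snd z) * max (- real ?m) (min (real ?m) (H (snd z) (fst z))))) \<in> borel_measurable (F u \<Otimes>\<^sub>M lborel)"
      by (intro borel_measurable_scaleR measurable_compose[OF measurable_snd]) auto
    \<comment> \<open>The averaging cell ends at \<open>u\<close>, so the integrand cut off at
      \<open>u\<close> and the one cut off at \<open>t\<close> coincide on it. Hence the average
      depends on \<open>F u\<close> alone.\<close>
    then have "(\<lambda>(\<omega>, r). indicator {(real i - 1) * t / ?n<..real i * t / ?n} r *\<^sub>R clamped t ?m H \<omega> r) \<in> borel_measurable (F u \<Otimes>\<^sub>M lborel)"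
      by (rule measurable_cong[THEN iffD1, rotated]) (use u in \<open>auto simp: clamped_def indicator_def u_def approx_grid_def\<close>)
    from lborel.borel_measurable_lebesgue_integral[OF this]
    show "approx_value t H j i \<in> borel_measurable (F (approx_grid t j i))"
      unfolding approx_value_def[abs_def] cell_avg_def set_lebesgue_integral_def u_def[symmetric] by simp
    have "\<bar>approx_value t H j i \<omega>\<bar> \<le> real ?m" if "\<omega> \<in> space M" for \<omega>
      unfolding approx_value_def
      by (rule cell_avg_bound) (use t i clamped_bound clamped_measurable[OF progressive_sections_M[OF H] that] in auto)
    then show "\<exists>C. \<forall>\<omega>\<in>space M. \<bar>approx_value t H j i \<omega>\<bar> \<le> C" by blast
  qed
  then show ?thesis unfolding simple_integrand_def
    using grid t by (auto simp: approx_grid_def intro!: divide_right_mono mult_right_mono)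
qed

lemma approx_process_sections:
  assumes "0 < t" "t \<le> T" "progressive t F H"
  shows "sections_measurable M t (approx_process t H j)"
  unfolding approx_process_def by (rule simple_process_sections[OF approx_simple_integrand[OF assms] assms(2)])

text \<open>Clamping moves a value by at most its own modulus, so the energy of \<open>H\<close>
  dominates in both applications of dominated convergence, in time and in \<omega>.\<close>

lemma clamp_energy_tendsto:
  assumes t: "0 < t" "t \<le> T" and H: "progressive t F H"
    and fin: "(\<integral>\<^sup>+\<omega>. energy t (\<lambda>s. H s \<omega>) \<partial>M) < \<infinity>"
  shows "(\<lambda>m. \<integral>\<^sup>+\<omega>. energy t (\<lambda>s. clamped t m H \<omega> s - H s \<omega>) \<partial>M) \<longlonglongrightarrow> 0"
proof -
  have Hm: "sections_measurable M t H" using progressive_sections_M[OF H] t by simp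
  have cm: "energy t (\<lambda>s. clamped t m H \<omega> s - H s \<omega>) = energy t (\<lambda>s. max (- real m) (min (real m) (H s \<omega>)) - H s \<omega>)" for m \<omega>
    by (rule energy_cong) (simp add: clamped_def)
  have meas: "(\<lambda>\<omega>. energy t (\<lambda>s. clamped t m H \<omega> s - H s \<omega>)) \<in> borel_measurable M" for m
    unfolding cm by (rule sections_measurable_energy[OF sections_measurable_diff[OF sections_measurable_clamp[OF Hm] Hm]])
  have sq: "(max (- real m) (min (real m) x) - x)\<^sup>2 \<le> x\<^sup>2" for m x
    by (rule abs_le_square_iff[THEN iffD1]) (auto simp: max_def min_def)
  have dom: "energy t (\<lambda>s. clamped t m H \<omega> s - H s \<omega>) \<le> energy t (\<lambda>s. H s \<omega>)" for m \<omega>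
    unfolding cm unfolding energy_def by (intro nn_integral_mono mult_right_mono ennreal_leI sq) auto
  have lim: "(\<lambda>m. energy t (\<lambda>s. clamped t m H \<omega> s - H s \<omega>)) \<longlonglongrightarrow> 0" if w: "\<omega> \<in> space M" "energy t (\<lambda>s. H s \<omega>) < \<infinity>" for \<omega>
  proof -
    note sec = sections_measurable_section[OF Hm w(1)]
    have "(\<lambda>m. energy t (\<lambda>s. clamped t m H \<omega> s - H s \<omega>)) \<longlonglongrightarrow> (\<integral>\<^sup>+s. 0 \<partial>(lborel::real measure))"
      unfolding energy_eq
    proof (rule nn_integral_dominated_convergence[where w = "\<lambda>s. ennreal ((indicator {0..t} s * H s \<omega>)\<^sup>2)"])
      show "(\<lambda>s. ennreal ((indicator {0..t} s * (clamped t m H \<omega> s - H s \<omega>))\<^sup>2)) \<in> borel_measurable lborel" for m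
      proof -
        have "(\<lambda>s. indicator {0..t} s * clamped t m H \<omega> s) \<in> borel_measurable borel"
          using clamped_measurable[OF Hm w(1)] by (intro borel_measurable_times) auto
        from borel_measurable_diff[OF this sec] show ?thesis unfolding right_diff_distrib by simp
      qed
      show "AE s in lborel. ennreal ((indicator {0..t} s * (clamped t m H \<omega> s - H s \<omega>))\<^sup>2) \<le> ennreal ((indicator {0..t} s * H s \<omega>)\<^sup>2)" for m
        using sq by (intro AE_I2 ennreal_leI) (auto simp: clamped_def indicator_def)
      show "AE s in lborel. (\<lambda>m. ennreal ((indicator {0..t} s * (clamped t m H \<omega> s - H s \<omega>))\<^sup>2)) \<longlonglongrightarrow> 0"
      proof (intro AE_I2 tendsto_eventually)
        fix s
        obtain N :: nat where N: "\<bar>H s \<omega>\<bar> \<le> N" using real_arch_simple by blast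
        show "eventually (\<lambda>m. ennreal ((indicator {0..t} s * (clamped t m H \<omega> s - H s \<omega>))\<^sup>2) = 0) sequentially"
          using eventually_ge_at_top[of N]
        proof eventually_elim
          case (elim m)
          then have "real N \<le> real m" by simp
          then have "max (- real m) (min (real m) (H s \<omega>)) = H s \<omega>" using N by (auto simp: max_def min_def)
          then show ?case by (simp add: clamped_def indicator_def)
        qed
      qed
    qed (use sec w(2) in \<open>simp_all add: energy_eq\<close>)
    then show ?thesis by simp
  qed
  have "(\<lambda>m. \<integral>\<^sup>+\<omega>. energy t (\<lambda>s. clamped t m H \<omega> s - H s \<omega>) \<partial>M) \<longlonglongrightarrow> (\<integral>\<^sup>+\<omega>. 0 \<partial>M)"
  proof (rule nn_integral_dominated_convergence[where w = "\<lambda>\<omega>. energy t (\<lambda>s. H s \<omega>)"])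
    have "AE \<omega> in M. energy t (\<lambda>s. H s \<omega>) \<noteq> \<infinity>"
      by (rule nn_integral_PInf_AE[OF sections_measurable_energy[OF Hm]]) (use fin in auto)
    then show "AE \<omega> in M. (\<lambda>m. energy t (\<lambda>s. clamped t m H \<omega> s - H s \<omega>)) \<longlonglongrightarrow> 0"
      using AE_space by eventually_elim (use lim in \<open>auto simp: less_top\<close>)
  qed (use meas sections_measurable_energy[OF Hm] dom fin in auto)
  then show ?thesis by simp
qed

text \<open>First the truncation level is fixed, then the mesh. Each error is kept below
  \<open>e / 4\<close> because the squared triangle inequality doubles both.\<close>

lemma approx_error_small:
  assumes t: "0 < t" "t \<le> T" and H: "progressive t F H"
    and fin: "(\<integral>\<^sup>+\<omega>. energy t (\<lambda>s. H s \<omega>) \<partial>M) < \<infinity>" and e: "(e::real) > 0"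
  shows "\<exists>j. (\<integral>\<^sup>+\<omega>. energy t (\<lambda>s. approx_process t H j s \<omega> - H s \<omega>) \<partial>M) \<le> ennreal e"
proof -
  have Hm: "sections_measurable M t H" using progressive_sections_M[OF H] t by simp
  have e4: "0 < ennreal (e / 4)" using e by simp
  obtain m where m: "(\<integral>\<^sup>+\<omega>. energy t (\<lambda>s. clamped t m H \<omega> s - H s \<omega>) \<partial>M) < ennreal (e / 4)"
    using order_tendstoD(2)[OF clamp_energy_tendsto[OF t H fin] e4] by (auto dest: eventually_happens)
  have cs: "energy t (\<lambda>s. approx_process t H (prod_encode (m, n)) s \<omega> - clamped t m H \<omega> s)
     = (\<integral>\<^sup>+s\<in>{0..t}. ennreal ((cell_step t n (clamped t m H \<omega>) s - clamped t m H \<omega> s)\<^sup>2) \<partial>lborel)" for n \<omega>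
    unfolding energy_def approx_process_eq approx_cells_def by simp
  have cm: "sections_measurable M t (\<lambda>s \<omega>. clamped t m H \<omega> s)"
  proof -
    have "(\<lambda>(\<omega>, s). indicator {0..t} s * clamped t m H \<omega> s) = (\<lambda>(\<omega>, s). indicator {0..t} s * max (- real m) (min (real m) (H s \<omega>)))"
      by (auto simp: clamped_def indicator_def)
    then show ?thesis using sections_measurable_clamp[OF Hm, of "real m"] unfolding sections_measurable_def by simp
  qed
  note ap = approx_process_sections[OF t H]
  have "(\<lambda>n. \<integral>\<^sup>+\<omega>. energy t (\<lambda>s. approx_process t H (prod_encode (m, n)) s \<omega> - clamped t m H \<omega> s) \<partial>M) \<longlonglongrightarrow> (\<integral>\<^sup>+\<omega>. 0 \<partial>M)"
  proof (rule nn_integral_dominated_convergence[where w = "\<lambda>_. ennreal ((2 * real m)\<^sup>2 * t)"])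
    show "AE \<omega> in M. energy t (\<lambda>s. approx_process t H (prod_encode (m, n)) s \<omega> - clamped t m H \<omega> s) \<le> ennreal ((2 * real m)\<^sup>2 * t)" for n
    proof (rule AE_I2)
      fix \<omega> assume w: "\<omega> \<in> space M"
      have "\<bar>cell_step t n (clamped t m H \<omega>) s - clamped t m H \<omega> s\<bar> \<le> 2 * real m" for s
        using cell_step_bound[OF t(1) clamped_measurable[OF Hm w] clamped_bound, of n m s] clamped_bound[of t m H \<omega> s] by linarith
      then have "(cell_step t n (clamped t m H \<omega>) s - clamped t m H \<omega> s)\<^sup>2 \<le> (2 * real m)\<^sup>2" for s
        by (intro abs_le_square_iff[THEN iffD1]) simp
      then have "energy t (\<lambda>s. approx_process t H (prod_encode (m, n)) s \<omega> - clamped t m H \<omega> s) \<le> (\<integral>\<^sup>+s. ennreal ((2 * real m)\<^sup>2) * indicator {0..t} s \<partial>lborel)"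
        unfolding cs by (intro nn_integral_mono mult_right_mono ennreal_leI) auto
      also have "\<dots> = ennreal ((2 * real m)\<^sup>2 * t)" using t by (simp add: nn_integral_cmult_indicator ennreal_mult)
      finally show "energy t (\<lambda>s. approx_process t H (prod_encode (m, n)) s \<omega> - clamped t m H \<omega> s) \<le> ennreal ((2 * real m)\<^sup>2 * t)" .
    qed
    show "AE \<omega> in M. (\<lambda>n. energy t (\<lambda>s. approx_process t H (prod_encode (m, n)) s \<omega> - clamped t m H \<omega> s)) \<longlonglongrightarrow> 0"
      unfolding cs using cell_step_L2_tendsto[OF t(1) clamped_measurable[OF Hm] clamped_bound] by (intro AE_I2)
    show "(\<integral>\<^sup>+\<omega>. ennreal ((2 * real m)\<^sup>2 * t) \<partial>M) < \<infinity>" by (simp add: emeasure_space_1 less_top[symmetric])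
  qed (use sections_measurable_energy[OF sections_measurable_diff[OF ap cm]] in auto)
  then have "(\<lambda>n. \<integral>\<^sup>+\<omega>. energy t (\<lambda>s. approx_process t H (prod_encode (m, n)) s \<omega> - clamped t m H \<omega> s) \<partial>M) \<longlonglongrightarrow> 0" by simp
  from order_tendstoD(2)[OF this e4]
  obtain n where n: "(\<integral>\<^sup>+\<omega>. energy t (\<lambda>s. approx_process t H (prod_encode (m, n)) s \<omega> - clamped t m H \<omega> s) \<partial>M) < ennreal (e / 4)"
    by (auto dest: eventually_happens)
  let ?S = "approx_process t H (prod_encode (m, n))"
  have "(\<integral>\<^sup>+\<omega>. energy t (\<lambda>s. ?S s \<omega> - H s \<omega>) \<partial>M) \<le>
     (\<integral>\<^sup>+\<omega>. 2 * energy t (\<lambda>s. ?S s \<omega> - clamped t m H \<omega> s) + 2 * energy t (\<lambda>s. clamped t m H \<omega> s - H s \<omega>) \<partial>M)"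
  proof (rule nn_integral_mono)
    fix \<omega> assume w: "\<omega> \<in> space M"
    have *: "energy t (\<lambda>s. H s \<omega> - clamped t m H \<omega> s) = energy t (\<lambda>s. clamped t m H \<omega> s - H s \<omega>)"
      unfolding energy_def by (simp add: power2_commute)
    show "energy t (\<lambda>s. ?S s \<omega> - H s \<omega>) \<le> 2 * energy t (\<lambda>s. ?S s \<omega> - clamped t m H \<omega> s) + 2 * energy t (\<lambda>s. clamped t m H \<omega> s - H s \<omega>)"
      using energy_diff_le[of t "\<lambda>s. ?S s \<omega> - clamped t m H \<omega> s" "\<lambda>s. H s \<omega> - clamped t m H \<omega> s"]
        sections_measurable_section[OF sections_measurable_diff[OF ap cm] w, of "prod_encode (m, n)"]
        sections_measurable_section[OF sections_measurable_diff[OF Hm cm] w] by (simp add: *)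
  qed
  also have "\<dots> = 2 * (\<integral>\<^sup>+\<omega>. energy t (\<lambda>s. ?S s \<omega> - clamped t m H \<omega> s) \<partial>M) + 2 * (\<integral>\<^sup>+\<omega>. energy t (\<lambda>s. clamped t m H \<omega> s - H s \<omega>) \<partial>M)"
    using sections_measurable_energy[OF sections_measurable_diff[OF ap cm], of "prod_encode (m, n)"]
      sections_measurable_energy[OF sections_measurable_diff[OF cm Hm]]
    by (subst nn_integral_add) (simp_all add: nn_integral_cmult)
  also have "\<dots> \<le> 2 * ennreal (e / 4) + 2 * ennreal (e / 4)" using n m by (intro add_mono mult_left_mono) auto
  also have "\<dots> = ennreal e" using e by (simp add: mult_2 ennreal_plus[symmetric] del: ennreal_plus)
  finally show ?thesis by blast
qed

end

section \<open>Locality and jointly measurable versions of the It\^o integral\<close>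

context brownian_setup
begin

lemma simple_energy:
  assumes "simple_integrand M F t n p \<eta>"
  shows "energy t (\<lambda>s. simple_process n p \<eta> s \<omega>) = ennreal (\<Sum>i<n. (\<eta> i \<omega>)\<^sup>2 * (p (Suc i) - p i))"
  unfolding energy_def by (rule simple_process_square_integral) (use assms in \<open>auto simp: simple_integrand_def\<close>)

text \<open>The definition of the integral measures the error by a Bochner integral, which is 0 by
  convention when the integrand is not integrable. As \<open>H\<close> has almost surely square
  integrable paths, it agrees almost surely with the extended-valued \<open>energy\<close>, and the
  latter can be used from here on.\<close>

lemma ito_approximation:
  assumes t: "0 \<le> t" "t \<le> T" and I: "has_ito_integral M F B t H J"
  shows "\<exists>n p \<eta>. (\<forall>k. simple_integrand M F t (n k) (p k) (\<eta> k)) \<and>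
    (\<forall>\<epsilon>>0. (\<lambda>k. prob {\<omega>\<in>space M. energy t (\<lambda>s. simple_process (n k) (p k) (\<eta> k) s \<omega> - H s \<omega>) > ennreal \<epsilon>}) \<longlonglongrightarrow> 0) \<and>
    tendsto_in_prob M (\<lambda>k. simple_ito B (n k) (p k) (\<eta> k)) J"
proof -
  obtain n p \<eta> where S: "\<And>k. simple_integrand M F t (n k) (p k) (\<eta> k)"
    and c: "tendsto_in_prob M (\<lambda>k \<omega>. LINT s:{0..t}|lborel. (simple_process (n k) (p k) (\<eta> k) s \<omega> - H s \<omega>)\<^sup>2) (\<lambda>\<omega>. 0)"
    and d: "tendsto_in_prob M (\<lambda>k. simple_ito B (n k) (p k) (\<eta> k)) J"
    using I unfolding has_ito_integral_def by blast
  let ?S = "\<lambda>k. simple_process (n k) (p k) (\<eta> k)"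
  have Hm: "sections_measurable M t H"
    using I t progressive_sections_M unfolding has_ito_integral_def by auto
  have "AE \<omega> in M. set_integrable lborel {0..t} (\<lambda>s. (H s \<omega>)\<^sup>2)" using I unfolding has_ito_integral_def by simp
  then have AE_eq: "AE \<omega> in M. \<forall>k. energy t (\<lambda>s. ?S k s \<omega> - H s \<omega>) = ennreal (LINT s:{0..t}|lborel. (?S k s \<omega> - H s \<omega>)\<^sup>2)"
    using AE_space
  proof eventually_elim
    case (elim \<omega>)
    show ?case
    proof
      fix k
      have Hfin: "energy t (\<lambda>s. H s \<omega>) < \<infinity>"
      proof -
        have "energy t (\<lambda>s. H s \<omega>) = (\<integral>\<^sup>+s. ennreal (norm (indicator {0..t} s *\<^sub>R (H s \<omega>)\<^sup>2)) \<partial>lborel)"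
          unfolding energy_def by (intro nn_integral_cong) (auto simp: indicator_def)
        then show ?thesis using elim(1) unfolding set_integrable_def integrable_iff_bounded by simp
      qed
      have Sm: "(\<lambda>s. indicator {0..t} s * ?S k s \<omega>) \<in> borel_measurable borel"
        using sections_measurable_section[OF simple_process_sections[OF S t(2)] elim(2)] .
      note Hs = sections_measurable_section[OF Hm elim(2)]
      have Dm: "(\<lambda>s. indicator {0..t} s * (?S k s \<omega> - H s \<omega>)) \<in> borel_measurable borel"
        using borel_measurable_diff[OF Sm Hs] by (simp add: right_diff_distrib)
      have "energy t (\<lambda>s. ?S k s \<omega> - H s \<omega>) \<le> 2 * energy t (\<lambda>s. ?S k s \<omega>) + 2 * energy t (\<lambda>s. H s \<omega>)"
        by (rule energy_diff_le[OF Sm Hs])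
      also have "\<dots> < \<infinity>" using Hfin by (simp add: simple_energy[OF S] ennreal_mult_less_top)
      finally have fin: "energy t (\<lambda>s. ?S k s \<omega> - H s \<omega>) < \<infinity>" .
      have e: "energy t (\<lambda>s. ?S k s \<omega> - H s \<omega>) = (\<integral>\<^sup>+s. ennreal (indicator {0..t} s *\<^sub>R (?S k s \<omega> - H s \<omega>)\<^sup>2) \<partial>lborel)"
        unfolding energy_def by (intro nn_integral_cong) (auto simp: indicator_def)
      have "integrable lborel (\<lambda>s. indicator {0..t} s *\<^sub>R (?S k s \<omega> - H s \<omega>)\<^sup>2)"
      proof (rule integrableI_nonneg)
        have "(\<lambda>s. (indicator {0..t} s * (?S k s \<omega> - H s \<omega>))\<^sup>2) \<in> borel_measurable lborel" using Dm by simp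
        then show "(\<lambda>s. indicator {0..t} s *\<^sub>R (?S k s \<omega> - H s \<omega>)\<^sup>2) \<in> borel_measurable lborel"
          by (rule measurable_cong[THEN iffD1, rotated]) (auto simp: indicator_def)
      qed (use fin e in auto)
      then show "energy t (\<lambda>s. ?S k s \<omega> - H s \<omega>) = ennreal (LINT s:{0..t}|lborel. (?S k s \<omega> - H s \<omega>)\<^sup>2)"
        unfolding e set_lebesgue_integral_def by (intro nn_integral_eq_integral) auto
    qed
  qed
  have "(\<lambda>k. prob {\<omega>\<in>space M. energy t (\<lambda>s. ?S k s \<omega> - H s \<omega>) > ennreal \<epsilon>}) \<longlonglongrightarrow> 0" if "\<epsilon> > 0" for \<epsilon>
  proof -
    have m[measurable]: "(\<lambda>\<omega>. energy t (\<lambda>s. ?S k s \<omega> - H s \<omega>)) \<in> borel_measurable M" for k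
      by (rule sections_measurable_energy[OF sections_measurable_diff[OF simple_process_sections[OF S t(2)] Hm]])
    have m2: "{\<omega>\<in>space M. \<bar>(LINT s:{0..t}|lborel. (?S k s \<omega> - H s \<omega>)\<^sup>2) - 0\<bar> > \<epsilon>} \<in> events" for k
    proof -
      have "(\<lambda>(\<omega>, s). (indicator {0..t} s * (?S k s \<omega> - H s \<omega>))\<^sup>2) \<in> borel_measurable (M \<Otimes>\<^sub>M lborel)"
      proof -
        have "(\<lambda>z. case z of (\<omega>, s) \<Rightarrow> indicator {0..t} s * (?S k s \<omega> - H s \<omega>)) \<in> borel_measurable (M \<Otimes>\<^sub>M lborel)"
          using sections_measurable_diff[OF simple_process_sections[OF S t(2)] Hm, of k]
          unfolding sections_measurable_def by (simp cong: measurable_cong_sets sets_pair_measure_cong)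
        then have "(\<lambda>z. (case z of (\<omega>, s) \<Rightarrow> indicator {0..t} s * (?S k s \<omega> - H s \<omega>))\<^sup>2) \<in> borel_measurable (M \<Otimes>\<^sub>M lborel)"
          by (rule borel_measurable_power)
        then show ?thesis by (simp add: case_prod_beta')
      qed
      from lborel.borel_measurable_lebesgue_integral[OF this]
      have [measurable]: "(\<lambda>\<omega>. LINT s:{0..t}|lborel. (?S k s \<omega> - H s \<omega>)\<^sup>2) \<in> borel_measurable M"
        unfolding set_lebesgue_integral_def
        by (rule measurable_cong[THEN iffD1, rotated]) (auto intro!: Bochner_Integration.integral_cong simp: indicator_def)
      show ?thesis by measurable
    qed
    have "prob {\<omega>\<in>space M. energy t (\<lambda>s. ?S k s \<omega> - H s \<omega>) > ennreal \<epsilon>}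
      = prob {\<omega>\<in>space M. \<bar>(LINT s:{0..t}|lborel. (?S k s \<omega> - H s \<omega>)\<^sup>2) - 0\<bar> > \<epsilon>}" for k
    proof (rule finite_measure_eq_AE)
      show "AE \<omega> in M. (\<omega> \<in> {\<omega>\<in>space M. energy t (\<lambda>s. ?S k s \<omega> - H s \<omega>) > ennreal \<epsilon>}) =
        (\<omega> \<in> {\<omega>\<in>space M. \<bar>(LINT s:{0..t}|lborel. (?S k s \<omega> - H s \<omega>)\<^sup>2) - 0\<bar> > \<epsilon>})"
        using AE_eq
      proof eventually_elim
        case (elim \<omega>)
        have "0 \<le> (LINT s:{0..t}|lborel. (?S k s \<omega> - H s \<omega>)\<^sup>2)"
          unfolding set_lebesgue_integral_def by (intro Bochner_Integration.integral_nonneg) simp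
        then show ?case using elim that by (auto simp: ennreal_less_iff)
      qed
      show "{\<omega>\<in>space M. energy t (\<lambda>s. ?S k s \<omega> - H s \<omega>) > ennreal \<epsilon>} \<in> events" by measurable
    qed (rule m2)
    then show ?thesis using c that unfolding tendsto_in_prob_def by simp
  qed
  then show ?thesis using S d by blast
qed

lemma tendsto_in_prob_diff:
  assumes X: "tendsto_in_prob M X Z" and X': "tendsto_in_prob M X' Z'"
    and [measurable]: "\<And>k. X k \<in> borel_measurable M" "Z \<in> borel_measurable M"
     "\<And>k. X' k \<in> borel_measurable M" "Z' \<in> borel_measurable M"
  shows "tendsto_in_prob M (\<lambda>k \<omega>. X k \<omega> - X' k \<omega>) (\<lambda>\<omega>. Z \<omega> - Z' \<omega>)"
  unfolding tendsto_in_prob_def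
proof (intro allI impI)
  fix e :: real assume e: "e > 0"
  have "(\<lambda>k. prob {\<omega>\<in>space M. \<bar>X k \<omega> - Z \<omega>\<bar> > e / 2} + prob {\<omega>\<in>space M. \<bar>X' k \<omega> - Z' \<omega>\<bar> > e / 2}) \<longlonglongrightarrow> 0 + 0"
    using e by (intro tendsto_add X[unfolded tendsto_in_prob_def, rule_format] X'[unfolded tendsto_in_prob_def, rule_format]) simp_all
  then have lim: "(\<lambda>k. prob {\<omega>\<in>space M. \<bar>X k \<omega> - Z \<omega>\<bar> > e / 2} + prob {\<omega>\<in>space M. \<bar>X' k \<omega> - Z' \<omega>\<bar> > e / 2}) \<longlonglongrightarrow> 0" by simp
  show "(\<lambda>k. prob {\<omega>\<in>space M. \<bar>X k \<omega> - X' k \<omega> - (Z \<omega> - Z' \<omega>)\<bar> > e}) \<longlonglongrightarrow> 0"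
  proof (rule tendsto_sandwich[OF _ _ tendsto_const lim])
    have "prob {\<omega>\<in>space M. \<bar>X k \<omega> - X' k \<omega> - (Z \<omega> - Z' \<omega>)\<bar> > e} \<le>
      prob ({\<omega>\<in>space M. \<bar>X k \<omega> - Z \<omega>\<bar> > e / 2} \<union> {\<omega>\<in>space M. \<bar>X' k \<omega> - Z' \<omega>\<bar> > e / 2})" for k
    proof (rule finite_measure_mono)
      have "e / 2 < \<bar>a - c\<bar> \<or> e / 2 < \<bar>b - d\<bar>" if "e < \<bar>a - b - (c - d)\<bar>" for a b c d :: real
        using that by arith
      then show "{\<omega>\<in>space M. \<bar>X k \<omega> - X' k \<omega> - (Z \<omega> - Z' \<omega>)\<bar> > e}
        \<subseteq> {\<omega>\<in>space M. \<bar>X k \<omega> - Z \<omega>\<bar> > e / 2} \<union> {\<omega>\<in>space M. \<bar>X' k \<omega> - Z' \<omega>\<bar> > e / 2}"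
        by blast
    qed measurable
    also have "\<dots> k \<le> prob {\<omega>\<in>space M. \<bar>X k \<omega> - Z \<omega>\<bar> > e / 2} + prob {\<omega>\<in>space M. \<bar>X' k \<omega> - Z' \<omega>\<bar> > e / 2}" for k
      by (rule measure_Un_le) measurable
    finally show "\<forall>\<^sub>F k in sequentially. prob {\<omega>\<in>space M. \<bar>X k \<omega> - X' k \<omega> - (Z \<omega> - Z' \<omega>)\<bar> > e} \<le>
       prob {\<omega>\<in>space M. \<bar>X k \<omega> - Z \<omega>\<bar> > e / 2} + prob {\<omega>\<in>space M. \<bar>X' k \<omega> - Z' \<omega>\<bar> > e / 2}" by simp
  qed simp
qed

lemma prob_Markov_ennreal:
  assumes [measurable]: "f \<in> borel_measurable M" and "(\<integral>\<^sup>+\<omega>. f \<omega> \<partial>M) \<le> ennreal a" "e > 0" "a \<ge> 0"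
  shows "prob {\<omega>\<in>space M. f \<omega> > ennreal e} \<le> a / e"
proof -
  have "ennreal e * emeasure M {\<omega>\<in>space M. f \<omega> > ennreal e} = (\<integral>\<^sup>+\<omega>. ennreal e * indicator {\<omega>\<in>space M. f \<omega> > ennreal e} \<omega> \<partial>M)"
    by (subst nn_integral_cmult_indicator) auto
  also have "\<dots> \<le> (\<integral>\<^sup>+\<omega>. f \<omega> \<partial>M)" by (intro nn_integral_mono) (auto simp: indicator_def)
  also have "\<dots> \<le> ennreal a" by fact
  finally have "ennreal (e * prob {\<omega>\<in>space M. f \<omega> > ennreal e}) \<le> ennreal a"
    using \<open>e > 0\<close> by (simp add: emeasure_eq_measure ennreal_mult)
  then have "e * prob {\<omega>\<in>space M. f \<omega> > ennreal e} \<le> a" using \<open>a \<ge> 0\<close> by simp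
  then show ?thesis using \<open>e > 0\<close> by (simp add: field_simps)
qed

text \<open>Two squared triangle inequalities, each with factor 2:
  \<open>2 * \<delta>/16 + 2 * \<delta>/16 = \<delta>/4\<close>, then
  \<open>2 * \<delta>/4 + 2 * \<delta>/4 = \<delta>\<close>.\<close>

lemma energy_triple:
  assumes "(\<lambda>s. indicator {0..t} s * f s) \<in> borel_measurable borel" "(\<lambda>s. indicator {0..t} s * g s) \<in> borel_measurable borel"
    "(\<lambda>s. indicator {0..t} s * h s) \<in> borel_measurable borel"
    and "energy t f \<le> ennreal (\<delta> / 16)" "energy t g \<le> ennreal (\<delta> / 16)" "energy t h \<le> ennreal (\<delta> / 4)" "\<delta> \<ge> 0"
  shows "energy t (\<lambda>s. (f s - g s) - h s) \<le> ennreal \<delta>"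
proof -
  have fg: "(\<lambda>s. indicator {0..t} s * (f s - g s)) \<in> borel_measurable borel"
    using borel_measurable_diff[OF assms(1,2)] by (simp add: right_diff_distrib)
  have "energy t (\<lambda>s. f s - g s) \<le> 2 * energy t f + 2 * energy t g" by (rule energy_diff_le[OF assms(1,2)])
  also have "\<dots> \<le> 2 * ennreal (\<delta> / 16) + 2 * ennreal (\<delta> / 16)" using assms by (intro add_mono mult_left_mono) auto
  also have "\<dots> = ennreal (\<delta> / 4)" using assms(7) by (simp add: mult_2 ennreal_plus[symmetric] del: ennreal_plus)
  finally have 1: "energy t (\<lambda>s. f s - g s) \<le> ennreal (\<delta> / 4)" .
  have "energy t (\<lambda>s. (f s - g s) - h s) \<le> 2 * energy t (\<lambda>s. f s - g s) + 2 * energy t h" by (rule energy_diff_le[OF fg assms(3)])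
  also have "\<dots> \<le> 2 * ennreal (\<delta> / 4) + 2 * ennreal (\<delta> / 4)" using assms 1 by (intro add_mono mult_left_mono) auto
  also have "\<dots> = ennreal \<delta>" using assms(7) by (simp add: mult_2 ennreal_plus[symmetric] del: ennreal_plus)
  finally show ?thesis .
qed

text \<open>Isometry and locality in one statement. \<open>K\<close> has to match
  \<open>H - H'\<close> only on the event \<open>A\<close>, which need not be known at any
  particular time before the end. The elementary integrals of approximations of \<open>K\<close>
  converge in probability on \<open>A\<close> to \<open>J - J'\<close>, because
  \<open>simple_ito_prob_bound\<close> controls elementary integrals on \<open>A\<close> by energies
  on \<open>A\<close>. Fatou's lemma then carries the isometry over to the limit.\<close>

theorem ito_localized_bound:
  assumes t: "0 < t" "t \<le> T" and I: "has_ito_integral M F B t H J" and I': "has_ito_integral M F B t H' J'"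
    and A: "A \<in> events" and K: "progressive t F K"
    and agree: "\<And>\<omega>. \<omega> \<in> A \<Longrightarrow> AE s in lborel. s \<in> {0..t} \<longrightarrow> K s \<omega> = H s \<omega> - H' s \<omega>"
  shows "(\<integral>\<^sup>+\<omega>\<in>A. ennreal ((J \<omega> - J' \<omega>)\<^sup>2) \<partial>M) \<le> 2 * (\<integral>\<^sup>+\<omega>. energy t (\<lambda>s. K s \<omega>) \<partial>M)"
proof (cases "(\<integral>\<^sup>+\<omega>. energy t (\<lambda>s. K s \<omega>) \<partial>M) < \<infinity>")
  case False
  then show ?thesis by (simp add: less_top[symmetric] ennreal_mult_top)
next
  case fin: True
  have t0: "0 \<le> t" using t by simp
  have Km: "sections_measurable M t K" using progressive_sections_M[OF K] t by simp
  have Hm: "sections_measurable M t H" "sections_measurable M t H'"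
    using I I' t progressive_sections_M unfolding has_ito_integral_def by auto
  have Jm[measurable]: "J \<in> borel_measurable M" "J' \<in> borel_measurable M" using I I' unfolding has_ito_integral_def by auto
  have As: "A \<subseteq> space M" using sets.sets_into_space[OF A] .
  obtain n p \<eta> where S: "\<And>k. simple_integrand M F t (n k) (p k) (\<eta> k)"
    "\<And>\<epsilon>. \<epsilon> > 0 \<Longrightarrow> (\<lambda>k. prob {\<omega>\<in>space M. energy t (\<lambda>s. simple_process (n k) (p k) (\<eta> k) s \<omega> - H s \<omega>) > ennreal \<epsilon>}) \<longlonglongrightarrow> 0"
    "tendsto_in_prob M (\<lambda>k. simple_ito B (n k) (p k) (\<eta> k)) J" using ito_approximation[OF t0 t(2) I] by blast
  obtain n' p' \<eta>' where S': "\<And>k. simple_integrand M F t (n' k) (p' k) (\<eta>' k)"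
    "\<And>\<epsilon>. \<epsilon> > 0 \<Longrightarrow> (\<lambda>k. prob {\<omega>\<in>space M. energy t (\<lambda>s. simple_process (n' k) (p' k) (\<eta>' k) s \<omega> - H' s \<omega>) > ennreal \<epsilon>}) \<longlonglongrightarrow> 0"
    "tendsto_in_prob M (\<lambda>k. simple_ito B (n' k) (p' k) (\<eta>' k)) J'" using ito_approximation[OF t0 t(2) I'] by blast
  have "\<forall>k. \<exists>j. (\<integral>\<^sup>+\<omega>. energy t (\<lambda>s. approx_process t K j s \<omega> - K s \<omega>) \<partial>M) \<le> ennreal (1 / Suc k)"
    by (intro allI approx_error_small[OF t K fin]) simp
  then obtain j where j: "\<And>k. (\<integral>\<^sup>+\<omega>. energy t (\<lambda>s. approx_process t K (j k) s \<omega> - K s \<omega>) \<partial>M) \<le> ennreal (1 / Suc k)" by metis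
  let ?S = "\<lambda>k. simple_process (n k) (p k) (\<eta> k)" and ?S' = "\<lambda>k. simple_process (n' k) (p' k) (\<eta>' k)"
  let ?Z = "\<lambda>k. approx_process t K (j k)"
  let ?IZ = "\<lambda>k. simple_ito B (approx_cells (j k)) (approx_grid t (j k)) (approx_value t K (j k))"
  have Z: "simple_integrand M F t (approx_cells (j k)) (approx_grid t (j k)) (approx_value t K (j k))" for k
    by (rule approx_simple_integrand[OF t K])
  have Sm: "sections_measurable M t (?S k)" "sections_measurable M t (?S' k)" "sections_measurable M t (?Z k)" for k
    by (rule simple_process_sections[OF S(1) t(2)], rule simple_process_sections[OF S'(1) t(2)], rule approx_process_sections[OF t K])
  have IZm[measurable]: "?IZ k \<in> borel_measurable M" for k by (rule simple_ito_measurable[OF Z t(2)])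
  have ISm[measurable]: "simple_ito B (n k) (p k) (\<eta> k) \<in> borel_measurable M" "simple_ito B (n' k) (p' k) (\<eta>' k) \<in> borel_measurable M" for k
    using simple_ito_measurable[OF S(1) t(2)] simple_ito_measurable[OF S'(1) t(2)] by auto
  let ?ID = "\<lambda>k \<omega>. simple_ito B (n k) (p k) (\<eta> k) \<omega> - simple_ito B (n' k) (p' k) (\<eta>' k) \<omega>"
  have diff: "tendsto_in_prob M ?ID (\<lambda>\<omega>. J \<omega> - J' \<omega>)"
    by (rule tendsto_in_prob_diff[OF S(3) S'(3)]) measurable
  let ?e1 = "\<lambda>k \<omega>. energy t (\<lambda>s. ?S k s \<omega> - H s \<omega>)"
  let ?e2 = "\<lambda>k \<omega>. energy t (\<lambda>s. ?S' k s \<omega> - H' s \<omega>)"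
  let ?e3 = "\<lambda>k \<omega>. energy t (\<lambda>s. ?Z k s \<omega> - K s \<omega>)"
  have em[measurable]: "?e1 k \<in> borel_measurable M" "?e2 k \<in> borel_measurable M" "?e3 k \<in> borel_measurable M" for k
    by (rule sections_measurable_energy[OF sections_measurable_diff[OF Sm(1) Hm(1)]],
        rule sections_measurable_energy[OF sections_measurable_diff[OF Sm(2) Hm(2)]],
        rule sections_measurable_energy[OF sections_measurable_diff[OF Sm(3) Km]])
  \<comment> \<open>Half of the tolerance is spent on the approximations of \<open>J - J'\<close>,
    half on the elementary integral of the combined simple process. The energy of the latter is
    small on \<open>A\<close> outside three error events.\<close>
  have key: "prob {\<omega>\<in>A. \<bar>?IZ k \<omega> - (J \<omega> - J' \<omega>)\<bar> > \<epsilon>} \<le>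
     prob {\<omega>\<in>space M. \<bar>?ID k \<omega> - (J \<omega> - J' \<omega>)\<bar> > \<epsilon> / 2} + \<delta> / (\<epsilon> / 2)\<^sup>2
     + prob {\<omega>\<in>space M. ?e1 k \<omega> > ennreal (\<delta> / 16)} + prob {\<omega>\<in>space M. ?e2 k \<omega> > ennreal (\<delta> / 16)}
     + prob {\<omega>\<in>space M. ?e3 k \<omega> > ennreal (\<delta> / 4)}" if "\<epsilon> > 0" "\<delta> > 0" for \<epsilon> \<delta> k
  proof -
    obtain m1 q1 \<zeta>1 where R1: "simple_integrand M F t m1 q1 \<zeta>1"
      "\<And>s \<omega>. simple_process m1 q1 \<zeta>1 s \<omega> = ?S k s \<omega> - ?S' k s \<omega>"
      "\<And>\<omega>. simple_ito B m1 q1 \<zeta>1 \<omega> = ?ID k \<omega>"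
      using simple_integrand_diff[OF S(1)[of k] S'(1)[of k] t(2)] by blast
    obtain m q \<zeta> where R: "simple_integrand M F t m q \<zeta>"
      "\<And>s \<omega>. simple_process m q \<zeta> s \<omega> = simple_process m1 q1 \<zeta>1 s \<omega> - ?Z k s \<omega>"
      "\<And>\<omega>. simple_ito B m q \<zeta> \<omega> = simple_ito B m1 q1 \<zeta>1 \<omega> - ?IZ k \<omega>"
      using simple_integrand_diff[OF R1(1) Z[of k] t(2)] unfolding approx_process_def by blast
    let ?V = "\<lambda>\<omega>. \<Sum>i<m. (\<zeta> i \<omega>)\<^sup>2 * (q (Suc i) - q i)"
    have small: "?V \<omega> \<le> \<delta>" if w: "\<omega> \<in> A" "?e1 k \<omega> \<le> ennreal (\<delta> / 16)" "?e2 k \<omega> \<le> ennreal (\<delta> / 16)" "?e3 k \<omega> \<le> ennreal (\<delta> / 4)" for \<omega>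
    proof -
      have sp: "\<omega> \<in> space M" using w As by auto
      have "ennreal (?V \<omega>) = energy t (\<lambda>s. simple_process m q \<zeta> s \<omega>)" by (rule simple_energy[OF R(1), symmetric])
      \<comment> \<open>On \<open>A\<close> the integrands cancel for almost every \<open>s\<close>,
        which leaves exactly the three approximation errors.\<close>
      also have "\<dots> = energy t (\<lambda>s. ((?S k s \<omega> - H s \<omega>) - (?S' k s \<omega> - H' s \<omega>)) - (?Z k s \<omega> - K s \<omega>))"
        unfolding energy_def R(2) R1(2)
      proof (rule nn_integral_cong_AE, use agree[OF w(1)] in eventually_elim)
        fix s assume a: "s \<in> {0..t} \<longrightarrow> K s \<omega> = H s \<omega> - H' s \<omega>"
        have eq: "?S k s \<omega> - ?S' k s \<omega> - ?Z k s \<omega> = (?S k s \<omega> - H s \<omega>) - (?S' k s \<omega> - H' s \<omega>) - (?Z k s \<omega> - K s \<omega>)"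
          if "s \<in> {0..t}" using a that by simp
        show "ennreal ((?S k s \<omega> - ?S' k s \<omega> - ?Z k s \<omega>)\<^sup>2) * indicator {0..t} s =
          ennreal (((?S k s \<omega> - H s \<omega>) - (?S' k s \<omega> - H' s \<omega>) - (?Z k s \<omega> - K s \<omega>))\<^sup>2) * indicator {0..t} s"
        proof (cases "s \<in> {0..t}")
          case True
          show ?thesis unfolding eq[OF True] by (rule refl)
        qed simp
      qed
      also have "\<dots> \<le> ennreal \<delta>"
        by (rule energy_triple)
           (use w \<open>\<delta> > 0\<close> sections_measurable_section[OF sections_measurable_diff[OF Sm(1) Hm(1)] sp, of k]
             sections_measurable_section[OF sections_measurable_diff[OF Sm(2) Hm(2)] sp, of k]
             sections_measurable_section[OF sections_measurable_diff[OF Sm(3) Km] sp, of k] in auto)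
      finally show ?thesis using \<open>\<delta> > 0\<close> by simp
    qed
    let ?U1 = "{\<omega>\<in>space M. \<bar>?ID k \<omega> - (J \<omega> - J' \<omega>)\<bar> > \<epsilon> / 2}"
    let ?U2 = "{\<omega>\<in>A. \<bar>simple_ito B m q \<zeta> \<omega>\<bar> > \<epsilon> / 2}"
    let ?E = "{\<omega>\<in>space M. ?e1 k \<omega> > ennreal (\<delta> / 16)} \<union> {\<omega>\<in>space M. ?e2 k \<omega> > ennreal (\<delta> / 16)} \<union> {\<omega>\<in>space M. ?e3 k \<omega> > ennreal (\<delta> / 4)}"
    have Rm[measurable]: "simple_ito B m q \<zeta> \<in> borel_measurable M" by (rule simple_ito_measurable[OF R(1) t(2)])
    have U2m: "?U2 \<in> events"
    proof -
      have "?U2 = A \<inter> {\<omega>\<in>space M. \<bar>simple_ito B m q \<zeta> \<omega>\<bar> > \<epsilon> / 2}" using As by auto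
      moreover have "{\<omega>\<in>space M. \<bar>simple_ito B m q \<zeta> \<omega>\<bar> > \<epsilon> / 2} \<in> events" by measurable
      ultimately show ?thesis using A by auto
    qed
    have U1m: "?U1 \<in> events" by measurable
    have Em: "{\<omega>\<in>space M. ?e1 k \<omega> > ennreal (\<delta> / 16)} \<in> events" "{\<omega>\<in>space M. ?e2 k \<omega> > ennreal (\<delta> / 16)} \<in> events"
      "{\<omega>\<in>space M. ?e3 k \<omega> > ennreal (\<delta> / 4)} \<in> events" by measurable
    have "prob {\<omega>\<in>A. \<bar>?IZ k \<omega> - (J \<omega> - J' \<omega>)\<bar> > \<epsilon>} \<le> prob (?U1 \<union> ?U2)"
    proof (rule finite_measure_mono)
      show "{\<omega>\<in>A. \<bar>?IZ k \<omega> - (J \<omega> - J' \<omega>)\<bar> > \<epsilon>} \<subseteq> ?U1 \<union> ?U2"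
      proof -
        have "\<epsilon> / 2 < \<bar>d - z\<bar> \<or> \<epsilon> / 2 < \<bar>d - c\<bar>" if "\<epsilon> < \<bar>c - z\<bar>" for c d z :: real
          using that by arith
        then show ?thesis using As unfolding R(3) R1(3) by blast
      qed
    qed (use U1m U2m in blast)
    also have "\<dots> \<le> prob ?U1 + prob ?U2" by (rule measure_Un_le[OF U1m U2m])
    also have "prob ?U2 \<le> \<delta> / (\<epsilon> / 2)\<^sup>2 + prob {\<omega>\<in>A. ?V \<omega> > \<delta>}"
      by (rule simple_ito_prob_bound[OF R(1) t(2) A]) (use that in auto)
    also have "prob {\<omega>\<in>A. ?V \<omega> > \<delta>} \<le> prob ?E"
    proof (rule finite_measure_mono)
      show "{\<omega>\<in>A. ?V \<omega> > \<delta>} \<subseteq> ?E" using small As by (fastforce simp: not_le[symmetric])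
    qed (use Em in blast)
    also have "prob ?E \<le> prob {\<omega>\<in>space M. ?e1 k \<omega> > ennreal (\<delta> / 16)} + prob {\<omega>\<in>space M. ?e2 k \<omega> > ennreal (\<delta> / 16)}
      + prob {\<omega>\<in>space M. ?e3 k \<omega> > ennreal (\<delta> / 4)}"
      using measure_Un_le[OF sets.Un[OF Em(1,2)] Em(3)] measure_Un_le[OF Em(1,2)] by linarith
    finally show ?thesis by simp
  qed
  have IZlim: "(\<lambda>k. prob {\<omega>\<in>A. \<bar>?IZ k \<omega> - (J \<omega> - J' \<omega>)\<bar> > \<epsilon>}) \<longlonglongrightarrow> 0" if e: "\<epsilon> > 0" for \<epsilon>
  proof (rule LIMSEQ_I)
    fix r :: real assume r: "r > 0"
    \<comment> \<open>Chosen so that the term contributed by \<open>simple_ito_prob_bound\<close> is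
      exactly \<open>r / 2\<close>.\<close>
    define \<delta> where "\<delta> = r / 2 * (\<epsilon> / 2)\<^sup>2"
    have d: "\<delta> > 0" using r e unfolding \<delta>_def by simp
    have de: "\<delta> / (\<epsilon> / 2)\<^sup>2 = r / 2" using e unfolding \<delta>_def by simp
    have e3: "(\<lambda>k. prob {\<omega>\<in>space M. ?e3 k \<omega> > ennreal (\<delta> / 4)}) \<longlonglongrightarrow> 0"
    proof (rule tendsto_sandwich[OF _ _ tendsto_const])
      show "\<forall>\<^sub>F k in sequentially. prob {\<omega>\<in>space M. ?e3 k \<omega> > ennreal (\<delta> / 4)} \<le> (1 / Suc k) / (\<delta> / 4)"
        using d by (intro always_eventually allI prob_Markov_ennreal[OF em(3) j]) auto
      have "(\<lambda>k. (1 / Suc k) / (\<delta> / 4)) \<longlonglongrightarrow> 0 / (\<delta> / 4)"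
        using d LIMSEQ_inverse_real_of_nat by (intro tendsto_divide) (auto simp: inverse_eq_divide)
      then show "(\<lambda>k. (1 / Suc k) / (\<delta> / 4)) \<longlonglongrightarrow> 0" by simp
    qed simp
    have "(\<lambda>k. prob {\<omega>\<in>space M. \<bar>?ID k \<omega> - (J \<omega> - J' \<omega>)\<bar> > \<epsilon> / 2}
     + prob {\<omega>\<in>space M. ?e1 k \<omega> > ennreal (\<delta> / 16)} + prob {\<omega>\<in>space M. ?e2 k \<omega> > ennreal (\<delta> / 16)}
     + prob {\<omega>\<in>space M. ?e3 k \<omega> > ennreal (\<delta> / 4)}) \<longlonglongrightarrow> 0 + 0 + 0 + 0"
      using e d by (intro tendsto_add diff[unfolded tendsto_in_prob_def, rule_format] S(2) S'(2) e3) simp_all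
    then have "\<forall>\<^sub>F k in sequentially. prob {\<omega>\<in>space M. \<bar>?ID k \<omega> - (J \<omega> - J' \<omega>)\<bar> > \<epsilon> / 2}
     + prob {\<omega>\<in>space M. ?e1 k \<omega> > ennreal (\<delta> / 16)} + prob {\<omega>\<in>space M. ?e2 k \<omega> > ennreal (\<delta> / 16)}
     + prob {\<omega>\<in>space M. ?e3 k \<omega> > ennreal (\<delta> / 4)} < r / 2"
      using r by (intro order_tendstoD(2)) auto
    then have "\<forall>\<^sub>F k in sequentially. norm (prob {\<omega>\<in>A. \<bar>?IZ k \<omega> - (J \<omega> - J' \<omega>)\<bar> > \<epsilon>} - 0) < r"
    proof eventually_elim
      case (elim k)
      then show ?case using key[OF e d, of k] unfolding de by simp
    qed
    then show "\<exists>no. \<forall>k\<ge>no. norm (prob {\<omega>\<in>A. \<bar>?IZ k \<omega> - (J \<omega> - J' \<omega>)\<bar> > \<epsilon>} - 0) < r"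
      by (simp add: eventually_sequentially)
  qed
  obtain r where r: "strict_mono r" "AE \<omega> in M. \<omega> \<in> A \<longrightarrow> (\<lambda>k. ?IZ (r k) \<omega>) \<longlonglongrightarrow> J \<omega> - J' \<omega>"
    by (rule tendsto_in_prob_AE_subseq[OF A _ _ IZlim]) measurable
  \<comment> \<open>Fatou along the almost surely convergent subsequence.\<close>
  have "(\<integral>\<^sup>+\<omega>\<in>A. ennreal ((J \<omega> - J' \<omega>)\<^sup>2) \<partial>M) \<le> (\<integral>\<^sup>+\<omega>. liminf (\<lambda>k. ennreal ((?IZ (r k) \<omega>)\<^sup>2)) \<partial>M)"
  proof (rule nn_integral_mono_AE, use r(2) in eventually_elim)
    fix \<omega> assume l: "\<omega> \<in> A \<longrightarrow> (\<lambda>k. ?IZ (r k) \<omega>) \<longlonglongrightarrow> J \<omega> - J' \<omega>"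
    show "ennreal ((J \<omega> - J' \<omega>)\<^sup>2) * indicator A \<omega> \<le> liminf (\<lambda>k. ennreal ((?IZ (r k) \<omega>)\<^sup>2))"
    proof (cases "\<omega> \<in> A")
      case True
      then have "(\<lambda>k. ennreal ((?IZ (r k) \<omega>)\<^sup>2)) \<longlonglongrightarrow> ennreal ((J \<omega> - J' \<omega>)\<^sup>2)"
        using l by (intro tendsto_ennrealI tendsto_power) auto
      then have "liminf (\<lambda>k. ennreal ((?IZ (r k) \<omega>)\<^sup>2)) = ennreal ((J \<omega> - J' \<omega>)\<^sup>2)"
        by (intro lim_imp_Liminf) auto
      then show ?thesis using True by simp
    qed simp
  qed
  also have "\<dots> \<le> liminf (\<lambda>k. \<integral>\<^sup>+\<omega>. ennreal ((?IZ (r k) \<omega>)\<^sup>2) \<partial>M)"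
    by (rule nn_integral_liminf) measurable
  also have "\<dots> \<le> liminf (\<lambda>k. 2 * (\<integral>\<^sup>+\<omega>. energy t (\<lambda>s. K s \<omega>) \<partial>M) + 2 * ennreal (1 / Suc (r k)))"
  proof (rule Liminf_mono, intro always_eventually allI)
    fix k
    have "(\<integral>\<^sup>+\<omega>. ennreal ((?IZ (r k) \<omega>)\<^sup>2) \<partial>M) = (\<integral>\<^sup>+\<omega>. energy t (\<lambda>s. ?Z (r k) s \<omega>) \<partial>M)"
      unfolding energy_def approx_process_def by (rule simple_ito_isometry[OF Z t(2)])
    \<comment> \<open>Writing the approximation as \<open>K - (K - Z)\<close> is where the factor 2
      of the conclusion comes from.\<close>
    also have "\<dots> \<le> (\<integral>\<^sup>+\<omega>. 2 * energy t (\<lambda>s. K s \<omega>) + 2 * ?e3 (r k) \<omega> \<partial>M)"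
    proof (rule nn_integral_mono)
      fix \<omega> assume w: "\<omega> \<in> space M"
      have *: "energy t (\<lambda>s. K s \<omega> - ?Z (r k) s \<omega>) = ?e3 (r k) \<omega>" unfolding energy_def by (simp add: power2_commute)
      have "energy t (\<lambda>s. K s \<omega> - (K s \<omega> - ?Z (r k) s \<omega>)) \<le> 2 * energy t (\<lambda>s. K s \<omega>) + 2 * energy t (\<lambda>s. K s \<omega> - ?Z (r k) s \<omega>)"
        by (intro energy_diff_le sections_measurable_section[OF Km w] sections_measurable_section[OF sections_measurable_diff[OF Km Sm(3)] w])
      then show "energy t (\<lambda>s. ?Z (r k) s \<omega>) \<le> 2 * energy t (\<lambda>s. K s \<omega>) + 2 * ?e3 (r k) \<omega>" unfolding * by simp
    qed
    also have "\<dots> = 2 * (\<integral>\<^sup>+\<omega>. energy t (\<lambda>s. K s \<omega>) \<partial>M) + 2 * (\<integral>\<^sup>+\<omega>. ?e3 (r k) \<omega> \<partial>M)"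
      using sections_measurable_energy[OF Km] em(3)[of "r k"] by (subst nn_integral_add) (simp_all add: nn_integral_cmult)
    also have "\<dots> \<le> 2 * (\<integral>\<^sup>+\<omega>. energy t (\<lambda>s. K s \<omega>) \<partial>M) + 2 * ennreal (1 / Suc (r k))"
      using j by (intro add_mono mult_left_mono) auto
    finally show "(\<integral>\<^sup>+\<omega>. ennreal ((?IZ (r k) \<omega>)\<^sup>2) \<partial>M) \<le> 2 * (\<integral>\<^sup>+\<omega>. energy t (\<lambda>s. K s \<omega>) \<partial>M) + 2 * ennreal (1 / Suc (r k))" .
  qed
  also have "\<dots> = 2 * (\<integral>\<^sup>+\<omega>. energy t (\<lambda>s. K s \<omega>) \<partial>M)"
  proof (rule lim_imp_Liminf)
    have "(\<lambda>k. inverse (real (Suc (r k)))) \<longlonglongrightarrow> 0"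
      using LIMSEQ_subseq_LIMSEQ[OF LIMSEQ_inverse_real_of_nat r(1)] by (simp add: comp_def)
    then have "(\<lambda>k. 2 * ennreal (1 / Suc (r k))) \<longlonglongrightarrow> 2 * ennreal 0"
      by (intro ennreal_tendsto_cmult tendsto_ennrealI) (auto simp: inverse_eq_divide)
    then have "(\<lambda>k. 2 * (\<integral>\<^sup>+\<omega>. energy t (\<lambda>s. K s \<omega>) \<partial>M) + 2 * ennreal (1 / Suc (r k))) \<longlonglongrightarrow> 2 * (\<integral>\<^sup>+\<omega>. energy t (\<lambda>s. K s \<omega>) \<partial>M) + 0"
      by (intro tendsto_add tendsto_const) simp
    then show "(\<lambda>k. 2 * (\<integral>\<^sup>+\<omega>. energy t (\<lambda>s. K s \<omega>) \<partial>M) + 2 * ennreal (1 / Suc (r k))) \<longlonglongrightarrow> 2 * (\<integral>\<^sup>+\<omega>. energy t (\<lambda>s. K s \<omega>) \<partial>M)" by simp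
  qed simp
  finally show ?thesis .
qed

end

lemma ennreal_double_double:
  assumes "a \<ge> 0"
  shows "2 * ennreal a + 2 * ennreal a = ennreal (4 * a)"
proof -
  have "ennreal (4 * a) = ennreal (2 * a + 2 * a)" by simp
  also have "\<dots> = ennreal (2 * a) + ennreal (2 * a)" using assms by (intro ennreal_plus) auto
  also have "ennreal (2 * a) = 2 * ennreal a" by (simp add: ennreal_mult')
  finally show ?thesis by simp
qed

text \<open>Mean square increments of order \<open>(1/4)^k\<close> have first moments of order
  \<open>(1/2)^k\<close>, which are summable, so almost every path converges. The distance to the
  limit follows by Fatou; on the exceptional null set the value of \<open>lim\<close> does not
  affect the integral.\<close>

lemma (in prob_space) L2_fast_convergence:
  fixes X :: "nat \<Rightarrow> 'a \<Rightarrow> real"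
  assumes X[measurable]: "\<And>k. X k \<in> borel_measurable M" and C: "C \<ge> 0"
    and fast: "\<And>k m. k \<le> m \<Longrightarrow> (\<integral>\<^sup>+\<omega>. ennreal ((X m \<omega> - X k \<omega>)\<^sup>2) \<partial>M) \<le> ennreal (C * (1 / 4) ^ k)"
  shows "AE \<omega> in M. convergent (\<lambda>k. X k \<omega>)"
    and "(\<integral>\<^sup>+\<omega>. ennreal ((lim (\<lambda>k. X k \<omega>) - X k \<omega>)\<^sup>2) \<partial>M) \<le> ennreal (C * (1 / 4) ^ k)"
proof -
  let ?d = "\<lambda>k \<omega>. \<bar>X (Suc k) \<omega> - X k \<omega>\<bar>"
  have bnd: "(\<integral>\<^sup>+\<omega>. ennreal (?d k \<omega>) \<partial>M) \<le> ennreal ((C + 1) * (1 / 2) ^ k)" for k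
  proof -
    \<comment> \<open>This is \<open>(2^k * |y| - 1)^2 >= 0\<close> rearranged: a square of order
      \<open>(1/4)^k\<close> is traded for a first moment of order \<open>(1/2)^k\<close>.\<close>
    have le: "\<bar>y\<bar> \<le> 2 ^ k * y\<^sup>2 + (1 / 2) ^ k" for y :: real
    proof -
      have p: "(2::real) ^ k * (1 / 2) ^ k = 1" by (simp add: power_mult_distrib[symmetric])
      have pos: "(2::real) ^ k > 0" by simp
      have "0 \<le> (2 ^ k * \<bar>y\<bar> - 1)\<^sup>2" by simp
      also have "\<dots> = 2 ^ k * (2 ^ k * y\<^sup>2 + (1 / 2) ^ k - 2 * \<bar>y\<bar>)"
        using p by (simp add: power2_diff power_mult_distrib algebra_simps power2_eq_square)
      finally have "0 \<le> 2 ^ k * y\<^sup>2 + (1 / 2) ^ k - 2 * \<bar>y\<bar>" using pos by (simp add: zero_le_mult_iff)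
      then show ?thesis by linarith
    qed
    have "(\<integral>\<^sup>+\<omega>. ennreal (?d k \<omega>) \<partial>M) \<le> (\<integral>\<^sup>+\<omega>. ennreal (2 ^ k) * ennreal ((X (Suc k) \<omega> - X k \<omega>)\<^sup>2) + ennreal ((1 / 2) ^ k) \<partial>M)"
      using le by (intro nn_integral_mono) (simp add: ennreal_mult[symmetric] ennreal_plus[symmetric] ennreal_leI del: ennreal_plus)
    also have "\<dots> = ennreal (2 ^ k) * (\<integral>\<^sup>+\<omega>. ennreal ((X (Suc k) \<omega> - X k \<omega>)\<^sup>2) \<partial>M) + ennreal ((1 / 2) ^ k)"
      by (subst nn_integral_add) (simp_all add: nn_integral_cmult emeasure_space_1)
    also have "\<dots> \<le> ennreal (2 ^ k) * ennreal (C * (1 / 4) ^ k) + ennreal ((1 / 2) ^ k)"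
      by (intro add_mono mult_left_mono fast) auto
    also have "\<dots> = ennreal (2 ^ k * (C * (1 / 4) ^ k) + (1 / 2) ^ k)"
      using C by (subst ennreal_plus) (auto simp: ennreal_mult)
    also have "2 ^ k * (C * (1 / 4) ^ k) = C * (2 * (1 / 4)) ^ k" by (simp only: power_mult_distrib) simp
    also have "C * (2 * (1 / 4)) ^ k + (1 / 2) ^ k = (C + 1) * (1 / 2 :: real) ^ k" by (simp add: algebra_simps)
    finally show ?thesis .
  qed
  have "(\<integral>\<^sup>+\<omega>. (\<Sum>k. ennreal (?d k \<omega>)) \<partial>M) = (\<Sum>k. \<integral>\<^sup>+\<omega>. ennreal (?d k \<omega>) \<partial>M)"
    by (rule nn_integral_suminf) measurable
  also have "\<dots> \<le> (\<Sum>k. ennreal ((C + 1) * (1 / 2) ^ k))" by (intro suminf_le bnd summableI)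
  also have "\<dots> < \<infinity>"
  proof -
    have "summable (\<lambda>k. (C + 1) * (1 / 2 :: real) ^ k)" by (intro summable_mult summable_geometric) simp
    then have "(\<Sum>k. ennreal ((C + 1) * (1 / 2) ^ k)) = ennreal (\<Sum>k. (C + 1) * (1 / 2) ^ k)"
      using C by (intro suminf_ennreal2) auto
    then show ?thesis by simp
  qed
  finally have "(\<integral>\<^sup>+\<omega>. (\<Sum>k. ennreal (?d k \<omega>)) \<partial>M) \<noteq> \<infinity>" by auto
  then have "AE \<omega> in M. (\<Sum>k. ennreal (?d k \<omega>)) \<noteq> \<infinity>"
    by (intro nn_integral_PInf_AE) measurable
  then show conv: "AE \<omega> in M. convergent (\<lambda>k. X k \<omega>)"
  proof eventually_elim
    case (elim \<omega>)
    have "summable (\<lambda>k. ?d k \<omega>)" using elim by (intro summable_suminf_not_top) auto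
    then have "summable (\<lambda>k. X (Suc k) \<omega> - X k \<omega>)" by (rule summable_rabs_cancel)
    then have "(\<lambda>n. X 0 \<omega> + (\<Sum>k<n. X (Suc k) \<omega> - X k \<omega>)) \<longlonglongrightarrow> X 0 \<omega> + (\<Sum>k. X (Suc k) \<omega> - X k \<omega>)"
      by (intro tendsto_add tendsto_const summable_LIMSEQ)
    moreover have "X 0 \<omega> + (\<Sum>k<n. X (Suc k) \<omega> - X k \<omega>) = X n \<omega>" for n
      by (subst sum_lessThan_telescope) simp
    ultimately show ?case unfolding convergent_def by auto
  qed
  have "(\<integral>\<^sup>+\<omega>. ennreal ((lim (\<lambda>k. X k \<omega>) - X k \<omega>)\<^sup>2) \<partial>M) \<le> (\<integral>\<^sup>+\<omega>. liminf (\<lambda>m. ennreal ((X m \<omega> - X k \<omega>)\<^sup>2)) \<partial>M)"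
  proof (rule nn_integral_mono_AE, use conv in eventually_elim)
    fix \<omega> assume "convergent (\<lambda>k. X k \<omega>)"
    then have "(\<lambda>m. X m \<omega>) \<longlonglongrightarrow> lim (\<lambda>k. X k \<omega>)" by (simp add: convergent_LIMSEQ_iff)
    then have "(\<lambda>m. ennreal ((X m \<omega> - X k \<omega>)\<^sup>2)) \<longlonglongrightarrow> ennreal ((lim (\<lambda>k. X k \<omega>) - X k \<omega>)\<^sup>2)"
      by (intro tendsto_ennrealI tendsto_power tendsto_diff tendsto_const)
    then show "ennreal ((lim (\<lambda>k. X k \<omega>) - X k \<omega>)\<^sup>2) \<le> liminf (\<lambda>m. ennreal ((X m \<omega> - X k \<omega>)\<^sup>2))"
      by (intro eq_refl lim_imp_Liminf[symmetric]) simp_all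
  qed
  also have "\<dots> \<le> liminf (\<lambda>m. \<integral>\<^sup>+\<omega>. ennreal ((X m \<omega> - X k \<omega>)\<^sup>2) \<partial>M)"
    by (rule nn_integral_liminf) measurable
  also have "\<dots> \<le> liminf (\<lambda>m. ennreal (C * (1 / 4) ^ k))"
    by (rule Liminf_mono) (use fast in \<open>auto simp: eventually_sequentially\<close>)
  also have "\<dots> = ennreal (C * (1 / 4) ^ k)" by (simp add: Liminf_const)
  finally show "(\<integral>\<^sup>+\<omega>. ennreal ((lim (\<lambda>k. X k \<omega>) - X k \<omega>)\<^sup>2) \<partial>M) \<le> ennreal (C * (1 / 4) ^ k)" .
qed

section \<open>Jointly measurable versions of parameter-dependent Ito integrals\<close>

context brownian_setup
begin

text \<open>By the usual conditions \<open>F 0\<close> contains a null event covering all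
  discontinuous paths, so setting the paths to 0 there keeps adaptedness. With every path
  continuous, joint measurability in time and \<omega> becomes provable.\<close>

lemma continuous_version:
  obtains Bc where "\<And>t. t \<in> {0..T} \<Longrightarrow> Bc t \<in> borel_measurable (F t)"
    "\<And>\<omega>. \<omega> \<in> space M \<Longrightarrow> continuous_on {0..T} (\<lambda>t. Bc t \<omega>)"
    "AE \<omega> in M. \<forall>t. Bc t \<omega> = B t \<omega>"
proof -
  have "AE \<omega> in M. continuous_on {0..T} (\<lambda>t. B t \<omega>)"
    using brownian[unfolded brownian_motion_def, THEN conjunct2, THEN conjunct2, THEN conjunct1] .
  then obtain N where N: "{\<omega>\<in>space M. \<not> continuous_on {0..T} (\<lambda>t. B t \<omega>)} \<subseteq> N" "N \<in> null_sets M"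
    by (auto elim!: AE_E simp: null_sets_def)
  have "\<forall>N\<in>null_sets M. \<forall>A\<subseteq>N. A \<in> sets (F 0)"
    using filtration[unfolded usual_filtration_def, THEN conjunct2, THEN conjunct2, THEN conjunct2] .
  then have N0: "N \<in> sets (F 0)" using bspec[OF _ N(2)] by blast
  define Bc where "Bc = (\<lambda>t \<omega>. if \<omega> \<in> N then 0 else B t \<omega>)"
  show ?thesis
  proof (rule that)
    fix t assume t: "t \<in> {0..T}"
    then have Nt: "N \<in> sets (F t)" using N0 sets_F_mono[of 0 t] by auto
    note [measurable] = B_measurable_F[OF t] Nt
    show "Bc t \<in> borel_measurable (F t)" unfolding Bc_def by measurable
  next
    fix \<omega> assume "\<omega> \<in> space M"
    then show "continuous_on {0..T} (\<lambda>t. Bc t \<omega>)" using N(1) unfolding Bc_def by (cases "\<omega> \<in> N") auto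
  next
    show "AE \<omega> in M. \<forall>t. Bc t \<omega> = B t \<omega>"
      using AE_not_in[OF N(2)] by eventually_elim (simp add: Bc_def)
  qed
qed

text \<open>Discretized times take countably many values, for each of which adaptedness gives
  measurability; continuity of the paths passes to the limit. Clamping keeps the discretized times
  inside \<open>{0..u}\<close>.\<close>

lemma continuous_adapted_jointly_measurable:
  assumes Bc: "\<And>t. t \<in> {0..T} \<Longrightarrow> Bc t \<in> borel_measurable (F t)"
    and cont: "\<And>\<omega>. \<omega> \<in> space M \<Longrightarrow> continuous_on {0..T} (\<lambda>t. Bc t \<omega>)"
    and u: "u \<in> {0..T}"
  shows "(\<lambda>(\<omega>, s). Bc (max 0 (min u s)) \<omega> :: real) \<in> borel_measurable (F u \<Otimes>\<^sub>M borel)"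
proof -
  let ?c = "\<lambda>s. max 0 (min u s)"
  let ?q = "\<lambda>n s. ?c (real_of_int \<lfloor>real (Suc n) * s\<rfloor> / real (Suc n))"
  have cu: "?c s \<in> {0..u}" "?c s \<in> {0..T}" for s using u by auto
  have m: "(\<lambda>z. Bc (?q n (snd z)) (fst z)) \<in> borel_measurable (F u \<Otimes>\<^sub>M borel)" for n
  proof -
    have "(\<lambda>z. Bc (?c (real_of_int k / real (Suc n))) (fst z)) \<in> borel_measurable (F u \<Otimes>\<^sub>M (borel :: real measure))" for k
    proof (rule measurable_compose[OF measurable_fst])
      define r where "r = ?c (real_of_int k / real (Suc n))"
      have "0 \<le> r" "r \<le> u" using cu(1)[of "real_of_int k / real (Suc n)"] unfolding r_def by auto
      then show "Bc r \<in> borel_measurable (F u)"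
        using u measurable_F_mono[OF _ _ _ Bc, of r u] by auto
    qed
    moreover have "(\<lambda>z. \<lfloor>real (Suc n) * snd z\<rfloor>) \<in> measurable (F u \<Otimes>\<^sub>M (borel :: real measure)) (count_space UNIV)"
      by measurable
    ultimately show ?thesis
      by (rule measurable_compose_countable[where f = "\<lambda>k z. Bc (?c (real_of_int k / real (Suc n))) (fst z)"
            and g = "\<lambda>z. \<lfloor>real (Suc n) * snd z\<rfloor>"])
  qed
  have lim: "(\<lambda>n. Bc (?q n (snd z)) (fst z)) \<longlonglongrightarrow> Bc (?c (snd z)) (fst z)" if z: "z \<in> space (F u \<Otimes>\<^sub>M (borel :: real measure))" for z
  proof -
    have w: "fst z \<in> space M" using z unfolding space_pair_measure space_F[OF u] mem_Times_iff by (rule conjunct1)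
    have "(\<lambda>n. real_of_int \<lfloor>real (Suc n) * snd z\<rfloor> / real (Suc n)) \<longlonglongrightarrow> snd z"
    proof (rule tendsto_sandwich)
      have "real (Suc n) * snd z - 1 \<le> real_of_int \<lfloor>real (Suc n) * snd z\<rfloor>" for n by linarith
      then have "(real (Suc n) * snd z - 1) / real (Suc n) \<le> real_of_int \<lfloor>real (Suc n) * snd z\<rfloor> / real (Suc n)" for n
        by (rule divide_right_mono) simp
      then have "snd z - inverse (real (Suc n)) \<le> real_of_int \<lfloor>real (Suc n) * snd z\<rfloor> / real (Suc n)" for n
        by (simp add: diff_divide_distrib inverse_eq_divide del: of_nat_Suc)
      then show "\<forall>\<^sub>F n in sequentially. snd z - inverse (real (Suc n)) \<le> real_of_int \<lfloor>real (Suc n) * snd z\<rfloor> / real (Suc n)" by simp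
      have "real_of_int \<lfloor>real (Suc n) * snd z\<rfloor> / real (Suc n) \<le> real (Suc n) * snd z / real (Suc n)" for n
        by (intro divide_right_mono) auto
      then show "\<forall>\<^sub>F n in sequentially. real_of_int \<lfloor>real (Suc n) * snd z\<rfloor> / real (Suc n) \<le> snd z"
        by (simp del: of_nat_Suc)
      show "(\<lambda>n. snd z - inverse (real (Suc n))) \<longlonglongrightarrow> snd z"
        using tendsto_diff[OF tendsto_const[of "snd z"] LIMSEQ_inverse_real_of_nat] by simp
    qed simp
    then have "(\<lambda>n. ?q n (snd z)) \<longlonglongrightarrow> ?c (snd z)" by (intro tendsto_max tendsto_min tendsto_const)
    then show ?thesis
      by (rule continuous_on_tendsto_compose[OF cont[OF w]]) (use cu in auto)
  qed
  have "(\<lambda>z. Bc (?c (snd z)) (fst z)) \<in> borel_measurable (F u \<Otimes>\<^sub>M borel)"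
    by (rule borel_measurable_LIMSEQ_real[OF lim m])
  then show ?thesis by (simp add: case_prod_beta')
qed

text \<open>The parameters \<open>t\<close> and \<open>x\<close> enter jointly measurably; only the
  integration time \<open>s\<close> is tied to the filtration.\<close>

definition progressive_family :: "(real \<Rightarrow> real \<Rightarrow> real \<Rightarrow> 'a \<Rightarrow> real) \<Rightarrow> bool" where
  "progressive_family H \<longleftrightarrow> (\<forall>u\<in>{0..T}. (\<lambda>(\<omega>, t, x, s). indicator {0..u} s * H t x s \<omega>)
     \<in> borel_measurable (F u \<Otimes>\<^sub>M borel \<Otimes>\<^sub>M borel \<Otimes>\<^sub>M borel))"

lemma progressive_family_progressive:
  assumes "progressive_family H" "t \<le> T"
  shows "progressive t F (H t x)"
  unfolding progressive_sections[OF assms(2)] sections_measurable_def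
proof
  fix u assume u: "u \<in> {0..t}"
  have "(\<lambda>z. (fst z, t, x, snd z)) \<in> measurable (F u \<Otimes>\<^sub>M borel) (F u \<Otimes>\<^sub>M borel \<Otimes>\<^sub>M borel \<Otimes>\<^sub>M borel)" by measurable
  from measurable_compose[OF this, of "\<lambda>(\<omega>, t, x, s). indicator {0..u} s * H t x s \<omega>" borel]
  show "(\<lambda>(\<omega>, s). indicator {0..u} s * H t x s \<omega>) \<in> borel_measurable (F u \<Otimes>\<^sub>M borel)"
    using assms u unfolding progressive_family_def by (simp add: case_prod_beta')
qed

lemma progressive_field_iff:
  "progressive_field T F Y \<longleftrightarrow> (\<forall>u\<in>{0..T}. (\<lambda>(\<omega>, s, x). indicator {0..u} s * Y s x \<omega>) \<in> borel_measurable (F u \<Otimes>\<^sub>M borel \<Otimes>\<^sub>M borel))"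
proof -
  have "(\<lambda>(\<omega>, s, x). Y s x \<omega>) \<in> borel_measurable (F u \<Otimes>\<^sub>M restrict_space borel {0..u} \<Otimes>\<^sub>M borel) \<longleftrightarrow>
    (\<lambda>(\<omega>, s, x). indicator {0..u} s * Y s x \<omega>) \<in> borel_measurable (F u \<Otimes>\<^sub>M borel \<Otimes>\<^sub>M borel)" if u: "u \<in> {0..T}" for u
  proof
    assume m: "(\<lambda>(\<omega>, s, x). Y s x \<omega>) \<in> borel_measurable (F u \<Otimes>\<^sub>M restrict_space borel {0..u} \<Otimes>\<^sub>M borel)"
    have "(\<lambda>z. (fst z, max 0 (min u (fst (snd z))), snd (snd z))) \<in> measurable (F u \<Otimes>\<^sub>M borel \<Otimes>\<^sub>M borel) (F u \<Otimes>\<^sub>M restrict_space borel {0..u} \<Otimes>\<^sub>M (borel :: real measure))"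
      using u by (intro measurable_Pair measurable_fst measurable_restrict_space2) auto
    from measurable_compose[OF this m]
    have "(\<lambda>z. Y (max 0 (min u (fst (snd z)))) (snd (snd z)) (fst z)) \<in> borel_measurable (F u \<Otimes>\<^sub>M borel \<Otimes>\<^sub>M borel)" by simp
    then have "(\<lambda>z. indicator {0..u} (fst (snd z)) * Y (max 0 (min u (fst (snd z)))) (snd (snd z)) (fst z)) \<in> borel_measurable (F u \<Otimes>\<^sub>M borel \<Otimes>\<^sub>M borel)"
      by measurable
    then show "(\<lambda>(\<omega>, s, x). indicator {0..u} s * Y s x \<omega>) \<in> borel_measurable (F u \<Otimes>\<^sub>M borel \<Otimes>\<^sub>M borel)"
      by (rule measurable_cong[THEN iffD1, rotated]) (auto simp: indicator_def)
  next
    assume m: "(\<lambda>(\<omega>, s, x). indicator {0..u} s * Y s x \<omega>) \<in> borel_measurable (F u \<Otimes>\<^sub>M borel \<Otimes>\<^sub>M borel)"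
    have "(\<lambda>z. (fst z, fst (snd z), snd (snd z))) \<in> measurable (F u \<Otimes>\<^sub>M restrict_space borel {0..u} \<Otimes>\<^sub>M borel) (F u \<Otimes>\<^sub>M borel \<Otimes>\<^sub>M (borel :: real measure))"
      by (intro measurable_Pair measurable_fst measurable_compose[OF measurable_snd] measurable_compose[OF measurable_fst measurable_restrict_space1] measurable_snd) auto
    from measurable_compose[OF this m]
    have "(\<lambda>z. indicator {0..u} (fst (snd z)) * Y (fst (snd z)) (snd (snd z)) (fst z)) \<in> borel_measurable (F u \<Otimes>\<^sub>M restrict_space borel {0..u} \<Otimes>\<^sub>M borel)" by (simp add: case_prod_beta')
    then show "(\<lambda>(\<omega>, s, x). Y s x \<omega>) \<in> borel_measurable (F u \<Otimes>\<^sub>M restrict_space borel {0..u} \<Otimes>\<^sub>M borel)"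
      by (rule measurable_cong[THEN iffD1, rotated]) (auto simp: space_pair_measure)
  qed
  then show ?thesis unfolding progressive_field_def by simp
qed

text \<open>Lets the integrand cut off at \<open>u\<close>, for which measurability with respect to
  \<open>F u\<close> is known, stand in for \<open>H\<close>.\<close>

lemma approx_value_cut:
  assumes "t \<le> u"
  shows "approx_value t (\<lambda>s \<omega>. indicator {0..u} s * H s \<omega>) j i \<omega> = approx_value t H j i \<omega>"
proof -
  have "clamped t m (\<lambda>s \<omega>. indicator {0..u} s * H s \<omega>) \<omega> = clamped t m H \<omega>" for m
    using assms by (auto simp: clamped_def indicator_def fun_eq_iff)
  then show ?thesis unfolding approx_value_def by simp
qed

lemma approx_value_family_measurable:
  fixes h :: "'b \<Rightarrow> real \<Rightarrow> real \<Rightarrow> real \<Rightarrow> real"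
  assumes "(\<lambda>(\<omega>, t, x, s). h \<omega> t x s) \<in> borel_measurable (N \<Otimes>\<^sub>M borel \<Otimes>\<^sub>M borel \<Otimes>\<^sub>M borel)"
  shows "(\<lambda>(\<omega>, t, x). cell_avg t n (\<lambda>r. indicator {0..t} r * max (- c) (min c (h \<omega> t x r))) i) \<in> borel_measurable (N \<Otimes>\<^sub>M borel \<Otimes>\<^sub>M borel)"
proof -
  let ?P = "N \<Otimes>\<^sub>M (borel :: real measure) \<Otimes>\<^sub>M (borel :: real measure)"
  have "(\<lambda>z. (fst (fst z), fst (snd (fst z)), snd (snd (fst z)), snd z)) \<in> measurable (?P \<Otimes>\<^sub>M borel) (N \<Otimes>\<^sub>M borel \<Otimes>\<^sub>M borel \<Otimes>\<^sub>M borel)"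
    by measurable
  from measurable_compose[OF this assms]
  have [measurable]: "(\<lambda>z. h (fst (fst z)) (fst (snd (fst z))) (snd (snd (fst z))) (snd z)) \<in> borel_measurable (?P \<Otimes>\<^sub>M borel)" by simp
  have "(\<lambda>z. if (real i - 1) * fst (snd (fst z)) / n < snd z \<and> snd z \<le> real i * fst (snd (fst z)) / n \<and> 0 \<le> snd z \<and> snd z \<le> fst (snd (fst z))
      then max (- c) (min c (h (fst (fst z)) (fst (snd (fst z))) (snd (snd (fst z))) (snd z))) else 0) \<in> borel_measurable (?P \<Otimes>\<^sub>M borel)"
    by measurable
  then have "(\<lambda>(y, r). indicator {(real i - 1) * fst (snd y) / n<..real i * fst (snd y) / n} r *\<^sub>R (indicator {0..fst (snd y)} r * max (- c) (min c (h (fst y) (fst (snd y)) (snd (snd y)) r)))) \<in> borel_measurable (?P \<Otimes>\<^sub>M borel)"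
    by (rule measurable_cong[THEN iffD1, rotated]) (auto simp: indicator_def)
  then have "(\<lambda>(y, r). indicator {(real i - 1) * fst (snd y) / n<..real i * fst (snd y) / n} r *\<^sub>R (indicator {0..fst (snd y)} r * max (- c) (min c (h (fst y) (fst (snd y)) (snd (snd y)) r)))) \<in> borel_measurable (?P \<Otimes>\<^sub>M lborel)"
    by (simp cong: measurable_cong_sets sets_pair_measure_cong)
  note L = lborel.borel_measurable_lebesgue_integral[OF this]
  have D: "(\<lambda>y. fst (snd y)) \<in> borel_measurable ?P" by measurable
  have "(\<lambda>y. real n / fst (snd y) * (\<integral>r. indicator {(real i - 1) * fst (snd y) / n<..real i * fst (snd y) / n} r *\<^sub>R (indicator {0..fst (snd y)} r * max (- c) (min c (h (fst y) (fst (snd y)) (snd (snd y)) r))) \<partial>lborel)) \<in> borel_measurable ?P"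
    by (intro borel_measurable_times borel_measurable_divide borel_measurable_const L D)
  then show ?thesis unfolding cell_avg_def set_lebesgue_integral_def by (simp add: case_prod_beta')
qed


lemma approx_ito_family_measurable:
  assumes Bc: "\<And>t. t \<in> {0..T} \<Longrightarrow> Bc t \<in> borel_measurable (F t)"
    and cont: "\<And>\<omega>. \<omega> \<in> space M \<Longrightarrow> continuous_on {0..T} (\<lambda>t. Bc t \<omega> :: real)"
    and u: "u \<in> {0..T}" and H: "progressive_family H"
  shows "(\<lambda>z. indicator {0..u} (fst (snd z)) * simple_ito Bc (approx_cells j) (approx_grid (fst (snd z)) j) (approx_value (fst (snd z)) (H (fst (snd z)) (snd (snd z))) j) (fst z))
    \<in> borel_measurable (F u \<Otimes>\<^sub>M borel \<Otimes>\<^sub>M borel)"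
proof -
  let ?n = "approx_cells j" and ?m = "real (fst (prod_decode j))" and ?c = "\<lambda>s. max 0 (min u s)"
  let ?P = "F u \<Otimes>\<^sub>M (borel :: real measure) \<Otimes>\<^sub>M (borel :: real measure)"
  have Hu: "(\<lambda>(\<omega>, t, x, s). indicator {0..u} s * H t x s \<omega>) \<in> borel_measurable (F u \<Otimes>\<^sub>M borel \<Otimes>\<^sub>M borel \<Otimes>\<^sub>M borel)"
    using H u unfolding progressive_family_def by blast
  have V: "(\<lambda>z. approx_value (fst (snd z)) (\<lambda>s \<omega>. indicator {0..u} s * H (fst (snd z)) (snd (snd z)) s \<omega>) j i (fst z)) \<in> borel_measurable ?P" for i
    using approx_value_family_measurable[OF Hu, of ?n ?m i] unfolding approx_value_def clamped_def by (simp add: case_prod_beta')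
  have Bm: "(\<lambda>z. Bc (?c (approx_grid (fst (snd z)) j i)) (fst z)) \<in> borel_measurable ?P" for i
  proof -
    have "(\<lambda>z. (fst z, approx_grid (fst (snd z)) j i)) \<in> measurable ?P (F u \<Otimes>\<^sub>M borel)"
      unfolding approx_grid_def by measurable
    from measurable_compose[OF this continuous_adapted_jointly_measurable[OF Bc cont u]] show ?thesis by simp
  qed
  have I: "(\<lambda>z. indicator {0..u} (fst (snd z)) :: real) \<in> borel_measurable ?P"
    by measurable
  have "(\<lambda>z. indicator {0..u} (fst (snd z)) * (\<Sum>i<?n. approx_value (fst (snd z)) (\<lambda>s \<omega>. indicator {0..u} s * H (fst (snd z)) (snd (snd z)) s \<omega>) j i (fst z)
      * (Bc (?c (approx_grid (fst (snd z)) j (Suc i))) (fst z) - Bc (?c (approx_grid (fst (snd z)) j i)) (fst z)))) \<in> borel_measurable ?P"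
    by (intro borel_measurable_times I borel_measurable_sum V borel_measurable_diff Bm)
  then show ?thesis
  proof (rule measurable_cong[THEN iffD1, rotated])
    fix z :: "'a \<times> real \<times> real"
    show "indicator {0..u} (fst (snd z)) * (\<Sum>i<?n. approx_value (fst (snd z)) (\<lambda>s \<omega>. indicator {0..u} s * H (fst (snd z)) (snd (snd z)) s \<omega>) j i (fst z)
      * (Bc (?c (approx_grid (fst (snd z)) j (Suc i))) (fst z) - Bc (?c (approx_grid (fst (snd z)) j i)) (fst z)))
      = indicator {0..u} (fst (snd z)) * simple_ito Bc (approx_cells j) (approx_grid (fst (snd z)) j) (approx_value (fst (snd z)) (H (fst (snd z)) (snd (snd z))) j) (fst z)"
    proof (cases "fst (snd z) \<in> {0..u}")
      case True
      \<comment> \<open>For a parameter \<open>t\<close> of at most \<open>u\<close> all grid points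
        already lie in \<open>{0..u}\<close>, so the clamping does nothing.\<close>
      have grid: "?c (approx_grid (fst (snd z)) j i) = approx_grid (fst (snd z)) j i" if "i \<le> ?n" "?n > 0" for i
      proof -
        have "real i * fst (snd z) \<le> real ?n * fst (snd z)" using that True by (intro mult_right_mono) auto
        then have "approx_grid (fst (snd z)) j i \<le> fst (snd z)" using that(2) unfolding approx_grid_def by (simp add: field_simps)
        moreover have "0 \<le> approx_grid (fst (snd z)) j i" using True unfolding approx_grid_def by simp
        ultimately show ?thesis using True by auto
      qed
      have "fst (snd z) \<le> u" using True by simp
      then show ?thesis unfolding simple_ito_def using grid by (auto intro!: sum.cong simp: approx_value_cut)
    qed simp
  qed
qed

text \<open>Makes the selection of a good approximation measurable in \<open>(t, x)\<close>. The cut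
  at \<open>T\<close> gives joint measurability in all variables and changes no value that matters
  for \<open>t <= T\<close>.\<close>

lemma approx_error_measurable:
  assumes H: "progressive_family H"
  shows "(\<lambda>y. \<integral>\<^sup>+\<omega>. energy (fst y) (\<lambda>s. approx_process (fst y) (\<lambda>s \<omega>. indicator {0..T} s * H (fst y) (snd y) s \<omega>) j s \<omega>
      - indicator {0..T} s * H (fst y) (snd y) s \<omega>) \<partial>M) \<in> borel_measurable (borel \<Otimes>\<^sub>M borel)"
proof -
  let ?n = "approx_cells j" and ?m = "real (fst (prod_decode j))"
  let ?R = "(borel :: (real \<times> real) measure) \<Otimes>\<^sub>M M"
  have TT: "T \<in> {0..T}" using T_pos by simp
  have HT: "(\<lambda>(\<omega>, t, x, s). indicator {0..T} s * H t x s \<omega>) \<in> borel_measurable (F T \<Otimes>\<^sub>M borel \<Otimes>\<^sub>M borel \<Otimes>\<^sub>M borel)"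
    using H TT unfolding progressive_family_def by blast
  have idm: "(\<lambda>x. x) \<in> measurable M (F T)" by (rule measurable_F_M[OF TT]) simp
  let ?H = "\<lambda>t x s \<omega>. indicator {0..T} s * H t x s \<omega>"
  have f1: "(\<lambda>w. fst (fst (fst w))) \<in> borel_measurable (?R \<Otimes>\<^sub>M lborel)" "(\<lambda>w. snd (fst (fst w))) \<in> borel_measurable (?R \<Otimes>\<^sub>M lborel)"
    "(\<lambda>w. snd w) \<in> borel_measurable (?R \<Otimes>\<^sub>M lborel)" "(\<lambda>w. snd (fst w)) \<in> measurable (?R \<Otimes>\<^sub>M lborel) (F T)"
    by (auto simp: borel_prod[symmetric] intro!: measurable_compose[OF _ idm])
  have "(\<lambda>w. (snd (fst w), fst (fst (fst w)), snd (fst (fst w)), snd w)) \<in> measurable (?R \<Otimes>\<^sub>M lborel) (F T \<Otimes>\<^sub>M borel \<Otimes>\<^sub>M borel \<Otimes>\<^sub>M borel)"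
    by (intro measurable_Pair f1)
  from measurable_compose[OF this HT]
  have H1: "(\<lambda>w. ?H (fst (fst (fst w))) (snd (fst (fst w))) (snd w) (snd (fst w))) \<in> borel_measurable (?R \<Otimes>\<^sub>M lborel)" by simp
  have V: "(\<lambda>(\<omega>, t, x). approx_value t (?H t x) j i \<omega>) \<in> borel_measurable (F T \<Otimes>\<^sub>M borel \<Otimes>\<^sub>M borel)" for i
    using approx_value_family_measurable[OF HT, of ?n ?m i] unfolding approx_value_def clamped_def by (simp add: case_prod_beta')
  have "(\<lambda>w. (snd (fst w), fst (fst (fst w)), snd (fst (fst w)))) \<in> measurable (?R \<Otimes>\<^sub>M lborel) (F T \<Otimes>\<^sub>M borel \<Otimes>\<^sub>M borel)"
    by (intro measurable_Pair f1)
  from measurable_compose[OF this V]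
  have V1: "(\<lambda>w. approx_value (fst (fst (fst w))) (?H (fst (fst (fst w))) (snd (fst (fst w)))) j i (snd (fst w))) \<in> borel_measurable (?R \<Otimes>\<^sub>M lborel)" for i by (simp add: case_prod_beta')
  have g: "(\<lambda>w. approx_grid (fst (fst (fst w))) j i) \<in> borel_measurable (?R \<Otimes>\<^sub>M lborel)" for i
    unfolding approx_grid_def using f1(1) by measurable
  have ind: "(\<lambda>w. indicator {approx_grid (fst (fst (fst w))) j i<..approx_grid (fst (fst (fst w))) j (Suc i)} (snd w) :: real) \<in> borel_measurable (?R \<Otimes>\<^sub>M lborel)" for i
  proof -
    note [measurable] = g f1(3)
    have "(\<lambda>w. if approx_grid (fst (fst (fst w))) j i < snd w \<and> snd w \<le> approx_grid (fst (fst (fst w))) j (Suc i) then 1 else 0 :: real) \<in> borel_measurable (?R \<Otimes>\<^sub>M lborel)"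
      by measurable
    then show ?thesis by (rule measurable_cong[THEN iffD1, rotated]) (auto simp: indicator_def)
  qed
  have ind2: "(\<lambda>w. indicator {0..fst (fst (fst w))} (snd w) :: real) \<in> borel_measurable (?R \<Otimes>\<^sub>M lborel)"
  proof -
    note [measurable] = f1
    have "(\<lambda>w. if 0 \<le> snd w \<and> snd w \<le> fst (fst (fst w)) then 1 else 0 :: real) \<in> borel_measurable (?R \<Otimes>\<^sub>M lborel)"
      by measurable
    then show ?thesis by (rule measurable_cong[THEN iffD1, rotated]) (auto simp: indicator_def)
  qed
  let ?D = "\<lambda>w. indicator {0..fst (fst (fst w))} (snd w) * ((\<Sum>i<?n. approx_value (fst (fst (fst w))) (?H (fst (fst (fst w))) (snd (fst (fst w)))) j i (snd (fst w))
    * indicator {approx_grid (fst (fst (fst w))) j i<..approx_grid (fst (fst (fst w))) j (Suc i)} (snd w)) - ?H (fst (fst (fst w))) (snd (fst (fst w))) (snd w) (snd (fst w)))"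
  have "?D \<in> borel_measurable (?R \<Otimes>\<^sub>M lborel)"
    by (intro borel_measurable_times borel_measurable_diff borel_measurable_sum V1 ind ind2 H1)
  then have "(\<lambda>w. ennreal ((?D w)\<^sup>2)) \<in> borel_measurable (?R \<Otimes>\<^sub>M lborel)"
    by (intro measurable_compose[OF borel_measurable_power measurable_ennreal])
  from lborel.borel_measurable_nn_integral_fst[OF this]
  have "(\<lambda>y. \<integral>\<^sup>+s. ennreal ((?D (y, s))\<^sup>2) \<partial>lborel) \<in> borel_measurable ?R" .
  from borel_measurable_nn_integral_fst[OF this]
  show ?thesis unfolding energy_eq approx_process_def simple_process_def
    by (simp add: borel_prod[symmetric])
qed

text \<open>For fixed \<open>(t, x)\<close> an integral exists as a limit of step approximations;
  the point is one choice that is measurable in \<open>(t, x)\<close>. The index of the k-th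
  approximation is selected measurably with error at most \<open>(1/4)^k\<close>, and this rate
  gives almost sure convergence without passing to subsequences that depend on
  \<open>(t, x)\<close>.\<close>

theorem ito_family_version:
  assumes H: "progressive_family H"
    and fin: "\<And>t x. 0 < t \<Longrightarrow> t \<le> T \<Longrightarrow> (\<integral>\<^sup>+\<omega>. energy t (\<lambda>s. H t x s \<omega>) \<partial>M) < \<infinity>"
  obtains J where "progressive_field T F J" "\<And>t x. 0 < t \<Longrightarrow> t \<le> T \<Longrightarrow> has_ito_integral M F B t (H t x) (J t x)"
proof -
  obtain Bc where Bc: "\<And>t. t \<in> {0..T} \<Longrightarrow> Bc t \<in> borel_measurable (F t)"
    "\<And>\<omega>. \<omega> \<in> space M \<Longrightarrow> continuous_on {0..T} (\<lambda>t. Bc t \<omega>)"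
    "AE \<omega> in M. \<forall>t. Bc t \<omega> = B t \<omega>" using continuous_version by blast
  define err where "err = (\<lambda>j y. \<integral>\<^sup>+\<omega>. energy (fst y) (\<lambda>s. approx_process (fst y) (\<lambda>s \<omega>. indicator {0..T} s * H (fst y) (snd y) s \<omega>) j s \<omega>
      - indicator {0..T} s * H (fst y) (snd y) s \<omega>) \<partial>M)"
  have err_m: "err j \<in> borel_measurable (borel \<Otimes>\<^sub>M borel)" for j
    unfolding err_def by (rule approx_error_measurable[OF H])
  have err_eq: "err j (t, x) = (\<integral>\<^sup>+\<omega>. energy t (\<lambda>s. approx_process t (H t x) j s \<omega> - H t x s \<omega>) \<partial>M)" if "t \<le> T" for j t x
  proof -
    have "approx_process t (\<lambda>s \<omega>. indicator {0..T} s * H t x s \<omega>) j s \<omega> = approx_process t (H t x) j s \<omega>" for s \<omega>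
      unfolding approx_process_def simple_process_def using approx_value_cut[OF that, of "H t x"] by simp
    then show ?thesis unfolding err_def using that by (auto intro!: nn_integral_cong energy_cong)
  qed
  \<comment> \<open>The least good index is a measurable function of \<open>(t, x)\<close>, since
    each error is.\<close>
  define sel where "sel = (\<lambda>k y. LEAST j. err j y \<le> ennreal ((1 / 4) ^ k))"
  have sel_m: "sel k \<in> measurable (borel \<Otimes>\<^sub>M borel) (count_space UNIV)" for k
    unfolding sel_def using err_m by measurable
  have sel: "err (sel k (t, x)) (t, x) \<le> ennreal ((1 / 4) ^ k)" if "0 < t" "t \<le> T" for k t x
  proof -
    have "\<exists>j. err j (t, x) \<le> ennreal ((1 / 4) ^ k)"
      unfolding err_eq[OF that(2)] by (rule approx_error_small[OF that progressive_family_progressive[OF H that(2)] fin[OF that]]) simp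
    then show ?thesis unfolding sel_def by (rule LeastI_ex)
  qed
  define I where "I = (\<lambda>j t x \<omega>. simple_ito Bc (approx_cells j) (approx_grid t j) (approx_value t (H t x) j) \<omega>)"
  define J where "J = (\<lambda>t x \<omega>. lim (\<lambda>k. I (sel k (t, x)) t x \<omega>))"
  have field: "progressive_field T F J"
    unfolding progressive_field_iff
  proof
    fix u assume u: "u \<in> {0..T}"
    let ?P = "F u \<Otimes>\<^sub>M (borel :: real measure) \<Otimes>\<^sub>M (borel :: real measure)"
    have Im: "(\<lambda>z. indicator {0..u} (fst (snd z)) * I j (fst (snd z)) (snd (snd z)) (fst z)) \<in> borel_measurable ?P" for j
      unfolding I_def by (rule approx_ito_family_measurable[OF Bc(1,2) u H])
    have s: "(\<lambda>z. sel k (snd z)) \<in> measurable ?P (count_space UNIV)" for k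
      by (rule measurable_compose[OF measurable_snd sel_m])
    have SI: "(\<lambda>z. indicator {0..u} (fst (snd z)) * I (sel k (snd z)) (fst (snd z)) (snd (snd z)) (fst z)) \<in> borel_measurable ?P" for k
      by (rule measurable_compose_countable[where f = "\<lambda>j z. indicator {0..u} (fst (snd z)) * I j (fst (snd z)) (snd (snd z)) (fst z)", OF Im s])
    have ind: "(\<lambda>z. indicator {0..u} (fst (snd z)) :: real) \<in> borel_measurable ?P" by measurable
    have "(\<lambda>z. indicator {0..u} (fst (snd z)) * lim (\<lambda>k. indicator {0..u} (fst (snd z)) * I (sel k (snd z)) (fst (snd z)) (snd (snd z)) (fst z))) \<in> borel_measurable ?P"
      by (intro borel_measurable_times[OF ind borel_measurable_lim_metric] SI)
    then show "(\<lambda>(\<omega>, s, x). indicator {0..u} s * J s x \<omega>) \<in> borel_measurable ?P"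
      by (rule measurable_cong[THEN iffD1, rotated]) (auto simp: J_def indicator_def)
  qed
  have ito: "has_ito_integral M F B t (H t x) (J t x)" if t: "0 < t" "t \<le> T" for t x
  proof -
    let ?H = "H t x" and ?s = "\<lambda>k. sel k (t, x)"
    note prog = progressive_family_progressive[OF H t(2), of x]
    have Hm: "sections_measurable M t ?H" using progressive_sections_M[OF prog] t by simp
    let ?n = "\<lambda>k. approx_cells (?s k)" and ?p = "\<lambda>k. approx_grid t (?s k)" and ?v = "\<lambda>k. approx_value t ?H (?s k)"
    note si = approx_simple_integrand[OF t prog]
    note ps = approx_process_sections[OF t prog]
    let ?S = "\<lambda>k. approx_process t ?H (?s k)"
    have r: "(\<integral>\<^sup>+\<omega>. energy t (\<lambda>s. ?S k s \<omega> - ?H s \<omega>) \<partial>M) \<le> ennreal ((1 / 4) ^ k)" for k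
      using sel[OF t, of k x] unfolding err_eq[OF t(2)] .
    define X where "X = (\<lambda>k. simple_ito B (?n k) (?p k) (?v k))"
    have Xm[measurable]: "X k \<in> borel_measurable M" for k unfolding X_def by (rule simple_ito_measurable[OF si t(2)])
    have fast: "(\<integral>\<^sup>+\<omega>. ennreal ((X m \<omega> - X k \<omega>)\<^sup>2) \<partial>M) \<le> ennreal (4 * (1 / 4) ^ k)" if "k \<le> m" for k m
    proof -
      obtain n p \<eta> where R: "simple_integrand M F t n p \<eta>"
        "\<And>s \<omega>. simple_process n p \<eta> s \<omega> = ?S m s \<omega> - ?S k s \<omega>" "\<And>\<omega>. simple_ito B n p \<eta> \<omega> = X m \<omega> - X k \<omega>"
        using simple_integrand_diff[OF si[of "?s m"] si[of "?s k"] t(2)] unfolding approx_process_def X_def by blast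
      have "(\<integral>\<^sup>+\<omega>. ennreal ((X m \<omega> - X k \<omega>)\<^sup>2) \<partial>M) = (\<integral>\<^sup>+\<omega>. energy t (\<lambda>s. ?S m s \<omega> - ?S k s \<omega>) \<partial>M)"
        using simple_ito_isometry[OF R(1) t(2)] unfolding R energy_def .
      also have "\<dots> \<le> (\<integral>\<^sup>+\<omega>. 2 * energy t (\<lambda>s. ?S m s \<omega> - ?H s \<omega>) + 2 * energy t (\<lambda>s. ?S k s \<omega> - ?H s \<omega>) \<partial>M)"
      proof (rule nn_integral_mono)
        fix \<omega> assume w: "\<omega> \<in> space M"
        show "energy t (\<lambda>s. ?S m s \<omega> - ?S k s \<omega>) \<le> 2 * energy t (\<lambda>s. ?S m s \<omega> - ?H s \<omega>) + 2 * energy t (\<lambda>s. ?S k s \<omega> - ?H s \<omega>)"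
          using energy_diff_le[OF sections_measurable_section[OF sections_measurable_diff[OF ps Hm] w, of "?s m"]
             sections_measurable_section[OF sections_measurable_diff[OF ps Hm] w, of "?s k"]] by simp
      qed
      also have "\<dots> = 2 * (\<integral>\<^sup>+\<omega>. energy t (\<lambda>s. ?S m s \<omega> - ?H s \<omega>) \<partial>M) + 2 * (\<integral>\<^sup>+\<omega>. energy t (\<lambda>s. ?S k s \<omega> - ?H s \<omega>) \<partial>M)"
        using sections_measurable_energy[OF sections_measurable_diff[OF ps Hm]]
        by (subst nn_integral_add) (simp_all add: nn_integral_cmult)
      also have "\<dots> \<le> 2 * ennreal ((1 / 4) ^ k) + 2 * ennreal ((1 / 4) ^ k)"
      proof -
        have "ennreal ((1 / 4) ^ m) \<le> ennreal ((1 / 4) ^ k)" using that by (intro ennreal_leI power_decreasing) auto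
        from order_trans[OF r[of m] this] r[of k] show ?thesis by (intro add_mono mult_left_mono) auto
      qed
      also have "\<dots> = ennreal (4 * (1 / 4) ^ k)" by (rule ennreal_double_double) simp
      finally show ?thesis .
    qed
    have JX: "AE \<omega> in M. J t x \<omega> = lim (\<lambda>k. X k \<omega>)"
      using Bc(3) by eventually_elim (simp add: J_def I_def X_def simple_ito_def)
    have Jm[measurable]: "J t x \<in> borel_measurable M"
    proof -
      have tt: "t \<in> {0..T}" using t by simp
      have "(\<lambda>(\<omega>, s, x). indicator {0..t} s * J s x \<omega>) \<in> borel_measurable (F t \<Otimes>\<^sub>M borel \<Otimes>\<^sub>M borel)"
        using field tt unfolding progressive_field_iff by blast
      from measurable_compose[OF measurable_Pair[OF measurable_ident measurable_const[of "(t, x)" "borel \<Otimes>\<^sub>M borel"]] this]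
      have "(\<lambda>\<omega>. indicator {0..t} t * J t x \<omega>) \<in> borel_measurable (F t)" by (simp add: borel_prod)
      then show ?thesis using t by (intro measurable_F_M[OF tt]) simp
    qed
    have XJ: "(\<integral>\<^sup>+\<omega>. ennreal ((X k \<omega> - J t x \<omega>)\<^sup>2) \<partial>M) \<le> ennreal (4 * (1 / 4) ^ k)" for k
    proof -
      have "(\<integral>\<^sup>+\<omega>. ennreal ((X k \<omega> - J t x \<omega>)\<^sup>2) \<partial>M) = (\<integral>\<^sup>+\<omega>. ennreal ((lim (\<lambda>k. X k \<omega>) - X k \<omega>)\<^sup>2) \<partial>M)"
        by (rule nn_integral_cong_AE) (use JX in \<open>eventually_elim, simp add: power2_commute\<close>)
      then show ?thesis using L2_fast_convergence(2)[OF Xm _ fast, of k] by simp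
    qed
    have pow: "(\<lambda>k. C * (1 / 4) ^ k / e) \<longlonglongrightarrow> 0" for C e :: real
      using tendsto_divide[OF tendsto_mult[OF tendsto_const[of C] LIMSEQ_realpow_zero[of "1 / 4 :: real"]] tendsto_const[of e]]
      by (cases "e = 0") auto
    show ?thesis unfolding has_ito_integral_def
    proof (intro conjI exI allI)
      show "progressive t F ?H" by (rule prog)
      show "J t x \<in> borel_measurable M" by (rule Jm)
      have "AE \<omega> in M. energy t (\<lambda>s. ?H s \<omega>) \<noteq> \<infinity>"
        using fin[OF t, of x] by (intro nn_integral_PInf_AE sections_measurable_energy[OF Hm]) auto
      then show "AE \<omega> in M. set_integrable lborel {0..t} (\<lambda>s. (?H s \<omega>)\<^sup>2)"
        using AE_space
      proof eventually_elim
        case (elim \<omega>)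
        have "integrable lborel (\<lambda>s. (indicator {0..t} s * ?H s \<omega>)\<^sup>2)"
          using elim sections_measurable_section[OF Hm elim(2)] unfolding energy_eq
          by (intro integrableI_nonneg) (auto simp: less_top)
        then show ?case unfolding set_integrable_def
          by (rule Bochner_Integration.integrable_cong[THEN iffD1, rotated -1]) (auto simp: indicator_def)
      qed
      show "simple_integrand M F t (?n k) (?p k) (?v k)" for k by (rule si)
      show "tendsto_in_prob M (\<lambda>k \<omega>. LINT s:{0..t}|lborel. (simple_process (?n k) (?p k) (?v k) s \<omega> - ?H s \<omega>)\<^sup>2) (\<lambda>\<omega>. 0)"
        unfolding tendsto_in_prob_def
      proof (intro allI impI)
        fix e :: real assume e: "e > 0"
        show "(\<lambda>k. prob {\<omega>\<in>space M. \<bar>(LINT s:{0..t}|lborel. (simple_process (?n k) (?p k) (?v k) s \<omega> - ?H s \<omega>)\<^sup>2) - 0\<bar> > e}) \<longlonglongrightarrow> 0"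
        proof (rule tendsto_sandwich[OF _ _ tendsto_const pow[of 1 e]])
          have "prob {\<omega>\<in>space M. \<bar>(LINT s:{0..t}|lborel. (simple_process (?n k) (?p k) (?v k) s \<omega> - ?H s \<omega>)\<^sup>2) - 0\<bar> > e}
             \<le> 1 * (1 / 4) ^ k / e" for k
          proof -
            note em = sections_measurable_energy[OF sections_measurable_diff[OF ps[of "?s k"] Hm]]
            have "prob {\<omega>\<in>space M. \<bar>(LINT s:{0..t}|lborel. (simple_process (?n k) (?p k) (?v k) s \<omega> - ?H s \<omega>)\<^sup>2) - 0\<bar> > e}
              \<le> prob {\<omega>\<in>space M. energy t (\<lambda>s. ?S k s \<omega> - ?H s \<omega>) > ennreal e}"
            proof (rule finite_measure_mono, clarify)
              fix \<omega> assume w: "\<omega> \<in> space M" and g: "e < \<bar>(LINT s:{0..t}|lborel. (simple_process (?n k) (?p k) (?v k) s \<omega> - ?H s \<omega>)\<^sup>2) - 0\<bar>"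
              let ?f = "\<lambda>s. indicator {0..t} s *\<^sub>R (?S k s \<omega> - ?H s \<omega>)\<^sup>2"
              have g': "e < \<bar>integral\<^sup>L lborel ?f\<bar>" using g unfolding approx_process_def set_lebesgue_integral_def by simp
              \<comment> \<open>A nonzero Bochner integral certifies integrability, as the integral
                of a nonintegrable function is 0.\<close>
              have i: "integrable lborel ?f" using g' e not_integrable_integral_eq[of lborel ?f] by auto
              have "energy t (\<lambda>s. ?S k s \<omega> - ?H s \<omega>) = (\<integral>\<^sup>+s. ennreal (?f s) \<partial>lborel)"
                unfolding energy_def by (intro nn_integral_cong) (auto simp: indicator_def)
              also have "\<dots> = ennreal (integral\<^sup>L lborel ?f)" by (rule nn_integral_eq_integral[OF i]) auto
              finally show "energy t (\<lambda>s. ?S k s \<omega> - ?H s \<omega>) > ennreal e"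
                using g' e by (simp add: ennreal_less_iff)
            qed (use em in measurable)
            also have "\<dots> \<le> (1 / 4) ^ k / e" by (rule prob_Markov_ennreal[OF em r e]) simp
            finally show ?thesis by simp
          qed
          then show "\<forall>\<^sub>F k in sequentially. prob {\<omega>\<in>space M. \<bar>(LINT s:{0..t}|lborel. (simple_process (?n k) (?p k) (?v k) s \<omega> - ?H s \<omega>)\<^sup>2) - 0\<bar> > e}
             \<le> 1 * (1 / 4) ^ k / e" by simp
        qed simp
      qed
      show "tendsto_in_prob M (\<lambda>k. simple_ito B (?n k) (?p k) (?v k)) (J t x)"
        unfolding tendsto_in_prob_def X_def[symmetric]
      proof (intro allI impI)
        fix e :: real assume e: "e > 0"
        show "(\<lambda>k. prob {\<omega>\<in>space M. \<bar>X k \<omega> - J t x \<omega>\<bar> > e}) \<longlonglongrightarrow> 0"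
        proof (rule tendsto_sandwich[OF _ _ tendsto_const pow[of 4 "e\<^sup>2"]])
          have "prob {\<omega>\<in>space M. \<bar>X k \<omega> - J t x \<omega>\<bar> > e} \<le> 4 * (1 / 4) ^ k / e\<^sup>2" for k
          proof -
            have "e < \<bar>y\<bar> \<longleftrightarrow> ennreal (e\<^sup>2) < ennreal (y\<^sup>2)" for y
              using e abs_le_square_iff[of y e] by (auto simp: ennreal_less_iff not_le[symmetric])
            then have "prob {\<omega>\<in>space M. \<bar>X k \<omega> - J t x \<omega>\<bar> > e} = prob {\<omega>\<in>space M. ennreal ((X k \<omega> - J t x \<omega>)\<^sup>2) > ennreal (e\<^sup>2)}" by simp
            also have "\<dots> \<le> 4 * (1 / 4) ^ k / e\<^sup>2"
              by (rule prob_Markov_ennreal[OF _ XJ]) (use e in \<open>simp_all\<close>)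
            finally show ?thesis .
          qed
          then show "\<forall>\<^sub>F k in sequentially. prob {\<omega>\<in>space M. \<bar>X k \<omega> - J t x \<omega>\<bar> > e} \<le> 4 * (1 / 4) ^ k / e\<^sup>2" by simp
        qed simp
      qed
    qed
  qed
  show ?thesis using that field ito by blast
qed

end

section \<open>Bounds for the heat kernel\<close>

locale diffusion_kernel =
  fixes a1 a2 \<rho>1 \<rho>2 :: real
  assumes pos: "a1 > 0" "a2 > 0" "\<rho>1 > 0" "\<rho>2 > 0"
begin

abbreviation "h \<equiv> h_fun a1 a2"
abbreviation "lam0 \<equiv> \<bar>lam a1 a2 \<rho>1 \<rho>2\<bar>"
abbreviation "K \<equiv> G a1 a2 \<rho>1 \<rho>2"

text \<open>Derivative of \<open>h\<close> away from the origin, that is, the Jacobian of the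
  coordinate in which the kernel is a Gaussian.\<close>

definition \<nu> :: "real \<Rightarrow> real" where
  "\<nu> z = indicator {..0} z / sqrt a1 + indicator {0<..} z / sqrt a2"

text \<open>The kernel without its reflected part: the Brownian transition density in the coordinate
  \<open>h\<close>.\<close>

definition gauss :: "real \<Rightarrow> real \<Rightarrow> real \<Rightarrow> real" where
  "gauss t x z = indicator {0<..} t / sqrt (2 * pi * t) * \<nu> z * exp (- ((h x - h z)\<^sup>2 / (2 * t)))"

lemma \<nu>_pos: "\<nu> z > 0"
  using pos by (auto simp: \<nu>_def indicator_def)

lemma \<nu>_measurable[measurable]: "\<nu> \<in> borel_measurable borel"
  unfolding \<nu>_def[abs_def] by measurable

lemma h_measurable[measurable]: "h \<in> borel_measurable borel"
  unfolding h_fun_def[abs_def] by measurable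

lemma abs_lam_less: "lam0 < 1"
proof -
  have p: "\<rho>1 * sqrt a1 > 0" "\<rho>2 * sqrt a2 > 0" using pos by auto
  then have "\<bar>\<rho>2 * sqrt a2 - \<rho>1 * sqrt a1\<bar> < \<rho>2 * sqrt a2 + \<rho>1 * sqrt a1" by linarith
  then show ?thesis using p unfolding lam_def by (simp add: abs_divide)
qed

lemma K_eq: "K t x z = gauss t x z + lam a1 a2 \<rho>1 \<rho>2 * lsign z * (indicator {0<..} t / sqrt (2 * pi * t) * \<nu> z
          * exp (- ((\<bar>h x\<bar> + \<bar>h z\<bar>)\<^sup>2 / (2 * t))))"
  unfolding G_def gauss_def \<nu>_def by (simp add: algebra_simps)

lemma gauss_nonneg: "gauss t x z \<ge> 0"
  unfolding gauss_def using \<nu>_pos[of z] by (auto simp: indicator_def intro!: mult_nonneg_nonneg)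

lemma reflected_le_gauss:
  "indicator {0<..} t / sqrt (2 * pi * t) * \<nu> z * exp (- ((\<bar>h x\<bar> + \<bar>h z\<bar>)\<^sup>2 / (2 * t))) \<le> gauss t x z"
proof (cases "t > 0")
  case True
  have "(h x - h z)\<^sup>2 \<le> (\<bar>h x\<bar> + \<bar>h z\<bar>)\<^sup>2"
    by (rule abs_le_square_iff[THEN iffD1]) linarith
  then have "exp (- ((\<bar>h x\<bar> + \<bar>h z\<bar>)\<^sup>2 / (2 * t))) \<le> exp (- ((h x - h z)\<^sup>2 / (2 * t)))"
    using True by (simp add: divide_right_mono)
  then show ?thesis unfolding gauss_def using True \<nu>_pos[of z] by (intro mult_left_mono) auto
qed (simp add: gauss_def)

text \<open>The reflected exponential never exceeds the direct one, so reflection changes the kernel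
  by a factor between \<open>1 - lam0\<close> and \<open>1 + lam0\<close>. The lower bound, a
  positive multiple of the Gaussian since \<open>lam0 < 1\<close>, is what later converts Gaussians
  back into kernels.\<close>

lemma K_bounds: "(1 - lam0) * gauss t x z \<le> K t x z" "K t x z \<le> 2 * gauss t x z"
proof -
  define e where "e = indicator {0<..} t / sqrt (2 * pi * t) * \<nu> z * exp (- ((\<bar>h x\<bar> + \<bar>h z\<bar>)\<^sup>2 / (2 * t)))"
  have e: "0 \<le> e" "e \<le> gauss t x z"
    using reflected_le_gauss[of t z x] \<nu>_pos[of z] unfolding e_def by (auto simp: indicator_def intro!: mult_nonneg_nonneg)
  have l: "\<bar>lam a1 a2 \<rho>1 \<rho>2 * lsign z\<bar> = lam0" by (auto simp: lsign_def abs_mult)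
  have "\<bar>lam a1 a2 \<rho>1 \<rho>2 * lsign z * e\<bar> = lam0 * e" using e(1) l by (simp add: abs_mult)
  also have "\<dots> \<le> lam0 * gauss t x z" using e by (intro mult_left_mono) auto
  finally have b: "\<bar>lam a1 a2 \<rho>1 \<rho>2 * lsign z * e\<bar> \<le> lam0 * gauss t x z" .
  have "lam0 * gauss t x z \<le> 1 * gauss t x z" using abs_lam_less gauss_nonneg by (intro mult_right_mono) auto
  then show "(1 - lam0) * gauss t x z \<le> K t x z" "K t x z \<le> 2 * gauss t x z"
    using b unfolding K_eq e_def[symmetric] by (simp_all add: left_diff_distrib)
qed

lemma K_nonneg: "K t x z \<ge> 0"
proof -
  have "0 \<le> (1 - lam0) * gauss t x z" using abs_lam_less gauss_nonneg by simp
  then show ?thesis using K_bounds(1) by (rule order_trans)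
qed

lemma K_zero: "t \<le> 0 \<Longrightarrow> K t x z = 0"
  by (simp add: G_def)

lemma K_measurable:
  "(\<lambda>y. K (fst y) (fst (snd y)) (snd (snd y))) \<in> borel_measurable (borel \<Otimes>\<^sub>M borel \<Otimes>\<^sub>M borel)"
proof -
  have [measurable]: "lsign \<in> borel_measurable borel" unfolding lsign_def[abs_def] by measurable
  show ?thesis unfolding G_def by measurable
qed

lemma K_measurable'[measurable (raw)]:
  assumes [measurable]: "f \<in> borel_measurable N" "g \<in> borel_measurable N" "k \<in> borel_measurable N"
  shows "(\<lambda>y. K (f y) (g y) (k y)) \<in> borel_measurable N"
proof -
  have "(\<lambda>y. (f y, g y, k y)) \<in> measurable N (borel \<Otimes>\<^sub>M borel \<Otimes>\<^sub>M borel)" by measurable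
  from measurable_compose[OF this K_measurable] show ?thesis by simp
qed

text \<open>Change of variables \<open>y = h z\<close>, done on the two half-lines, each of which
  \<open>h\<close> scales linearly onto itself.\<close>

lemma nn_integral_h:
  assumes f[measurable]: "f \<in> borel_measurable borel"
  shows "(\<integral>\<^sup>+z. f (h z) * ennreal (\<nu> z) \<partial>lborel) = (\<integral>\<^sup>+y. f y \<partial>lborel)"
proof -
  have split: "f y = f y * indicator {..0} y + f y * indicator {0<..} y" for y :: real
    by (auto simp: indicator_def)
  have side: "(\<integral>\<^sup>+y. f y * indicator S y \<partial>lborel) = (\<integral>\<^sup>+z. f (z / sqrt a) * ennreal (1 / sqrt a) * indicator S z \<partial>lborel)"
    if a: "a > 0" and S: "S = {..0} \<or> S = {0<..}" for a :: real and S :: "real set"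
  proof -
    have [measurable]: "S \<in> sets borel" using S by auto
    have mem: "z / sqrt a \<in> S \<longleftrightarrow> z \<in> S" for z
      using S a by (auto simp: divide_le_0_iff zero_less_divide_iff)
    have "(\<integral>\<^sup>+y. f y * indicator S y \<partial>lborel) = ennreal \<bar>1 / sqrt a\<bar> * (\<integral>\<^sup>+z. f (0 + 1 / sqrt a * z) * indicator S (0 + 1 / sqrt a * z) \<partial>lborel)"
      using a by (intro nn_integral_real_affine[of "\<lambda>y. f y * indicator S y"]) auto
    also have "\<dots> = (\<integral>\<^sup>+z. ennreal \<bar>1 / sqrt a\<bar> * (f (0 + 1 / sqrt a * z) * indicator S (0 + 1 / sqrt a * z)) \<partial>lborel)"
      by (rule nn_integral_cmult[symmetric]) measurable
    also have "\<dots> = (\<integral>\<^sup>+z. f (z / sqrt a) * ennreal (1 / sqrt a) * indicator S z \<partial>lborel)"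
      using a mem by (intro nn_integral_cong) (auto simp: indicator_def mult_ac)
    finally show ?thesis .
  qed
  have "(\<integral>\<^sup>+y. f y \<partial>lborel) = (\<integral>\<^sup>+y. f y * indicator {..0} y \<partial>lborel) + (\<integral>\<^sup>+y. f y * indicator {0<..} y \<partial>lborel)"
    by (subst nn_integral_add[symmetric]) (auto intro!: nn_integral_cong simp: split[symmetric])
  also have "\<dots> = (\<integral>\<^sup>+z. f (z / sqrt a1) * ennreal (1 / sqrt a1) * indicator {..0} z \<partial>lborel)
      + (\<integral>\<^sup>+z. f (z / sqrt a2) * ennreal (1 / sqrt a2) * indicator {0<..} z \<partial>lborel)"
    using side[OF pos(1), of "{..0}"] side[OF pos(2), of "{0<..}"] by simp
  also have "\<dots> = (\<integral>\<^sup>+z. f (h z) * ennreal (\<nu> z) \<partial>lborel)"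
    by (subst nn_integral_add[symmetric]) (auto intro!: nn_integral_cong simp: \<nu>_def h_fun_def indicator_def)
  finally show ?thesis by simp
qed

text \<open>A bound for the reciprocal of \<nu>, whose values are \<open>sqrt a1\<close> and
  \<open>sqrt a2\<close>.\<close>

definition dmax :: real where "dmax = sqrt a1 + sqrt a2"

lemma dmax_pos: "dmax > 0" unfolding dmax_def using pos by (simp add: add_pos_pos)

lemma one_le_dmax_\<nu>: "1 \<le> dmax * \<nu> z"
  unfolding dmax_def \<nu>_def using pos by (auto simp: indicator_def field_simps)

lemma nn_integral_h_le:
  assumes f[measurable]: "f \<in> borel_measurable borel"
  shows "(\<integral>\<^sup>+z. f (h z) \<partial>lborel) \<le> ennreal dmax * (\<integral>\<^sup>+y. f y \<partial>lborel)"
proof -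
  have "(\<integral>\<^sup>+z. f (h z) \<partial>lborel) \<le> (\<integral>\<^sup>+z. ennreal dmax * (f (h z) * ennreal (\<nu> z)) \<partial>lborel)"
  proof (intro nn_integral_mono)
    fix z
    have "f (h z) = f (h z) * ennreal 1" by simp
    also have "\<dots> \<le> f (h z) * ennreal (dmax * \<nu> z)" using one_le_dmax_\<nu> by (intro mult_left_mono ennreal_leI) auto
    also have "\<dots> = ennreal dmax * (f (h z) * ennreal (\<nu> z))"
      using dmax_pos \<nu>_pos[of z] by (simp add: ennreal_mult mult_ac)
    finally show "f (h z) \<le> ennreal dmax * (f (h z) * ennreal (\<nu> z))" .
  qed
  also have "\<dots> = ennreal dmax * (\<integral>\<^sup>+y. f y \<partial>lborel)"
    by (subst nn_integral_cmult) (simp_all add: nn_integral_h)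
  finally show ?thesis .
qed

lemma gauss_normal: "t > 0 \<Longrightarrow> gauss t x z = normal_density (h x) (sqrt t) (h z) * \<nu> z"
  unfolding gauss_def normal_density_def by (simp add: power2_commute)

lemma nn_integral_gauss:
  assumes "t > 0" and f[measurable]: "f \<in> borel_measurable borel"
  shows "(\<integral>\<^sup>+z. ennreal (gauss t x z) * f (h z) \<partial>lborel) = (\<integral>\<^sup>+y. ennreal (normal_density (h x) (sqrt t) y) * f y \<partial>lborel)"
proof -
  have "(\<integral>\<^sup>+z. ennreal (gauss t x z) * f (h z) \<partial>lborel)
      = (\<integral>\<^sup>+z. (\<lambda>y. ennreal (normal_density (h x) (sqrt t) y) * f y) (h z) * ennreal (\<nu> z) \<partial>lborel)"
    using \<nu>_pos by (intro nn_integral_cong) (simp add: gauss_normal[OF assms(1)] ennreal_mult less_imp_le mult_ac)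
  also have "\<dots> = (\<integral>\<^sup>+y. ennreal (normal_density (h x) (sqrt t) y) * f y \<partial>lborel)"
    by (rule nn_integral_h) measurable
  finally show ?thesis .
qed

lemma nn_integral_K_le: "(\<integral>\<^sup>+z. ennreal (K t x z) \<partial>lborel) \<le> 2"
proof (cases "t > 0")
  case True
  have "(\<integral>\<^sup>+z. ennreal (K t x z) \<partial>lborel) \<le> (\<integral>\<^sup>+z. 2 * (ennreal (gauss t x z) * 1) \<partial>lborel)"
    using K_bounds(2) by (intro nn_integral_mono) (simp add: ennreal_leI ennreal_mult''[symmetric] gauss_nonneg flip: ennreal_numeral)
  also have "\<dots> = 2 * (\<integral>\<^sup>+z. ennreal (gauss t x z) * 1 \<partial>lborel)"
    by (rule nn_integral_cmult) (unfold gauss_def, measurable)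
  also have "(\<integral>\<^sup>+z. ennreal (gauss t x z) * 1 \<partial>lborel) = (\<integral>\<^sup>+y. ennreal (normal_density (h x) (sqrt t) y) * 1 \<partial>lborel)"
    by (rule nn_integral_gauss[OF True]) simp
  also have "\<dots> = 1"
    using True by (simp add: nn_integral_eq_integral)
  finally show ?thesis by simp
qed (simp add: K_zero)

end

section \<open>Existence by Picard iteration\<close>

text \<open>The kernel is split as \<open>sqrt k * sqrt k\<close>, so one factor carries only the
  total mass.\<close>

lemma weighted_Cauchy_Schwarz:
  fixes k g :: "'b \<Rightarrow> real"
  assumes [measurable]: "k \<in> borel_measurable N" "g \<in> borel_measurable N" and k: "\<And>z. k z \<ge> 0"
  shows "(\<integral>\<^sup>+z. ennreal \<bar>k z * g z\<bar> \<partial>N)\<^sup>2 \<le> (\<integral>\<^sup>+z. ennreal (k z) \<partial>N) * (\<integral>\<^sup>+z. ennreal (k z) * ennreal ((g z)\<^sup>2) \<partial>N)"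
proof -
  have "(\<integral>\<^sup>+z. ennreal \<bar>k z * g z\<bar> \<partial>N) = (\<integral>\<^sup>+z. ennreal (sqrt (k z)) * ennreal (sqrt (k z) * \<bar>g z\<bar>) \<partial>N)"
    using k by (intro nn_integral_cong) (simp add: ennreal_mult[symmetric] abs_mult mult.assoc[symmetric])
  also have "(\<dots>)\<^sup>2 \<le> (\<integral>\<^sup>+z. (ennreal (sqrt (k z)))\<^sup>2 \<partial>N) * (\<integral>\<^sup>+z. (ennreal (sqrt (k z) * \<bar>g z\<bar>))\<^sup>2 \<partial>N)"
    by (rule Cauchy_Schwarz_nn_integral) measurable
  also have "\<dots> = (\<integral>\<^sup>+z. ennreal (k z) \<partial>N) * (\<integral>\<^sup>+z. ennreal (k z) * ennreal ((g z)\<^sup>2) \<partial>N)"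
    using k by (intro arg_cong2[where f = "(*)"] nn_integral_cong)
      (simp_all add: ennreal_power ennreal_mult[symmetric] power_mult_distrib)
  finally show ?thesis .
qed

section \<open>Convolution of coefficients with the kernel\<close>

locale spde = brownian_setup M T F B + diffusion_kernel a1 a2 \<rho>1 \<rho>2
  for M :: "'a measure" and T :: real and F :: "real \<Rightarrow> 'a measure" and B :: "real \<Rightarrow> 'a \<Rightarrow> real"
    and a1 a2 \<rho>1 \<rho>2 :: real +
  fixes b \<sigma> :: "'a \<Rightarrow> real \<Rightarrow> real \<Rightarrow> real \<Rightarrow> real" and \<xi> :: "real \<Rightarrow> real" and L :: real
  assumes coeff_progressive: "progressive_coefficient T F b" "progressive_coefficient T F \<sigma>"
    and L_pos: "L > 0"
    and lipschitz: "\<And>\<omega> t x y y'. \<lbrakk>\<omega> \<in> space M; t \<in> {0..T}\<rbrakk> \<Longrightarrow>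
           max \<bar>b \<omega> t x y - b \<omega> t x y'\<bar> \<bar>\<sigma> \<omega> t x y - \<sigma> \<omega> t x y'\<bar> \<le> L * \<bar>y - y'\<bar>"
    and growth: "\<And>\<omega> t x y. \<lbrakk>\<omega> \<in> space M; t \<in> {0..T}\<rbrakk> \<Longrightarrow>
           max \<bar>b \<omega> t x y\<bar> \<bar>\<sigma> \<omega> t x y\<bar> \<le> L * (1 + \<bar>y\<bar>)"
    and \<xi>_measurable[measurable]: "\<xi> \<in> borel_measurable borel" and \<xi>_bounded: "bounded (range \<xi>)"
begin

text \<open>Bundles what \<open>b\<close> and \<sigma> have in common, so that each estimate is
  proved once for both.\<close>

definition admissible :: "('a \<Rightarrow> real \<Rightarrow> real \<Rightarrow> real \<Rightarrow> real) \<Rightarrow> bool" where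
  "admissible f \<longleftrightarrow> progressive_coefficient T F f \<and>
    (\<forall>\<omega>\<in>space M. \<forall>t\<in>{0..T}. \<forall>x y y'. \<bar>f \<omega> t x y - f \<omega> t x y'\<bar> \<le> L * \<bar>y - y'\<bar>) \<and>
    (\<forall>\<omega>\<in>space M. \<forall>t\<in>{0..T}. \<forall>x y. \<bar>f \<omega> t x y\<bar> \<le> L * (1 + \<bar>y\<bar>))"

lemma admissible_b: "admissible b" and admissible_\<sigma>: "admissible \<sigma>"
  using coeff_progressive lipschitz growth unfolding admissible_def by auto

definition conv :: "('a \<Rightarrow> real \<Rightarrow> real \<Rightarrow> real \<Rightarrow> real) \<Rightarrow> (real \<Rightarrow> real \<Rightarrow> 'a \<Rightarrow> real) \<Rightarrow> real \<Rightarrow> real \<Rightarrow> real \<Rightarrow> 'a \<Rightarrow> real" where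
  "conv f Y t x s \<omega> = (LINT z|lborel. K (t - s) x z * f \<omega> s z (Y s z \<omega>))"

text \<open>Absolute, extended-valued counterpart of \<open>conv\<close>. It takes the field with
  the solution already inserted, so that differences of coefficients along two fields fit as
  well.\<close>

definition nconv :: "('a \<Rightarrow> real \<Rightarrow> real \<Rightarrow> real) \<Rightarrow> real \<Rightarrow> real \<Rightarrow> real \<Rightarrow> 'a \<Rightarrow> ennreal" where
  "nconv g t x s \<omega> = (\<integral>\<^sup>+z. ennreal \<bar>K (t - s) x z * g \<omega> s z\<bar> \<partial>lborel)"

definition random_field :: "('a \<Rightarrow> real \<Rightarrow> real \<Rightarrow> real) \<Rightarrow> bool" where
  "random_field g \<longleftrightarrow> (\<lambda>w. indicator {0..T} (fst (snd w)) * g (fst w) (fst (snd w)) (snd (snd w))) \<in> borel_measurable (M \<Otimes>\<^sub>M borel \<Otimes>\<^sub>M borel)"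

lemma field_measurable:
  assumes "progressive_field T F Y" "u \<in> {0..T}"
  shows "(\<lambda>w. indicator {0..u} (fst (snd w)) * Y (fst (snd w)) (snd (snd w)) (fst w)) \<in> borel_measurable (F u \<Otimes>\<^sub>M borel \<Otimes>\<^sub>M borel)"
  using assms unfolding progressive_field_iff by (simp add: case_prod_beta')

lemma coefficient_field_measurable:
  assumes f: "admissible f" and Y: "progressive_field T F Y" and u: "u \<in> {0..T}"
  shows "(\<lambda>w. indicator {0..u} (fst (snd w)) * f (fst w) (fst (snd w)) (snd (snd w)) (Y (fst (snd w)) (snd (snd w)) (fst w)))
    \<in> borel_measurable (F u \<Otimes>\<^sub>M borel \<Otimes>\<^sub>M borel)"
proof -
  let ?P = "F u \<Otimes>\<^sub>M (borel :: real measure) \<Otimes>\<^sub>M (borel :: real measure)"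
  have fm: "(\<lambda>(\<omega>, s, x, y). f \<omega> s x y) \<in> borel_measurable (F u \<Otimes>\<^sub>M restrict_space borel {0..u} \<Otimes>\<^sub>M borel \<Otimes>\<^sub>M borel)"
    using f u unfolding admissible_def progressive_coefficient_def by blast
  have "(\<lambda>w. max 0 (min u (fst (snd w)))) \<in> measurable ?P (restrict_space borel {0..u})"
    using u by (intro measurable_restrict_space2) auto
  moreover have "(\<lambda>w. fst w) \<in> measurable ?P (F u)" "(\<lambda>w. snd (snd w)) \<in> borel_measurable ?P" by measurable
  ultimately have "(\<lambda>w. (fst w, max 0 (min u (fst (snd w))), snd (snd w), indicator {0..u} (fst (snd w)) * Y (fst (snd w)) (snd (snd w)) (fst w)))
     \<in> measurable ?P (F u \<Otimes>\<^sub>M restrict_space borel {0..u} \<Otimes>\<^sub>M borel \<Otimes>\<^sub>M borel)"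
    by (intro measurable_Pair field_measurable[OF Y u])
  from measurable_compose[OF this fm]
  have m: "(\<lambda>w. f (fst w) (max 0 (min u (fst (snd w)))) (snd (snd w)) (indicator {0..u} (fst (snd w)) * Y (fst (snd w)) (snd (snd w)) (fst w)))
    \<in> borel_measurable ?P" by simp
  have ind: "(\<lambda>w. indicator {0..u} (fst (snd w)) :: real) \<in> borel_measurable ?P" by measurable
  from borel_measurable_times[OF ind m] show ?thesis
    by (rule measurable_cong[THEN iffD1, rotated]) (auto simp: indicator_def)
qed

lemma random_field_F:
  assumes "(\<lambda>w. indicator {0..T} (fst (snd w)) * g (fst w) (fst (snd w)) (snd (snd w))) \<in> borel_measurable (F T \<Otimes>\<^sub>M borel \<Otimes>\<^sub>M borel)"
  shows "random_field g"
proof -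
  have TT: "T \<in> {0..T}" using T_pos by simp
  have idm: "(\<lambda>x. x) \<in> measurable M (F T)" by (rule measurable_F_M[OF TT]) simp
  have "(\<lambda>w. (fst w, fst (snd w), snd (snd w))) \<in> measurable (M \<Otimes>\<^sub>M borel \<Otimes>\<^sub>M borel) (F T \<Otimes>\<^sub>M (borel :: real measure) \<Otimes>\<^sub>M (borel :: real measure))"
    by (intro measurable_Pair measurable_compose[OF measurable_fst idm]) auto
  from measurable_compose[OF this assms] show ?thesis unfolding random_field_def by simp
qed

lemma random_field_progressive: "progressive_field T F Y \<Longrightarrow> random_field (\<lambda>\<omega> s z. Y s z \<omega>)"
  using field_measurable[of Y T] T_pos by (intro random_field_F) auto

lemma random_field_coefficient: "admissible f \<Longrightarrow> progressive_field T F Y \<Longrightarrow> random_field (\<lambda>\<omega> s z. f \<omega> s z (Y s z \<omega>))"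
  using coefficient_field_measurable[of f Y T] T_pos by (intro random_field_F) auto

lemma random_field_diff: "random_field g \<Longrightarrow> random_field k \<Longrightarrow> random_field (\<lambda>\<omega> s z. g \<omega> s z - k \<omega> s z)"
  unfolding random_field_def right_diff_distrib by (rule borel_measurable_diff)

lemma random_field_section:
  assumes "random_field g" "\<omega> \<in> space M" "s \<in> {0..T}"
  shows "g \<omega> s \<in> borel_measurable borel"
proof -
  have "(\<lambda>z. (\<omega>, s, z)) \<in> measurable borel (M \<Otimes>\<^sub>M borel \<Otimes>\<^sub>M borel)" using assms(2) by measurable
  from measurable_compose[OF this assms(1)[unfolded random_field_def]] show ?thesis using assms(3) by simp
qed

lemma random_field_section2:
  assumes "random_field g" "s \<in> {0..T}"
  shows "(\<lambda>(\<omega>, z). g \<omega> s z) \<in> borel_measurable (M \<Otimes>\<^sub>M borel)"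
proof -
  have "(\<lambda>w. (fst w, s, snd w)) \<in> measurable (M \<Otimes>\<^sub>M (borel :: real measure)) (M \<Otimes>\<^sub>M borel \<Otimes>\<^sub>M borel)" by measurable
  from measurable_compose[OF this assms(1)[unfolded random_field_def]] show ?thesis using assms(2) by (simp add: case_prod_beta')
qed

lemma conv_family:
  assumes f: "admissible f" and Y: "progressive_field T F Y"
  shows "progressive_family (conv f Y)"
  unfolding progressive_family_def
proof
  fix u assume u: "u \<in> {0..T}"
  let ?P = "F u \<Otimes>\<^sub>M (borel :: real measure) \<Otimes>\<^sub>M (borel :: real measure) \<Otimes>\<^sub>M (borel :: real measure)"
  have "(\<lambda>w. (fst (fst w), snd (snd (snd (fst w))), snd w)) \<in> measurable (?P \<Otimes>\<^sub>M lborel) (F u \<Otimes>\<^sub>M borel \<Otimes>\<^sub>M (borel :: real measure))" by measurable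
  from measurable_compose[OF this coefficient_field_measurable[OF f Y u]]
  have m: "(\<lambda>w. indicator {0..u} (snd (snd (snd (fst w)))) * f (fst (fst w)) (snd (snd (snd (fst w)))) (snd w) (Y (snd (snd (snd (fst w)))) (snd w) (fst (fst w))))
    \<in> borel_measurable (?P \<Otimes>\<^sub>M lborel)" by simp
  have k: "(\<lambda>w. K (fst (snd (fst w)) - snd (snd (snd (fst w)))) (fst (snd (snd (fst w)))) (snd w)) \<in> borel_measurable (?P \<Otimes>\<^sub>M lborel)"
    by measurable
  from borel_measurable_times[OF k m]
  have "(\<lambda>(y, z). K (fst (snd y) - snd (snd (snd y))) (fst (snd (snd y))) z * (indicator {0..u} (snd (snd (snd y))) * f (fst y) (snd (snd (snd y))) z (Y (snd (snd (snd y))) z (fst y))))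
    \<in> borel_measurable (?P \<Otimes>\<^sub>M lborel)" by (simp add: case_prod_beta')
  from lborel.borel_measurable_lebesgue_integral[OF this]
  show "(\<lambda>(\<omega>, t, x, s). indicator {0..u} s * conv f Y t x s \<omega>) \<in> borel_measurable ?P"
    unfolding conv_def by (rule measurable_cong[THEN iffD1, rotated]) (auto simp: indicator_def)
qed

lemma nconv_measurable_wrt:
  assumes "(\<lambda>w. indicator {0..u} (fst (snd w)) * g (fst w) (fst (snd w)) (snd (snd w))) \<in> borel_measurable (N \<Otimes>\<^sub>M borel \<Otimes>\<^sub>M borel)"
  shows "(\<lambda>(\<omega>, s). nconv g t x s \<omega> * indicator {0..u} s) \<in> borel_measurable (N \<Otimes>\<^sub>M lborel)"
proof -
  let ?P = "N \<Otimes>\<^sub>M (lborel :: real measure)"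
  have "(\<lambda>w. (fst (fst w), snd (fst w), snd w)) \<in> measurable (?P \<Otimes>\<^sub>M lborel) (N \<Otimes>\<^sub>M borel \<Otimes>\<^sub>M (borel :: real measure))" by measurable
  from measurable_compose[OF this assms]
  have m: "(\<lambda>w. indicator {0..u} (snd (fst w)) * g (fst (fst w)) (snd (fst w)) (snd w)) \<in> borel_measurable (?P \<Otimes>\<^sub>M lborel)" by simp
  have k: "(\<lambda>w. K (t - snd (fst w)) x (snd w)) \<in> borel_measurable (?P \<Otimes>\<^sub>M lborel)" by measurable
  have "(\<lambda>w. ennreal \<bar>K (t - snd (fst w)) x (snd w) * (indicator {0..u} (snd (fst w)) * g (fst (fst w)) (snd (fst w)) (snd w))\<bar>) \<in> borel_measurable (?P \<Otimes>\<^sub>M lborel)"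
    by (intro measurable_compose[OF _ measurable_ennreal] borel_measurable_abs borel_measurable_times k m)
  from lborel.borel_measurable_nn_integral_fst[OF this]
  show ?thesis unfolding nconv_def by (rule measurable_cong[THEN iffD1, rotated]) (auto simp: indicator_def)
qed

lemma nconv_measurable:
  assumes "random_field g"
  shows "(\<lambda>(\<omega>, s). nconv g t x s \<omega> * indicator {0..T} s) \<in> borel_measurable (M \<Otimes>\<^sub>M lborel)"
  by (rule nconv_measurable_wrt[OF assms[unfolded random_field_def]])

lemma nconv_square_le:
  assumes g: "random_field g" and w: "\<omega> \<in> space M" "s \<in> {0..T}"
  shows "(nconv g t x s \<omega>)\<^sup>2 \<le> 2 * (\<integral>\<^sup>+z. ennreal (K (t - s) x z) * ennreal ((g \<omega> s z)\<^sup>2) \<partial>lborel)"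
proof -
  note [measurable] = random_field_section[OF g w]
  have "(nconv g t x s \<omega>)\<^sup>2 \<le> (\<integral>\<^sup>+z. ennreal (K (t - s) x z) \<partial>lborel) * (\<integral>\<^sup>+z. ennreal (K (t - s) x z) * ennreal ((g \<omega> s z)\<^sup>2) \<partial>lborel)"
    unfolding nconv_def by (rule weighted_Cauchy_Schwarz) (measurable, simp_all add: K_nonneg)
  also have "\<dots> \<le> 2 * (\<integral>\<^sup>+z. ennreal (K (t - s) x z) * ennreal ((g \<omega> s z)\<^sup>2) \<partial>lborel)"
    by (intro mult_right_mono nn_integral_K_le) simp
  finally show ?thesis .
qed

text \<open>The constant is 2 * 2: the total mass bound of the kernel enters once through
  Cauchy-Schwarz and once when the uniform bound \<open>c\<close> is integrated.\<close>

lemma nconv_second_moment: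
  assumes g: "random_field g" and s: "s \<in> {0..T}" and bnd: "\<And>z. (\<integral>\<^sup>+\<omega>. ennreal ((g \<omega> s z)\<^sup>2) \<partial>M) \<le> c"
  shows "(\<integral>\<^sup>+\<omega>. (nconv g t x s \<omega>)\<^sup>2 \<partial>M) \<le> 4 * c"
proof -
  interpret pair_sigma_finite M lborel ..
  have gm: "(\<lambda>w. g (fst w) s (snd w)) \<in> borel_measurable (M \<Otimes>\<^sub>M lborel)"
    using random_field_section2[OF g s] by (simp add: case_prod_beta' cong: measurable_cong_sets sets_pair_measure_cong)
  have km: "(\<lambda>w. K (t - s) x (snd w)) \<in> borel_measurable (M \<Otimes>\<^sub>M lborel)" by measurable
  have m: "(\<lambda>w. ennreal (K (t - s) x (snd w)) * ennreal ((g (fst w) s (snd w))\<^sup>2)) \<in> borel_measurable (M \<Otimes>\<^sub>M lborel)"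
    by (intro borel_measurable_times_ennreal measurable_compose[OF _ measurable_ennreal] borel_measurable_power km gm)
  have gm1: "(\<lambda>\<omega>. ennreal ((g \<omega> s z)\<^sup>2)) \<in> borel_measurable M" for z
    using measurable_compose[OF measurable_Pair[OF measurable_ident measurable_const[of z lborel]] gm] by simp
  have "(\<integral>\<^sup>+\<omega>. (nconv g t x s \<omega>)\<^sup>2 \<partial>M) \<le> (\<integral>\<^sup>+\<omega>. 2 * (\<integral>\<^sup>+z. ennreal (K (t - s) x z) * ennreal ((g \<omega> s z)\<^sup>2) \<partial>lborel) \<partial>M)"
    by (intro nn_integral_mono nconv_square_le g s)
  also have "\<dots> = 2 * (\<integral>\<^sup>+\<omega>. (\<integral>\<^sup>+z. ennreal (K (t - s) x z) * ennreal ((g \<omega> s z)\<^sup>2) \<partial>lborel) \<partial>M)"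
    using lborel.borel_measurable_nn_integral_fst[OF m] by (intro nn_integral_cmult) simp
  finally have first: "(\<integral>\<^sup>+\<omega>. (nconv g t x s \<omega>)\<^sup>2 \<partial>M) \<le> 2 * (\<integral>\<^sup>+\<omega>. (\<integral>\<^sup>+z. ennreal (K (t - s) x z) * ennreal ((g \<omega> s z)\<^sup>2) \<partial>lborel) \<partial>M)" .
  have "(\<integral>\<^sup>+\<omega>. (\<integral>\<^sup>+z. ennreal (K (t - s) x z) * ennreal ((g \<omega> s z)\<^sup>2) \<partial>lborel) \<partial>M)
     = (\<integral>\<^sup>+z. (\<integral>\<^sup>+\<omega>. ennreal (K (t - s) x z) * ennreal ((g \<omega> s z)\<^sup>2) \<partial>M) \<partial>lborel)"
    by (rule Fubini'[symmetric]) (use m in \<open>simp add: case_prod_beta'\<close>)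
  also have "\<dots> = (\<integral>\<^sup>+z. ennreal (K (t - s) x z) * (\<integral>\<^sup>+\<omega>. ennreal ((g \<omega> s z)\<^sup>2) \<partial>M) \<partial>lborel)"
    by (intro nn_integral_cong nn_integral_cmult gm1)
  also have "\<dots> \<le> (\<integral>\<^sup>+z. ennreal (K (t - s) x z) * c \<partial>lborel)"
    by (intro nn_integral_mono mult_left_mono bnd) simp
  also have "\<dots> = (\<integral>\<^sup>+z. ennreal (K (t - s) x z) \<partial>lborel) * c" by (rule nn_integral_multc) measurable
  also have "\<dots> \<le> 2 * c" by (intro mult_right_mono nn_integral_K_le) auto
  finally have "2 * (\<integral>\<^sup>+\<omega>. (\<integral>\<^sup>+z. ennreal (K (t - s) x z) * ennreal ((g \<omega> s z)\<^sup>2) \<partial>lborel) \<partial>M) \<le> 2 * (2 * c)"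
    by (rule mult_left_mono) simp
  from order_trans[OF first this] show ?thesis by (simp add: mult.assoc[symmetric])
qed

lemma nconv_time_second_moment:
  assumes g: "random_field g" and t: "t \<le> T" and [measurable]: "\<phi> \<in> borel_measurable borel"
    and bnd: "\<And>s z. s \<in> {0..T} \<Longrightarrow> (\<integral>\<^sup>+\<omega>. ennreal ((g \<omega> s z)\<^sup>2) \<partial>M) \<le> \<phi> s"
  shows "(\<integral>\<^sup>+\<omega>. (\<integral>\<^sup>+s\<in>{0..t}. (nconv g t x s \<omega>)\<^sup>2 \<partial>lborel) \<partial>M) \<le> 4 * (\<integral>\<^sup>+s\<in>{0..t}. \<phi> s \<partial>lborel)"
proof -
  interpret pair_sigma_finite M lborel ..
  have "(\<lambda>w. (nconv g t x (snd w) (fst w) * indicator {0..T} (snd w))\<^sup>2 * indicator {0..t} (snd w)) \<in> borel_measurable (M \<Otimes>\<^sub>M lborel)"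
  proof -
    have n: "(\<lambda>w. nconv g t x (snd w) (fst w) * indicator {0..T} (snd w)) \<in> borel_measurable (M \<Otimes>\<^sub>M lborel)"
      using nconv_measurable[OF g, of t x] by (simp add: case_prod_beta')
    have "(\<lambda>w. indicator {0..t} (snd w) :: ennreal) \<in> borel_measurable (M \<Otimes>\<^sub>M lborel)" by measurable
    from borel_measurable_times_ennreal[OF borel_measurable_times_ennreal[OF n n] this]
    show ?thesis by (simp add: power2_eq_square)
  qed
  then have m: "(\<lambda>(\<omega>, s). (nconv g t x s \<omega>)\<^sup>2 * indicator {0..t} s) \<in> borel_measurable (M \<Otimes>\<^sub>M lborel)"
    by (rule measurable_cong[THEN iffD1, rotated]) (use t in \<open>auto simp: indicator_def\<close>)
  have m1: "(\<lambda>\<omega>. (nconv g t x s \<omega>)\<^sup>2 * indicator {0..t} s) \<in> borel_measurable M" for s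
    using measurable_compose[OF measurable_Pair[OF measurable_ident measurable_const[of s lborel]] m] by simp
  have "(\<integral>\<^sup>+\<omega>. (\<integral>\<^sup>+s\<in>{0..t}. (nconv g t x s \<omega>)\<^sup>2 \<partial>lborel) \<partial>M) = (\<integral>\<^sup>+s. (\<integral>\<^sup>+\<omega>. (nconv g t x s \<omega>)\<^sup>2 * indicator {0..t} s \<partial>M) \<partial>lborel)"
    by (rule Fubini'[symmetric, OF m])
  also have "\<dots> \<le> (\<integral>\<^sup>+s. 4 * (\<phi> s * indicator {0..t} s) \<partial>lborel)"
  proof (rule nn_integral_mono)
    fix s
    show "(\<integral>\<^sup>+\<omega>. (nconv g t x s \<omega>)\<^sup>2 * indicator {0..t} s \<partial>M) \<le> 4 * (\<phi> s * indicator {0..t} s)"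
      using nconv_second_moment[OF g _ bnd, of s t x] t by (cases "s \<in> {0..t}") auto
  qed
  also have "\<dots> = 4 * (\<integral>\<^sup>+s\<in>{0..t}. \<phi> s \<partial>lborel)" by (rule nn_integral_cmult) measurable
  finally show ?thesis .
qed

lemma nn_integral_time_square:
  assumes t: "0 \<le> t" and [measurable]: "(\<lambda>s. a s * indicator {0..t} s) \<in> borel_measurable borel"
  shows "(\<integral>\<^sup>+s\<in>{0..t}. a s \<partial>lborel)\<^sup>2 \<le> ennreal t * (\<integral>\<^sup>+s\<in>{0..t}. (a s)\<^sup>2 \<partial>lborel)"
proof -
  have "(\<integral>\<^sup>+s\<in>{0..t}. a s \<partial>lborel)\<^sup>2 = (\<integral>\<^sup>+s. indicator {0..t} s * (a s * indicator {0..t} s) \<partial>lborel)\<^sup>2"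
    by (intro arg_cong[where f = "\<lambda>x. x\<^sup>2"] nn_integral_cong) (auto simp: indicator_def)
  also have "\<dots> \<le> (\<integral>\<^sup>+s. (indicator {0..t} s)\<^sup>2 \<partial>lborel) * (\<integral>\<^sup>+s. (a s * indicator {0..t} s)\<^sup>2 \<partial>lborel)"
    by (rule Cauchy_Schwarz_nn_integral) measurable
  also have "(\<integral>\<^sup>+s. (indicator {0..t} s)\<^sup>2 \<partial>lborel) = (\<integral>\<^sup>+s. indicator {0..t} s \<partial>(lborel :: real measure))"
    by (intro nn_integral_cong) (auto simp: indicator_def)
  also have "\<dots> = ennreal t" using t by simp
  also have "(\<integral>\<^sup>+s. (a s * indicator {0..t} s)\<^sup>2 \<partial>lborel) = (\<integral>\<^sup>+s\<in>{0..t}. (a s)\<^sup>2 \<partial>lborel)"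
    by (intro nn_integral_cong) (auto simp: indicator_def)
  finally show ?thesis .
qed

lemma energy_le_nconv:
  assumes "AE s in lborel. s \<in> {0..t} \<longrightarrow> ennreal \<bar>q s\<bar> \<le> nconv g t x s \<omega>"
  shows "energy t q \<le> (\<integral>\<^sup>+s\<in>{0..t}. (nconv g t x s \<omega>)\<^sup>2 \<partial>lborel)"
  unfolding energy_def
proof (rule nn_integral_mono_AE, use assms in eventually_elim)
  fix s assume a: "s \<in> {0..t} \<longrightarrow> ennreal \<bar>q s\<bar> \<le> nconv g t x s \<omega>"
  have "ennreal ((q s)\<^sup>2) = (ennreal \<bar>q s\<bar>)\<^sup>2" by (simp add: ennreal_power)
  then show "ennreal ((q s)\<^sup>2) * indicator {0..t} s \<le> (nconv g t x s \<omega>)\<^sup>2 * indicator {0..t} s"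
    using a by (cases "s \<in> {0..t}") (auto intro: power_mono)
qed

text \<open>Holds without integrability, because the Bochner integral is then 0.\<close>

lemma conv_le_nconv: "ennreal \<bar>conv f Y t x s \<omega>\<bar> \<le> nconv (\<lambda>\<omega> s z. f \<omega> s z (Y s z \<omega>)) t x s \<omega>"
proof (cases "integrable lborel (\<lambda>z. K (t - s) x z * f \<omega> s z (Y s z \<omega>))")
  case True
  from integral_norm_bound_ennreal[OF this] show ?thesis unfolding conv_def nconv_def by simp
next
  case False
  then show ?thesis unfolding conv_def by (simp add: not_integrable_integral_eq)
qed

lemma conv_integrable:
  assumes f: "admissible f" and Y: "progressive_field T F Y" and w: "\<omega> \<in> space M" "s \<in> {0..T}"
    and fin: "nconv (\<lambda>\<omega> s z. f \<omega> s z (Y s z \<omega>)) t x s \<omega> < \<infinity>"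
  shows "integrable lborel (\<lambda>z. K (t - s) x z * f \<omega> s z (Y s z \<omega>))"
proof (rule integrableI_bounded)
  have [measurable]: "(\<lambda>z. f \<omega> s z (Y s z \<omega>)) \<in> borel_measurable borel"
    using random_field_section[OF random_field_coefficient[OF f Y] w] .
  show "(\<lambda>z. K (t - s) x z * f \<omega> s z (Y s z \<omega>)) \<in> borel_measurable lborel" by measurable
qed (use fin in \<open>simp add: nconv_def\<close>)

lemma conv_diff_le:
  assumes f: "admissible f" and Y: "progressive_field T F Y" "progressive_field T F Y'" and w: "\<omega> \<in> space M" "s \<in> {0..T}"
    and fin: "nconv (\<lambda>\<omega> s z. f \<omega> s z (Y s z \<omega>)) t x s \<omega> < \<infinity>" "nconv (\<lambda>\<omega> s z. f \<omega> s z (Y' s z \<omega>)) t x s \<omega> < \<infinity>"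
  shows "ennreal \<bar>conv f Y t x s \<omega> - conv f Y' t x s \<omega>\<bar> \<le> nconv (\<lambda>\<omega> s z. f \<omega> s z (Y s z \<omega>) - f \<omega> s z (Y' s z \<omega>)) t x s \<omega>"
proof -
  note i = conv_integrable[OF f Y(1) w fin(1)] conv_integrable[OF f Y(2) w fin(2)]
  have "conv f Y t x s \<omega> - conv f Y' t x s \<omega> = (LINT z|lborel. K (t - s) x z * f \<omega> s z (Y s z \<omega>) - K (t - s) x z * f \<omega> s z (Y' s z \<omega>))"
    unfolding conv_def by (rule Bochner_Integration.integral_diff[symmetric, OF i])
  then show ?thesis
    using integral_norm_bound_ennreal[OF Bochner_Integration.integrable_diff[OF i]]
    unfolding nconv_def by (simp add: right_diff_distrib)
qed

end

lemma nn_integral_exp_le: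
  assumes "0 < \<beta>" "0 \<le> A" "0 \<le> t"
  shows "(\<integral>\<^sup>+s\<in>{0..t}. ennreal (A * exp (\<beta> * s)) \<partial>lborel) \<le> ennreal (A / \<beta> * exp (\<beta> * t))"
proof -
  have "(\<integral>\<^sup>+s\<in>{0..t}. ennreal (A * exp (\<beta> * s)) \<partial>lborel) = ennreal (A / \<beta> * exp (\<beta> * t) - A / \<beta> * exp (\<beta> * 0))"
  proof (rule nn_integral_FTC_Icc)
    fix s
    show "DERIV (\<lambda>s. A / \<beta> * exp (\<beta> * s)) s :> A * exp (\<beta> * s)"
      using assms by (auto intro!: derivative_eq_intros)
  qed (use assms in auto)
  also have "\<dots> \<le> ennreal (A / \<beta> * exp (\<beta> * t))" using assms by (intro ennreal_leI) simp
  finally show ?thesis .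
qed

lemma numeral_mult_ennreal_real: "numeral n * ennreal c = ennreal (numeral n * c)"
  by (simp add: ennreal_mult')

lemma square_sum_le: "(x + y)\<^sup>2 \<le> 2 * x\<^sup>2 + 2 * (y::real)\<^sup>2"
  using square_diff_le[of x "- y"] by simp

context prob_space
begin

lemma second_moment_diff_le:
  assumes [measurable]: "X \<in> borel_measurable M" "Y \<in> borel_measurable M"
    and "(\<integral>\<^sup>+\<omega>. ennreal ((X \<omega>)\<^sup>2) \<partial>M) \<le> ennreal a" "(\<integral>\<^sup>+\<omega>. ennreal ((Y \<omega>)\<^sup>2) \<partial>M) \<le> ennreal c" "0 \<le> a" "0 \<le> c"
  shows "(\<integral>\<^sup>+\<omega>. ennreal ((X \<omega> - Y \<omega>)\<^sup>2) \<partial>M) \<le> ennreal (2 * a + 2 * c)"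
proof -
  have "(\<integral>\<^sup>+\<omega>. ennreal ((X \<omega> - Y \<omega>)\<^sup>2) \<partial>M) \<le> (\<integral>\<^sup>+\<omega>. 2 * ennreal ((X \<omega>)\<^sup>2) + 2 * ennreal ((Y \<omega>)\<^sup>2) \<partial>M)"
    by (intro nn_integral_mono ennreal_square_diff_le)
  also have "\<dots> = 2 * (\<integral>\<^sup>+\<omega>. ennreal ((X \<omega>)\<^sup>2) \<partial>M) + 2 * (\<integral>\<^sup>+\<omega>. ennreal ((Y \<omega>)\<^sup>2) \<partial>M)"
    by (subst nn_integral_add) (simp_all add: nn_integral_cmult)
  also have "\<dots> \<le> 2 * ennreal a + 2 * ennreal c" using assms by (intro add_mono mult_left_mono) auto
  also have "\<dots> = ennreal (2 * a) + ennreal (2 * c)" by (simp add: ennreal_mult')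
  also have "\<dots> = ennreal (2 * a + 2 * c)" using assms by (intro ennreal_plus[symmetric]) auto
  finally show ?thesis .
qed

lemma second_moment_add_le:
  assumes "X \<in> borel_measurable M" "Y \<in> borel_measurable M"
    and "(\<integral>\<^sup>+\<omega>. ennreal ((X \<omega>)\<^sup>2) \<partial>M) \<le> ennreal a" "(\<integral>\<^sup>+\<omega>. ennreal ((Y \<omega>)\<^sup>2) \<partial>M) \<le> ennreal c" "0 \<le> a" "0 \<le> c"
  shows "(\<integral>\<^sup>+\<omega>. ennreal ((X \<omega> + Y \<omega>)\<^sup>2) \<partial>M) \<le> ennreal (2 * a + 2 * c)"
  using second_moment_diff_le[of X "\<lambda>\<omega>. - Y \<omega>" a c] assms by simp

lemma second_moment_triangle:
  assumes "X \<in> borel_measurable M" "Y \<in> borel_measurable M" "Z \<in> borel_measurable M"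
    and "(\<integral>\<^sup>+\<omega>. ennreal ((X \<omega> - Y \<omega>)\<^sup>2) \<partial>M) \<le> ennreal a" "(\<integral>\<^sup>+\<omega>. ennreal ((Y \<omega> - Z \<omega>)\<^sup>2) \<partial>M) \<le> ennreal c" "0 \<le> a" "0 \<le> c"
  shows "(\<integral>\<^sup>+\<omega>. ennreal ((X \<omega> - Z \<omega>)\<^sup>2) \<partial>M) \<le> ennreal (2 * a + 2 * c)"
  using second_moment_add_le[of "\<lambda>\<omega>. X \<omega> - Y \<omega>" "\<lambda>\<omega>. Y \<omega> - Z \<omega>" a c] assms by simp

end

lemma (in brownian_setup) time_integral_field:
  assumes H: "progressive_family H"
  shows "progressive_field T F (\<lambda>t x \<omega>. LINT s:{0..t}|lborel. H t x s \<omega>)"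
  unfolding progressive_field_iff
proof
  fix u assume u: "u \<in> {0..T}"
  let ?P = "F u \<Otimes>\<^sub>M (borel :: real measure) \<Otimes>\<^sub>M (borel :: real measure)"
  have "(\<lambda>w. (fst (fst w), fst (snd (fst w)), snd (snd (fst w)), snd w)) \<in> measurable (?P \<Otimes>\<^sub>M lborel) (F u \<Otimes>\<^sub>M borel \<Otimes>\<^sub>M borel \<Otimes>\<^sub>M (borel :: real measure))" by measurable
  from measurable_compose[OF this, of "\<lambda>(\<omega>, t, x, s). indicator {0..u} s * H t x s \<omega>" borel]
  have m: "(\<lambda>w. indicator {0..u} (snd w) * H (fst (snd (fst w))) (snd (snd (fst w))) (snd w) (fst (fst w))) \<in> borel_measurable (?P \<Otimes>\<^sub>M lborel)"
    using H u unfolding progressive_family_def by (simp add: case_prod_beta')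
  have "(\<lambda>w. if 0 \<le> snd w \<and> snd w \<le> fst (snd (fst w)) then 1 else 0 :: real) \<in> borel_measurable (?P \<Otimes>\<^sub>M lborel)" by measurable
  from borel_measurable_times[OF this m]
  have "(\<lambda>(y, s). (if 0 \<le> s \<and> s \<le> fst (snd y) then 1 else 0) * (indicator {0..u} s * H (fst (snd y)) (snd (snd y)) s (fst y))) \<in> borel_measurable (?P \<Otimes>\<^sub>M lborel)"
    by (simp add: case_prod_beta')
  note l = lborel.borel_measurable_lebesgue_integral[OF this]
  have ind: "(\<lambda>y. indicator {0..u} (fst (snd y)) :: real) \<in> borel_measurable ?P" by measurable
  from borel_measurable_times[OF ind l]
  show "(\<lambda>(\<omega>, t, x). indicator {0..u} t * (LINT s:{0..t}|lborel. H t x s \<omega>)) \<in> borel_measurable ?P"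
    unfolding set_lebesgue_integral_def
    by (rule measurable_cong[THEN iffD1, rotated]) (auto simp: indicator_def intro!: Bochner_Integration.integral_cong)
qed

section \<open>The Picard map: moments, distances and contraction\<close>

context spde
begin

definition initial :: "real \<Rightarrow> real \<Rightarrow> real" where
  "initial t x = (LINT z|lborel. K t x z * \<xi> z)"

definition drift :: "(real \<Rightarrow> real \<Rightarrow> 'a \<Rightarrow> real) \<Rightarrow> real \<Rightarrow> real \<Rightarrow> 'a \<Rightarrow> real" where
  "drift Y t x \<omega> = (LINT s:{0..t}|lborel. conv b Y t x s \<omega>)"

text \<open>A relation and not a function, because Ito integrals are fixed only up to null sets; a
  progressive representative is chosen when a step is carried out. The equation holds for every
  \<omega> with the chosen \<open>J\<close>.\<close>

definition picard :: "(real \<Rightarrow> real \<Rightarrow> 'a \<Rightarrow> real) \<Rightarrow> (real \<Rightarrow> real \<Rightarrow> 'a \<Rightarrow> real) \<Rightarrow> bool" where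
  "picard X Y \<longleftrightarrow> progressive_field T F Y \<and> (\<forall>x \<omega>. Y 0 x \<omega> = \<xi> x) \<and>
    (\<forall>t x. 0 < t \<and> t \<le> T \<longrightarrow> (\<exists>J. has_ito_integral M F B t (conv \<sigma> X t x) J \<and>
       (\<forall>\<omega>. Y t x \<omega> = initial t x + drift X t x \<omega> + J \<omega>)))"

definition moment :: "real \<Rightarrow> (real \<Rightarrow> real \<Rightarrow> 'a \<Rightarrow> real) \<Rightarrow> bool" where
  "moment C Y \<longleftrightarrow> 0 \<le> C \<and> (\<forall>s\<in>{0..T}. \<forall>z. (\<integral>\<^sup>+\<omega>. ennreal ((Y s z \<omega>)\<^sup>2) \<partial>M) \<le> ennreal C)"

text \<open>The bound \<open>\<phi>\<close> carries the exponential weight in time; in use it is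
  \<open>A * exp (\<beta> * s)\<close> and only the constant \<open>A\<close> changes from step to
  step.\<close>

definition distance_le :: "(real \<Rightarrow> real) \<Rightarrow> (real \<Rightarrow> real \<Rightarrow> 'a \<Rightarrow> real) \<Rightarrow> (real \<Rightarrow> real \<Rightarrow> 'a \<Rightarrow> real) \<Rightarrow> bool" where
  "distance_le \<phi> X Y \<longleftrightarrow> (\<forall>s\<in>{0..T}. \<forall>z. (\<integral>\<^sup>+\<omega>. ennreal ((X s z \<omega> - Y s z \<omega>)\<^sup>2) \<partial>M) \<le> ennreal (\<phi> s))"

lemma field_random_variable:
  assumes "progressive_field T F Y" "t \<in> {0..T}"
  shows "Y t x \<in> borel_measurable M"
proof -
  have "(\<lambda>\<omega>. (\<omega>, x)) \<in> measurable M (M \<Otimes>\<^sub>M borel)" by measurable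
  from measurable_compose[OF this random_field_section2[OF random_field_progressive[OF assms(1)] assms(2)]]
  show ?thesis by simp
qed

lemma coefficient_moment:
  assumes f: "admissible f" and Y: "progressive_field T F Y" "moment C Y" and s: "s \<in> {0..T}"
  shows "(\<integral>\<^sup>+\<omega>. ennreal ((f \<omega> s z (Y s z \<omega>))\<^sup>2) \<partial>M) \<le> ennreal (2 * L\<^sup>2 * (1 + C))"
proof -
  note [measurable] = field_random_variable[OF Y(1) s]
  have C: "0 \<le> C" using Y(2) unfolding moment_def by simp
  have "(\<integral>\<^sup>+\<omega>. ennreal ((f \<omega> s z (Y s z \<omega>))\<^sup>2) \<partial>M) \<le> (\<integral>\<^sup>+\<omega>. ennreal (2 * L\<^sup>2) * (1 + ennreal ((Y s z \<omega>)\<^sup>2)) \<partial>M)"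
  proof (rule nn_integral_mono)
    fix \<omega> assume w: "\<omega> \<in> space M"
    let ?y = "Y s z \<omega>"
    have "\<bar>f \<omega> s z ?y\<bar> \<le> L * (1 + \<bar>?y\<bar>)" using f w s unfolding admissible_def by blast
    then have "(f \<omega> s z ?y)\<^sup>2 \<le> (L * (1 + \<bar>?y\<bar>))\<^sup>2" by (intro abs_le_square_iff[THEN iffD1]) (use L_pos in auto)
    also have "\<dots> = L\<^sup>2 * (1 + \<bar>?y\<bar>)\<^sup>2" by (simp add: power_mult_distrib)
    also have "\<dots> \<le> L\<^sup>2 * (2 * 1\<^sup>2 + 2 * \<bar>?y\<bar>\<^sup>2)" by (intro mult_left_mono square_sum_le) simp
    finally have "(f \<omega> s z ?y)\<^sup>2 \<le> 2 * L\<^sup>2 * (1 + ?y\<^sup>2)" by (simp add: algebra_simps)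
    then have "ennreal ((f \<omega> s z ?y)\<^sup>2) \<le> ennreal (2 * L\<^sup>2 * (1 + ?y\<^sup>2))" by (rule ennreal_leI)
    also have "\<dots> = ennreal (2 * L\<^sup>2) * ennreal (1 + ?y\<^sup>2)" by (rule ennreal_mult) auto
    also have "ennreal (1 + ?y\<^sup>2) = 1 + ennreal (?y\<^sup>2)" by (subst ennreal_plus) auto
    finally show "ennreal ((f \<omega> s z ?y)\<^sup>2) \<le> ennreal (2 * L\<^sup>2) * (1 + ennreal (?y\<^sup>2))" .
  qed
  also have "\<dots> = ennreal (2 * L\<^sup>2) * (1 + (\<integral>\<^sup>+\<omega>. ennreal ((Y s z \<omega>)\<^sup>2) \<partial>M))"
    by (subst nn_integral_cmult, measurable, subst nn_integral_add) (simp_all add: emeasure_space_1)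
  also have "\<dots> \<le> ennreal (2 * L\<^sup>2) * (1 + ennreal C)"
    using Y(2) s unfolding moment_def by (intro mult_left_mono add_mono) auto
  also have "1 + ennreal C = ennreal (1 + C)" using C by (subst ennreal_plus) auto
  also have "ennreal (2 * L\<^sup>2) * ennreal (1 + C) = ennreal (2 * L\<^sup>2 * (1 + C))" using C by (intro ennreal_mult[symmetric]) auto
  finally show ?thesis .
qed

lemma coefficient_distance:
  assumes f: "admissible f" and Y: "progressive_field T F X" "progressive_field T F Y" "distance_le \<phi> X Y" and s: "s \<in> {0..T}"
    and \<phi>: "\<phi> s \<ge> 0"
  shows "(\<integral>\<^sup>+\<omega>. ennreal ((f \<omega> s z (X s z \<omega>) - f \<omega> s z (Y s z \<omega>))\<^sup>2) \<partial>M) \<le> ennreal (L\<^sup>2 * \<phi> s)"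
proof -
  note [measurable] = field_random_variable[OF Y(1) s] field_random_variable[OF Y(2) s]
  have "(\<integral>\<^sup>+\<omega>. ennreal ((f \<omega> s z (X s z \<omega>) - f \<omega> s z (Y s z \<omega>))\<^sup>2) \<partial>M) \<le> (\<integral>\<^sup>+\<omega>. ennreal (L\<^sup>2) * ennreal ((X s z \<omega> - Y s z \<omega>)\<^sup>2) \<partial>M)"
  proof (rule nn_integral_mono)
    fix \<omega> assume w: "\<omega> \<in> space M"
    have "\<bar>f \<omega> s z (X s z \<omega>) - f \<omega> s z (Y s z \<omega>)\<bar> \<le> L * \<bar>X s z \<omega> - Y s z \<omega>\<bar>"
      using f w s unfolding admissible_def by blast
    also have "\<dots> = \<bar>L * (X s z \<omega> - Y s z \<omega>)\<bar>" using L_pos by (simp add: abs_mult)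
    finally have "(f \<omega> s z (X s z \<omega>) - f \<omega> s z (Y s z \<omega>))\<^sup>2 \<le> (L * (X s z \<omega> - Y s z \<omega>))\<^sup>2"
      by (rule abs_le_square_iff[THEN iffD1])
    then show "ennreal ((f \<omega> s z (X s z \<omega>) - f \<omega> s z (Y s z \<omega>))\<^sup>2) \<le> ennreal (L\<^sup>2) * ennreal ((X s z \<omega> - Y s z \<omega>)\<^sup>2)"
      by (simp add: ennreal_mult[symmetric] ennreal_leI power_mult_distrib)
  qed
  also have "\<dots> = ennreal (L\<^sup>2) * (\<integral>\<^sup>+\<omega>. ennreal ((X s z \<omega> - Y s z \<omega>)\<^sup>2) \<partial>M)" by (rule nn_integral_cmult) measurable
  also have "\<dots> \<le> ennreal (L\<^sup>2) * ennreal (\<phi> s)" using Y(3) s unfolding distance_le_def by (intro mult_left_mono) auto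
  also have "\<dots> = ennreal (L\<^sup>2 * \<phi> s)" using \<phi> by (intro ennreal_mult[symmetric]) auto
  finally show ?thesis .
qed

abbreviation along :: "('a \<Rightarrow> real \<Rightarrow> real \<Rightarrow> real \<Rightarrow> real) \<Rightarrow> (real \<Rightarrow> real \<Rightarrow> 'a \<Rightarrow> real) \<Rightarrow> 'a \<Rightarrow> real \<Rightarrow> real \<Rightarrow> real" where
  "along f Y \<equiv> (\<lambda>\<omega> s z. f \<omega> s z (Y s z \<omega>))"

lemma nconv_square_integrable:
  assumes f: "admissible f" and Y: "progressive_field T F Y" "moment C Y" and t: "0 \<le> t" "t \<le> T"
  shows "(\<integral>\<^sup>+\<omega>. (\<integral>\<^sup>+s\<in>{0..t}. (nconv (along f Y) t x s \<omega>)\<^sup>2 \<partial>lborel) \<partial>M) \<le> ennreal (8 * L\<^sup>2 * (1 + C) * T)"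
proof -
  have C: "0 \<le> C" using Y(2) unfolding moment_def by simp
  have "(\<integral>\<^sup>+\<omega>. (\<integral>\<^sup>+s\<in>{0..t}. (nconv (along f Y) t x s \<omega>)\<^sup>2 \<partial>lborel) \<partial>M) \<le> 4 * (\<integral>\<^sup>+s\<in>{0..t}. ennreal (2 * L\<^sup>2 * (1 + C)) \<partial>lborel)"
    by (rule nconv_time_second_moment[OF random_field_coefficient[OF f Y(1)] t(2)])
       (use coefficient_moment[OF f Y] in auto)
  also have "(\<integral>\<^sup>+s\<in>{0..t}. ennreal (2 * L\<^sup>2 * (1 + C)) \<partial>lborel) = ennreal (2 * L\<^sup>2 * (1 + C) * t)"
    using t C by (simp add: nn_integral_cmult_indicator ennreal_mult[symmetric])
  also have "4 * \<dots> = ennreal (4 * (2 * L\<^sup>2 * (1 + C) * t))" by (rule numeral_mult_ennreal_real)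
  also have "\<dots> \<le> ennreal (8 * L\<^sup>2 * (1 + C) * T)"
    using t C by (intro ennreal_leI) (simp add: mult_left_mono)
  finally show ?thesis .
qed

lemma nconv_section_measurable:
  assumes "random_field g" "\<omega> \<in> space M"
  shows "(\<lambda>s. nconv g t x s \<omega> * indicator {0..T} s) \<in> borel_measurable borel"
  using measurable_compose[OF measurable_Pair1'[OF assms(2)] nconv_measurable[OF assms(1), of t x]] by simp

lemma nconv_section_measurable':
  assumes "random_field g" "\<omega> \<in> space M" "t' \<le> T"
  shows "(\<lambda>s. nconv g t x s \<omega> * indicator {0..t'} s) \<in> borel_measurable borel"
proof -
  have "(\<lambda>s. (nconv g t x s \<omega> * indicator {0..T} s) * indicator {0..t'} s) \<in> borel_measurable borel"
    by (intro borel_measurable_times_ennreal nconv_section_measurable assms) auto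
  then show ?thesis by (rule measurable_cong[THEN iffD1, rotated]) (use assms(3) in \<open>auto simp: indicator_def\<close>)
qed

lemma nconv_sq_measurable:
  assumes g: "random_field g" and t: "t \<le> T"
  shows "(\<lambda>\<omega>. (\<integral>\<^sup>+s\<in>{0..t}. (nconv g t' x s \<omega>)\<^sup>2 \<partial>lborel)) \<in> borel_measurable M"
proof -
  have "(\<lambda>(\<omega>, s). (nconv g t' x s \<omega>)\<^sup>2 * indicator {0..t} s) \<in> borel_measurable (M \<Otimes>\<^sub>M lborel)"
  proof -
    have n: "(\<lambda>w. nconv g t' x (snd w) (fst w) * indicator {0..T} (snd w)) \<in> borel_measurable (M \<Otimes>\<^sub>M lborel)"
      using nconv_measurable[OF g, of t' x] by (simp add: case_prod_beta')
    have "(\<lambda>w. indicator {0..t} (snd w) :: ennreal) \<in> borel_measurable (M \<Otimes>\<^sub>M lborel)" by measurable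
    from borel_measurable_times_ennreal[OF borel_measurable_times_ennreal[OF n n] this]
    show ?thesis by (rule measurable_cong[THEN iffD1, rotated]) (use t in \<open>auto simp: indicator_def power2_eq_square\<close>)
  qed
  from lborel.borel_measurable_nn_integral[OF this] show ?thesis .
qed

lemma nconv_finite:
  assumes f: "admissible f" and Y: "progressive_field T F Y" "moment C Y" and t: "0 \<le> t" "t \<le> T"
  shows "AE \<omega> in M. (\<integral>\<^sup>+s\<in>{0..t}. (nconv (along f Y) t x s \<omega>)\<^sup>2 \<partial>lborel) < \<infinity> \<and>
    (\<integral>\<^sup>+s\<in>{0..t}. nconv (along f Y) t x s \<omega> \<partial>lborel) < \<infinity> \<and>
    (AE s in lborel. s \<in> {0..t} \<longrightarrow> nconv (along f Y) t x s \<omega> < \<infinity>)"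
proof -
  let ?g = "along f Y"
  note g = random_field_coefficient[OF f Y(1)]
  note nm = nconv_sq_measurable[OF g t(2), of t x]
  have "AE \<omega> in M. (\<integral>\<^sup>+s\<in>{0..t}. (nconv ?g t x s \<omega>)\<^sup>2 \<partial>lborel) \<noteq> \<infinity>"
  proof (rule nn_integral_PInf_AE[OF nm])
    have "(\<integral>\<^sup>+\<omega>. (\<integral>\<^sup>+s\<in>{0..t}. (nconv ?g t x s \<omega>)\<^sup>2 \<partial>lborel) \<partial>M) < \<infinity>"
      by (rule le_less_trans[OF nconv_square_integrable[OF f Y t, of x]]) simp
    then show "(\<integral>\<^sup>+\<omega>. (\<integral>\<^sup>+s\<in>{0..t}. (nconv ?g t x s \<omega>)\<^sup>2 \<partial>lborel) \<partial>M) \<noteq> \<infinity>" by simp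
  qed
  then show ?thesis using AE_space
  proof eventually_elim
    case (elim \<omega>)
    note m = nconv_section_measurable'[OF g elim(2) t(2), of t x]
    have fin: "(\<integral>\<^sup>+s\<in>{0..t}. (nconv ?g t x s \<omega>)\<^sup>2 \<partial>lborel) < \<infinity>" using elim by (simp add: less_top)
    have "(\<integral>\<^sup>+s\<in>{0..t}. nconv ?g t x s \<omega> \<partial>lborel)\<^sup>2 \<le> ennreal t * (\<integral>\<^sup>+s\<in>{0..t}. (nconv ?g t x s \<omega>)\<^sup>2 \<partial>lborel)"
      by (rule nn_integral_time_square[OF t(1) m])
    also have "\<dots> < \<infinity>" using fin by (simp add: ennreal_mult_less_top)
    finally have fin1: "(\<integral>\<^sup>+s\<in>{0..t}. nconv ?g t x s \<omega> \<partial>lborel) < \<infinity>"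
      by (auto simp: power2_eq_square ennreal_mult_less_top less_top[symmetric] ennreal_mult_eq_top_iff)
    have "AE s in lborel. nconv ?g t x s \<omega> * indicator {0..t} s \<noteq> \<infinity>"
      by (rule nn_integral_PInf_AE) (use m fin1 in auto)
    then have "AE s in lborel. s \<in> {0..t} \<longrightarrow> nconv ?g t x s \<omega> < \<infinity>"
      by eventually_elim (auto simp: less_top)
    then show ?case using fin fin1 by blast
  qed
qed

lemma conv_energy_finite:
  assumes f: "admissible f" and Y: "progressive_field T F Y" "moment C Y" and t: "0 \<le> t" "t \<le> T"
  shows "(\<integral>\<^sup>+\<omega>. energy t (\<lambda>s. conv f Y t x s \<omega>) \<partial>M) \<le> ennreal (8 * L\<^sup>2 * (1 + C) * T)"
  by (rule order_trans[OF nn_integral_mono nconv_square_integrable[OF f Y t, of x]])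
     (auto intro!: energy_le_nconv conv_le_nconv)

lemma conv_sections: "admissible f \<Longrightarrow> progressive_field T F Y \<Longrightarrow> 0 \<le> t \<Longrightarrow> t \<le> T \<Longrightarrow> sections_measurable M t (conv f Y t x)"
  by (intro progressive_sections_M progressive_family_progressive conv_family)

lemma drift_field: "progressive_field T F Y \<Longrightarrow> progressive_field T F (drift Y)"
  unfolding drift_def[abs_def] by (rule time_integral_field[OF conv_family[OF admissible_b]])

lemma conv_time_integrable:
  assumes f: "admissible f" and Y: "progressive_field T F Y" and t: "0 \<le> t" "t \<le> T" and w: "\<omega> \<in> space M"
    and fin: "(\<integral>\<^sup>+s\<in>{0..t}. nconv (along f Y) t x s \<omega> \<partial>lborel) < \<infinity>"
  shows "set_integrable lborel {0..t} (\<lambda>s. conv f Y t x s \<omega>)"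
  unfolding set_integrable_def
proof (rule integrableI_bounded)
  show "(\<lambda>s. indicator {0..t} s *\<^sub>R conv f Y t x s \<omega>) \<in> borel_measurable lborel"
    using sections_measurable_section[OF conv_sections[OF f Y t, of x] w] by simp
  have "(\<integral>\<^sup>+s. ennreal (norm (indicator {0..t} s *\<^sub>R conv f Y t x s \<omega>)) \<partial>lborel) \<le> (\<integral>\<^sup>+s\<in>{0..t}. nconv (along f Y) t x s \<omega> \<partial>lborel)"
    by (intro nn_integral_mono) (use conv_le_nconv in \<open>auto simp: indicator_def\<close>)
  then show "(\<integral>\<^sup>+s. ennreal (norm (indicator {0..t} s *\<^sub>R conv f Y t x s \<omega>)) \<partial>lborel) < \<infinity>" using fin by (rule le_less_trans)
qed

text \<open>Bochner integrals may be subtracted only when both are integrable, here first in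
  \<open>z\<close> for almost every \<open>s\<close> and then in \<open>s\<close>; the finiteness
  assumptions supply this.\<close>

lemma drift_diff_le:
  assumes Y: "progressive_field T F X" "progressive_field T F Y" and t: "0 \<le> t" "t \<le> T" and w: "\<omega> \<in> space M"
    and fin: "(\<integral>\<^sup>+s\<in>{0..t}. nconv (along b X) t x s \<omega> \<partial>lborel) < \<infinity>" "(\<integral>\<^sup>+s\<in>{0..t}. nconv (along b Y) t x s \<omega> \<partial>lborel) < \<infinity>"
    and ae: "AE s in lborel. s \<in> {0..t} \<longrightarrow> nconv (along b X) t x s \<omega> < \<infinity>" "AE s in lborel. s \<in> {0..t} \<longrightarrow> nconv (along b Y) t x s \<omega> < \<infinity>"
  shows "ennreal \<bar>drift X t x \<omega> - drift Y t x \<omega>\<bar> \<le> (\<integral>\<^sup>+s\<in>{0..t}. nconv (\<lambda>\<omega> s z. along b X \<omega> s z - along b Y \<omega> s z) t x s \<omega> \<partial>lborel)"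
proof -
  note i = conv_time_integrable[OF admissible_b Y(1) t w fin(1)] conv_time_integrable[OF admissible_b Y(2) t w fin(2)]
  have "drift X t x \<omega> - drift Y t x \<omega> = (LINT s:{0..t}|lborel. conv b X t x s \<omega> - conv b Y t x s \<omega>)"
    unfolding drift_def by (rule set_integral_diff(2)[symmetric, OF i])
  then have "ennreal \<bar>drift X t x \<omega> - drift Y t x \<omega>\<bar> \<le> (\<integral>\<^sup>+s. ennreal (norm (indicator {0..t} s *\<^sub>R (conv b X t x s \<omega> - conv b Y t x s \<omega>))) \<partial>lborel)"
    using integral_norm_bound_ennreal[OF set_integral_diff(1)[OF i, unfolded set_integrable_def]]
    unfolding set_lebesgue_integral_def by simp
  also have "\<dots> \<le> (\<integral>\<^sup>+s\<in>{0..t}. nconv (\<lambda>\<omega> s z. along b X \<omega> s z - along b Y \<omega> s z) t x s \<omega> \<partial>lborel)"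
  proof (rule nn_integral_mono_AE, use ae in eventually_elim)
    fix s assume "s \<in> {0..t} \<longrightarrow> nconv (along b X) t x s \<omega> < \<infinity>" "s \<in> {0..t} \<longrightarrow> nconv (along b Y) t x s \<omega> < \<infinity>"
    then show "ennreal (norm (indicator {0..t} s *\<^sub>R (conv b X t x s \<omega> - conv b Y t x s \<omega>)))
       \<le> nconv (\<lambda>\<omega> s z. along b X \<omega> s z - along b Y \<omega> s z) t x s \<omega> * indicator {0..t} s"
      using conv_diff_le[OF admissible_b Y w, of s t x] t by (cases "s \<in> {0..t}") auto
  qed
  finally show ?thesis .
qed

end

text \<open>Taken as the second integral in \<open>ito_localized_bound\<close>, it yields the second
  moment bound for a single Ito integral.\<close>

lemma (in brownian_setup) has_ito_integral_zero:
  assumes "0 \<le> t" "t \<le> T"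
  shows "has_ito_integral M F B t (\<lambda>s \<omega>. 0) (\<lambda>\<omega>. 0)"
proof -
  have "simple_integrand M F t 0 (\<lambda>_. 0) (\<lambda>_ _. 0)" using assms by (simp add: simple_integrand_def)
  then show ?thesis unfolding has_ito_integral_def progressive_def set_integrable_def
    by (intro conjI exI[of _ "\<lambda>_. 0"] exI[of _ "\<lambda>_ _. 0"] exI[of _ "\<lambda>_ _ _. 0"])
      (simp_all add: tendsto_in_prob_def simple_process_def simple_ito_def)
qed

context spde
begin

text \<open>Chosen so that \<open>8 * (T + 2) * L\<^sup>2 / \<beta> = 1 / 4\<close>: in the
  contraction estimate the drift contributes \<open>8 * T\<close> and the Ito part 16.\<close>

definition \<beta> :: real where "\<beta> = 32 * L\<^sup>2 * (T + 2)"

lemma \<beta>_pos: "\<beta> > 0"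
  unfolding \<beta>_def using L_pos T_pos by simp

text \<open>Integrating \<open>exp (\<beta> * s)\<close> in time gains the factor
  \<open>1 / \<beta>\<close>, which is the source of the contraction.\<close>

lemma nconv_distance:
  assumes f: "admissible f" and Y: "progressive_field T F X" "progressive_field T F Y"
    and d: "distance_le (\<lambda>s. A * exp (\<beta> * s)) X Y" "0 \<le> A" and t: "0 \<le> t" "t \<le> T"
  shows "(\<integral>\<^sup>+\<omega>. (\<integral>\<^sup>+s\<in>{0..t}. (nconv (\<lambda>\<omega> s z. along f X \<omega> s z - along f Y \<omega> s z) t x s \<omega>)\<^sup>2 \<partial>lborel) \<partial>M)
    \<le> ennreal (4 * (L\<^sup>2 * A / \<beta> * exp (\<beta> * t)))"
proof -
  note rf = random_field_diff[OF random_field_coefficient[OF f Y(1)] random_field_coefficient[OF f Y(2)]]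
  have "(\<integral>\<^sup>+\<omega>. (\<integral>\<^sup>+s\<in>{0..t}. (nconv (\<lambda>\<omega> s z. along f X \<omega> s z - along f Y \<omega> s z) t x s \<omega>)\<^sup>2 \<partial>lborel) \<partial>M)
     \<le> 4 * (\<integral>\<^sup>+s\<in>{0..t}. ennreal (L\<^sup>2 * (A * exp (\<beta> * s))) \<partial>lborel)"
    by (rule nconv_time_second_moment[OF rf t(2)]) (use coefficient_distance[OF f Y d(1)] d(2) in auto)
  also have "\<dots> \<le> 4 * ennreal (L\<^sup>2 * A / \<beta> * exp (\<beta> * t))"
    using nn_integral_exp_le[OF \<beta>_pos, of "L\<^sup>2 * A" t] d(2) t by (intro mult_left_mono) (simp_all add: mult.assoc)
  also have "\<dots> = ennreal (4 * (L\<^sup>2 * A / \<beta> * exp (\<beta> * t)))" by (rule numeral_mult_ennreal_real)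
  finally show ?thesis .
qed

text \<open>Cauchy-Schwarz in time moves the square inside the time integral at the cost of a factor
  \<open>t <= T\<close>.\<close>

lemma drift_distance:
  assumes X: "progressive_field T F X" "moment C X" and Y: "progressive_field T F Y" "moment C' Y"
    and d: "distance_le (\<lambda>s. A * exp (\<beta> * s)) X Y" "0 \<le> A" and t: "0 \<le> t" "t \<le> T"
  shows "(\<integral>\<^sup>+\<omega>. ennreal ((drift X t x \<omega> - drift Y t x \<omega>)\<^sup>2) \<partial>M) \<le> ennreal (T * (4 * (L\<^sup>2 * A / \<beta> * exp (\<beta> * t))))"
proof -
  let ?g = "\<lambda>\<omega> s z. along b X \<omega> s z - along b Y \<omega> s z"
  note rf = random_field_diff[OF random_field_coefficient[OF admissible_b X(1)] random_field_coefficient[OF admissible_b Y(1)]]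
  have "(\<integral>\<^sup>+\<omega>. ennreal ((drift X t x \<omega> - drift Y t x \<omega>)\<^sup>2) \<partial>M)
    \<le> (\<integral>\<^sup>+\<omega>. ennreal T * (\<integral>\<^sup>+s\<in>{0..t}. (nconv ?g t x s \<omega>)\<^sup>2 \<partial>lborel) \<partial>M)"
  proof (rule nn_integral_mono_AE)
    show "AE \<omega> in M. ennreal ((drift X t x \<omega> - drift Y t x \<omega>)\<^sup>2) \<le> ennreal T * (\<integral>\<^sup>+s\<in>{0..t}. (nconv ?g t x s \<omega>)\<^sup>2 \<partial>lborel)"
      using nconv_finite[OF admissible_b X t, of x] nconv_finite[OF admissible_b Y t, of x] AE_space
    proof eventually_elim
      case (elim \<omega>)
      have "ennreal ((drift X t x \<omega> - drift Y t x \<omega>)\<^sup>2) = (ennreal \<bar>drift X t x \<omega> - drift Y t x \<omega>\<bar>)\<^sup>2"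
        by (simp add: ennreal_power)
      also have "\<dots> \<le> (\<integral>\<^sup>+s\<in>{0..t}. nconv ?g t x s \<omega> \<partial>lborel)\<^sup>2"
        by (intro power_mono drift_diff_le[OF X(1) Y(1) t]) (use elim in auto)
      also have "\<dots> \<le> ennreal t * (\<integral>\<^sup>+s\<in>{0..t}. (nconv ?g t x s \<omega>)\<^sup>2 \<partial>lborel)"
        by (rule nn_integral_time_square[OF t(1) nconv_section_measurable'[OF rf elim(3) t(2)]])
      also have "\<dots> \<le> ennreal T * (\<integral>\<^sup>+s\<in>{0..t}. (nconv ?g t x s \<omega>)\<^sup>2 \<partial>lborel)"
        using t by (intro mult_right_mono ennreal_leI) auto
      finally show ?case .
    qed
  qed
  also have "\<dots> \<le> ennreal T * (\<integral>\<^sup>+\<omega>. (\<integral>\<^sup>+s\<in>{0..t}. (nconv ?g t x s \<omega>)\<^sup>2 \<partial>lborel) \<partial>M)"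
    by (subst nn_integral_cmult) (use nconv_sq_measurable[OF rf t(2)] in auto)
  also have "\<dots> \<le> ennreal T * ennreal (4 * (L\<^sup>2 * A / \<beta> * exp (\<beta> * t)))"
    by (intro mult_left_mono nconv_distance[OF admissible_b X(1) Y(1) d t]) simp
  also have "\<dots> = ennreal (T * (4 * (L\<^sup>2 * A / \<beta> * exp (\<beta> * t))))"
    using T_pos d(2) \<beta>_pos by (intro ennreal_mult[symmetric]) auto
  finally show ?thesis .
qed

text \<open>Locality is used with the whole space as event; the constant is 2 from
  \<open>ito_localized_bound\<close> times 4 from \<open>nconv_distance\<close>.\<close>

lemma ito_distance:
  assumes X: "progressive_field T F X" "moment C X" and Y: "progressive_field T F Y" "moment C' Y"
    and d: "distance_le (\<lambda>s. A * exp (\<beta> * s)) X Y" "0 \<le> A" and t: "0 < t" "t \<le> T"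
    and J: "has_ito_integral M F B t (conv \<sigma> X t x) J" "has_ito_integral M F B t (conv \<sigma> Y t x) J'"
  shows "(\<integral>\<^sup>+\<omega>. ennreal ((J \<omega> - J' \<omega>)\<^sup>2) \<partial>M) \<le> ennreal (8 * (L\<^sup>2 * A / \<beta> * exp (\<beta> * t)))"
proof -
  have t0: "0 \<le> t" using t by simp
  let ?D = "\<lambda>s \<omega>. conv \<sigma> X t x s \<omega> - conv \<sigma> Y t x s \<omega>"
  have prog: "progressive t F ?D"
    unfolding progressive_sections[OF t(2)]
    using progressive_family_progressive[OF conv_family[OF admissible_\<sigma> X(1)] t(2), of x, unfolded progressive_sections[OF t(2)]]
      progressive_family_progressive[OF conv_family[OF admissible_\<sigma> Y(1)] t(2), of x, unfolded progressive_sections[OF t(2)]]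
    by (intro ballI sections_measurable_diff) auto
  have "(\<integral>\<^sup>+\<omega>. ennreal ((J \<omega> - J' \<omega>)\<^sup>2) \<partial>M) = (\<integral>\<^sup>+\<omega>\<in>space M. ennreal ((J \<omega> - J' \<omega>)\<^sup>2) \<partial>M)"
    by (intro nn_integral_cong) simp
  also have "\<dots> \<le> 2 * (\<integral>\<^sup>+\<omega>. energy t (\<lambda>s. ?D s \<omega>) \<partial>M)"
    by (rule ito_localized_bound[OF t J _ prog]) auto
  also have "\<dots> \<le> 2 * (\<integral>\<^sup>+\<omega>. (\<integral>\<^sup>+s\<in>{0..t}. (nconv (\<lambda>\<omega> s z. along \<sigma> X \<omega> s z - along \<sigma> Y \<omega> s z) t x s \<omega>)\<^sup>2 \<partial>lborel) \<partial>M)"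
  proof (rule mult_left_mono[OF nn_integral_mono_AE])
    show "AE \<omega> in M. energy t (\<lambda>s. ?D s \<omega>) \<le> (\<integral>\<^sup>+s\<in>{0..t}. (nconv (\<lambda>\<omega> s z. along \<sigma> X \<omega> s z - along \<sigma> Y \<omega> s z) t x s \<omega>)\<^sup>2 \<partial>lborel)"
      using nconv_finite[OF admissible_\<sigma> X t0 t(2), of x] nconv_finite[OF admissible_\<sigma> Y t0 t(2), of x] AE_space
    proof eventually_elim
      case (elim \<omega>)
      have "AE s in lborel. s \<in> {0..t} \<longrightarrow> ennreal \<bar>?D s \<omega>\<bar> \<le> nconv (\<lambda>\<omega> s z. along \<sigma> X \<omega> s z - along \<sigma> Y \<omega> s z) t x s \<omega>"
        using elim(1)[THEN conjunct2, THEN conjunct2] elim(2)[THEN conjunct2, THEN conjunct2]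
      proof eventually_elim
        case (elim s)
        then show ?case using conv_diff_le[OF admissible_\<sigma> X(1) Y(1) \<open>\<omega> \<in> space M\<close>, of s t x] t by auto
      qed
      then show ?case by (rule energy_le_nconv)
    qed
  qed simp
  also have "\<dots> \<le> 2 * ennreal (4 * (L\<^sup>2 * A / \<beta> * exp (\<beta> * t)))"
    by (intro mult_left_mono nconv_distance[OF admissible_\<sigma> X(1) Y(1) d t0 t(2)]) simp
  also have "\<dots> = ennreal (2 * (4 * (L\<^sup>2 * A / \<beta> * exp (\<beta> * t))))" by (rule numeral_mult_ennreal_real)
  finally show ?thesis by simp
qed

text \<open>The gain of 1/4 in the squared distance is exactly the rate that
  \<open>L2_fast_convergence\<close> expects.\<close>

lemma picard_contraction:
  assumes X: "progressive_field T F X" "moment C X" and Y: "progressive_field T F Y" "moment C' Y"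
    and P: "picard X X'" "picard Y Y'" and d: "distance_le (\<lambda>s. A * exp (\<beta> * s)) X Y" "0 \<le> A"
  shows "distance_le (\<lambda>s. A / 4 * exp (\<beta> * s)) X' Y'"
  unfolding distance_le_def
proof (intro ballI allI)
  fix t x assume t: "t \<in> {0..T}"
  show "(\<integral>\<^sup>+\<omega>. ennreal ((X' t x \<omega> - Y' t x \<omega>)\<^sup>2) \<partial>M) \<le> ennreal (A / 4 * exp (\<beta> * t))"
  proof (cases "t = 0")
    case True
    then show ?thesis using P unfolding picard_def by simp
  next
    case False
    then have t: "0 < t" "t \<le> T" "0 \<le> t" "t \<in> {0..T}" using t by auto
    obtain J where J: "has_ito_integral M F B t (conv \<sigma> X t x) J" "\<And>\<omega>. X' t x \<omega> = initial t x + drift X t x \<omega> + J \<omega>"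
      using P(1) t unfolding picard_def by blast
    obtain J' where J': "has_ito_integral M F B t (conv \<sigma> Y t x) J'" "\<And>\<omega>. Y' t x \<omega> = initial t x + drift Y t x \<omega> + J' \<omega>"
      using P(2) t unfolding picard_def by blast
    let ?q = "L\<^sup>2 * A / \<beta> * exp (\<beta> * t)"
    have q: "0 \<le> ?q" using d(2) \<beta>_pos by simp
    have m: "(\<lambda>\<omega>. drift X t x \<omega> - drift Y t x \<omega>) \<in> borel_measurable M" "(\<lambda>\<omega>. J \<omega> - J' \<omega>) \<in> borel_measurable M"
      using field_random_variable[OF drift_field[OF X(1)] t(4)] field_random_variable[OF drift_field[OF Y(1)] t(4)] J(1) J'(1)
      unfolding has_ito_integral_def by auto
    have "(\<integral>\<^sup>+\<omega>. ennreal ((X' t x \<omega> - Y' t x \<omega>)\<^sup>2) \<partial>M) = (\<integral>\<^sup>+\<omega>. ennreal (((drift X t x \<omega> - drift Y t x \<omega>) + (J \<omega> - J' \<omega>))\<^sup>2) \<partial>M)"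
      unfolding J(2) J'(2) by (simp add: algebra_simps)
    also have "\<dots> \<le> ennreal (2 * (T * (4 * ?q)) + 2 * (8 * ?q))"
    proof (rule second_moment_add_le[OF m drift_distance[OF X Y d t(3,2)] ito_distance[OF X Y d t(1,2) J(1) J'(1)]])
      show "0 \<le> 8 * ?q" using q by linarith
      have "0 \<le> 4 * ?q" using q by linarith
      then show "0 \<le> T * (4 * ?q)" by (rule mult_nonneg_nonneg[OF less_imp_le[OF T_pos]])
    qed
    also have "2 * (T * (4 * ?q)) + 2 * (8 * ?q) = A / 4 * exp (\<beta> * t)"
    proof -
      have "2 * (T * (4 * ?q)) + 2 * (8 * ?q) = (8 * (T + 2) * L\<^sup>2) * (A / \<beta> * exp (\<beta> * t))" by (simp add: algebra_simps)
      also have "8 * (T + 2) * L\<^sup>2 = \<beta> / 4" unfolding \<beta>_def by simp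
      finally show ?thesis using \<beta>_pos by simp
    qed
    finally show ?thesis .
  qed
qed

lemma initial_data_bound:
  obtains R where "R \<ge> 0" "\<And>x. \<bar>\<xi> x\<bar> \<le> R"
    "\<And>t x. integrable lborel (\<lambda>z. K t x z * \<xi> z)" "\<And>t x. \<bar>initial t x\<bar> \<le> 2 * R"
proof -
  obtain R where R: "\<And>x. \<bar>\<xi> x\<bar> \<le> R" using \<xi>_bounded unfolding bounded_iff by auto
  have R0: "0 \<le> R" using R[of 0] by auto
  have bnd: "(\<integral>\<^sup>+z. ennreal (norm (K t x z * \<xi> z)) \<partial>lborel) \<le> ennreal (2 * R)" for t x
  proof -
    have "(\<integral>\<^sup>+z. ennreal (norm (K t x z * \<xi> z)) \<partial>lborel) \<le> (\<integral>\<^sup>+z. ennreal (K t x z) * ennreal R \<partial>lborel)"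
      using R K_nonneg by (intro nn_integral_mono) (simp add: abs_mult ennreal_mult[symmetric] ennreal_leI mult_left_mono R0)
    also have "\<dots> = (\<integral>\<^sup>+z. ennreal (K t x z) \<partial>lborel) * ennreal R" by (rule nn_integral_multc) measurable
    also have "\<dots> \<le> 2 * ennreal R" by (intro mult_right_mono nn_integral_K_le) simp
    also have "\<dots> = ennreal (2 * R)" by (rule numeral_mult_ennreal_real)
    finally show ?thesis .
  qed
  have int: "integrable lborel (\<lambda>z. K t x z * \<xi> z)" for t x
  proof (rule integrableI_bounded)
    show "(\<integral>\<^sup>+z. ennreal (norm (K t x z * \<xi> z)) \<partial>lborel) < \<infinity>" by (rule le_less_trans[OF bnd]) simp
  qed measurable
  have "\<bar>initial t x\<bar> \<le> 2 * R" for t x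
  proof -
    have "ennreal \<bar>initial t x\<bar> \<le> ennreal (2 * R)"
      using order_trans[OF integral_norm_bound_ennreal[OF int] bnd, of t x] unfolding initial_def by simp
    then show ?thesis using R0 by simp
  qed
  then show ?thesis using that R0 R int by blast
qed

lemma initial_measurable: "(\<lambda>y. initial (fst y) (snd y)) \<in> borel_measurable (borel \<Otimes>\<^sub>M borel)"
proof -
  have "(\<lambda>(y, z). K (fst y) (snd y) z * \<xi> z) \<in> borel_measurable ((borel \<Otimes>\<^sub>M borel) \<Otimes>\<^sub>M lborel)" by measurable
  from lborel.borel_measurable_lebesgue_integral[OF this] show ?thesis unfolding initial_def .
qed

lemma drift_moment:
  assumes X: "progressive_field T F X" "moment C X" and t: "0 \<le> t" "t \<le> T"
  shows "(\<integral>\<^sup>+\<omega>. ennreal ((drift X t x \<omega>)\<^sup>2) \<partial>M) \<le> ennreal (T * (8 * L\<^sup>2 * (1 + C) * T))"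
proof -
  have C: "0 \<le> C" using X(2) unfolding moment_def by simp
  let ?g = "along b X"
  note rf = random_field_coefficient[OF admissible_b X(1)]
  have "(\<integral>\<^sup>+\<omega>. ennreal ((drift X t x \<omega>)\<^sup>2) \<partial>M) \<le> (\<integral>\<^sup>+\<omega>. ennreal T * (\<integral>\<^sup>+s\<in>{0..t}. (nconv ?g t x s \<omega>)\<^sup>2 \<partial>lborel) \<partial>M)"
  proof (rule nn_integral_mono_AE)
    show "AE \<omega> in M. ennreal ((drift X t x \<omega>)\<^sup>2) \<le> ennreal T * (\<integral>\<^sup>+s\<in>{0..t}. (nconv ?g t x s \<omega>)\<^sup>2 \<partial>lborel)"
      using nconv_finite[OF admissible_b X t, of x] AE_space
    proof eventually_elim
      case (elim \<omega>)
      note i = conv_time_integrable[OF admissible_b X(1) t elim(2) elim(1)[THEN conjunct2, THEN conjunct1]]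
      have "ennreal \<bar>drift X t x \<omega>\<bar> \<le> (\<integral>\<^sup>+s. ennreal (norm (indicator {0..t} s *\<^sub>R conv b X t x s \<omega>)) \<partial>lborel)"
        using integral_norm_bound_ennreal[OF i[unfolded set_integrable_def]] unfolding drift_def set_lebesgue_integral_def by simp
      also have "\<dots> \<le> (\<integral>\<^sup>+s\<in>{0..t}. nconv ?g t x s \<omega> \<partial>lborel)"
        by (intro nn_integral_mono) (use conv_le_nconv in \<open>auto simp: indicator_def\<close>)
      finally have d: "ennreal \<bar>drift X t x \<omega>\<bar> \<le> (\<integral>\<^sup>+s\<in>{0..t}. nconv ?g t x s \<omega> \<partial>lborel)" .
      have "ennreal ((drift X t x \<omega>)\<^sup>2) = (ennreal \<bar>drift X t x \<omega>\<bar>)\<^sup>2" by (simp add: ennreal_power)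
      also have "\<dots> \<le> (\<integral>\<^sup>+s\<in>{0..t}. nconv ?g t x s \<omega> \<partial>lborel)\<^sup>2" by (intro power_mono d) simp
      also have "\<dots> \<le> ennreal t * (\<integral>\<^sup>+s\<in>{0..t}. (nconv ?g t x s \<omega>)\<^sup>2 \<partial>lborel)"
        by (rule nn_integral_time_square[OF t(1) nconv_section_measurable'[OF rf elim(2) t(2)]])
      also have "\<dots> \<le> ennreal T * (\<integral>\<^sup>+s\<in>{0..t}. (nconv ?g t x s \<omega>)\<^sup>2 \<partial>lborel)"
        using t by (intro mult_right_mono ennreal_leI) auto
      finally show ?case .
    qed
  qed
  also have "\<dots> \<le> ennreal T * (\<integral>\<^sup>+\<omega>. (\<integral>\<^sup>+s\<in>{0..t}. (nconv ?g t x s \<omega>)\<^sup>2 \<partial>lborel) \<partial>M)"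
    by (subst nn_integral_cmult) (use nconv_sq_measurable[OF rf t(2)] in auto)
  also have "\<dots> \<le> ennreal T * ennreal (8 * L\<^sup>2 * (1 + C) * T)"
    by (intro mult_left_mono nconv_square_integrable[OF admissible_b X t]) simp
  also have "\<dots> = ennreal (T * (8 * L\<^sup>2 * (1 + C) * T))"
    using T_pos C by (intro ennreal_mult[symmetric]) auto
  finally show ?thesis .
qed

lemma picard_step:
  assumes X: "progressive_field T F X" "moment C X"
  shows "\<exists>Y C'. picard X Y \<and> moment C' Y"
proof -
  have C: "0 \<le> C" using X(2) unfolding moment_def by simp
  obtain R where R: "R \<ge> 0" "\<And>x. \<bar>\<xi> x\<bar> \<le> R" "\<And>t x. \<bar>initial t x\<bar> \<le> 2 * R" using initial_data_bound by metis
  have e: "(\<integral>\<^sup>+\<omega>. energy t (\<lambda>s. conv \<sigma> X t x s \<omega>) \<partial>M) \<le> ennreal (8 * L\<^sup>2 * (1 + C) * T)" if "0 \<le> t" "t \<le> T" for t x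
    by (rule conv_energy_finite[OF admissible_\<sigma> X that])
  obtain J where J: "progressive_field T F J" "\<And>t x. 0 < t \<Longrightarrow> t \<le> T \<Longrightarrow> has_ito_integral M F B t (conv \<sigma> X t x) (J t x)"
  proof (rule ito_family_version[OF conv_family[OF admissible_\<sigma> X(1)]])
    show "(\<integral>\<^sup>+\<omega>. energy t (\<lambda>s. conv \<sigma> X t x s \<omega>) \<partial>M) < \<infinity>" if "0 < t" "t \<le> T" for t x
      by (rule le_less_trans[OF e[of t x]]) (use that in auto)
  qed blast
  define Y where "Y = (\<lambda>t x \<omega>. if t = 0 then \<xi> x else initial t x + drift X t x \<omega> + J t x \<omega>)"
  have "progressive_field T F Y"
    unfolding progressive_field_iff
  proof
    fix u assume u: "u \<in> {0..T}"
    let ?P = "F u \<Otimes>\<^sub>M (borel :: real measure) \<Otimes>\<^sub>M (borel :: real measure)"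
    have ind: "(\<lambda>w. indicator {0..u} (fst (snd w)) :: real) \<in> borel_measurable ?P" by measurable
    have i0: "(\<lambda>w. initial (fst (snd w)) (snd (snd w))) \<in> borel_measurable ?P"
      using measurable_compose[OF measurable_snd initial_measurable] .
    have x0: "(\<lambda>w. \<xi> (snd (snd w))) \<in> borel_measurable ?P" by measurable
    have z: "{w \<in> space ?P. fst (snd w) = 0} \<in> sets ?P" by measurable
    have "(\<lambda>w. if fst (snd w) = 0 then indicator {0..u} (fst (snd w)) * \<xi> (snd (snd w))
      else indicator {0..u} (fst (snd w)) * initial (fst (snd w)) (snd (snd w)) + indicator {0..u} (fst (snd w)) * drift X (fst (snd w)) (snd (snd w)) (fst w)
        + indicator {0..u} (fst (snd w)) * J (fst (snd w)) (snd (snd w)) (fst w)) \<in> borel_measurable ?P"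
      by (intro measurable_If z borel_measurable_add field_measurable[OF J(1) u] field_measurable[OF drift_field[OF X(1)] u]
         borel_measurable_times ind i0 x0)
    then show "(\<lambda>(\<omega>, s, x). indicator {0..u} s * Y s x \<omega>) \<in> borel_measurable ?P"
      by (rule measurable_cong[THEN iffD1, rotated]) (auto simp: Y_def distrib_left)
  qed
  then have "picard X Y" unfolding picard_def using J(2) by (auto simp: Y_def)
  moreover
  let ?c = "8 * L\<^sup>2 * (1 + C) * T"
  \<comment> \<open>The first summand covers time 0, where the iterate is \<xi>; the rest is the
    squared triangle inequality applied twice, to the initial part, the drift and the Ito
    integral.\<close>
  let ?C' = "R\<^sup>2 + (2 * (2 * (2 * R)\<^sup>2 + 2 * (T * ?c)) + 2 * (2 * ?c))"
  have c0: "0 \<le> ?c" "0 \<le> T * ?c" using T_pos C by auto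
  have "moment ?C' Y"
    unfolding moment_def
  proof (intro conjI ballI allI)
    show "0 \<le> ?C'" using c0 by simp
    fix t x assume t: "t \<in> {0..T}"
    show "(\<integral>\<^sup>+\<omega>. ennreal ((Y t x \<omega>)\<^sup>2) \<partial>M) \<le> ennreal ?C'"
    proof (cases "t = 0")
      case True
      have "(\<xi> x)\<^sup>2 \<le> R\<^sup>2" using R(1) R(2)[of x] by (intro abs_le_square_iff[THEN iffD1]) auto
      moreover have "0 \<le> 2 * (2 * (2 * R)\<^sup>2 + 2 * (T * ?c)) + 2 * (2 * ?c)"
        by (intro add_nonneg_nonneg mult_nonneg_nonneg[of 2] c0) simp_all
      ultimately have "(\<xi> x)\<^sup>2 \<le> ?C'" by (rule order_trans[OF _ le_add_same_cancel1[THEN iffD2]])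
      then show ?thesis using True by (simp add: Y_def emeasure_space_1 ennreal_leI)
    next
      case False
      then have t: "0 < t" "t \<le> T" "0 \<le> t" "t \<in> {0..T}" using t by auto
      have Jb: "(\<integral>\<^sup>+\<omega>. ennreal ((J t x \<omega>)\<^sup>2) \<partial>M) \<le> ennreal (2 * ?c)"
      proof -
        have "(\<integral>\<^sup>+\<omega>. ennreal ((J t x \<omega>)\<^sup>2) \<partial>M) = (\<integral>\<^sup>+\<omega>\<in>space M. ennreal ((J t x \<omega> - 0)\<^sup>2) \<partial>M)"
          by (intro nn_integral_cong) simp
        also have "\<dots> \<le> 2 * (\<integral>\<^sup>+\<omega>. energy t (\<lambda>s. conv \<sigma> X t x s \<omega>) \<partial>M)"
          by (rule ito_localized_bound[OF t(1,2) J(2)[OF t(1,2)] has_ito_integral_zero[OF t(3,2)] sets.top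
               progressive_family_progressive[OF conv_family[OF admissible_\<sigma> X(1)] t(2)]]) simp
        also have "\<dots> \<le> 2 * ennreal ?c" by (intro mult_left_mono e t) simp
        finally show ?thesis by (simp only: numeral_mult_ennreal_real)
      qed
      have Ib: "(\<integral>\<^sup>+\<omega>. ennreal ((initial t x)\<^sup>2) \<partial>M) \<le> ennreal ((2 * R)\<^sup>2)"
      proof -
        have "(initial t x)\<^sup>2 \<le> (2 * R)\<^sup>2" using R(1) R(3)[of t x] by (intro abs_le_square_iff[THEN iffD1]) auto
        then show ?thesis by (simp add: emeasure_space_1 ennreal_leI del: power_mult_distrib)
      qed
      note m = field_random_variable[OF drift_field[OF X(1)] t(4), of x] field_random_variable[OF J(1) t(4), of x]
      have m0: "(\<lambda>\<omega>. initial t x + drift X t x \<omega>) \<in> borel_measurable M" using m by simp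
      note s1 = second_moment_add_le[OF borel_measurable_const m(1) Ib drift_moment[OF X t(3,2)] zero_le_power2 c0(2)]
      have "(\<integral>\<^sup>+\<omega>. ennreal ((initial t x + drift X t x \<omega> + J t x \<omega>)\<^sup>2) \<partial>M) \<le> ennreal (2 * (2 * (2 * R)\<^sup>2 + 2 * (T * ?c)) + 2 * (2 * ?c))"
        by (rule second_moment_add_le[OF m0 m(2) s1 Jb]) (use c0 in auto)
      also have "\<dots> \<le> ennreal ?C'" by (intro ennreal_leI) simp
      finally show ?thesis using False by (simp add: Y_def)
    qed
  qed
  ultimately show ?thesis by blast
qed


theorem mild_solution_exists: "\<exists>Y. mild_solution M T F B a1 a2 \<rho>1 \<rho>2 b \<sigma> \<xi> Y"
proof -
  let ?e = "\<lambda>A s. A * exp (\<beta> * s)"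
  \<comment> \<open>Each step yields its own moment constant, so the constant is quantified inside
    the choice; uniform control is recovered below from the contraction.\<close>
  have "\<exists>Ys. \<forall>n. (progressive_field T F (Ys n) \<and> (\<exists>C. moment C (Ys n))) \<and> picard (Ys n) (Ys (Suc n))"
  proof (rule dependent_nat_choice)
    have "progressive_field T F (\<lambda>_ _ _. 0)" unfolding progressive_field_def by simp
    moreover have "moment 0 (\<lambda>_ _ _. 0)" unfolding moment_def by simp
    ultimately show "\<exists>Y. progressive_field T F Y \<and> (\<exists>C. moment C Y)" by blast
  next
    fix X :: "real \<Rightarrow> real \<Rightarrow> 'a \<Rightarrow> real"
    assume "progressive_field T F X \<and> (\<exists>C. moment C X)"
    then obtain Y C' where "picard X Y" "moment C' Y" using picard_step by blast
    then show "\<exists>Y. (progressive_field T F Y \<and> (\<exists>C. moment C Y)) \<and> picard X Y" unfolding picard_def by blast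
  qed
  then obtain Ys where Ys: "\<And>n. progressive_field T F (Ys n)" "\<And>n. \<exists>C. moment C (Ys n)" "\<And>n. picard (Ys n) (Ys (Suc n))" by blast
  obtain C where C: "\<And>n. moment (C n) (Ys n)" using Ys(2) by metis
  have C0: "0 \<le> C n" for n using C[of n] unfolding moment_def by simp
  have Cb: "(\<integral>\<^sup>+\<omega>. ennreal ((Ys n s z \<omega>)\<^sup>2) \<partial>M) \<le> ennreal (C n)" if "s \<in> {0..T}" for n s z
    using C[of n] that unfolding moment_def by simp
  note Ym = field_random_variable[OF Ys(1)]
  have contraction: "distance_le (?e (A / 4)) (Ys (Suc m)) (Ys (Suc n))" if "distance_le (?e A) (Ys m) (Ys n)" "0 \<le> A" for A m n
    by (rule picard_contraction[OF Ys(1) C Ys(1) C Ys(3) Ys(3) that])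
  define a where "a = 2 * C 1 + 2 * C 0"
  have a0: "0 \<le> a" unfolding a_def using C0 by simp
  have exp1: "A \<le> ?e A s" if "0 \<le> A" "s \<in> {0..T}" for A s
    using that \<beta>_pos by (simp add: mult_le_cancel_left1)
  have d1: "distance_le (?e a) (Ys 1) (Ys 0)"
    unfolding distance_le_def
  proof (intro ballI allI)
    fix s z assume s: "s \<in> {0..T}"
    have "(\<integral>\<^sup>+\<omega>. ennreal ((Ys 1 s z \<omega> - Ys 0 s z \<omega>)\<^sup>2) \<partial>M) \<le> ennreal a"
      unfolding a_def by (rule second_moment_diff_le[OF Ym[OF s] Ym[OF s] Cb[OF s] Cb[OF s] C0 C0])
    then show "(\<integral>\<^sup>+\<omega>. ennreal ((Ys 1 s z \<omega> - Ys 0 s z \<omega>)\<^sup>2) \<partial>M) \<le> ennreal (?e a s)"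
      by (rule order_trans[OF _ ennreal_leI[OF exp1[OF a0 s]]])
  qed
  \<comment> \<open>The constant \<open>4 * a\<close> reproduces itself: contraction turns it into
    \<open>a\<close>, the first step adds another \<open>a\<close>, and the squared triangle
    inequality gives \<open>2 * a + 2 * a\<close>.\<close>
  have d0: "distance_le (?e (4 * a)) (Ys m) (Ys 0)" for m
  proof (induction m)
    case 0
    then show ?case unfolding distance_le_def by simp
  next
    case (Suc m)
    have c: "distance_le (?e a) (Ys (Suc m)) (Ys 1)" using contraction[OF Suc] a0 by simp
    show ?case unfolding distance_le_def
    proof (intro ballI allI)
      fix s z assume s: "s \<in> {0..T}"
      have "(\<integral>\<^sup>+\<omega>. ennreal ((Ys (Suc m) s z \<omega> - Ys 0 s z \<omega>)\<^sup>2) \<partial>M) \<le> ennreal (2 * ?e a s + 2 * ?e a s)"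
        by (rule second_moment_triangle[OF Ym[OF s, of "Suc m"] Ym[OF s, of 1] Ym[OF s, of 0]])
          (use c d1 s a0 in \<open>auto simp: distance_le_def\<close>)
      then show "(\<integral>\<^sup>+\<omega>. ennreal ((Ys (Suc m) s z \<omega> - Ys 0 s z \<omega>)\<^sup>2) \<partial>M) \<le> ennreal (?e (4 * a) s)"
        by (simp add: algebra_simps)
    qed
  qed
  have dk: "distance_le (?e (4 * a * (1 / 4) ^ k)) (Ys (k + j)) (Ys k)" for k j
  proof (induction k)
    case 0
    then show ?case using d0 by simp
  next
    case (Suc k)
    then show ?case using contraction[OF Suc] a0 by simp
  qed
  define Y where "Y = (\<lambda>s z \<omega>. lim (\<lambda>k. Ys k s z \<omega>))"
  have Yprog: "progressive_field T F Y"
    unfolding progressive_field_iff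
  proof
    fix u assume u: "u \<in> {0..T}"
    let ?P = "F u \<Otimes>\<^sub>M (borel :: real measure) \<Otimes>\<^sub>M (borel :: real measure)"
    have ind: "(\<lambda>w. indicator {0..u} (fst (snd w)) :: real) \<in> borel_measurable ?P" by measurable
    have "(\<lambda>w. indicator {0..u} (fst (snd w)) * lim (\<lambda>k. indicator {0..u} (fst (snd w)) * Ys k (fst (snd w)) (snd (snd w)) (fst w))) \<in> borel_measurable ?P"
      by (intro borel_measurable_times[OF ind borel_measurable_lim_metric] field_measurable[OF Ys(1) u])
    then show "(\<lambda>(\<omega>, s, x). indicator {0..u} s * Y s x \<omega>) \<in> borel_measurable ?P"
      by (rule measurable_cong[THEN iffD1, rotated]) (auto simp: Y_def indicator_def)
  qed
  have dY: "distance_le (?e (4 * a * (1 / 4) ^ k)) Y (Ys k)" for k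
    unfolding distance_le_def
  proof (intro ballI allI)
    fix s z assume s: "s \<in> {0..T}"
    have "(\<integral>\<^sup>+\<omega>. ennreal ((lim (\<lambda>k. Ys k s z \<omega>) - Ys k s z \<omega>)\<^sup>2) \<partial>M) \<le> ennreal (?e (4 * a) s * (1 / 4) ^ k)"
    proof (rule L2_fast_convergence(2)[OF Ym[OF s]])
      show "0 \<le> ?e (4 * a) s" using a0 by simp
      fix k m :: nat assume "k \<le> m"
      then show "(\<integral>\<^sup>+\<omega>. ennreal ((Ys m s z \<omega> - Ys k s z \<omega>)\<^sup>2) \<partial>M) \<le> ennreal (?e (4 * a) s * (1 / 4) ^ k)"
        using dk[of k "m - k"] s unfolding distance_le_def by (simp add: mult_ac)
    qed
    then show "(\<integral>\<^sup>+\<omega>. ennreal ((Y s z \<omega> - Ys k s z \<omega>)\<^sup>2) \<partial>M) \<le> ennreal (?e (4 * a * (1 / 4) ^ k) s)"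
      unfolding Y_def by (simp add: mult_ac)
  qed
  have Ymom: "moment (2 * ?e (4 * a) T + 2 * C 0) Y"
    unfolding moment_def
  proof (intro conjI ballI allI)
    show "0 \<le> 2 * ?e (4 * a) T + 2 * C 0" using a0 C0 by simp
    fix s z assume s: "s \<in> {0..T}"
    have le: "?e (4 * a) s \<le> ?e (4 * a) T" using s a0 \<beta>_pos by (intro mult_left_mono) auto
    have d: "(\<integral>\<^sup>+\<omega>. ennreal ((Y s z \<omega> - Ys 0 s z \<omega>)\<^sup>2) \<partial>M) \<le> ennreal (?e (4 * a) T)"
      using dY[of 0] s order_trans[OF _ ennreal_leI[OF le]] unfolding distance_le_def by simp
    have m: "(\<lambda>\<omega>. Y s z \<omega> - Ys 0 s z \<omega>) \<in> borel_measurable M"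
      using field_random_variable[OF Yprog s] Ym[OF s] by simp
    from second_moment_add_le[OF m Ym[OF s, where x = z] d Cb[OF s, of 0] _ C0]
    show "(\<integral>\<^sup>+\<omega>. ennreal ((Y s z \<omega>)\<^sup>2) \<partial>M) \<le> ennreal (2 * ?e (4 * a) T + 2 * C 0)" using a0 by simp
  qed
  \<comment> \<open>The limit \<open>Y\<close> is not yet known to satisfy the equation. One Picard
    step from \<open>Y\<close> produces \<open>Z\<close>, which satisfies it with \<open>Y\<close>
    on the right-hand side, so it remains to see that \<open>Z\<close> and \<open>Y\<close> agree
    almost surely at each point.\<close>
  obtain Z C' where Z: "picard Y Z" "moment C' Z" using picard_step[OF Yprog Ymom] by blast
  have Zprog: "progressive_field T F Z" using Z(1) unfolding picard_def by simp
  have YZ: "AE \<omega> in M. Y s z \<omega> = Z s z \<omega>" if s: "s \<in> {0..T}" for s z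
  proof -
    have ym: "Y s z \<in> borel_measurable M" "Z s z \<in> borel_measurable M"
      using field_random_variable[OF Yprog s] field_random_variable[OF Zprog s] by auto
    let ?I = "\<integral>\<^sup>+\<omega>. ennreal ((Z s z \<omega> - Y s z \<omega>)\<^sup>2) \<partial>M"
    \<comment> \<open>\<open>Z\<close> and \<open>Ys (Suc k)\<close> are Picard images of
      \<open>Y\<close> and \<open>Ys k\<close>. Both \<open>Z\<close> and \<open>Y\<close> are
      therefore close to the same iterate.\<close>
    have b: "?I \<le> ennreal (4 * ?e a s * (1 / 4) ^ k)" for k
    proof -
      have c1: "distance_le (?e (4 * a * (1 / 4) ^ k / 4)) Z (Ys (Suc k))"
        using a0 by (intro picard_contraction[OF Yprog Ymom Ys(1) C Z(1) Ys(3) dY]) simp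
      have c1': "(\<integral>\<^sup>+\<omega>. ennreal ((Z s z \<omega> - Ys (Suc k) s z \<omega>)\<^sup>2) \<partial>M) \<le> ennreal (?e a s * (1 / 4) ^ k)"
        using c1 s unfolding distance_le_def by (simp add: mult_ac)
      have c2: "(\<integral>\<^sup>+\<omega>. ennreal ((Ys (Suc k) s z \<omega> - Y s z \<omega>)\<^sup>2) \<partial>M) \<le> ennreal (?e a s * (1 / 4) ^ k)"
        using dY[of "Suc k"] s unfolding distance_le_def by (simp add: mult_ac power2_commute)
      have "?I \<le> ennreal (2 * (?e a s * (1 / 4) ^ k) + 2 * (?e a s * (1 / 4) ^ k))"
        by (rule second_moment_triangle[OF ym(2) Ym[OF s] ym(1) c1' c2]) (use a0 in auto)
      then show ?thesis by (simp add: algebra_simps)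
    qed
    have "(\<lambda>k. 4 * ?e a s * (1 / 4 :: real) ^ k) \<longlonglongrightarrow> 4 * ?e a s * 0"
      by (intro tendsto_mult tendsto_const LIMSEQ_realpow_zero) auto
    then have "(\<lambda>k. ennreal (4 * ?e a s * (1 / 4) ^ k)) \<longlonglongrightarrow> ennreal 0" by (intro tendsto_ennrealI) simp
    then have "?I \<le> ennreal 0" by (rule LIMSEQ_le_const) (use b in blast)
    then have "?I = 0" by simp
    then have "AE \<omega> in M. ennreal ((Z s z \<omega> - Y s z \<omega>)\<^sup>2) = 0"
      using ym by (subst (asm) nn_integral_0_iff_AE) auto
    then show ?thesis by eventually_elim simp
  qed
  obtain R where int: "\<And>t x. integrable lborel (\<lambda>z. K t x z * \<xi> z)" using initial_data_bound by metis
  have "mild_solution M T F B a1 a2 \<rho>1 \<rho>2 b \<sigma> \<xi> Y"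
    unfolding mild_solution_def
  proof (intro conjI ballI allI)
    show "progressive_field T F Y" by (rule Yprog)
    show "AE \<omega> in M. Y 0 x \<omega> = \<xi> x" for x
      using YZ[of 0 x] Z(1) T_pos unfolding picard_def by simp
    fix t x assume "t \<in> {0<..T}"
    then have t: "0 < t" "0 \<le> t" "t \<le> T" "t \<in> {0..T}" by auto
    show "integrable lborel (\<lambda>z. K t x z * \<xi> z)" by (rule int)
    show "AE \<omega> in M. (\<integral>\<^sup>+ s\<in>{0..t}. (\<integral>\<^sup>+ z. ennreal \<bar>K (t - s) x z * b \<omega> s z (Y s z \<omega>)\<bar> \<partial>lborel) \<partial>lborel) < \<infinity>"
      using nconv_finite[OF admissible_b Yprog Ymom t(2,3), of x] unfolding nconv_def by eventually_elim simp
    show "AE \<omega> in M. (\<integral>\<^sup>+ s\<in>{0..t}. (\<integral>\<^sup>+ z. ennreal \<bar>K (t - s) x z * \<sigma> \<omega> s z (Y s z \<omega>)\<bar> \<partial>lborel)\<^sup>2 \<partial>lborel) < \<infinity>"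
      using nconv_finite[OF admissible_\<sigma> Yprog Ymom t(2,3), of x] unfolding nconv_def by eventually_elim simp
    obtain J where J: "has_ito_integral M F B t (conv \<sigma> Y t x) J" "\<And>\<omega>. Z t x \<omega> = initial t x + drift Y t x \<omega> + J \<omega>"
      using Z(1) t unfolding picard_def by blast
    have cv: "(\<lambda>s \<omega>. LINT z|lborel. K (t - s) x z * \<sigma> \<omega> s z (Y s z \<omega>)) = conv \<sigma> Y t x" by (intro ext) (simp add: conv_def)
    show "\<exists>J. has_ito_integral M F B t (\<lambda>s \<omega>. LINT z|lborel. K (t - s) x z * \<sigma> \<omega> s z (Y s z \<omega>)) J \<and>
      (AE \<omega> in M. Y t x \<omega> = (LINT z|lborel. K t x z * \<xi> z) + (LINT s:{0..t}|lborel. LINT z|lborel. K (t - s) x z * b \<omega> s z (Y s z \<omega>)) + J \<omega>)"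
      unfolding cv
    proof (intro exI conjI)
      show "has_ito_integral M F B t (conv \<sigma> Y t x) J" by (rule J(1))
      show "AE \<omega> in M. Y t x \<omega> = (LINT z|lborel. K t x z * \<xi> z) + (LINT s:{0..t}|lborel. LINT z|lborel. K (t - s) x z * b \<omega> s z (Y s z \<omega>)) + J \<omega>"
        using YZ[OF t(4), of x] by eventually_elim (simp add: J(2) initial_def drift_def conv_def)
    qed
  qed
  then show ?thesis by blast
qed

end

section \<open>Gaussian weights\<close>

lemma ennreal_mult4:
  assumes "0 \<le> a" "0 \<le> b" "0 \<le> c" "0 \<le> d"
  shows "ennreal (a * b * c * d) = ennreal a * ennreal b * ennreal c * ennreal d"
  using assms by (simp add: ennreal_mult)

text \<open>Completing the square. The product of Gaussians with variances \<open>R\<close> and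
  \<tau> is a Gaussian in \<eta> of variance \<open>R + \<tau>\<close> times a Gaussian in
  \<open>y\<close> whose mean and variance are those of the Brownian bridge between the two.\<close>

lemma gaussian_product:
  fixes R \<tau> y \<eta> :: real
  assumes "R > 0" "\<tau> > 0"
  shows "exp (- (y\<^sup>2 / (2 * R))) * exp (- ((y - \<eta>)\<^sup>2 / (2 * \<tau>)))
    = exp (- (\<eta>\<^sup>2 / (2 * (R + \<tau>)))) * exp (- ((y - \<eta> * R / (R + \<tau>))\<^sup>2 / (2 * (R * \<tau> / (R + \<tau>)))))"
proof -
  have S: "R + \<tau> > 0" using assms by simp
  have "y\<^sup>2 / (2 * R) + (y - \<eta>)\<^sup>2 / (2 * \<tau>) = (y\<^sup>2 * \<tau> + (y - \<eta>)\<^sup>2 * R) / (2 * R * \<tau>)"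
    using assms by (simp add: field_simps)
  also have "\<dots> = (\<eta>\<^sup>2 * R * \<tau> + (y * (R + \<tau>) - \<eta> * R)\<^sup>2) / (2 * R * \<tau> * (R + \<tau>))"
  proof -
    have "(y\<^sup>2 * \<tau> + (y - \<eta>)\<^sup>2 * R) * (R + \<tau>) = \<eta>\<^sup>2 * R * \<tau> + (y * (R + \<tau>) - \<eta> * R)\<^sup>2"
      by (simp add: power2_eq_square algebra_simps)
    then show ?thesis using S assms by (simp add: frac_eq_eq)
  qed
  also have "\<dots> = \<eta>\<^sup>2 / (2 * (R + \<tau>)) + (y * (R + \<tau>) - \<eta> * R)\<^sup>2 / (2 * R * \<tau> * (R + \<tau>))"
    using assms S by (simp add: add_divide_distrib)
  also have "(y * (R + \<tau>) - \<eta> * R)\<^sup>2 / (2 * R * \<tau> * (R + \<tau>)) = (y - \<eta> * R / (R + \<tau>))\<^sup>2 / (2 * (R * \<tau> / (R + \<tau>)))"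
  proof -
    have "y * (R + \<tau>) - \<eta> * R = (y - \<eta> * R / (R + \<tau>)) * (R + \<tau>)" using S by (simp add: field_simps)
    then have "(y * (R + \<tau>) - \<eta> * R)\<^sup>2 = (y - \<eta> * R / (R + \<tau>))\<^sup>2 * (R + \<tau>)\<^sup>2" by (simp add: power_mult_distrib)
    then show ?thesis using S assms by (simp add: power2_eq_square)
  qed
  finally show ?thesis by (simp add: exp_add[symmetric] exp_minus_inverse)
qed

text \<open>Dividing the product formula by a Gaussian turns it into the action of the heat kernel on the
  growing solution \<open>exp (y\<^sup>2 / (2 (T - t))) / sqrt (T - t)\<close> of the heat equation.\<close>

lemma gaussian_growing_product:
  fixes R \<tau> y \<eta> :: real
  assumes "R > 0" "\<tau> > 0"
  shows "exp (\<eta>\<^sup>2 / (2 * (R + \<tau>))) * exp (- ((y - \<eta>)\<^sup>2 / (2 * \<tau>)))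
    = exp (y\<^sup>2 / (2 * R)) * exp (- ((y - \<eta> * R / (R + \<tau>))\<^sup>2 / (2 * (R * \<tau> / (R + \<tau>)))))"
proof -
  have "exp (\<eta>\<^sup>2 / (2 * (R + \<tau>))) * exp (- ((y - \<eta>)\<^sup>2 / (2 * \<tau>)))
     = exp (\<eta>\<^sup>2 / (2 * (R + \<tau>))) * exp (y\<^sup>2 / (2 * R)) * (exp (- (y\<^sup>2 / (2 * R))) * exp (- ((y - \<eta>)\<^sup>2 / (2 * \<tau>))))"
    by (simp add: exp_minus)
  also have "\<dots> = exp (\<eta>\<^sup>2 / (2 * (R + \<tau>))) * exp (y\<^sup>2 / (2 * R)) * (exp (- (\<eta>\<^sup>2 / (2 * (R + \<tau>)))) * exp (- ((y - \<eta> * R / (R + \<tau>))\<^sup>2 / (2 * (R * \<tau> / (R + \<tau>))))))"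
    unfolding gaussian_product[OF assms] ..
  also have "\<dots> = exp (y\<^sup>2 / (2 * R)) * exp (- ((y - \<eta> * R / (R + \<tau>))\<^sup>2 / (2 * (R * \<tau> / (R + \<tau>)))))"
    by (simp add: exp_minus)
  finally show ?thesis .
qed

lemma nn_integral_gaussian:
  assumes "v > 0"
  shows "(\<integral>\<^sup>+y. ennreal (exp (- ((y - m)\<^sup>2 / (2 * v)))) \<partial>lborel) = ennreal (sqrt (2 * pi * v))"
proof -
  have "exp (- ((y - m)\<^sup>2 / (2 * v))) = sqrt (2 * pi * v) * normal_density m (sqrt v) y" for y
    using assms unfolding normal_density_def by simp
  then have "(\<integral>\<^sup>+y. ennreal (exp (- ((y - m)\<^sup>2 / (2 * v)))) \<partial>lborel) = (\<integral>\<^sup>+y. ennreal (sqrt (2 * pi * v)) * ennreal (normal_density m (sqrt v) y) \<partial>lborel)"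
    using assms by (simp add: ennreal_mult')
  also have "\<dots> = ennreal (sqrt (2 * pi * v)) * (\<integral>\<^sup>+y. ennreal (normal_density m (sqrt v) y) \<partial>lborel)"
    by (rule nn_integral_cmult) measurable
  also have "(\<integral>\<^sup>+y. ennreal (normal_density m (sqrt v) y) \<partial>lborel) = 1"
    using assms by (simp add: nn_integral_eq_integral)
  finally show ?thesis by simp
qed

context diffusion_kernel
begin

text \<open>The square of an unnormalized Gaussian of variance \<open>S - t\<close> in
  \<open>h x\<close>. In a second moment each of the two kernels takes one of the square
  roots.\<close>

definition weight :: "real \<Rightarrow> real \<Rightarrow> real \<Rightarrow> real" where
  "weight S t x = exp (- ((h x)\<^sup>2 / (S - t)))"

lemma weight_measurable[measurable]: "(\<lambda>y. weight S (fst y) (snd y)) \<in> borel_measurable (borel \<Otimes>\<^sub>M borel)"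
  unfolding weight_def by measurable

lemma weight_pos: "weight S t x > 0" by (simp add: weight_def)

lemma weight_split: "weight S t x = exp (- ((h x)\<^sup>2 / (2 * (S - t)))) * exp (- ((h x)\<^sup>2 / (2 * (S - t))))"
proof -
  have "c / r = c / (2 * r) + c / (2 * r)" for c r :: real by (cases "r = 0") (simp_all add: field_simps)
  from this[of "(h x)\<^sup>2" "S - t"] show ?thesis unfolding weight_def exp_add[symmetric] by simp
qed

text \<open>The cost of replacing an unnormalized Gaussian by the kernel ending at the origin: its
  normalization, bounded uniformly for times up to \<open>S\<close>, over the lower constant in
  \<open>K_bounds\<close>.\<close>

definition \<kappa> :: "real \<Rightarrow> real" where
  "\<kappa> S = sqrt (2 * pi * S) / (1 - lam0)"

lemma \<kappa>_pos: "S > 0 \<Longrightarrow> \<kappa> S > 0"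
  unfolding \<kappa>_def using abs_lam_less by simp

lemma gaussian_le_K:
  assumes "0 < r" "r \<le> S"
  shows "\<nu> z * exp (- ((h z)\<^sup>2 / (2 * r))) \<le> \<kappa> S * K r 0 z"
proof -
  have l: "1 - lam0 > 0" using abs_lam_less by simp
  let ?q = "\<nu> z * exp (- ((h z)\<^sup>2 / (2 * r)))"
  have q: "0 \<le> ?q" using \<nu>_pos[of z] by simp
  have "h 0 = 0" by (simp add: h_fun_def)
  then have g: "gauss r 0 z = ?q / sqrt (2 * pi * r)" using assms unfolding gauss_def by simp
  have "?q = sqrt (2 * pi * r) * gauss r 0 z" unfolding g using assms by simp
  also have "\<dots> \<le> sqrt (2 * pi * S) * gauss r 0 z" using assms gauss_nonneg by (intro mult_right_mono) auto
  also have "gauss r 0 z \<le> K r 0 z / (1 - lam0)" using K_bounds(1)[of r 0 z] l by (simp add: field_simps)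
  then have "sqrt (2 * pi * S) * gauss r 0 z \<le> sqrt (2 * pi * S) * (K r 0 z / (1 - lam0))"
    using assms by (intro mult_left_mono) auto
  finally show ?thesis unfolding \<kappa>_def by simp
qed

lemma K_le_gaussian:
  assumes "\<tau> > 0"
  shows "K \<tau> x z \<le> 2 * (\<nu> z / sqrt (2 * pi * \<tau>) * exp (- ((h x - h z)\<^sup>2 / (2 * \<tau>))))"
  using K_bounds(2)[of \<tau> x z] assms unfolding gauss_def by simp

text \<open>Half of the weight turns a kernel that starts from \<open>z\<close> at time
  \<open>s\<close> into a Gaussian in \<open>h z\<close> of variance \<open>S - s\<close>, the shape
  of the kernel ending at \<open>(S, 0)\<close>, times a Gaussian in \<open>h x\<close>.\<close>

lemma weighted_K_le:
  assumes "t < S" "s < t"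
  shows "exp (- ((h x)\<^sup>2 / (2 * (S - t)))) * K (t - s) x z
    \<le> 2 * (\<nu> z * exp (- ((h z)\<^sup>2 / (2 * (S - s))))) / sqrt (2 * pi * (t - s)) *
       exp (- ((h x - h z * (S - t) / (S - s))\<^sup>2 / (2 * ((S - t) * (t - s) / (S - s)))))"
proof -
  have R: "S - t > 0" and \<tau>: "t - s > 0" using assms by auto
  have sum: "S - t + (t - s) = S - s" by simp
  have "exp (- ((h x)\<^sup>2 / (2 * (S - t)))) * K (t - s) x z
     \<le> exp (- ((h x)\<^sup>2 / (2 * (S - t)))) * (2 * (\<nu> z / sqrt (2 * pi * (t - s)) * exp (- ((h x - h z)\<^sup>2 / (2 * (t - s))))))"
    by (intro mult_left_mono K_le_gaussian \<tau>) simp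
  also have "\<dots> = 2 * \<nu> z / sqrt (2 * pi * (t - s)) * (exp (- ((h x)\<^sup>2 / (2 * (S - t)))) * exp (- ((h x - h z)\<^sup>2 / (2 * (t - s)))))" by simp
  also have "\<dots> = 2 * (\<nu> z * exp (- ((h z)\<^sup>2 / (2 * (S - s))))) / sqrt (2 * pi * (t - s)) *
       exp (- ((h x - h z * (S - t) / (S - s))\<^sup>2 / (2 * ((S - t) * (t - s) / (S - s)))))"
    unfolding gaussian_product[OF R \<tau>, of "h x" "h z"] sum by simp
  finally show ?thesis .
qed

text \<open>Both kernels are converted by \<open>weighted_K_le\<close>. The Gaussian in
  \<open>x\<close> left by the first is bounded by 1, which costs \<open>1 / sqrt (t - s)\<close>;
  integrating the one left by the second cancels its normalization. Only one of the two
  singularities survives, and it is integrable in \<open>t\<close>.\<close>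

lemma two_kernel_bound:
  assumes s: "0 \<le> s" "s < t" "0 \<le> s'" "s' < t" and t: "t < S"
  shows "(\<integral>\<^sup>+x. ennreal (weight S t x) * ennreal (K (t - s) x z) * ennreal (K (t - s') x z') \<partial>lborel)
    \<le> ennreal (4 * dmax * (\<kappa> S)\<^sup>2 / sqrt (2 * pi)) * ennreal (1 / sqrt (t - s)) * ennreal (K (S - s) 0 z) * ennreal (K (S - s') 0 z')"
proof -
  have S: "S > 0" using s t by simp
  let ?A = "\<nu> z * exp (- ((h z)\<^sup>2 / (2 * (S - s))))" and ?A' = "\<nu> z' * exp (- ((h z')\<^sup>2 / (2 * (S - s'))))"
  let ?v = "(S - t) * (t - s') / (S - s')" and ?m = "h z' * (S - t) / (S - s')"
  let ?g = "\<lambda>y. exp (- ((y - ?m)\<^sup>2 / (2 * ?v)))"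
  have A: "0 \<le> ?A" "0 \<le> ?A'" and nn: "0 \<le> \<nu> z" "0 \<le> \<nu> z'"
    using \<nu>_pos[of z] \<nu>_pos[of z'] by auto
  have v: "0 < ?v" "?v \<le> t - s'"
  proof -
    show "0 < ?v" using s t by simp
    have "(S - t) / (S - s') \<le> 1" using s t by simp
    then have "(S - t) / (S - s') * (t - s') \<le> 1 * (t - s')" using s by (intro mult_right_mono) auto
    then show "?v \<le> t - s'" by simp
  qed
  let ?c = "4 * ?A * ?A' / (sqrt (2 * pi * (t - s)) * sqrt (2 * pi * (t - s')))"
  have c0: "0 \<le> ?c" using A s nn by (intro divide_nonneg_nonneg mult_nonneg_nonneg) auto
  have pw: "weight S t x * K (t - s) x z * K (t - s') x z' \<le> ?c * ?g (h x)" for x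
  proof -
    \<comment> \<open>The first factor gives up its decay in \<open>x\<close>; the decay of the
      second alone makes the integral converge.\<close>
    have 1: "exp (- ((h x)\<^sup>2 / (2 * (S - t)))) * K (t - s) x z \<le> 2 * ?A / sqrt (2 * pi * (t - s))"
    proof (rule order_trans[OF weighted_K_le[OF t s(2)]])
      have "exp (- ((h x - h z * (S - t) / (S - s))\<^sup>2 / (2 * ((S - t) * (t - s) / (S - s))))) \<le> 1"
        using s t by simp
      then have "2 * ?A / sqrt (2 * pi * (t - s)) * exp (- ((h x - h z * (S - t) / (S - s))\<^sup>2 / (2 * ((S - t) * (t - s) / (S - s))))) \<le> 2 * ?A / sqrt (2 * pi * (t - s)) * 1"
        using A s nn by (intro mult_left_mono divide_nonneg_nonneg mult_nonneg_nonneg) auto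
      then show "2 * ?A / sqrt (2 * pi * (t - s)) * exp (- ((h x - h z * (S - t) / (S - s))\<^sup>2 / (2 * ((S - t) * (t - s) / (S - s))))) \<le> 2 * ?A / sqrt (2 * pi * (t - s))"
        by simp
    qed
    have "weight S t x * K (t - s) x z * K (t - s') x z'
      = (exp (- ((h x)\<^sup>2 / (2 * (S - t)))) * K (t - s) x z) * (exp (- ((h x)\<^sup>2 / (2 * (S - t)))) * K (t - s') x z')"
      unfolding weight_split by (simp add: mult_ac)
    also have "\<dots> \<le> (2 * ?A / sqrt (2 * pi * (t - s))) * (2 * ?A' / sqrt (2 * pi * (t - s')) * ?g (h x))"
      using A s nn by (intro mult_mono 1 weighted_K_le[OF t s(4)]) (auto intro!: mult_nonneg_nonneg divide_nonneg_nonneg K_nonneg)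
    also have "\<dots> = ?c * ?g (h x)" by simp
    finally show ?thesis .
  qed
  have "(\<integral>\<^sup>+x. ennreal (weight S t x) * ennreal (K (t - s) x z) * ennreal (K (t - s') x z') \<partial>lborel)
     \<le> (\<integral>\<^sup>+x. ennreal ?c * ennreal (?g (h x)) \<partial>lborel)"
  proof (rule nn_integral_mono)
    fix x
    have "ennreal (weight S t x) * ennreal (K (t - s) x z) * ennreal (K (t - s') x z') = ennreal (weight S t x * K (t - s) x z * K (t - s') x z')"
      using weight_pos[of S t x] K_nonneg by (simp add: ennreal_mult less_imp_le)
    also have "\<dots> \<le> ennreal (?c * ?g (h x))" by (intro ennreal_leI pw)
    also have "\<dots> = ennreal ?c * ennreal (?g (h x))" using c0 by (intro ennreal_mult) auto
    finally show "ennreal (weight S t x) * ennreal (K (t - s) x z) * ennreal (K (t - s') x z') \<le> ennreal ?c * ennreal (?g (h x))" .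
  qed
  also have "\<dots> = ennreal ?c * (\<integral>\<^sup>+x. (\<lambda>y. ennreal (?g y)) (h x) \<partial>lborel)" by (rule nn_integral_cmult) measurable
  also have "\<dots> \<le> ennreal ?c * (ennreal dmax * (\<integral>\<^sup>+y. ennreal (?g y) \<partial>lborel))"
    by (intro mult_left_mono nn_integral_h_le) auto
  also have "\<dots> = ennreal ?c * (ennreal dmax * ennreal (sqrt (2 * pi * ?v)))"
    by (simp only: nn_integral_gaussian[OF v(1)])
  also have "\<dots> = ennreal (?c * (dmax * sqrt (2 * pi * ?v)))"
  proof -
    have "ennreal (?c * (dmax * sqrt (2 * pi * ?v))) = ennreal ?c * ennreal (dmax * sqrt (2 * pi * ?v))"
      using v by (intro ennreal_mult c0 mult_nonneg_nonneg less_imp_le[OF dmax_pos] real_sqrt_ge_zero) auto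
    also have "ennreal (dmax * sqrt (2 * pi * ?v)) = ennreal dmax * ennreal (sqrt (2 * pi * ?v))"
      using v by (intro ennreal_mult less_imp_le[OF dmax_pos] real_sqrt_ge_zero mult_nonneg_nonneg) auto
    finally show ?thesis by simp
  qed
  also have "\<dots> \<le> ennreal (4 * dmax * (\<kappa> S)\<^sup>2 / sqrt (2 * pi) * (1 / sqrt (t - s)) * K (S - s) 0 z * K (S - s') 0 z')"
  proof (rule ennreal_leI)
    have "?c * (dmax * sqrt (2 * pi * ?v)) \<le> ?c * (dmax * sqrt (2 * pi * (t - s')))"
    proof -
      have "sqrt (2 * pi * ?v) \<le> sqrt (2 * pi * (t - s'))" by (intro real_sqrt_le_mono mult_left_mono v(2)) auto
      then show ?thesis by (intro mult_left_mono c0 less_imp_le[OF dmax_pos])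
    qed
    also have "\<dots> = 4 * dmax / (sqrt (2 * pi) * sqrt (t - s)) * (?A * ?A')"
    proof -
      \<comment> \<open>The variance of the second Gaussian in \<open>x\<close> is at most
        \<open>t - s'\<close>, so its mass compensates the normalization of the second
        kernel.\<close>
      have cancel: "4 * A * A' / (P * P') * (d * P') = 4 * d / P * (A * A')" if "P' > 0" for A A' P P' d :: real
        using that by simp
      have "sqrt (2 * pi * (t - s)) = sqrt (2 * pi) * sqrt (t - s)" by (rule real_sqrt_mult)
      moreover have "sqrt (2 * pi * (t - s')) > 0" using s by simp
      ultimately show ?thesis using cancel[of "sqrt (2 * pi * (t - s'))" ?A ?A' "sqrt (2 * pi) * sqrt (t - s)" dmax] by (simp only:)
    qed
    also have "\<dots> \<le> 4 * dmax / (sqrt (2 * pi) * sqrt (t - s)) * ((\<kappa> S * K (S - s) 0 z) * (\<kappa> S * K (S - s') 0 z'))"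
      using A dmax_pos s t \<kappa>_pos[OF S] K_nonneg
      by (intro mult_left_mono mult_mono gaussian_le_K) (auto intro!: mult_nonneg_nonneg divide_nonneg_nonneg simp: less_imp_le)
    also have "\<dots> = 4 * dmax * (\<kappa> S)\<^sup>2 / sqrt (2 * pi) * (1 / sqrt (t - s)) * K (S - s) 0 z * K (S - s') 0 z'"
      by (simp add: power2_eq_square)
    finally show "?c * (dmax * sqrt (2 * pi * ?v)) \<le> \<dots>" .
  qed
  also have "\<dots> = ennreal (4 * dmax * (\<kappa> S)\<^sup>2 / sqrt (2 * pi)) * ennreal (1 / sqrt (t - s)) * ennreal (K (S - s) 0 z) * ennreal (K (S - s') 0 z')"
    using dmax_pos s by (intro ennreal_mult4 K_nonneg divide_nonneg_nonneg) auto
  finally show ?thesis .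
qed

end

lemma measurable_two_args:
  assumes "(\<lambda>(s, z). q s z) \<in> borel_measurable (borel \<Otimes>\<^sub>M borel)" "f \<in> borel_measurable N" "g \<in> borel_measurable N"
  shows "(\<lambda>y. q (f y) (g y)) \<in> borel_measurable N"
  using measurable_compose[OF measurable_Pair[OF assms(2,3)] assms(1)] by simp

lemma nn_integral_inverse_sqrt:
  assumes "s \<le> S"
  shows "(\<integral>\<^sup>+t. indicator {s<..<S} t * ennreal (1 / sqrt (t - s)) \<partial>lborel) \<le> ennreal (2 * sqrt (S - s))"
proof -
  let ?c = "S - s"
  have "((\<lambda>x. x powr (- 1 / 2)) has_integral (?c powr (- 1 / 2 + 1) / (- 1 / 2 + 1))) {0..?c}"
    using assms by (intro has_integral_powr_from_0) auto
  then have hi: "((\<lambda>x. x powr (- 1 / 2)) has_integral (2 * sqrt ?c)) {0..?c}"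
    using assms by (simp add: powr_half_sqrt mult.commute)
  have "(\<integral>\<^sup>+x. ennreal (indicator {0..?c} x * x powr (- 1 / 2)) \<partial>lborel) = ennreal (2 * sqrt ?c)"
    by (rule nn_integral_has_integral_lebesgue[OF _ hi]) simp
  have "(\<integral>\<^sup>+t. indicator {s<..<S} t * ennreal (1 / sqrt (t - s)) \<partial>lborel)
     = ennreal \<bar>1\<bar> * (\<integral>\<^sup>+x. indicator {s<..<S} (s + 1 * x) * ennreal (1 / sqrt (s + 1 * x - s)) \<partial>lborel)"
    by (rule nn_integral_real_affine) auto
  also have "\<dots> \<le> (\<integral>\<^sup>+x. ennreal (indicator {0..?c} x * x powr (- 1 / 2)) \<partial>lborel)"
    by (simp, intro nn_integral_mono) (auto simp: indicator_def powr_minus powr_half_sqrt inverse_eq_divide)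
  also have "\<dots> = ennreal (2 * sqrt ?c)" by fact
  finally show ?thesis .
qed

section \<open>The kernel as a bounded operator between weighted spaces\<close>

context diffusion_kernel
begin

text \<open>Up to the factor 2 this is the evolution of the growing heat solution: with remaining
  time \<open>r\<close> it is \<open>exp (y^2 / (2 * r)) / sqrt r\<close>, and time \<tau> takes
  \<open>r\<close> from \<open>R + \<tau>\<close> to \<open>R\<close>. The square root is the ratio
  of the prefactors.\<close>

lemma kernel_on_growing:
  assumes R: "R > 0" and \<tau>: "\<tau> > 0"
  shows "(\<integral>\<^sup>+z. ennreal (K \<tau> x z) * ennreal (exp ((h z)\<^sup>2 / (2 * (R + \<tau>)))) \<partial>lborel)
    \<le> ennreal (2 * sqrt ((R + \<tau>) / R) * exp ((h x)\<^sup>2 / (2 * R)))"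
proof -
  let ?Q = "R + \<tau>" and ?y = "h x"
  have Q: "?Q > 0" using R \<tau> by simp
  let ?g = "\<lambda>\<eta>. exp (- ((\<eta> - ?y * ?Q / R)\<^sup>2 / (2 * (?Q * \<tau> / R))))"
  let ?c = "2 / sqrt (2 * pi * \<tau>) * exp (?y\<^sup>2 / (2 * R))"
  have c0: "0 \<le> ?c" using \<tau> by simp
  \<comment> \<open>The Gaussian is reread as a function of \<eta>, the variable over which the
    integral is taken.\<close>
  have e: "(?y - \<eta> * R / ?Q)\<^sup>2 / (2 * (R * \<tau> / ?Q)) = (\<eta> - ?y * ?Q / R)\<^sup>2 / (2 * (?Q * \<tau> / R))" for \<eta>
  proof -
    have a: "?y - \<eta> * R / ?Q = (?y * ?Q - \<eta> * R) / ?Q" using Q by (simp add: field_simps)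
    have b: "\<eta> - ?y * ?Q / R = - (?y * ?Q - \<eta> * R) / R" using R by (simp add: field_simps)
    show ?thesis unfolding a b power_divide power2_minus using R \<tau> Q by (simp add: power2_eq_square)
  qed
  have pw: "K \<tau> x z * exp ((h z)\<^sup>2 / (2 * ?Q)) \<le> ?c * (?g (h z) * \<nu> z)" for z
  proof -
    have "K \<tau> x z * exp ((h z)\<^sup>2 / (2 * ?Q)) \<le> 2 * (\<nu> z / sqrt (2 * pi * \<tau>) * exp (- ((?y - h z)\<^sup>2 / (2 * \<tau>)))) * exp ((h z)\<^sup>2 / (2 * ?Q))"
      by (intro mult_right_mono K_le_gaussian \<tau>) simp
    also have "\<dots> = 2 * (\<nu> z / sqrt (2 * pi * \<tau>)) * (exp ((h z)\<^sup>2 / (2 * ?Q)) * exp (- ((?y - h z)\<^sup>2 / (2 * \<tau>))))" by simp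
    also have "\<dots> = ?c * (?g (h z) * \<nu> z)" unfolding gaussian_growing_product[OF R \<tau>] e by simp
    finally show ?thesis .
  qed
  have "(\<integral>\<^sup>+z. ennreal (K \<tau> x z) * ennreal (exp ((h z)\<^sup>2 / (2 * ?Q))) \<partial>lborel) \<le> (\<integral>\<^sup>+z. ennreal ?c * (ennreal (?g (h z)) * ennreal (\<nu> z)) \<partial>lborel)"
  proof (rule nn_integral_mono)
    fix z
    have "ennreal (K \<tau> x z) * ennreal (exp ((h z)\<^sup>2 / (2 * ?Q))) = ennreal (K \<tau> x z * exp ((h z)\<^sup>2 / (2 * ?Q)))"
      by (rule ennreal_mult[symmetric]) (auto simp: K_nonneg)
    also have "\<dots> \<le> ennreal (?c * (?g (h z) * \<nu> z))" by (intro ennreal_leI pw)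
    also have "\<dots> = ennreal ?c * ennreal (?g (h z) * \<nu> z)" using \<nu>_pos[of z] by (intro ennreal_mult c0) simp
    also have "ennreal (?g (h z) * \<nu> z) = ennreal (?g (h z)) * ennreal (\<nu> z)" using \<nu>_pos[of z] by (intro ennreal_mult) auto
    finally show "ennreal (K \<tau> x z) * ennreal (exp ((h z)\<^sup>2 / (2 * ?Q))) \<le> ennreal ?c * (ennreal (?g (h z)) * ennreal (\<nu> z))" .
  qed
  also have "\<dots> = ennreal ?c * (\<integral>\<^sup>+z. ennreal (?g (h z)) * ennreal (\<nu> z) \<partial>lborel)" by (rule nn_integral_cmult) measurable
  also have "(\<integral>\<^sup>+z. ennreal (?g (h z)) * ennreal (\<nu> z) \<partial>lborel) = (\<integral>\<^sup>+y. ennreal (?g y) \<partial>lborel)"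
    by (rule nn_integral_h) measurable
  also have "\<dots> = ennreal (sqrt (2 * pi * (?Q * \<tau> / R)))" using R \<tau> Q by (intro nn_integral_gaussian) simp
  also have "ennreal ?c * \<dots> = ennreal (?c * sqrt (2 * pi * (?Q * \<tau> / R)))"
    using R \<tau> Q by (intro ennreal_mult[symmetric] c0 real_sqrt_ge_zero) simp
  also have "?c * sqrt (2 * pi * (?Q * \<tau> / R)) = 2 * sqrt (?Q / R) * exp (?y\<^sup>2 / (2 * R))"
  proof -
    have "2 * pi * (?Q * \<tau> / R) = (2 * pi * \<tau>) * (?Q / R)" by simp
    then have "sqrt (2 * pi * (?Q * \<tau> / R)) = sqrt (2 * pi * \<tau>) * sqrt (?Q / R)" by (simp only: real_sqrt_mult)
    moreover have "2 / P * E * (P * q) = 2 * q * E" if "P > 0" for P E q :: real using that by simp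
    moreover have "sqrt (2 * pi * \<tau>) > 0" using \<tau> by simp
    ultimately show ?thesis by (simp only:)
  qed
  finally show ?thesis .
qed

text \<open>The dual bound, with integration over the end point \<open>x\<close>. Its square root is
  the reciprocal of the one in \<open>kernel_on_growing\<close>.\<close>

lemma decaying_on_kernel:
  assumes "s < t" "t < S"
  shows "(\<integral>\<^sup>+x. ennreal (exp (- ((h x)\<^sup>2 / (2 * (S - t))))) * ennreal (K (t - s) x z) \<partial>lborel)
    \<le> ennreal (2 * dmax * \<nu> z * sqrt ((S - t) / (S - s)) * exp (- ((h z)\<^sup>2 / (2 * (S - s)))))"
proof -
  let ?A = "\<nu> z * exp (- ((h z)\<^sup>2 / (2 * (S - s))))" and ?v = "(S - t) * (t - s) / (S - s)" and ?m = "h z * (S - t) / (S - s)"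
  let ?g = "\<lambda>y. exp (- ((y - ?m)\<^sup>2 / (2 * ?v)))"
  let ?c = "2 * ?A / sqrt (2 * pi * (t - s))"
  have v: "0 < ?v" using assms by simp
  have c0: "0 \<le> ?c" using \<nu>_pos[of z] assms by (intro divide_nonneg_nonneg mult_nonneg_nonneg) auto
  have "(\<integral>\<^sup>+x. ennreal (exp (- ((h x)\<^sup>2 / (2 * (S - t))))) * ennreal (K (t - s) x z) \<partial>lborel) \<le> (\<integral>\<^sup>+x. ennreal ?c * ennreal (?g (h x)) \<partial>lborel)"
  proof (rule nn_integral_mono)
    fix x
    have "ennreal (exp (- ((h x)\<^sup>2 / (2 * (S - t))))) * ennreal (K (t - s) x z) = ennreal (exp (- ((h x)\<^sup>2 / (2 * (S - t)))) * K (t - s) x z)"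
      by (rule ennreal_mult[symmetric]) (auto simp: K_nonneg)
    also have "\<dots> \<le> ennreal (?c * ?g (h x))" by (rule ennreal_leI[OF weighted_K_le[OF assms(2,1)]])
    also have "\<dots> = ennreal ?c * ennreal (?g (h x))" by (intro ennreal_mult c0) simp
    finally show "ennreal (exp (- ((h x)\<^sup>2 / (2 * (S - t))))) * ennreal (K (t - s) x z) \<le> ennreal ?c * ennreal (?g (h x))" .
  qed
  also have "\<dots> = ennreal ?c * (\<integral>\<^sup>+x. (\<lambda>y. ennreal (?g y)) (h x) \<partial>lborel)" by (rule nn_integral_cmult) measurable
  also have "\<dots> \<le> ennreal ?c * (ennreal dmax * (\<integral>\<^sup>+y. ennreal (?g y) \<partial>lborel))"
    by (intro mult_left_mono nn_integral_h_le) auto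
  also have "\<dots> = ennreal ?c * (ennreal dmax * ennreal (sqrt (2 * pi * ?v)))"
    by (simp only: nn_integral_gaussian[OF v])
  also have "\<dots> = ennreal (?c * (dmax * sqrt (2 * pi * ?v)))"
  proof -
    have "ennreal (?c * (dmax * sqrt (2 * pi * ?v))) = ennreal ?c * ennreal (dmax * sqrt (2 * pi * ?v))"
      using v by (intro ennreal_mult c0 mult_nonneg_nonneg less_imp_le[OF dmax_pos] real_sqrt_ge_zero) auto
    also have "ennreal (dmax * sqrt (2 * pi * ?v)) = ennreal dmax * ennreal (sqrt (2 * pi * ?v))"
      using v by (intro ennreal_mult less_imp_le[OF dmax_pos] real_sqrt_ge_zero mult_nonneg_nonneg) auto
    finally show ?thesis by simp
  qed
  also have "?c * (dmax * sqrt (2 * pi * ?v)) = 2 * dmax * \<nu> z * sqrt ((S - t) / (S - s)) * exp (- ((h z)\<^sup>2 / (2 * (S - s))))"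
  proof -
    have "2 * pi * ?v = (2 * pi * (t - s)) * ((S - t) / (S - s))" by simp
    then have "sqrt (2 * pi * ?v) = sqrt (2 * pi * (t - s)) * sqrt ((S - t) / (S - s))" by (simp only: real_sqrt_mult)
    moreover have "2 * (n * E) / P * (d * (P * q)) = 2 * d * n * q * E" if "P > 0" for P E q n d :: real using that by simp
    moreover have "sqrt (2 * pi * (t - s)) > 0" using assms by simp
    ultimately show ?thesis by (simp only:)
  qed
  finally show ?thesis .
qed

text \<open>The factor 4 is the product of the two factors 2 from comparing the kernel with a
  Gaussian; \<open>dmax\<close> and the bound on \<nu> come from changing variables in
  \<open>x\<close>.\<close>

definition smoothing_const :: real where
  "smoothing_const = 4 * dmax * (1 / sqrt a1 + 1 / sqrt a2)"

lemma smoothing_const_pos: "smoothing_const \<ge> 0"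
  unfolding smoothing_const_def using dmax_pos pos by (simp add: less_imp_le)

text \<open>Schur test with the test function \<open>exp ((h z)^2 / (2 * (S - s)))\<close>: after
  Cauchy-Schwarz, \<open>kernel_on_growing\<close> bounds the integral over \<open>z\<close> and
  \<open>decaying_on_kernel\<close> the one over \<open>x\<close>. The time-dependent factors
  cancel, so the constant is uniform in \<open>s < t < S\<close>.\<close>

lemma weighted_smoothing:
  assumes st: "s < t" "t < S" and N[measurable]: "N \<in> borel_measurable borel"
  shows "(\<integral>\<^sup>+x. ennreal (weight S t x) * (\<integral>\<^sup>+z. ennreal \<bar>K (t - s) x z * N z\<bar> \<partial>lborel)\<^sup>2 \<partial>lborel)
    \<le> ennreal smoothing_const * (\<integral>\<^sup>+z. ennreal (weight S s z) * ennreal ((N z)\<^sup>2) \<partial>lborel)"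
proof -
  let ?R = "S - t" and ?\<tau> = "t - s" and ?Q = "S - s"
  have R: "?R > 0" and \<tau>: "?\<tau> > 0" and Q: "?Q > 0" and sum: "?R + ?\<tau> = ?Q" using st by auto
  let ?V = "\<lambda>z. exp ((h z)\<^sup>2 / (2 * ?Q))" and ?E = "\<lambda>z. exp (- ((h z)\<^sup>2 / (2 * ?Q)))"
  let ?D = "\<lambda>x. exp (- ((h x)\<^sup>2 / (2 * ?R)))"
  let ?r = "sqrt (?Q / ?R)"
  have VE: "?V z * ?E z = 1" for z by (simp add: exp_minus)
  have pw: "ennreal (weight S t x) * (\<integral>\<^sup>+z. ennreal \<bar>K ?\<tau> x z * N z\<bar> \<partial>lborel)\<^sup>2
    \<le> ennreal (2 * ?r) * (\<integral>\<^sup>+z. ennreal (?D x) * ennreal (K ?\<tau> x z) * (ennreal (?E z) * ennreal ((N z)\<^sup>2)) \<partial>lborel)" for x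
  proof -
    \<comment> \<open>As \<open>?V\<close> and \<open>?E\<close> are reciprocal, the kernel is split
      into a half with the growing and a half with the decaying factor.\<close>
    have eq: "(\<integral>\<^sup>+z. ennreal \<bar>K ?\<tau> x z * N z\<bar> \<partial>lborel) = (\<integral>\<^sup>+z. ennreal (sqrt (K ?\<tau> x z * ?V z)) * ennreal (sqrt (K ?\<tau> x z * ?E z) * \<bar>N z\<bar>) \<partial>lborel)"
    proof (rule nn_integral_cong)
      fix z
      have "sqrt (K ?\<tau> x z * ?V z) * (sqrt (K ?\<tau> x z * ?E z) * \<bar>N z\<bar>) = sqrt ((K ?\<tau> x z)\<^sup>2 * (?V z * ?E z)) * \<bar>N z\<bar>"
        unfolding mult.assoc[symmetric] real_sqrt_mult[symmetric] by (simp add: power2_eq_square mult_ac)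
      also have "\<dots> = \<bar>K ?\<tau> x z * N z\<bar>" unfolding VE by (simp add: abs_mult)
      finally show "ennreal \<bar>K ?\<tau> x z * N z\<bar> = ennreal (sqrt (K ?\<tau> x z * ?V z)) * ennreal (sqrt (K ?\<tau> x z * ?E z) * \<bar>N z\<bar>)"
        by (subst ennreal_mult[symmetric]) (auto simp: K_nonneg)
    qed
    have "(\<integral>\<^sup>+z. ennreal \<bar>K ?\<tau> x z * N z\<bar> \<partial>lborel)\<^sup>2 \<le> (\<integral>\<^sup>+z. (ennreal (sqrt (K ?\<tau> x z * ?V z)))\<^sup>2 \<partial>lborel) * (\<integral>\<^sup>+z. (ennreal (sqrt (K ?\<tau> x z * ?E z) * \<bar>N z\<bar>))\<^sup>2 \<partial>lborel)"
      unfolding eq by (rule Cauchy_Schwarz_nn_integral) measurable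
    also have "\<dots> = (\<integral>\<^sup>+z. ennreal (K ?\<tau> x z) * ennreal (?V z) \<partial>lborel) * (\<integral>\<^sup>+z. ennreal (K ?\<tau> x z) * (ennreal (?E z) * ennreal ((N z)\<^sup>2)) \<partial>lborel)"
    proof -
      have 1: "(ennreal (sqrt (k * v)))\<^sup>2 = ennreal k * ennreal v" if "0 \<le> k" "0 \<le> v" for k v :: real
        using that by (simp add: ennreal_power ennreal_mult)
      have 2: "(ennreal (sqrt (k * v) * \<bar>n\<bar>))\<^sup>2 = ennreal k * (ennreal v * ennreal (n\<^sup>2))" if "0 \<le> k" "0 \<le> v" for k v n :: real
        using that by (simp add: ennreal_power power_mult_distrib ennreal_mult mult.assoc)
      show ?thesis
        by (intro arg_cong2[where f = "(*)"] nn_integral_cong 1 2 K_nonneg exp_ge_zero)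
    qed
    also have "\<dots> \<le> ennreal (2 * ?r * exp ((h x)\<^sup>2 / (2 * ?R))) * (\<integral>\<^sup>+z. ennreal (K ?\<tau> x z) * (ennreal (?E z) * ennreal ((N z)\<^sup>2)) \<partial>lborel)"
      using kernel_on_growing[OF R \<tau>, of x] unfolding sum by (intro mult_right_mono) auto
    finally have cs: "(\<integral>\<^sup>+z. ennreal \<bar>K ?\<tau> x z * N z\<bar> \<partial>lborel)\<^sup>2 \<le> \<dots>" .
    have "ennreal (weight S t x) * (\<integral>\<^sup>+z. ennreal \<bar>K ?\<tau> x z * N z\<bar> \<partial>lborel)\<^sup>2
      \<le> ennreal (weight S t x) * (ennreal (2 * ?r * exp ((h x)\<^sup>2 / (2 * ?R))) * (\<integral>\<^sup>+z. ennreal (K ?\<tau> x z) * (ennreal (?E z) * ennreal ((N z)\<^sup>2)) \<partial>lborel))"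
      by (intro mult_left_mono cs) simp
    also have "\<dots> = ennreal (weight S t x * (2 * ?r * exp ((h x)\<^sup>2 / (2 * ?R)))) * (\<integral>\<^sup>+z. ennreal (K ?\<tau> x z) * (ennreal (?E z) * ennreal ((N z)\<^sup>2)) \<partial>lborel)"
      using R Q weight_pos[of S t x] by (subst ennreal_mult) (auto simp: mult.assoc less_imp_le)
    also have "weight S t x * (2 * ?r * exp ((h x)\<^sup>2 / (2 * ?R))) = 2 * ?r * ?D x"
      unfolding weight_split by (simp add: exp_minus)
    also have "ennreal (2 * ?r * ?D x) = ennreal (2 * ?r) * ennreal (?D x)" using R Q by (intro ennreal_mult) auto
    also have "ennreal (2 * ?r) * ennreal (?D x) * (\<integral>\<^sup>+z. ennreal (K ?\<tau> x z) * (ennreal (?E z) * ennreal ((N z)\<^sup>2)) \<partial>lborel)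
      = ennreal (2 * ?r) * (\<integral>\<^sup>+z. ennreal (?D x) * ennreal (K ?\<tau> x z) * (ennreal (?E z) * ennreal ((N z)\<^sup>2)) \<partial>lborel)"
      by (subst nn_integral_cmult[symmetric], measurable) (simp add: mult.assoc nn_integral_cmult[symmetric])
    finally show ?thesis .
  qed
  have inner: "(\<integral>\<^sup>+x. ennreal (?D x) * ennreal (K ?\<tau> x z) * (ennreal (?E z) * ennreal ((N z)\<^sup>2)) \<partial>lborel)
     \<le> ennreal (2 * dmax * (1 / sqrt a1 + 1 / sqrt a2) * sqrt (?R / ?Q)) * (ennreal (weight S s z) * ennreal ((N z)\<^sup>2))" for z
  proof -
    have nu: "\<nu> z \<le> 1 / sqrt a1 + 1 / sqrt a2" using pos by (auto simp: \<nu>_def indicator_def)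
    have "(\<integral>\<^sup>+x. ennreal (?D x) * ennreal (K ?\<tau> x z) * (ennreal (?E z) * ennreal ((N z)\<^sup>2)) \<partial>lborel)
      = (\<integral>\<^sup>+x. ennreal (?D x) * ennreal (K ?\<tau> x z) \<partial>lborel) * (ennreal (?E z) * ennreal ((N z)\<^sup>2))"
      by (rule nn_integral_multc) measurable
    also have "\<dots> \<le> ennreal (2 * dmax * \<nu> z * sqrt (?R / ?Q) * ?E z) * (ennreal (?E z) * ennreal ((N z)\<^sup>2))"
      by (intro mult_right_mono decaying_on_kernel st) simp
    also have "\<dots> \<le> ennreal (2 * dmax * (1 / sqrt a1 + 1 / sqrt a2) * sqrt (?R / ?Q) * ?E z) * (ennreal (?E z) * ennreal ((N z)\<^sup>2))"
      using dmax_pos nu R Q by (intro mult_right_mono ennreal_leI mult_left_mono) auto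
    also have "\<dots> = ennreal (2 * dmax * (1 / sqrt a1 + 1 / sqrt a2) * sqrt (?R / ?Q)) * (ennreal (?E z * ?E z) * ennreal ((N z)\<^sup>2))"
      using dmax_pos pos R Q by (subst (1 3) ennreal_mult) (auto simp: mult.assoc)
    also have "?E z * ?E z = weight S s z" unfolding weight_split ..
    finally show ?thesis .
  qed
  have "(\<integral>\<^sup>+x. ennreal (weight S t x) * (\<integral>\<^sup>+z. ennreal \<bar>K ?\<tau> x z * N z\<bar> \<partial>lborel)\<^sup>2 \<partial>lborel)
    \<le> (\<integral>\<^sup>+x. ennreal (2 * ?r) * (\<integral>\<^sup>+z. ennreal (?D x) * ennreal (K ?\<tau> x z) * (ennreal (?E z) * ennreal ((N z)\<^sup>2)) \<partial>lborel) \<partial>lborel)"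
    by (rule nn_integral_mono[OF pw])
  also have "\<dots> = ennreal (2 * ?r) * (\<integral>\<^sup>+x. (\<integral>\<^sup>+z. ennreal (?D x) * ennreal (K ?\<tau> x z) * (ennreal (?E z) * ennreal ((N z)\<^sup>2)) \<partial>lborel) \<partial>lborel)"
    by (rule nn_integral_cmult) measurable
  also have "(\<integral>\<^sup>+x. (\<integral>\<^sup>+z. ennreal (?D x) * ennreal (K ?\<tau> x z) * (ennreal (?E z) * ennreal ((N z)\<^sup>2)) \<partial>lborel) \<partial>lborel)
     = (\<integral>\<^sup>+z. (\<integral>\<^sup>+x. ennreal (?D x) * ennreal (K ?\<tau> x z) * (ennreal (?E z) * ennreal ((N z)\<^sup>2)) \<partial>lborel) \<partial>lborel)"
    by (rule lborel_pair.Fubini') measurable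
  finally have 1: "(\<integral>\<^sup>+x. ennreal (weight S t x) * (\<integral>\<^sup>+z. ennreal \<bar>K ?\<tau> x z * N z\<bar> \<partial>lborel)\<^sup>2 \<partial>lborel)
    \<le> ennreal (2 * ?r) * (\<integral>\<^sup>+z. (\<integral>\<^sup>+x. ennreal (?D x) * ennreal (K ?\<tau> x z) * (ennreal (?E z) * ennreal ((N z)\<^sup>2)) \<partial>lborel) \<partial>lborel)" .
  let ?k = "2 * dmax * (1 / sqrt a1 + 1 / sqrt a2) * sqrt (?R / ?Q)"
  have wm: "(\<lambda>z. ennreal (weight S s z) * ennreal ((N z)\<^sup>2)) \<in> borel_measurable lborel" unfolding weight_def by measurable
  have "(\<integral>\<^sup>+z. (\<integral>\<^sup>+x. ennreal (?D x) * ennreal (K ?\<tau> x z) * (ennreal (?E z) * ennreal ((N z)\<^sup>2)) \<partial>lborel) \<partial>lborel)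
     \<le> (\<integral>\<^sup>+z. ennreal ?k * (ennreal (weight S s z) * ennreal ((N z)\<^sup>2)) \<partial>lborel)" by (rule nn_integral_mono[OF inner])
  also have "\<dots> = ennreal ?k * (\<integral>\<^sup>+z. ennreal (weight S s z) * ennreal ((N z)\<^sup>2) \<partial>lborel)" by (rule nn_integral_cmult[OF wm])
  finally have "ennreal (2 * ?r) * (\<integral>\<^sup>+z. (\<integral>\<^sup>+x. ennreal (?D x) * ennreal (K ?\<tau> x z) * (ennreal (?E z) * ennreal ((N z)\<^sup>2)) \<partial>lborel) \<partial>lborel)
    \<le> ennreal (2 * ?r) * (ennreal ?k * (\<integral>\<^sup>+z. ennreal (weight S s z) * ennreal ((N z)\<^sup>2) \<partial>lborel))" by (rule mult_left_mono) simp
  also have "\<dots> = ennreal (2 * ?r * ?k) * (\<integral>\<^sup>+z. ennreal (weight S s z) * ennreal ((N z)\<^sup>2) \<partial>lborel)"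
  proof -
    have "0 \<le> ?k" using dmax_pos pos R Q by (intro mult_nonneg_nonneg) auto
    then have "ennreal (2 * ?r * ?k) = ennreal (2 * ?r) * ennreal ?k" using R Q by (intro ennreal_mult) auto
    then show ?thesis by (simp only: mult.assoc)
  qed
  \<comment> \<open>The two square roots are reciprocal; a blow-up as \<open>t\<close> approaches
    \<open>S\<close> is avoided here.\<close>
  also have "2 * ?r * ?k = smoothing_const"
  proof -
    have "?r * sqrt (?R / ?Q) = 1" using R Q by (simp add: real_sqrt_mult[symmetric])
    have "2 * ?r * ?k = 4 * dmax * (1 / sqrt a1 + 1 / sqrt a2) * (?r * sqrt (?R / ?Q))" by (simp only: mult_ac) simp
    then show ?thesis unfolding smoothing_const_def \<open>?r * sqrt (?R / ?Q) = 1\<close> by simp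
  qed
  finally show ?thesis using 1 by (rule order_trans[rotated])
qed

end

lemma measurable_three_args:
  assumes "(\<lambda>(a, b, c). f a b c) \<in> borel_measurable (borel \<Otimes>\<^sub>M borel \<Otimes>\<^sub>M borel)"
    "g1 \<in> borel_measurable N" "g2 \<in> borel_measurable N" "g3 \<in> borel_measurable N"
  shows "(\<lambda>y. f (g1 y) (g2 y) (g3 y)) \<in> borel_measurable N"
  using measurable_compose[OF measurable_Pair[OF assms(2) measurable_Pair[OF assms(3,4)]] assms(1)] by simp

lemma nn_integral_swap3:
  fixes f :: "real \<Rightarrow> real \<Rightarrow> real \<Rightarrow> ennreal"
  assumes f: "(\<lambda>(x, s, s'). f x s s') \<in> borel_measurable (borel \<Otimes>\<^sub>M borel \<Otimes>\<^sub>M borel)"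
  shows "(\<integral>\<^sup>+x. \<integral>\<^sup>+s. \<integral>\<^sup>+s'. f x s s' \<partial>lborel \<partial>lborel \<partial>lborel) = (\<integral>\<^sup>+s. \<integral>\<^sup>+s'. \<integral>\<^sup>+x. f x s s' \<partial>lborel \<partial>lborel \<partial>lborel)"
proof -
  note [measurable (raw)] = measurable_three_args[OF f]
  have "(\<integral>\<^sup>+x. \<integral>\<^sup>+s. \<integral>\<^sup>+s'. f x s s' \<partial>lborel \<partial>lborel \<partial>lborel) = (\<integral>\<^sup>+s. \<integral>\<^sup>+x. \<integral>\<^sup>+s'. f x s s' \<partial>lborel \<partial>lborel \<partial>lborel)"
    by (rule lborel_pair.Fubini') measurable
  also have "\<dots> = (\<integral>\<^sup>+s. \<integral>\<^sup>+s'. \<integral>\<^sup>+x. f x s s' \<partial>lborel \<partial>lborel \<partial>lborel)"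
    by (intro nn_integral_cong lborel_pair.Fubini') measurable
  finally show ?thesis .
qed

lemma nn_integral_product:
  fixes f g :: "real \<Rightarrow> ennreal"
  assumes [measurable]: "f \<in> borel_measurable borel" "g \<in> borel_measurable borel"
  shows "c * ((\<integral>\<^sup>+s. f s \<partial>lborel) * (\<integral>\<^sup>+s. g s \<partial>lborel)) = (\<integral>\<^sup>+s. \<integral>\<^sup>+s'. c * (f s * g s') \<partial>lborel \<partial>lborel)"
proof -
  have "(\<integral>\<^sup>+s. \<integral>\<^sup>+s'. c * (f s * g s') \<partial>lborel \<partial>lborel) = (\<integral>\<^sup>+s. c * (f s * (\<integral>\<^sup>+s'. g s' \<partial>lborel)) \<partial>lborel)"
    by (intro nn_integral_cong) (simp add: nn_integral_cmult)
  also have "\<dots> = c * (\<integral>\<^sup>+s. f s * (\<integral>\<^sup>+s'. g s' \<partial>lborel) \<partial>lborel)" by (rule nn_integral_cmult) measurable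
  also have "(\<integral>\<^sup>+s. f s * (\<integral>\<^sup>+s'. g s' \<partial>lborel) \<partial>lborel) = (\<integral>\<^sup>+s. f s \<partial>lborel) * (\<integral>\<^sup>+s'. g s' \<partial>lborel)"
    by (rule nn_integral_multc) measurable
  finally show ?thesis by simp
qed

section \<open>Convolutions at earlier times controlled by the convolution at the terminal
  point\<close>

context diffusion_kernel
begin

definition kint :: "(real \<Rightarrow> real \<Rightarrow> ennreal) \<Rightarrow> real \<Rightarrow> real \<Rightarrow> real \<Rightarrow> ennreal" where
  "kint q t x s = (\<integral>\<^sup>+z. ennreal (K (t - s) x z) * q s z \<partial>lborel)"

lemma kint_measurable:
  assumes q: "(\<lambda>(s, z). q s z) \<in> borel_measurable (borel \<Otimes>\<^sub>M borel)"
    and [measurable]: "f \<in> borel_measurable N" "g \<in> borel_measurable N" "k \<in> borel_measurable N"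
  shows "(\<lambda>y. kint q (f y) (g y) (k y)) \<in> borel_measurable N"
proof -
  note [measurable (raw)] = measurable_two_args[OF q]
  show ?thesis unfolding kint_def by measurable
qed

lemma weight_measurable'[measurable (raw)]:
  assumes [measurable]: "f \<in> borel_measurable N" "g \<in> borel_measurable N"
  shows "(\<lambda>y. weight S (f y) (g y)) \<in> borel_measurable N"
  unfolding weight_def by measurable

lemma kint_zero: "t \<le> s \<Longrightarrow> kint q t x s = 0"
  unfolding kint_def by (simp add: K_zero)

definition pair_const :: "real \<Rightarrow> ennreal" where
  "pair_const S = ennreal (4 * dmax * (\<kappa> S)\<^sup>2 / sqrt (2 * pi))"

text \<open>\<open>two_kernel_bound\<close> integrated against the source at two times; by Tonelli
  the integral over \<open>x\<close> is taken innermost.\<close>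

lemma kint_pair:
  assumes q: "(\<lambda>(s, z). q s z) \<in> borel_measurable (borel \<Otimes>\<^sub>M borel)"
    and s: "0 \<le> s" "s < t" "0 \<le> s'" "s' < t" and t: "t < S"
  shows "(\<integral>\<^sup>+x. ennreal (weight S t x) * (kint q t x s * kint q t x s') \<partial>lborel)
    \<le> ennreal (1 / sqrt (t - s)) * (pair_const S * (kint q S 0 s * kint q S 0 s'))"
proof -
  note [measurable (raw)] = measurable_two_args[OF q]
  let ?f = "\<lambda>x z z'. ennreal (weight S t x) * ((ennreal (K (t - s) x z) * q s z) * (ennreal (K (t - s') x z') * q s' z'))"
  have "(\<integral>\<^sup>+x. ennreal (weight S t x) * (kint q t x s * kint q t x s') \<partial>lborel) = (\<integral>\<^sup>+x. \<integral>\<^sup>+z. \<integral>\<^sup>+z'. ?f x z z' \<partial>lborel \<partial>lborel \<partial>lborel)"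
    unfolding kint_def by (intro nn_integral_cong nn_integral_product) measurable
  also have "\<dots> = (\<integral>\<^sup>+z. \<integral>\<^sup>+z'. \<integral>\<^sup>+x. ?f x z z' \<partial>lborel \<partial>lborel \<partial>lborel)"
    by (rule nn_integral_swap3) measurable
  also have "\<dots> \<le> (\<integral>\<^sup>+z. \<integral>\<^sup>+z'. (ennreal (1 / sqrt (t - s)) * pair_const S) * ((ennreal (K (S - s) 0 z) * q s z) * (ennreal (K (S - s') 0 z') * q s' z')) \<partial>lborel \<partial>lborel)"
  proof (intro nn_integral_mono)
    fix z z'
    have "(\<integral>\<^sup>+x. ?f x z z' \<partial>lborel) = (\<integral>\<^sup>+x. (ennreal (weight S t x) * ennreal (K (t - s) x z) * ennreal (K (t - s') x z')) * (q s z * q s' z') \<partial>lborel)"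
      by (simp only: mult_ac)
    also have "\<dots> = (\<integral>\<^sup>+x. ennreal (weight S t x) * ennreal (K (t - s) x z) * ennreal (K (t - s') x z') \<partial>lborel) * (q s z * q s' z')"
      by (rule nn_integral_multc) measurable
    also have "\<dots> \<le> (pair_const S * ennreal (1 / sqrt (t - s)) * ennreal (K (S - s) 0 z) * ennreal (K (S - s') 0 z')) * (q s z * q s' z')"
      unfolding pair_const_def by (intro mult_right_mono two_kernel_bound s t) simp
    also have "\<dots> = (ennreal (1 / sqrt (t - s)) * pair_const S) * ((ennreal (K (S - s) 0 z) * q s z) * (ennreal (K (S - s') 0 z') * q s' z'))"
      by (simp only: mult_ac)
    finally show "(\<integral>\<^sup>+x. ?f x z z' \<partial>lborel) \<le> \<dots>" .
  qed
  also have "\<dots> = (ennreal (1 / sqrt (t - s)) * pair_const S) * (kint q S 0 s * kint q S 0 s')"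
    unfolding kint_def by (intro nn_integral_product[symmetric]) measurable
  finally show ?thesis by (simp only: mult.assoc)
qed

text \<open>The kernel vanishes unless \<open>t\<close> exceeds both \<open>s\<close> and
  \<open>s'\<close>, and the remaining singularity at \<open>t = s\<close> has the finite integral
  \<open>2 * sqrt (S - s)\<close>.\<close>

lemma kint_time_pair:
  assumes q: "(\<lambda>(s, z). q s z) \<in> borel_measurable (borel \<Otimes>\<^sub>M borel)" and s: "0 \<le> s" "0 \<le> s'"
  shows "(\<integral>\<^sup>+t. indicator {0<..<S} t * (\<integral>\<^sup>+x. ennreal (weight S t x) * (kint q t x s * kint q t x s') \<partial>lborel) \<partial>lborel)
    \<le> ennreal (2 * sqrt S) * pair_const S * (kint q S 0 s * kint q S 0 s')"
proof -
  let ?D = "pair_const S * (kint q S 0 s * kint q S 0 s')"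
  have "(\<integral>\<^sup>+t. indicator {0<..<S} t * (\<integral>\<^sup>+x. ennreal (weight S t x) * (kint q t x s * kint q t x s') \<partial>lborel) \<partial>lborel)
    \<le> (\<integral>\<^sup>+t. (indicator {s<..<S} t * ennreal (1 / sqrt (t - s))) * ?D \<partial>lborel)"
  proof (rule nn_integral_mono)
    fix t
    show "indicator {0<..<S} t * (\<integral>\<^sup>+x. ennreal (weight S t x) * (kint q t x s * kint q t x s') \<partial>lborel)
      \<le> (indicator {s<..<S} t * ennreal (1 / sqrt (t - s))) * ?D"
    proof (cases "s < t \<and> s' < t \<and> t < S")
      case True
      then show ?thesis using kint_pair[OF q s(1) _ s(2), of t S] s by (simp add: mult.assoc)
    next
      case False
      then show ?thesis by (auto simp: not_less kint_zero indicator_def)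
    qed
  qed
  also have "\<dots> = (\<integral>\<^sup>+t. indicator {s<..<S} t * ennreal (1 / sqrt (t - s)) \<partial>lborel) * ?D"
    by (rule nn_integral_multc) measurable
  also have "\<dots> \<le> ennreal (2 * sqrt S) * ?D"
  proof (rule mult_right_mono)
    show "(\<integral>\<^sup>+t. indicator {s<..<S} t * ennreal (1 / sqrt (t - s)) \<partial>lborel) \<le> ennreal (2 * sqrt S)"
    proof (cases "s \<le> S")
      case True
      then have "sqrt (S - s) \<le> sqrt S" using s by simp
      then have "ennreal (2 * sqrt (S - s)) \<le> ennreal (2 * sqrt S)" by (intro ennreal_leI) simp
      then show ?thesis by (rule order_trans[OF nn_integral_inverse_sqrt[OF True]])
    qed simp
  qed simp
  finally show ?thesis by (simp only: mult.assoc)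
qed

text \<open>The diagonal case \<open>s = s'\<close> of the pair estimate; it serves the energy of
  the stochastic integrand.\<close>

lemma kint_square_bound:
  assumes q: "(\<lambda>(s, z). q s z) \<in> borel_measurable (borel \<Otimes>\<^sub>M borel)"
  shows "(\<integral>\<^sup>+t. indicator {0<..<S} t * (\<integral>\<^sup>+x. ennreal (weight S t x) * (\<integral>\<^sup>+s\<in>{0..S}. (kint q t x s)\<^sup>2 \<partial>lborel) \<partial>lborel) \<partial>lborel)
    \<le> ennreal (2 * sqrt S) * pair_const S * (\<integral>\<^sup>+s\<in>{0..S}. (kint q S 0 s)\<^sup>2 \<partial>lborel)"
proof -
  note [measurable (raw)] = kint_measurable[OF q]
  let ?f = "\<lambda>t x s. indicator {0<..<S} t * (ennreal (weight S t x) * ((kint q t x s)\<^sup>2 * indicator {0..S} s))"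
  have "(\<integral>\<^sup>+t. indicator {0<..<S} t * (\<integral>\<^sup>+x. ennreal (weight S t x) * (\<integral>\<^sup>+s\<in>{0..S}. (kint q t x s)\<^sup>2 \<partial>lborel) \<partial>lborel) \<partial>lborel)
     = (\<integral>\<^sup>+t. \<integral>\<^sup>+x. \<integral>\<^sup>+s. ?f t x s \<partial>lborel \<partial>lborel \<partial>lborel)"
    by (simp add: nn_integral_cmult)
  also have "\<dots> = (\<integral>\<^sup>+t. \<integral>\<^sup>+s. \<integral>\<^sup>+x. ?f t x s \<partial>lborel \<partial>lborel \<partial>lborel)"
    by (intro nn_integral_cong lborel_pair.Fubini') measurable
  also have "\<dots> = (\<integral>\<^sup>+s. \<integral>\<^sup>+t. \<integral>\<^sup>+x. ?f t x s \<partial>lborel \<partial>lborel \<partial>lborel)"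
    by (rule lborel_pair.Fubini') measurable
  also have "\<dots> \<le> (\<integral>\<^sup>+s. ennreal (2 * sqrt S) * pair_const S * ((kint q S 0 s)\<^sup>2 * indicator {0..S} s) \<partial>lborel)"
  proof (rule nn_integral_mono)
    fix s
    show "(\<integral>\<^sup>+t. \<integral>\<^sup>+x. ?f t x s \<partial>lborel \<partial>lborel) \<le> ennreal (2 * sqrt S) * pair_const S * ((kint q S 0 s)\<^sup>2 * indicator {0..S} s)"
    proof (cases "s \<in> {0..S}")
      case True
      then show ?thesis using kint_time_pair[OF q, of s s S] by (simp add: nn_integral_cmult power2_eq_square)
    qed simp
  qed
  also have "\<dots> = ennreal (2 * sqrt S) * pair_const S * (\<integral>\<^sup>+s\<in>{0..S}. (kint q S 0 s)\<^sup>2 \<partial>lborel)"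
    by (rule nn_integral_cmult) measurable
  finally show ?thesis .
qed

text \<open>The squared time integral is a double integral over \<open>s\<close> and
  \<open>s'\<close>, which is why the pair estimate allows two different times. It serves the
  drift.\<close>

lemma kint_integral_bound:
  assumes q: "(\<lambda>(s, z). q s z) \<in> borel_measurable (borel \<Otimes>\<^sub>M borel)"
  shows "(\<integral>\<^sup>+t. indicator {0<..<S} t * (\<integral>\<^sup>+x. ennreal (weight S t x) * (\<integral>\<^sup>+s\<in>{0..S}. kint q t x s \<partial>lborel)\<^sup>2 \<partial>lborel) \<partial>lborel)
    \<le> ennreal (2 * sqrt S) * pair_const S * (\<integral>\<^sup>+s\<in>{0..S}. kint q S 0 s \<partial>lborel)\<^sup>2"
proof -
  note [measurable (raw)] = kint_measurable[OF q]
  let ?i = "\<lambda>s. indicator {0..S} s :: ennreal"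
  let ?f = "\<lambda>t x s s'. ennreal (weight S t x) * ((kint q t x s * ?i s) * (kint q t x s' * ?i s'))"
  have "(\<integral>\<^sup>+t. indicator {0<..<S} t * (\<integral>\<^sup>+x. ennreal (weight S t x) * (\<integral>\<^sup>+s\<in>{0..S}. kint q t x s \<partial>lborel)\<^sup>2 \<partial>lborel) \<partial>lborel)
     = (\<integral>\<^sup>+t. indicator {0<..<S} t * (\<integral>\<^sup>+x. \<integral>\<^sup>+s. \<integral>\<^sup>+s'. ?f t x s s' \<partial>lborel \<partial>lborel \<partial>lborel) \<partial>lborel)"
    unfolding power2_eq_square by (subst nn_integral_product) simp_all
  also have "\<dots> = (\<integral>\<^sup>+t. indicator {0<..<S} t * (\<integral>\<^sup>+s. \<integral>\<^sup>+s'. \<integral>\<^sup>+x. ?f t x s s' \<partial>lborel \<partial>lborel \<partial>lborel) \<partial>lborel)"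
    by (subst nn_integral_swap3) simp_all
  also have "\<dots> = (\<integral>\<^sup>+t. \<integral>\<^sup>+s. \<integral>\<^sup>+s'. indicator {0<..<S} t * (\<integral>\<^sup>+x. ?f t x s s' \<partial>lborel) \<partial>lborel \<partial>lborel \<partial>lborel)"
    by (simp add: nn_integral_cmult)
  also have "\<dots> = (\<integral>\<^sup>+s. \<integral>\<^sup>+s'. \<integral>\<^sup>+t. indicator {0<..<S} t * (\<integral>\<^sup>+x. ?f t x s s' \<partial>lborel) \<partial>lborel \<partial>lborel \<partial>lborel)"
    by (rule nn_integral_swap3) measurable
  also have "\<dots> \<le> (\<integral>\<^sup>+s. \<integral>\<^sup>+s'. (ennreal (2 * sqrt S) * pair_const S) * ((kint q S 0 s * ?i s) * (kint q S 0 s' * ?i s')) \<partial>lborel \<partial>lborel)"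
  proof (intro nn_integral_mono)
    fix s s'
    show "(\<integral>\<^sup>+t. indicator {0<..<S} t * (\<integral>\<^sup>+x. ?f t x s s' \<partial>lborel) \<partial>lborel) \<le> (ennreal (2 * sqrt S) * pair_const S) * ((kint q S 0 s * ?i s) * (kint q S 0 s' * ?i s'))"
    proof (cases "s \<in> {0..S} \<and> s' \<in> {0..S}")
      case True
      then show ?thesis using kint_time_pair[OF q, of s s' S] by simp
    qed auto
  qed
  also have "\<dots> = ennreal (2 * sqrt S) * pair_const S * ((\<integral>\<^sup>+s\<in>{0..S}. kint q S 0 s \<partial>lborel) * (\<integral>\<^sup>+s\<in>{0..S}. kint q S 0 s \<partial>lborel))"
    by (rule nn_integral_product[symmetric]) measurable
  finally show ?thesis unfolding power2_eq_square .
qed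

end

section \<open>Uniqueness by localization\<close>

lemma ennreal_square_add_le: "(a + b)\<^sup>2 \<le> 2 * a\<^sup>2 + 2 * (b::ennreal)\<^sup>2"
proof (cases "a = top \<or> b = top")
  case True
  then show ?thesis by (auto simp: power2_eq_square ennreal_mult_top)
next
  case False
  then obtain x y where xy: "a = ennreal x" "0 \<le> x" "b = ennreal y" "0 \<le> y"
    by (metis ennreal_cases top.extremum_unique)
  have "(a + b)\<^sup>2 = ennreal ((x - (- y))\<^sup>2)"
    using xy by (simp add: ennreal_power ennreal_plus[symmetric] del: ennreal_plus)
  also have "\<dots> \<le> 2 * ennreal (x\<^sup>2) + 2 * ennreal ((- y)\<^sup>2)" by (rule ennreal_square_diff_le)
  finally show ?thesis using xy by (simp add: ennreal_power)
qed

text \<open>The last time \<open>r\<close> at which the clock is at most \<open>c\<close> is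
  approached by times \<open>p k\<close> at which the bound holds, and Fatou passes to the limit.
  This also covers a clock that is infinite after \<open>r\<close>.\<close>

lemma nn_integral_stopped:
  fixes a :: "real \<Rightarrow> ennreal"
  assumes [measurable]: "a \<in> borel_measurable borel"
    and \<Psi>: "\<And>r. \<Psi> r = (\<integral>\<^sup>+s\<in>{0..r}. a s \<partial>lborel)"
  shows "(\<integral>\<^sup>+s\<in>{0..T}. (if \<Psi> s \<le> c then a s else 0) \<partial>lborel) \<le> c"
proof -
  let ?S = "{s \<in> {0..T}. \<Psi> s \<le> c}"
  show ?thesis
  proof (cases "?S = {}")
    case True
    then have "(\<integral>\<^sup>+s\<in>{0..T}. (if \<Psi> s \<le> c then a s else 0) \<partial>lborel) = (\<integral>\<^sup>+s. 0 \<partial>(lborel :: real measure))"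
      by (intro nn_integral_cong) (auto simp: indicator_def)
    then show ?thesis by simp
  next
    case False
    have bdd: "bdd_above ?S" by (intro bdd_aboveI[of _ T]) auto
    define r where "r = Sup ?S"
    have "\<exists>s\<in>?S. r - inverse (real (Suc k)) < s" for k
      using less_cSupD[OF False, of "r - inverse (real (Suc k))"] unfolding r_def by auto
    then obtain p where p: "\<And>k. p k \<in> ?S" "\<And>k. r - inverse (real (Suc k)) < p k" by metis
    have pr: "p k \<le> r" for k unfolding r_def by (rule cSup_upper[OF p(1) bdd])
    have plim: "p \<longlonglongrightarrow> r"
    proof (rule tendsto_sandwich)
      show "\<forall>\<^sub>F k in sequentially. r - inverse (real (Suc k)) \<le> p k" using p(2) by (simp add: less_imp_le)
      show "\<forall>\<^sub>F k in sequentially. p k \<le> r" using pr by simp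
      show "(\<lambda>k. r - inverse (real (Suc k))) \<longlonglongrightarrow> r"
        using tendsto_diff[OF tendsto_const[of r] LIMSEQ_inverse_real_of_nat] by simp
    qed simp
    have "(\<integral>\<^sup>+s\<in>{0..T}. (if \<Psi> s \<le> c then a s else 0) \<partial>lborel) \<le> (\<integral>\<^sup>+s. liminf (\<lambda>k. a s * indicator {0..p k} s) \<partial>lborel)"
    proof (rule nn_integral_mono_AE)
      have "AE s in lborel. s \<noteq> r" by (rule AE_lborel_singleton)
      then show "AE s in lborel. (if \<Psi> s \<le> c then a s else 0) * indicator {0..T} s \<le> liminf (\<lambda>k. a s * indicator {0..p k} s)"
      proof eventually_elim
        case (elim s)
        show ?case
        proof (cases "s \<in> ?S")
          case True
          then have "s \<le> r" unfolding r_def by (rule cSup_upper[OF _ bdd])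
          then have "s < r" using elim by simp
          then have "\<forall>\<^sub>F k in sequentially. s < p k" by (rule order_tendstoD(1)[OF plim])
          then have "\<forall>\<^sub>F k in sequentially. a s \<le> a s * indicator {0..p k} s"
            by eventually_elim (use True in auto)
          then have "a s \<le> liminf (\<lambda>k. a s * indicator {0..p k} s)" by (rule Liminf_bounded)
          then show ?thesis using True by simp
        qed (auto simp: indicator_def)
      qed
    qed
    also have "\<dots> \<le> liminf (\<lambda>k. \<integral>\<^sup>+s. a s * indicator {0..p k} s \<partial>lborel)"
      by (rule nn_integral_liminf) measurable
    also have "\<dots> \<le> liminf (\<lambda>k::nat. c)"
      by (rule Liminf_mono) (use p(1) \<Psi> in auto)
    also have "\<dots> = c" by (simp add: Liminf_const)
    finally show ?thesis .
  qed
qed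

lemma nn_integral_exp_tail:
  assumes "0 < \<gamma>"
  shows "(\<integral>\<^sup>+t. indicator {s<..<S} t * ennreal (exp (- (\<gamma> * t))) \<partial>lborel) \<le> ennreal (exp (- (\<gamma> * s)) / \<gamma>)"
proof (cases "s \<le> S")
  case True
  have "(\<integral>\<^sup>+t. indicator {s<..<S} t * ennreal (exp (- (\<gamma> * t))) \<partial>lborel) \<le> (\<integral>\<^sup>+t\<in>{s..S}. ennreal (exp (- (\<gamma> * t))) \<partial>lborel)"
    by (intro nn_integral_mono) (auto simp: indicator_def)
  also have "\<dots> = ennreal (- (exp (- (\<gamma> * S)) / \<gamma>) - (- (exp (- (\<gamma> * s)) / \<gamma>)))"
  proof (rule nn_integral_FTC_Icc)
    fix t
    show "DERIV (\<lambda>t. - (exp (- (\<gamma> * t)) / \<gamma>)) t :> exp (- (\<gamma> * t))"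
      using assms by (auto intro!: derivative_eq_intros)
  qed (use True in auto)
  also have "\<dots> \<le> ennreal (exp (- (\<gamma> * s)) / \<gamma>)" using assms by (intro ennreal_leI) simp
  finally show ?thesis .
qed simp

text \<open>No continuity of \<Phi> is available, so the argument is integral: weighting with
  \<open>exp (- \<gamma> * t)\<close> and exchanging the integrals gives
  \<open>X <= (C / \<gamma>) * X\<close> for the weighted integral \<open>X\<close>, which forces
  \<open>X = 0\<close> because \<open>X\<close> is finite and the factor is below 1.\<close>

lemma nn_integral_Gronwall:
  fixes \<Phi> :: "real \<Rightarrow> ennreal"
  assumes [measurable]: "\<Phi> \<in> borel_measurable borel" and C: "C \<ge> 0"
    and fin: "(\<integral>\<^sup>+t. indicator {0<..<S} t * \<Phi> t \<partial>lborel) < \<infinity>"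
    and le: "\<And>t. 0 < t \<Longrightarrow> t < S \<Longrightarrow> \<Phi> t \<le> ennreal C * (\<integral>\<^sup>+s. indicator {0<..<t} s * \<Phi> s \<partial>lborel)"
  shows "(\<integral>\<^sup>+t. indicator {0<..<S} t * \<Phi> t \<partial>lborel) = 0"
proof -
  \<comment> \<open>Makes \<open>C / \<gamma>\<close> at most 1/2; the summand 1 keeps \<gamma>
    positive when \<open>C = 0\<close>.\<close>
  define \<gamma> where "\<gamma> = 2 * C + 1"
  have \<gamma>: "\<gamma> > 0" using C unfolding \<gamma>_def by simp
  define X where "X = (\<integral>\<^sup>+t. indicator {0<..<S} t * (ennreal (exp (- (\<gamma> * t))) * \<Phi> t) \<partial>lborel)"
  let ?i = "\<lambda>s t. if 0 < s \<and> s < t \<and> t < S then 1 else 0 :: ennreal"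
  have e1: "exp (- (\<gamma> * t)) \<le> 1" if "0 < t" for t using \<gamma> that by simp
  have "X \<le> (\<integral>\<^sup>+t. indicator {0<..<S} t * \<Phi> t \<partial>lborel)"
    unfolding X_def
  proof (rule nn_integral_mono)
    fix t
    show "indicator {0<..<S} t * (ennreal (exp (- (\<gamma> * t))) * \<Phi> t) \<le> indicator {0<..<S} t * \<Phi> t"
    proof (cases "0 < t")
      case True
      then have "ennreal (exp (- (\<gamma> * t))) * \<Phi> t \<le> ennreal 1 * \<Phi> t" by (intro mult_right_mono ennreal_leI e1) simp_all
      then show ?thesis by (intro mult_left_mono) auto
    qed simp
  qed
  then have Xfin: "X < \<infinity>" using fin by (rule le_less_trans)
  have "X \<le> (\<integral>\<^sup>+t. \<integral>\<^sup>+s. ?i s t * (ennreal (exp (- (\<gamma> * t))) * ennreal C * \<Phi> s) \<partial>lborel \<partial>lborel)"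
    unfolding X_def
  proof (rule nn_integral_mono)
    fix t
    show "indicator {0<..<S} t * (ennreal (exp (- (\<gamma> * t))) * \<Phi> t) \<le> (\<integral>\<^sup>+s. ?i s t * (ennreal (exp (- (\<gamma> * t))) * ennreal C * \<Phi> s) \<partial>lborel)"
    proof (cases "0 < t \<and> t < S")
      case True
      then have "ennreal (exp (- (\<gamma> * t))) * \<Phi> t \<le> ennreal (exp (- (\<gamma> * t))) * (ennreal C * (\<integral>\<^sup>+s. indicator {0<..<t} s * \<Phi> s \<partial>lborel))"
        by (intro mult_left_mono le) auto
      also have "\<dots> = (\<integral>\<^sup>+s. ennreal (exp (- (\<gamma> * t))) * ennreal C * (indicator {0<..<t} s * \<Phi> s) \<partial>lborel)"
        by (subst nn_integral_cmult) (simp_all add: mult.assoc)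
      also have "\<dots> = (\<integral>\<^sup>+s. ?i s t * (ennreal (exp (- (\<gamma> * t))) * ennreal C * \<Phi> s) \<partial>lborel)"
        using True by (intro nn_integral_cong) (auto simp: indicator_def)
      finally show ?thesis using True by simp
    qed (auto simp: indicator_def)
  qed
  also have "\<dots> = (\<integral>\<^sup>+s. \<integral>\<^sup>+t. ?i s t * (ennreal (exp (- (\<gamma> * t))) * ennreal C * \<Phi> s) \<partial>lborel \<partial>lborel)"
    by (rule lborel_pair.Fubini') measurable
  also have "\<dots> \<le> (\<integral>\<^sup>+s. ennreal (C / \<gamma>) * (indicator {0<..<S} s * (ennreal (exp (- (\<gamma> * s))) * \<Phi> s)) \<partial>lborel)"
  proof (rule nn_integral_mono)
    fix s
    show "(\<integral>\<^sup>+t. ?i s t * (ennreal (exp (- (\<gamma> * t))) * ennreal C * \<Phi> s) \<partial>lborel) \<le> ennreal (C / \<gamma>) * (indicator {0<..<S} s * (ennreal (exp (- (\<gamma> * s))) * \<Phi> s))"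
    proof (cases "0 < s \<and> s < S")
      case True
      have "(\<integral>\<^sup>+t. ?i s t * (ennreal (exp (- (\<gamma> * t))) * ennreal C * \<Phi> s) \<partial>lborel)
         = (\<integral>\<^sup>+t. (indicator {s<..<S} t * ennreal (exp (- (\<gamma> * t)))) * (ennreal C * \<Phi> s) \<partial>lborel)"
        using True by (intro nn_integral_cong) (auto simp: indicator_def mult_ac)
      also have "\<dots> = (\<integral>\<^sup>+t. indicator {s<..<S} t * ennreal (exp (- (\<gamma> * t))) \<partial>lborel) * (ennreal C * \<Phi> s)"
        by (rule nn_integral_multc) measurable
      also have "\<dots> \<le> ennreal (exp (- (\<gamma> * s)) / \<gamma>) * (ennreal C * \<Phi> s)"
        by (intro mult_right_mono nn_integral_exp_tail \<gamma>) simp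
      also have "\<dots> = ennreal (C / \<gamma>) * (ennreal (exp (- (\<gamma> * s))) * \<Phi> s)"
      proof -
        have "ennreal (exp (- (\<gamma> * s)) / \<gamma>) * ennreal C = ennreal (C / \<gamma>) * ennreal (exp (- (\<gamma> * s)))"
          using \<gamma> C by (simp add: ennreal_mult[symmetric] mult.commute)
        then show ?thesis by (simp only: mult.assoc[symmetric])
      qed
      finally show ?thesis using True by simp
    next
      case False
      then have "(\<integral>\<^sup>+t. ?i s t * (ennreal (exp (- (\<gamma> * t))) * ennreal C * \<Phi> s) \<partial>lborel) = (\<integral>\<^sup>+t. 0 \<partial>(lborel :: real measure))"
        by (intro nn_integral_cong) auto
      then show ?thesis by simp
    qed
  qed
  also have "\<dots> = ennreal (C / \<gamma>) * X" unfolding X_def by (rule nn_integral_cmult) measurable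
  finally have X: "X \<le> ennreal (C / \<gamma>) * X" .
  obtain x where x: "X = ennreal x" "0 \<le> x" using Xfin by (cases X) auto
  have "x \<le> C / \<gamma> * x" using X C \<gamma> unfolding x(1) by (simp add: ennreal_mult[symmetric] x(2))
  moreover have "C / \<gamma> \<le> 1 / 2" using C \<gamma> unfolding \<gamma>_def by (simp add: field_simps)
  then have "C / \<gamma> * x \<le> 1 / 2 * x" using x(2) by (rule mult_right_mono)
  ultimately have "x \<le> 1 / 2 * x" by (rule order_trans)
  then have "x = 0" using x(2) by linarith
  then have "X = 0" using x by simp
  then have "AE t in lborel. indicator {0<..<S} t * (ennreal (exp (- (\<gamma> * t))) * \<Phi> t) = 0"
    unfolding X_def by (subst (asm) nn_integral_0_iff_AE) auto
  then have "AE t in lborel. indicator {0<..<S} t * \<Phi> t = 0"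
    by eventually_elim (auto simp: ennreal_eq_0_iff not_le)
  then show ?thesis by (subst nn_integral_0_iff_AE) auto
qed

context spde
begin

lemma mild_solutionD:
  assumes Y: "mild_solution M T F B a1 a2 \<rho>1 \<rho>2 b \<sigma> \<xi> Y" and t: "0 < t" "t \<le> T"
  shows "AE \<omega> in M. (\<integral>\<^sup>+s\<in>{0..t}. nconv (along b Y) t x s \<omega> \<partial>lborel) < \<infinity>"
    "AE \<omega> in M. (\<integral>\<^sup>+s\<in>{0..t}. (nconv (along \<sigma> Y) t x s \<omega>)\<^sup>2 \<partial>lborel) < \<infinity>"
    "\<exists>J. has_ito_integral M F B t (conv \<sigma> Y t x) J \<and> (AE \<omega> in M. Y t x \<omega> = initial t x + drift Y t x \<omega> + J \<omega>)"
proof -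
  have cv: "(\<lambda>s \<omega>. LINT z|lborel. K (t - s) x z * \<sigma> \<omega> s z (Y s z \<omega>)) = conv \<sigma> Y t x" by (intro ext) (simp add: conv_def)
  have "t \<in> {0<..T}" using t by simp
  note * = Y[unfolded mild_solution_def, THEN conjunct2, THEN conjunct2, rule_format, OF this, of x, unfolded cv]
  show "AE \<omega> in M. (\<integral>\<^sup>+s\<in>{0..t}. nconv (along b Y) t x s \<omega> \<partial>lborel) < \<infinity>"
    using *[THEN conjunct2, THEN conjunct1] unfolding nconv_def .
  show "AE \<omega> in M. (\<integral>\<^sup>+s\<in>{0..t}. (nconv (along \<sigma> Y) t x s \<omega>)\<^sup>2 \<partial>lborel) < \<infinity>"
    using *[THEN conjunct2, THEN conjunct2, THEN conjunct1] unfolding nconv_def .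
  show "\<exists>J. has_ito_integral M F B t (conv \<sigma> Y t x) J \<and> (AE \<omega> in M. Y t x \<omega> = initial t x + drift Y t x \<omega> + J \<omega>)"
    using *[THEN conjunct2, THEN conjunct2, THEN conjunct2] unfolding initial_def drift_def conv_def .
qed

lemma mild_solution_field: "mild_solution M T F B a1 a2 \<rho>1 \<rho>2 b \<sigma> \<xi> Y \<Longrightarrow> progressive_field T F Y"
  unfolding mild_solution_def by (rule conjunct1)

lemma nconv_diff_le:
  assumes "random_field g" "random_field k" "\<omega> \<in> space M" "s \<in> {0..T}"
  shows "nconv (\<lambda>\<omega> s z. g \<omega> s z - k \<omega> s z) t x s \<omega> \<le> nconv g t x s \<omega> + nconv k t x s \<omega>"
proof -
  note [measurable] = random_field_section[OF assms(1,3,4)] random_field_section[OF assms(2,3,4)]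
  have "nconv (\<lambda>\<omega> s z. g \<omega> s z - k \<omega> s z) t x s \<omega> \<le> (\<integral>\<^sup>+z. ennreal \<bar>K (t - s) x z * g \<omega> s z\<bar> + ennreal \<bar>K (t - s) x z * k \<omega> s z\<bar> \<partial>lborel)"
    unfolding nconv_def
  proof (rule nn_integral_mono)
    fix z
    have "\<bar>K (t - s) x z * (g \<omega> s z - k \<omega> s z)\<bar> \<le> \<bar>K (t - s) x z * g \<omega> s z\<bar> + \<bar>K (t - s) x z * k \<omega> s z\<bar>"
      unfolding right_diff_distrib by (rule abs_triangle_ineq4)
    then show "ennreal \<bar>K (t - s) x z * (g \<omega> s z - k \<omega> s z)\<bar> \<le> ennreal \<bar>K (t - s) x z * g \<omega> s z\<bar> + ennreal \<bar>K (t - s) x z * k \<omega> s z\<bar>"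
      by (simp add: ennreal_plus[symmetric] ennreal_leI del: ennreal_plus)
  qed
  also have "\<dots> = nconv g t x s \<omega> + nconv k t x s \<omega>"
    unfolding nconv_def by (rule nn_integral_add) measurable
  finally show ?thesis .
qed

lemma AE_finite_of_nn_integral:
  assumes "(\<lambda>s. a s * indicator {0..t} s) \<in> borel_measurable borel" "(\<integral>\<^sup>+s\<in>{0..t}. a s \<partial>lborel) < (\<infinity>::ennreal)"
  shows "AE s in lborel. s \<in> {0..t} \<longrightarrow> a s < \<infinity>"
proof -
  have "AE s in lborel. a s * indicator {0..t} s \<noteq> \<infinity>"
    by (rule nn_integral_PInf_AE) (use assms in auto)
  then show ?thesis by eventually_elim (auto simp: less_top)
qed

end

section \<open>The stopped difference of two solutions\<close>

locale two_solutions = spde +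
  fixes Y Y' :: "real \<Rightarrow> real \<Rightarrow> 'a \<Rightarrow> real"
  assumes sol: "mild_solution M T F B a1 a2 \<rho>1 \<rho>2 b \<sigma> \<xi> Y" "mild_solution M T F B a1 a2 \<rho>1 \<rho>2 b \<sigma> \<xi> Y'"
begin

lemma fields: "progressive_field T F Y" "progressive_field T F Y'"
  using sol mild_solution_field by auto

definition diff_coeff :: "('a \<Rightarrow> real \<Rightarrow> real \<Rightarrow> real \<Rightarrow> real) \<Rightarrow> 'a \<Rightarrow> real \<Rightarrow> real \<Rightarrow> real" where
  "diff_coeff f = (\<lambda>\<omega> s z. along f Y \<omega> s z - along f Y' \<omega> s z)"

lemma diff_coeff_measurable:
  assumes "admissible f" "u \<in> {0..T}"
  shows "(\<lambda>w. indicator {0..u} (fst (snd w)) * diff_coeff f (fst w) (fst (snd w)) (snd (snd w))) \<in> borel_measurable (F u \<Otimes>\<^sub>M borel \<Otimes>\<^sub>M borel)"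
  unfolding diff_coeff_def right_diff_distrib
  by (intro borel_measurable_diff coefficient_field_measurable assms fields)

lemma random_field_diff_coeff: "admissible f \<Longrightarrow> random_field (diff_coeff f)"
  unfolding diff_coeff_def by (intro random_field_diff random_field_coefficient fields)

lemma diff_coeff_Lipschitz:
  assumes "admissible f" "\<omega> \<in> space M" "s \<in> {0..T}"
  shows "(diff_coeff f \<omega> s z)\<^sup>2 \<le> L\<^sup>2 * (Y s z \<omega> - Y' s z \<omega>)\<^sup>2"
proof -
  have "\<bar>diff_coeff f \<omega> s z\<bar> \<le> L * \<bar>Y s z \<omega> - Y' s z \<omega>\<bar>"
    using assms unfolding admissible_def diff_coeff_def by blast
  also have "\<dots> = \<bar>L * (Y s z \<omega> - Y' s z \<omega>)\<bar>" using L_pos by (simp add: abs_mult)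
  finally have "(diff_coeff f \<omega> s z)\<^sup>2 \<le> (L * (Y s z \<omega> - Y' s z \<omega>))\<^sup>2" by (rule abs_le_square_iff[THEN iffD1])
  then show ?thesis by (simp add: power_mult_distrib)
qed

text \<open>Only the convolutions at the terminal point \<open>(T, 0)\<close> enter the localization; the Gaussian
  estimates transfer the resulting bound to all other points.\<close>

definition rate :: "'a \<Rightarrow> real \<Rightarrow> ennreal" where
  "rate \<omega> r = ((nconv (diff_coeff \<sigma>) T 0 r \<omega>)\<^sup>2 + nconv (diff_coeff b) T 0 r \<omega>) * indicator {0..T} r"

definition clock :: "real \<Rightarrow> 'a \<Rightarrow> ennreal" where
  "clock s \<omega> = (\<integral>\<^sup>+r\<in>{0..s}. rate \<omega> r \<partial>lborel)"

text \<open>Adapted although the kernel in the clock is anchored at \<open>T\<close>: the kernel is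
  deterministic, and \<open>clock s\<close> uses the solutions only up to time \<open>s\<close>.
  Since the clock is monotone, a value 1 at \<open>t\<close> implies 1 at all earlier times.\<close>

definition cut :: "nat \<Rightarrow> real \<Rightarrow> 'a \<Rightarrow> real" where
  "cut n s \<omega> = of_bool (clock s \<omega> \<le> ennreal (real n))"

text \<open>Kept general in \<open>N\<close>, so that it serves both \<open>M\<close> and each
  \<open>F u\<close>, the latter for the adaptedness of \<open>cut\<close>.\<close>

lemma rate_measurable_wrt:
  assumes u: "u \<in> {0..T}"
    and m: "\<And>f. admissible f \<Longrightarrow> (\<lambda>w. indicator {0..u} (fst (snd w)) * diff_coeff f (fst w) (fst (snd w)) (snd (snd w))) \<in> borel_measurable (N \<Otimes>\<^sub>M borel \<Otimes>\<^sub>M borel)"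
  shows "(\<lambda>w. rate (fst w) (snd w) * indicator {0..u} (snd w)) \<in> borel_measurable (N \<Otimes>\<^sub>M lborel)"
proof -
  have n: "(\<lambda>w. nconv (diff_coeff f) T 0 (snd w) (fst w) * indicator {0..u} (snd w)) \<in> borel_measurable (N \<Otimes>\<^sub>M lborel)" if "admissible f" for f
    using nconv_measurable_wrt[OF m[OF that], of T 0] by (simp add: case_prod_beta')
  have "(\<lambda>w. (nconv (diff_coeff \<sigma>) T 0 (snd w) (fst w) * indicator {0..u} (snd w)) * (nconv (diff_coeff \<sigma>) T 0 (snd w) (fst w) * indicator {0..u} (snd w))
    + nconv (diff_coeff b) T 0 (snd w) (fst w) * indicator {0..u} (snd w)) \<in> borel_measurable (N \<Otimes>\<^sub>M lborel)"
    by (intro borel_measurable_add borel_measurable_times_ennreal n admissible_b admissible_\<sigma>)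
  then show ?thesis
    by (rule measurable_cong[THEN iffD1, rotated]) (use u in \<open>auto simp: rate_def indicator_def power2_eq_square\<close>)
qed

lemma clock_measurable_wrt:
  assumes "(\<lambda>w. rate (fst w) (snd w) * indicator {0..u} (snd w)) \<in> borel_measurable (N \<Otimes>\<^sub>M lborel)"
  shows "(\<lambda>w. clock (min u (snd w)) (fst w)) \<in> borel_measurable (N \<Otimes>\<^sub>M borel)"
proof -
  have "(\<lambda>v. (fst (fst v), snd v)) \<in> measurable ((N \<Otimes>\<^sub>M (borel :: real measure)) \<Otimes>\<^sub>M lborel) (N \<Otimes>\<^sub>M lborel)" by measurable
  from measurable_compose[OF this assms]
  have a: "(\<lambda>v. rate (fst (fst v)) (snd v) * indicator {0..u} (snd v)) \<in> borel_measurable ((N \<Otimes>\<^sub>M (borel :: real measure)) \<Otimes>\<^sub>M lborel)" by simp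
  have "(\<lambda>v. if 0 \<le> snd v \<and> snd v \<le> min u (snd (fst v)) then 1 else 0 :: ennreal) \<in> borel_measurable ((N \<Otimes>\<^sub>M (borel :: real measure)) \<Otimes>\<^sub>M lborel)" by measurable
  from lborel.borel_measurable_nn_integral_fst[OF borel_measurable_times_ennreal[OF a this]]
  show ?thesis unfolding clock_def
    by (rule measurable_cong[THEN iffD1, rotated]) (auto intro!: nn_integral_cong simp: indicator_def)
qed

lemma clock_mono: "s \<le> t \<Longrightarrow> clock s \<omega> \<le> clock t \<omega>"
  unfolding clock_def by (intro nn_integral_mono) (auto simp: indicator_def)

lemma clock_min: "clock (min T s) \<omega> = clock s \<omega>"
  unfolding clock_def by (intro nn_integral_cong) (auto simp: indicator_def rate_def)

lemma clock_measurable: "(\<lambda>w. clock (snd w) (fst w)) \<in> borel_measurable (M \<Otimes>\<^sub>M borel)"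
proof -
  have "(\<lambda>w. rate (fst w) (snd w) * indicator {0..T} (snd w)) \<in> borel_measurable (M \<Otimes>\<^sub>M lborel)"
    by (rule rate_measurable_wrt) (use T_pos random_field_diff_coeff in \<open>auto simp: random_field_def\<close>)
  from clock_measurable_wrt[OF this] show ?thesis unfolding clock_min .
qed

lemma cut_measurable[measurable (raw)]:
  assumes "w \<in> measurable N M" "k \<in> borel_measurable N"
  shows "(\<lambda>y. cut n (k y) (w y)) \<in> borel_measurable N"
proof -
  have [measurable]: "(\<lambda>y. clock (k y) (w y)) \<in> borel_measurable N"
    using measurable_compose[OF measurable_Pair[OF assms] clock_measurable] by simp
  show ?thesis unfolding cut_def by measurable
qed

lemma cut_01: "cut n s \<omega> = 0 \<or> cut n s \<omega> = 1" "0 \<le> cut n s \<omega>" "cut n s \<omega> \<le> 1"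
  unfolding cut_def by auto

lemma cut_antimono: "s \<le> t \<Longrightarrow> cut n t \<omega> = 1 \<Longrightarrow> cut n s \<omega> = 1"
  using clock_mono[of s t \<omega>] unfolding cut_def by (auto intro: order_trans)

lemma cut_sections:
  assumes "u \<in> {0..T}"
  shows "sections_measurable (F u) u (cut n)"
proof -
  have [measurable]: "(\<lambda>w. clock (min u (snd w)) (fst w)) \<in> borel_measurable (F u \<Otimes>\<^sub>M borel)"
    by (intro clock_measurable_wrt rate_measurable_wrt diff_coeff_measurable assms)
  have "(\<lambda>w. indicator {0..u} (snd w) * of_bool (clock (min u (snd w)) (fst w) \<le> ennreal (real n)) :: real) \<in> borel_measurable (F u \<Otimes>\<^sub>M borel)"
    by measurable
  then show ?thesis unfolding sections_measurable_def cut_def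
    by (rule measurable_cong[THEN iffD1, rotated]) (auto simp: indicator_def min_def)
qed

definition cut_coeff :: "('a \<Rightarrow> real \<Rightarrow> real \<Rightarrow> real \<Rightarrow> real) \<Rightarrow> nat \<Rightarrow> 'a \<Rightarrow> real \<Rightarrow> real \<Rightarrow> ennreal" where
  "cut_coeff f n \<omega> s z = ennreal (cut n s \<omega> * \<bar>indicator {0..T} s * diff_coeff f \<omega> s z\<bar>)"

lemma cut_coeff_measurable:
  assumes f: "admissible f" and m[measurable]: "w \<in> measurable N M" "k \<in> borel_measurable N" "l \<in> borel_measurable N"
  shows "(\<lambda>y. cut_coeff f n (w y) (k y) (l y)) \<in> borel_measurable N"
proof -
  have "(\<lambda>y. (w y, k y, l y)) \<in> measurable N (M \<Otimes>\<^sub>M borel \<Otimes>\<^sub>M borel)" by measurable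
  from measurable_compose[OF this random_field_diff_coeff[OF f, unfolded random_field_def]]
  have [measurable]: "(\<lambda>y. indicator {0..T} (k y) * diff_coeff f (w y) (k y) (l y)) \<in> borel_measurable N" by simp
  show ?thesis unfolding cut_coeff_def by measurable
qed

lemmas cut_coeff_measurable_b[measurable (raw)] = cut_coeff_measurable[OF admissible_b]
lemmas cut_coeff_measurable_\<sigma>[measurable (raw)] = cut_coeff_measurable[OF admissible_\<sigma>]

lemma cut_coeff_section: "admissible f \<Longrightarrow> \<omega> \<in> space M \<Longrightarrow> (\<lambda>(s, z). cut_coeff f n \<omega> s z) \<in> borel_measurable (borel \<Otimes>\<^sub>M borel)"
  using cut_coeff_measurable[of f "\<lambda>_. \<omega>" "borel \<Otimes>\<^sub>M borel" fst snd n] by (simp add: case_prod_beta')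

lemma cut_kint_measurable:
  assumes f: "admissible f" and [measurable]: "w \<in> measurable N M" "k \<in> borel_measurable N" "l \<in> borel_measurable N" "r \<in> borel_measurable N"
  shows "(\<lambda>y. kint (cut_coeff f n (w y)) (k y) (l y) (r y)) \<in> borel_measurable N"
proof -
  note [measurable (raw)] = cut_coeff_measurable[OF f]
  show ?thesis unfolding kint_def by measurable
qed

lemmas cut_kint_measurable_b[measurable (raw)] = cut_kint_measurable[OF admissible_b]
lemmas cut_kint_measurable_\<sigma>[measurable (raw)] = cut_kint_measurable[OF admissible_\<sigma>]

lemma kint_eq_nconv:
  assumes f: "admissible f" and w: "\<omega> \<in> space M" "s \<in> {0..T}"
  shows "kint (cut_coeff f n \<omega>) t x s = ennreal (cut n s \<omega>) * nconv (diff_coeff f) t x s \<omega>"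
proof -
  note [measurable] = random_field_section[OF random_field_diff_coeff[OF f] w]
  have "kint (cut_coeff f n \<omega>) t x s = (\<integral>\<^sup>+z. ennreal (cut n s \<omega>) * ennreal \<bar>K (t - s) x z * diff_coeff f \<omega> s z\<bar> \<partial>lborel)"
    unfolding kint_def cut_coeff_def
  proof (rule nn_integral_cong)
    fix z
    show "ennreal (K (t - s) x z) * ennreal (cut n s \<omega> * \<bar>indicator {0..T} s * diff_coeff f \<omega> s z\<bar>) = ennreal (cut n s \<omega>) * ennreal \<bar>K (t - s) x z * diff_coeff f \<omega> s z\<bar>"
      using w cut_01(2)[of n s \<omega>] K_nonneg[of "t - s" x z] by (simp add: ennreal_mult[symmetric] abs_mult mult_ac)
  qed
  also have "\<dots> = ennreal (cut n s \<omega>) * nconv (diff_coeff f) t x s \<omega>"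
    unfolding nconv_def by (rule nn_integral_cmult) measurable
  finally show ?thesis .
qed

text \<open>These bounds hold for every \<omega>, hence also in mean: they stand in for the missing
  moment bound on the solutions.\<close>

lemma stopped_bounds:
  assumes w: "\<omega> \<in> space M"
  shows "(\<integral>\<^sup>+s\<in>{0..T}. (kint (cut_coeff \<sigma> n \<omega>) T 0 s)\<^sup>2 \<partial>lborel) \<le> ennreal (real n)"
    "(\<integral>\<^sup>+s\<in>{0..T}. kint (cut_coeff b n \<omega>) T 0 s \<partial>lborel) \<le> ennreal (real n)"
proof -
  have rm: "rate \<omega> \<in> borel_measurable borel"
  proof -
    have "(\<lambda>w. rate (fst w) (snd w) * indicator {0..T} (snd w)) \<in> borel_measurable (M \<Otimes>\<^sub>M lborel)"
      by (rule rate_measurable_wrt) (use T_pos random_field_diff_coeff in \<open>auto simp: random_field_def\<close>)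
    from measurable_compose[OF measurable_Pair1'[OF w] this]
    have "(\<lambda>s. rate \<omega> s * indicator {0..T} s) \<in> borel_measurable borel" by simp
    then show ?thesis by (rule measurable_cong[THEN iffD1, rotated]) (auto simp: rate_def indicator_def)
  qed
  have st: "(\<integral>\<^sup>+s\<in>{0..T}. (if clock s \<omega> \<le> ennreal (real n) then rate \<omega> s else 0) \<partial>lborel) \<le> ennreal (real n)"
    by (rule nn_integral_stopped[OF rm]) (simp add: clock_def)
  have pw: "(kint (cut_coeff \<sigma> n \<omega>) T 0 s)\<^sup>2 \<le> (if clock s \<omega> \<le> ennreal (real n) then rate \<omega> s else 0)"
    "kint (cut_coeff b n \<omega>) T 0 s \<le> (if clock s \<omega> \<le> ennreal (real n) then rate \<omega> s else 0)" if "s \<in> {0..T}" for s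
    using that unfolding kint_eq_nconv[OF admissible_\<sigma> w that] kint_eq_nconv[OF admissible_b w that] cut_def rate_def
    by auto
  show "(\<integral>\<^sup>+s\<in>{0..T}. (kint (cut_coeff \<sigma> n \<omega>) T 0 s)\<^sup>2 \<partial>lborel) \<le> ennreal (real n)"
  proof (rule order_trans[OF nn_integral_mono st])
    fix s
    show "(kint (cut_coeff \<sigma> n \<omega>) T 0 s)\<^sup>2 * indicator {0..T} s \<le> (if clock s \<omega> \<le> ennreal (real n) then rate \<omega> s else 0) * indicator {0..T} s"
      using pw(1)[of s] by (cases "s \<in> {0..T}") (auto simp del: if_split)
  qed
  show "(\<integral>\<^sup>+s\<in>{0..T}. kint (cut_coeff b n \<omega>) T 0 s \<partial>lborel) \<le> ennreal (real n)"
  proof (rule order_trans[OF nn_integral_mono st])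
    fix s
    show "kint (cut_coeff b n \<omega>) T 0 s * indicator {0..T} s \<le> (if clock s \<omega> \<le> ennreal (real n) then rate \<omega> s else 0) * indicator {0..T} s"
      using pw(2)[of s] by (cases "s \<in> {0..T}") (auto simp del: if_split)
  qed
qed

lemma finiteness:
  assumes t: "0 < t" "t \<le> T"
  shows "AE \<omega> in M. (\<integral>\<^sup>+s\<in>{0..t}. nconv (along b Y) t x s \<omega> \<partial>lborel) < \<infinity> \<and> (\<integral>\<^sup>+s\<in>{0..t}. nconv (along b Y') t x s \<omega> \<partial>lborel) < \<infinity> \<and>
    (\<integral>\<^sup>+s\<in>{0..t}. (nconv (along \<sigma> Y) t x s \<omega>)\<^sup>2 \<partial>lborel) < \<infinity> \<and> (\<integral>\<^sup>+s\<in>{0..t}. (nconv (along \<sigma> Y') t x s \<omega>)\<^sup>2 \<partial>lborel) < \<infinity>"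
  using mild_solutionD(1,2)[OF sol(1) t, of x] mild_solutionD(1,2)[OF sol(2) t, of x]
  by eventually_elim simp

lemma nconv_AE_finite:
  assumes f: "admissible f" and X: "progressive_field T F X" and w: "\<omega> \<in> space M" and t: "t \<le> T"
  shows "(\<integral>\<^sup>+s\<in>{0..t}. nconv (along f X) t x s \<omega> \<partial>lborel) < \<infinity> \<Longrightarrow> AE s in lborel. s \<in> {0..t} \<longrightarrow> nconv (along f X) t x s \<omega> < \<infinity>"
    "(\<integral>\<^sup>+s\<in>{0..t}. (nconv (along f X) t x s \<omega>)\<^sup>2 \<partial>lborel) < \<infinity> \<Longrightarrow> AE s in lborel. s \<in> {0..t} \<longrightarrow> nconv (along f X) t x s \<omega> < \<infinity>"
proof -
  note m = nconv_section_measurable'[OF random_field_coefficient[OF f X] w t, of t x]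
  show "(\<integral>\<^sup>+s\<in>{0..t}. nconv (along f X) t x s \<omega> \<partial>lborel) < \<infinity> \<Longrightarrow> AE s in lborel. s \<in> {0..t} \<longrightarrow> nconv (along f X) t x s \<omega> < \<infinity>"
    by (rule AE_finite_of_nn_integral[OF m])
  have m2: "(\<lambda>s. (nconv (along f X) t x s \<omega>)\<^sup>2 * indicator {0..t} s) \<in> borel_measurable borel"
    using borel_measurable_times_ennreal[OF m m]
    by (rule measurable_cong[THEN iffD1, rotated]) (auto simp: indicator_def power2_eq_square)
  assume "(\<integral>\<^sup>+s\<in>{0..t}. (nconv (along f X) t x s \<omega>)\<^sup>2 \<partial>lborel) < \<infinity>"
  from AE_finite_of_nn_integral[OF m2 this]
  show "AE s in lborel. s \<in> {0..t} \<longrightarrow> nconv (along f X) t x s \<omega> < \<infinity>"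
  proof eventually_elim
    case (elim s)
    show ?case
    proof (rule impI, rule ccontr)
      assume "s \<in> {0..t}" "\<not> nconv (along f X) t x s \<omega> < \<infinity>"
      then show False using elim by (simp add: less_top[symmetric] power2_eq_square ennreal_top_mult)
    qed
  qed
qed

text \<open>The integrability clauses of the two mild solutions, evaluated at the single point
  \<open>(T, 0)\<close>.\<close>

lemma clock_finite: "AE \<omega> in M. clock T \<omega> < \<infinity>"
  using finiteness[OF T_pos order_refl, of 0] AE_space
proof eventually_elim
  case (elim \<omega>)
  note w = elim(2)
  let ?n = "\<lambda>f X s. nconv (along f X) T 0 s \<omega>"
  have m: "(\<lambda>s. ?n f X s * indicator {0..T} s) \<in> borel_measurable borel" if "admissible f" "progressive_field T F X" for f X
    by (rule nconv_section_measurable[OF random_field_coefficient[OF that] w])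
  note [measurable] = m[OF admissible_b fields(1)] m[OF admissible_b fields(2)] m[OF admissible_\<sigma> fields(1)] m[OF admissible_\<sigma> fields(2)]
  have le: "nconv (diff_coeff f) T 0 s \<omega> \<le> ?n f Y s + ?n f Y' s" if "admissible f" "s \<in> {0..T}" for f s
    unfolding diff_coeff_def by (rule nconv_diff_le[OF random_field_coefficient[OF that(1) fields(1)] random_field_coefficient[OF that(1) fields(2)] w that(2)])
  have "clock T \<omega> \<le> (\<integral>\<^sup>+s. 2 * (?n \<sigma> Y s * indicator {0..T} s)\<^sup>2 + 2 * (?n \<sigma> Y' s * indicator {0..T} s)\<^sup>2
     + (?n b Y s * indicator {0..T} s + ?n b Y' s * indicator {0..T} s) \<partial>lborel)"
    unfolding clock_def
  proof (rule nn_integral_mono)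
    fix s
    show "rate \<omega> s * indicator {0..T} s \<le> 2 * (?n \<sigma> Y s * indicator {0..T} s)\<^sup>2 + 2 * (?n \<sigma> Y' s * indicator {0..T} s)\<^sup>2
     + (?n b Y s * indicator {0..T} s + ?n b Y' s * indicator {0..T} s)"
    proof (cases "s \<in> {0..T}")
      case True
      have "(nconv (diff_coeff \<sigma>) T 0 s \<omega>)\<^sup>2 \<le> (?n \<sigma> Y s + ?n \<sigma> Y' s)\<^sup>2" by (intro power_mono le admissible_\<sigma> True) simp
      also have "\<dots> \<le> 2 * (?n \<sigma> Y s)\<^sup>2 + 2 * (?n \<sigma> Y' s)\<^sup>2" by (rule ennreal_square_add_le)
      finally show ?thesis using True le[OF admissible_b True] unfolding rate_def by (simp add: add_mono)
    qed simp
  qed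
  also have "\<dots> = 2 * (\<integral>\<^sup>+s. (?n \<sigma> Y s * indicator {0..T} s)\<^sup>2 \<partial>lborel) + 2 * (\<integral>\<^sup>+s. (?n \<sigma> Y' s * indicator {0..T} s)\<^sup>2 \<partial>lborel)
    + ((\<integral>\<^sup>+s\<in>{0..T}. ?n b Y s \<partial>lborel) + (\<integral>\<^sup>+s\<in>{0..T}. ?n b Y' s \<partial>lborel))"
    by (simp add: nn_integral_add nn_integral_cmult)
  also have "(\<integral>\<^sup>+s. (?n \<sigma> Y s * indicator {0..T} s)\<^sup>2 \<partial>lborel) = (\<integral>\<^sup>+s\<in>{0..T}. (?n \<sigma> Y s)\<^sup>2 \<partial>lborel)"
    by (intro nn_integral_cong) (auto simp: indicator_def)
  also have "(\<integral>\<^sup>+s. (?n \<sigma> Y' s * indicator {0..T} s)\<^sup>2 \<partial>lborel) = (\<integral>\<^sup>+s\<in>{0..T}. (?n \<sigma> Y' s)\<^sup>2 \<partial>lborel)"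
    by (intro nn_integral_cong) (auto simp: indicator_def)
  finally have "clock T \<omega> \<le> 2 * (\<integral>\<^sup>+s\<in>{0..T}. (?n \<sigma> Y s)\<^sup>2 \<partial>lborel) + 2 * (\<integral>\<^sup>+s\<in>{0..T}. (?n \<sigma> Y' s)\<^sup>2 \<partial>lborel)
    + ((\<integral>\<^sup>+s\<in>{0..T}. ?n b Y s \<partial>lborel) + (\<integral>\<^sup>+s\<in>{0..T}. ?n b Y' s \<partial>lborel))" .
  also have "\<dots> < \<infinity>" using elim(1) by (simp add: ennreal_mult_less_top)
  finally show ?case .
qed

definition cut_dist :: "nat \<Rightarrow> 'a \<Rightarrow> real \<Rightarrow> real \<Rightarrow> ennreal" where
  "cut_dist n \<omega> s z = ennreal (cut n s \<omega> * (indicator {0..T} s * (Y s z \<omega> - Y' s z \<omega>))\<^sup>2)"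

lemma cut_dist_measurable[measurable (raw)]:
  assumes [measurable]: "w \<in> measurable N M" "k \<in> borel_measurable N" "l \<in> borel_measurable N"
  shows "(\<lambda>y. cut_dist n (w y) (k y) (l y)) \<in> borel_measurable N"
proof -
  have "(\<lambda>y. (w y, k y, l y)) \<in> measurable N (M \<Otimes>\<^sub>M borel \<Otimes>\<^sub>M borel)" by measurable
  from measurable_compose[OF this random_field_diff[OF random_field_progressive[OF fields(1)] random_field_progressive[OF fields(2)], unfolded random_field_def]]
  have [measurable]: "(\<lambda>y. indicator {0..T} (k y) * (Y (k y) (l y) (w y) - Y' (k y) (l y) (w y))) \<in> borel_measurable N" by simp
  show ?thesis unfolding cut_dist_def by measurable
qed

text \<open>On the event that the clock has not passed \<open>n\<close> by time \<open>t\<close>,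
  the cut is inactive on all of \<open>{0..t}\<close>, so the stopped integrand is the true
  difference there and \<open>ito_localized_bound\<close> applies with this event. Off the event the
  left-hand side vanishes. The constant 4 is 2 from the squared triangle inequality times 2 from
  locality.\<close>

lemma cut_dist_le:
  assumes t: "0 < t" "t \<le> T"
  shows "(\<integral>\<^sup>+\<omega>. cut_dist n \<omega> t x \<partial>M) \<le> 2 * (\<integral>\<^sup>+\<omega>. (\<integral>\<^sup>+s\<in>{0..T}. kint (cut_coeff b n \<omega>) t x s \<partial>lborel)\<^sup>2 \<partial>M)
     + 4 * (\<integral>\<^sup>+\<omega>. (\<integral>\<^sup>+s\<in>{0..T}. (kint (cut_coeff \<sigma> n \<omega>) t x s)\<^sup>2 \<partial>lborel) \<partial>M)"
proof -
  have t': "0 \<le> t" "t \<in> {0..T}" using t by auto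
  obtain J where J: "has_ito_integral M F B t (conv \<sigma> Y t x) J" "AE \<omega> in M. Y t x \<omega> = initial t x + drift Y t x \<omega> + J \<omega>"
    using mild_solutionD(3)[OF sol(1) t] by blast
  obtain J' where J': "has_ito_integral M F B t (conv \<sigma> Y' t x) J'" "AE \<omega> in M. Y' t x \<omega> = initial t x + drift Y' t x \<omega> + J' \<omega>"
    using mild_solutionD(3)[OF sol(2) t] by blast
  have Jm[measurable]: "J \<in> borel_measurable M" "J' \<in> borel_measurable M" using J(1) J'(1) unfolding has_ito_integral_def by auto
  define A where "A = {\<omega>\<in>space M. cut n t \<omega> = 1}"
  have A[measurable]: "A \<in> events" unfolding A_def by measurable
  let ?N = "\<lambda>s \<omega>. cut n s \<omega> * (conv \<sigma> Y t x s \<omega> - conv \<sigma> Y' t x s \<omega>)"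
  have prog: "progressive t F ?N"
    unfolding progressive_sections[OF t(2)]
  proof
    fix u assume u: "u \<in> {0..t}"
    have "sections_measurable (F u) u (conv \<sigma> Y t x)" "sections_measurable (F u) u (conv \<sigma> Y' t x)"
      using progressive_family_progressive[OF conv_family[OF admissible_\<sigma> fields(1)] t(2), of x, unfolded progressive_sections[OF t(2)]]
        progressive_family_progressive[OF conv_family[OF admissible_\<sigma> fields(2)] t(2), of x, unfolded progressive_sections[OF t(2)]] u by auto
    from sections_measurable_diff[OF this] cut_sections[of u n]
    have "(\<lambda>w. (case w of (\<omega>, s) \<Rightarrow> indicator {0..u} s * cut n s \<omega>) * (case w of (\<omega>, s) \<Rightarrow> indicator {0..u} s * (conv \<sigma> Y t x s \<omega> - conv \<sigma> Y' t x s \<omega>))) \<in> borel_measurable (F u \<Otimes>\<^sub>M borel)"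
      using u t unfolding sections_measurable_def by (intro borel_measurable_times) auto
    then show "sections_measurable (F u) u ?N" unfolding sections_measurable_def
      by (rule measurable_cong[THEN iffD1, rotated]) (auto simp: indicator_def)
  qed
  have ito: "(\<integral>\<^sup>+\<omega>\<in>A. ennreal ((J \<omega> - J' \<omega>)\<^sup>2) \<partial>M) \<le> 2 * (\<integral>\<^sup>+\<omega>. energy t (\<lambda>s. ?N s \<omega>) \<partial>M)"
    by (rule ito_localized_bound[OF t J(1) J'(1) A prog])
       (auto simp: A_def intro!: AE_I2 dest: cut_antimono[rotated])
  also have "\<dots> \<le> 2 * (\<integral>\<^sup>+\<omega>. (\<integral>\<^sup>+s\<in>{0..T}. (kint (cut_coeff \<sigma> n \<omega>) t x s)\<^sup>2 \<partial>lborel) \<partial>M)"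
  proof (rule mult_left_mono[OF nn_integral_mono_AE])
    show "AE \<omega> in M. energy t (\<lambda>s. ?N s \<omega>) \<le> (\<integral>\<^sup>+s\<in>{0..T}. (kint (cut_coeff \<sigma> n \<omega>) t x s)\<^sup>2 \<partial>lborel)"
      using finiteness[OF t, of x] AE_space
    proof eventually_elim
      case (elim \<omega>)
      note w = elim(2)
      have "AE s in lborel. s \<in> {0..t} \<longrightarrow> nconv (along \<sigma> Y) t x s \<omega> < \<infinity>" "AE s in lborel. s \<in> {0..t} \<longrightarrow> nconv (along \<sigma> Y') t x s \<omega> < \<infinity>"
        using elim(1) nconv_AE_finite(2)[OF admissible_\<sigma> fields(1) w t(2)] nconv_AE_finite(2)[OF admissible_\<sigma> fields(2) w t(2)] by blast+
      then show ?case unfolding energy_def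
      proof (intro nn_integral_mono_AE, eventually_elim)
        case (elim s)
        show ?case
        proof (cases "s \<in> {0..t}")
          case True
          then have s: "s \<in> {0..T}" using t by simp
          have "ennreal \<bar>conv \<sigma> Y t x s \<omega> - conv \<sigma> Y' t x s \<omega>\<bar> \<le> nconv (diff_coeff \<sigma>) t x s \<omega>"
            unfolding diff_coeff_def by (rule conv_diff_le[OF admissible_\<sigma> fields w s]) (use elim True in auto)
          then have "ennreal (cut n s \<omega>) * ennreal \<bar>conv \<sigma> Y t x s \<omega> - conv \<sigma> Y' t x s \<omega>\<bar> \<le> kint (cut_coeff \<sigma> n \<omega>) t x s"
            unfolding kint_eq_nconv[OF admissible_\<sigma> w s] by (rule mult_left_mono) simp
          then have "ennreal \<bar>?N s \<omega>\<bar> \<le> kint (cut_coeff \<sigma> n \<omega>) t x s"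
            using cut_01(2)[of n s \<omega>] by (simp add: ennreal_mult[symmetric] abs_mult)
          then have "(ennreal \<bar>?N s \<omega>\<bar>)\<^sup>2 \<le> (kint (cut_coeff \<sigma> n \<omega>) t x s)\<^sup>2" by (rule power_mono) simp
          moreover have "(ennreal \<bar>?N s \<omega>\<bar>)\<^sup>2 = ennreal ((?N s \<omega>)\<^sup>2)" by (simp add: ennreal_power)
          ultimately show ?thesis using True s by simp
        qed simp
      qed
    qed
  qed simp
  finally have term2: "(\<integral>\<^sup>+\<omega>\<in>A. ennreal ((J \<omega> - J' \<omega>)\<^sup>2) \<partial>M) \<le> 2 * (\<integral>\<^sup>+\<omega>. (\<integral>\<^sup>+s\<in>{0..T}. (kint (cut_coeff \<sigma> n \<omega>) t x s)\<^sup>2 \<partial>lborel) \<partial>M)" .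
  have "(\<integral>\<^sup>+\<omega>. cut_dist n \<omega> t x \<partial>M) \<le> (\<integral>\<^sup>+\<omega>. 2 * (\<integral>\<^sup>+s\<in>{0..T}. kint (cut_coeff b n \<omega>) t x s \<partial>lborel)\<^sup>2 + 2 * (ennreal ((J \<omega> - J' \<omega>)\<^sup>2) * indicator A \<omega>) \<partial>M)"
  proof (rule nn_integral_mono_AE)
    show "AE \<omega> in M. cut_dist n \<omega> t x \<le> 2 * (\<integral>\<^sup>+s\<in>{0..T}. kint (cut_coeff b n \<omega>) t x s \<partial>lborel)\<^sup>2 + 2 * (ennreal ((J \<omega> - J' \<omega>)\<^sup>2) * indicator A \<omega>)"
      using finiteness[OF t, of x] J(2) J'(2) AE_space
    proof eventually_elim
      case (elim \<omega>)
      note w = elim(4)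
      show ?case
      proof (cases "cut n t \<omega> = 1")
        case True
        then have wA: "\<omega> \<in> A" using w unfolding A_def by simp
        have "ennreal \<bar>drift Y t x \<omega> - drift Y' t x \<omega>\<bar> \<le> (\<integral>\<^sup>+s\<in>{0..t}. nconv (diff_coeff b) t x s \<omega> \<partial>lborel)"
          unfolding diff_coeff_def
          by (rule drift_diff_le[OF fields t'(1) t(2) w])
             (use elim(1) nconv_AE_finite(1)[OF admissible_b fields(1) w t(2)] nconv_AE_finite(1)[OF admissible_b fields(2) w t(2)] in blast)+
        also have "\<dots> \<le> (\<integral>\<^sup>+s\<in>{0..T}. kint (cut_coeff b n \<omega>) t x s \<partial>lborel)"
        proof (rule nn_integral_mono)
          fix s
          show "nconv (diff_coeff b) t x s \<omega> * indicator {0..t} s \<le> kint (cut_coeff b n \<omega>) t x s * indicator {0..T} s"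
          proof (cases "s \<in> {0..t}")
            case s: True
            then have "s \<in> {0..T}" "cut n s \<omega> = 1" using t cut_antimono[OF _ True] by auto
            then show ?thesis using s kint_eq_nconv[OF admissible_b w] by simp
          qed simp
        qed
        finally have d: "ennreal \<bar>drift Y t x \<omega> - drift Y' t x \<omega>\<bar> \<le> (\<integral>\<^sup>+s\<in>{0..T}. kint (cut_coeff b n \<omega>) t x s \<partial>lborel)" .
        have "cut_dist n \<omega> t x = ennreal (((drift Y t x \<omega> - drift Y' t x \<omega>) - (J' \<omega> - J \<omega>))\<^sup>2)"
          unfolding cut_dist_def using True t' elim by (simp add: algebra_simps)
        also have "\<dots> \<le> 2 * ennreal ((drift Y t x \<omega> - drift Y' t x \<omega>)\<^sup>2) + 2 * ennreal ((J' \<omega> - J \<omega>)\<^sup>2)" by (rule ennreal_square_diff_le)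
        also have "\<dots> \<le> 2 * (\<integral>\<^sup>+s\<in>{0..T}. kint (cut_coeff b n \<omega>) t x s \<partial>lborel)\<^sup>2 + 2 * ennreal ((J' \<omega> - J \<omega>)\<^sup>2)"
        proof -
          have "ennreal ((drift Y t x \<omega> - drift Y' t x \<omega>)\<^sup>2) = (ennreal \<bar>drift Y t x \<omega> - drift Y' t x \<omega>\<bar>)\<^sup>2" by (simp add: ennreal_power)
          also have "\<dots> \<le> (\<integral>\<^sup>+s\<in>{0..T}. kint (cut_coeff b n \<omega>) t x s \<partial>lborel)\<^sup>2" by (intro power_mono d) simp
          finally show ?thesis by (intro add_mono mult_left_mono) auto
        qed
        finally show ?thesis using wA by (simp add: power2_commute)
      next
        case False
        then show ?thesis using cut_01(1)[of n t \<omega>] by (simp add: cut_dist_def)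
      qed
    qed
  qed
  also have "\<dots> = 2 * (\<integral>\<^sup>+\<omega>. (\<integral>\<^sup>+s\<in>{0..T}. kint (cut_coeff b n \<omega>) t x s \<partial>lborel)\<^sup>2 \<partial>M) + 2 * (\<integral>\<^sup>+\<omega>\<in>A. ennreal ((J \<omega> - J' \<omega>)\<^sup>2) \<partial>M)"
    by (subst nn_integral_add, measurable) (simp add: nn_integral_cmult)
  also have "\<dots> \<le> 2 * (\<integral>\<^sup>+\<omega>. (\<integral>\<^sup>+s\<in>{0..T}. kint (cut_coeff b n \<omega>) t x s \<partial>lborel)\<^sup>2 \<partial>M) + 2 * (2 * (\<integral>\<^sup>+\<omega>. (\<integral>\<^sup>+s\<in>{0..T}. (kint (cut_coeff \<sigma> n \<omega>) t x s)\<^sup>2 \<partial>lborel) \<partial>M))"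
    by (intro add_mono order_refl mult_left_mono term2) simp
  finally show ?thesis by (simp add: mult.assoc[symmetric])
qed


section \<open>Weighted second moment of the stopped difference\<close>

interpretation omega_lborel: pair_sigma_finite M "lborel :: real measure" ..

lemma weighted_expectation:
  assumes [measurable]: "(\<lambda>w. g (fst w) (snd w)) \<in> borel_measurable (M \<Otimes>\<^sub>M borel)"
  shows "(\<integral>\<^sup>+x. ennreal (weight T t x) * (\<integral>\<^sup>+\<omega>. g \<omega> x \<partial>M) \<partial>lborel) = (\<integral>\<^sup>+\<omega>. \<integral>\<^sup>+x. ennreal (weight T t x) * g \<omega> x \<partial>lborel \<partial>M)"
proof -
  have g[measurable (raw)]: "(\<lambda>y. g (p y) (q y)) \<in> borel_measurable N" if "p \<in> measurable N M" "q \<in> borel_measurable N" for p q N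
    using measurable_compose[OF measurable_Pair[OF that] assms] by simp
  have "(\<integral>\<^sup>+x. ennreal (weight T t x) * (\<integral>\<^sup>+\<omega>. g \<omega> x \<partial>M) \<partial>lborel) = (\<integral>\<^sup>+x. \<integral>\<^sup>+\<omega>. ennreal (weight T t x) * g \<omega> x \<partial>M \<partial>lborel)"
    by (intro nn_integral_cong nn_integral_cmult[symmetric]) measurable
  also have "\<dots> = (\<integral>\<^sup>+\<omega>. \<integral>\<^sup>+x. ennreal (weight T t x) * g \<omega> x \<partial>lborel \<partial>M)"
    by (rule omega_lborel.Fubini') measurable
  finally show ?thesis .
qed

lemma time_weighted_expectation:
  assumes g: "(\<lambda>w. g (fst w) (fst (snd w)) (snd (snd w))) \<in> borel_measurable (M \<Otimes>\<^sub>M borel \<Otimes>\<^sub>M borel)"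
  shows "(\<integral>\<^sup>+t. indicator {0<..<r} t * (\<integral>\<^sup>+x. ennreal (weight T t x) * (\<integral>\<^sup>+\<omega>. g \<omega> t x \<partial>M) \<partial>lborel) \<partial>lborel)
    = (\<integral>\<^sup>+\<omega>. \<integral>\<^sup>+t. indicator {0<..<r} t * (\<integral>\<^sup>+x. ennreal (weight T t x) * g \<omega> t x \<partial>lborel) \<partial>lborel \<partial>M)"
proof -
  have m[measurable (raw)]: "(\<lambda>y. g (p y) (q y) (r y)) \<in> borel_measurable N" if "p \<in> measurable N M" "q \<in> borel_measurable N" "r \<in> borel_measurable N" for p q r N
    using measurable_compose[OF measurable_Pair[OF that(1) measurable_Pair[OF that(2,3)]] g] by simp
  have "(\<integral>\<^sup>+t. indicator {0<..<r} t * (\<integral>\<^sup>+x. ennreal (weight T t x) * (\<integral>\<^sup>+\<omega>. g \<omega> t x \<partial>M) \<partial>lborel) \<partial>lborel)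
    = (\<integral>\<^sup>+t. indicator {0<..<r} t * (\<integral>\<^sup>+\<omega>. \<integral>\<^sup>+x. ennreal (weight T t x) * g \<omega> t x \<partial>lborel \<partial>M) \<partial>lborel)"
    by (subst weighted_expectation) simp_all
  also have "\<dots> = (\<integral>\<^sup>+t. \<integral>\<^sup>+\<omega>. indicator {0<..<r} t * (\<integral>\<^sup>+x. ennreal (weight T t x) * g \<omega> t x \<partial>lborel) \<partial>M \<partial>lborel)"
    by (intro nn_integral_cong nn_integral_cmult[symmetric]) measurable
  also have "\<dots> = (\<integral>\<^sup>+\<omega>. \<integral>\<^sup>+t. indicator {0<..<r} t * (\<integral>\<^sup>+x. ennreal (weight T t x) * g \<omega> t x \<partial>lborel) \<partial>lborel \<partial>M)"
    by (rule omega_lborel.Fubini') measurable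
  finally show ?thesis .
qed

definition total :: "nat \<Rightarrow> real \<Rightarrow> ennreal" where
  "total n t = (\<integral>\<^sup>+x. ennreal (weight T t x) * (\<integral>\<^sup>+\<omega>. cut_dist n \<omega> t x \<partial>M) \<partial>lborel)"

lemma total_measurable[measurable]: "total n \<in> borel_measurable borel"
  unfolding total_def by measurable

lemma total_le:
  assumes t: "0 < t" "t \<le> T"
  shows "total n t \<le> 2 * (\<integral>\<^sup>+x. ennreal (weight T t x) * (\<integral>\<^sup>+\<omega>. (\<integral>\<^sup>+s\<in>{0..T}. kint (cut_coeff b n \<omega>) t x s \<partial>lborel)\<^sup>2 \<partial>M) \<partial>lborel)
     + 4 * (\<integral>\<^sup>+x. ennreal (weight T t x) * (\<integral>\<^sup>+\<omega>. (\<integral>\<^sup>+s\<in>{0..T}. (kint (cut_coeff \<sigma> n \<omega>) t x s)\<^sup>2 \<partial>lborel) \<partial>M) \<partial>lborel)"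
proof -
  let ?A = "\<lambda>x. \<integral>\<^sup>+\<omega>. (\<integral>\<^sup>+s\<in>{0..T}. kint (cut_coeff b n \<omega>) t x s \<partial>lborel)\<^sup>2 \<partial>M"
  let ?B = "\<lambda>x. \<integral>\<^sup>+\<omega>. (\<integral>\<^sup>+s\<in>{0..T}. (kint (cut_coeff \<sigma> n \<omega>) t x s)\<^sup>2 \<partial>lborel) \<partial>M"
  have "total n t \<le> (\<integral>\<^sup>+x. ennreal (weight T t x) * (2 * ?A x + 4 * ?B x) \<partial>lborel)"
    unfolding total_def by (intro nn_integral_mono mult_left_mono cut_dist_le t) simp
  also have "\<dots> = (\<integral>\<^sup>+x. 2 * (ennreal (weight T t x) * ?A x) + 4 * (ennreal (weight T t x) * ?B x) \<partial>lborel)"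
    by (simp add: distrib_left mult.left_commute)
  also have "\<dots> = (\<integral>\<^sup>+x. 2 * (ennreal (weight T t x) * ?A x) \<partial>lborel) + (\<integral>\<^sup>+x. 4 * (ennreal (weight T t x) * ?B x) \<partial>lborel)"
    by (rule nn_integral_add) measurable
  also have "(\<integral>\<^sup>+x. 2 * (ennreal (weight T t x) * ?A x) \<partial>lborel) = 2 * (\<integral>\<^sup>+x. ennreal (weight T t x) * ?A x \<partial>lborel)"
    by (rule nn_integral_cmult) measurable
  also have "(\<integral>\<^sup>+x. 4 * (ennreal (weight T t x) * ?B x) \<partial>lborel) = 4 * (\<integral>\<^sup>+x. ennreal (weight T t x) * ?B x \<partial>lborel)"
    by (rule nn_integral_cmult) measurable
  finally show ?thesis .
qed

text \<open>The a priori bound that Gronwall requires. It is a bound on the time integral only,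
  because integration over \<open>t\<close> is what removes the singularity of the pair estimate;
  pathwise, the right-hand sides are the stopped quantities at \<open>(T, 0)\<close>.\<close>

lemma total_integral_finite: "(\<integral>\<^sup>+t. indicator {0<..<T} t * total n t \<partial>lborel) < \<infinity>"
proof -
  let ?A = "\<lambda>\<omega> t x. (\<integral>\<^sup>+s\<in>{0..T}. kint (cut_coeff b n \<omega>) t x s \<partial>lborel)\<^sup>2"
  let ?B = "\<lambda>\<omega> t x. \<integral>\<^sup>+s\<in>{0..T}. (kint (cut_coeff \<sigma> n \<omega>) t x s)\<^sup>2 \<partial>lborel"
  let ?c = "ennreal (2 * sqrt T) * pair_const T"
  let ?E = "\<lambda>g. \<integral>\<^sup>+t. indicator {0<..<T} t * (\<integral>\<^sup>+x. ennreal (weight T t x) * (\<integral>\<^sup>+\<omega>. g \<omega> t x \<partial>M) \<partial>lborel) \<partial>lborel"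
  have A: "?E ?A \<le> ?c * (ennreal (real n))\<^sup>2"
  proof -
    have "?E ?A = (\<integral>\<^sup>+\<omega>. \<integral>\<^sup>+t. indicator {0<..<T} t * (\<integral>\<^sup>+x. ennreal (weight T t x) * ?A \<omega> t x \<partial>lborel) \<partial>lborel \<partial>M)"
      by (rule time_weighted_expectation) measurable
    also have "\<dots> \<le> (\<integral>\<^sup>+\<omega>. ?c * (ennreal (real n))\<^sup>2 \<partial>M)"
    proof (rule nn_integral_mono)
      fix \<omega> assume w: "\<omega> \<in> space M"
      have "(\<integral>\<^sup>+t. indicator {0<..<T} t * (\<integral>\<^sup>+x. ennreal (weight T t x) * ?A \<omega> t x \<partial>lborel) \<partial>lborel)
         \<le> ?c * (\<integral>\<^sup>+s\<in>{0..T}. kint (cut_coeff b n \<omega>) T 0 s \<partial>lborel)\<^sup>2"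
        by (rule kint_integral_bound[OF cut_coeff_section[OF admissible_b w]])
      also have "\<dots> \<le> ?c * (ennreal (real n))\<^sup>2"
        by (intro mult_left_mono power_mono stopped_bounds(2) w) simp_all
      finally show "(\<integral>\<^sup>+t. indicator {0<..<T} t * (\<integral>\<^sup>+x. ennreal (weight T t x) * ?A \<omega> t x \<partial>lborel) \<partial>lborel) \<le> ?c * (ennreal (real n))\<^sup>2" .
    qed
    finally show ?thesis by (simp add: emeasure_space_1)
  qed
  have B: "?E ?B \<le> ?c * ennreal (real n)"
  proof -
    have "?E ?B = (\<integral>\<^sup>+\<omega>. \<integral>\<^sup>+t. indicator {0<..<T} t * (\<integral>\<^sup>+x. ennreal (weight T t x) * ?B \<omega> t x \<partial>lborel) \<partial>lborel \<partial>M)"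
      by (rule time_weighted_expectation) measurable
    also have "\<dots> \<le> (\<integral>\<^sup>+\<omega>. ?c * ennreal (real n) \<partial>M)"
    proof (rule nn_integral_mono)
      fix \<omega> assume w: "\<omega> \<in> space M"
      have "(\<integral>\<^sup>+t. indicator {0<..<T} t * (\<integral>\<^sup>+x. ennreal (weight T t x) * ?B \<omega> t x \<partial>lborel) \<partial>lborel)
         \<le> ?c * (\<integral>\<^sup>+s\<in>{0..T}. (kint (cut_coeff \<sigma> n \<omega>) T 0 s)\<^sup>2 \<partial>lborel)"
        by (rule kint_square_bound[OF cut_coeff_section[OF admissible_\<sigma> w]])
      also have "\<dots> \<le> ?c * ennreal (real n)"
        by (intro mult_left_mono stopped_bounds(1) w) simp_all
      finally show "(\<integral>\<^sup>+t. indicator {0<..<T} t * (\<integral>\<^sup>+x. ennreal (weight T t x) * ?B \<omega> t x \<partial>lborel) \<partial>lborel) \<le> ?c * ennreal (real n)" .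
    qed
    finally show ?thesis by (simp add: emeasure_space_1)
  qed
  let ?a = "\<lambda>t. indicator {0<..<T} t * (\<integral>\<^sup>+x. ennreal (weight T t x) * (\<integral>\<^sup>+\<omega>. ?A \<omega> t x \<partial>M) \<partial>lborel)"
  let ?b = "\<lambda>t. indicator {0<..<T} t * (\<integral>\<^sup>+x. ennreal (weight T t x) * (\<integral>\<^sup>+\<omega>. ?B \<omega> t x \<partial>M) \<partial>lborel)"
  have "(\<integral>\<^sup>+t. indicator {0<..<T} t * total n t \<partial>lborel) \<le> (\<integral>\<^sup>+t. 2 * ?a t + 4 * ?b t \<partial>lborel)"
  proof (rule nn_integral_mono)
    fix t show "indicator {0<..<T} t * total n t \<le> 2 * ?a t + 4 * ?b t"
      using total_le[of t n] by (cases "t \<in> {0<..<T}") simp_all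
  qed
  also have "\<dots> = (\<integral>\<^sup>+t. 2 * ?a t \<partial>lborel) + (\<integral>\<^sup>+t. 4 * ?b t \<partial>lborel)"
    by (rule nn_integral_add) measurable
  also have "(\<integral>\<^sup>+t. 2 * ?a t \<partial>lborel) = 2 * ?E ?A" by (rule nn_integral_cmult) measurable
  also have "(\<integral>\<^sup>+t. 4 * ?b t \<partial>lborel) = 4 * ?E ?B" by (rule nn_integral_cmult) measurable
  also have "2 * ?E ?A + 4 * ?E ?B \<le> 2 * (?c * (ennreal (real n))\<^sup>2) + 4 * (?c * ennreal (real n))"
    by (intro add_mono mult_left_mono A B) simp_all
  also have "\<dots> < \<infinity>"
    unfolding pair_const_def by (simp add: ennreal_mult_less_top ennreal_power)
  finally show ?thesis .
qed

text \<open>The cut takes only the values 0 and 1 and so equals its square; hence the Lipschitz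
  bound returns the same stopped distance and the estimate can be iterated.\<close>

lemma weighted_kint_le:
  assumes f: "admissible f" and w: "\<omega> \<in> space M" and s: "0 < s" "s < t" "t < T"
  shows "(\<integral>\<^sup>+x. ennreal (weight T t x) * (kint (cut_coeff f n \<omega>) t x s)\<^sup>2 \<partial>lborel)
    \<le> ennreal (smoothing_const * L\<^sup>2) * (\<integral>\<^sup>+z. ennreal (weight T s z) * cut_dist n \<omega> s z \<partial>lborel)"
proof -
  have sT: "s \<in> {0..T}" using s by simp
  note [measurable] = random_field_section[OF random_field_diff_coeff[OF f] w sT]
  let ?N = "\<lambda>z. cut n s \<omega> * diff_coeff f \<omega> s z"
  have k: "kint (cut_coeff f n \<omega>) t x s = (\<integral>\<^sup>+z. ennreal \<bar>K (t - s) x z * ?N z\<bar> \<partial>lborel)" for x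
    unfolding kint_def cut_coeff_def
  proof (rule nn_integral_cong)
    fix z
    show "ennreal (K (t - s) x z) * ennreal (cut n s \<omega> * \<bar>indicator {0..T} s * diff_coeff f \<omega> s z\<bar>) = ennreal \<bar>K (t - s) x z * ?N z\<bar>"
      using sT cut_01(2)[of n s \<omega>] K_nonneg[of "t - s" x z] by (simp add: ennreal_mult[symmetric] abs_mult)
  qed
  have "(\<integral>\<^sup>+x. ennreal (weight T t x) * (kint (cut_coeff f n \<omega>) t x s)\<^sup>2 \<partial>lborel)
     \<le> ennreal smoothing_const * (\<integral>\<^sup>+z. ennreal (weight T s z) * ennreal ((?N z)\<^sup>2) \<partial>lborel)"
    unfolding k by (rule weighted_smoothing[OF s(2,3)]) measurable
  also have "\<dots> \<le> ennreal smoothing_const * (\<integral>\<^sup>+z. ennreal (L\<^sup>2) * (ennreal (weight T s z) * cut_dist n \<omega> s z) \<partial>lborel)"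
  proof (rule mult_left_mono[OF nn_integral_mono])
    fix z
    have "(cut n s \<omega>)\<^sup>2 = cut n s \<omega>" using cut_01(1)[of n s \<omega>] by auto
    then have "(?N z)\<^sup>2 = cut n s \<omega> * (diff_coeff f \<omega> s z)\<^sup>2" by (simp add: power_mult_distrib)
    also have "\<dots> \<le> cut n s \<omega> * (L\<^sup>2 * (Y s z \<omega> - Y' s z \<omega>)\<^sup>2)"
      by (intro mult_left_mono diff_coeff_Lipschitz f w sT cut_01)
    also have "\<dots> = L\<^sup>2 * (cut n s \<omega> * (indicator {0..T} s * (Y s z \<omega> - Y' s z \<omega>))\<^sup>2)" using sT by simp
    finally have "ennreal ((?N z)\<^sup>2) \<le> ennreal (L\<^sup>2) * cut_dist n \<omega> s z"
      unfolding cut_dist_def using cut_01(2)[of n s \<omega>] by (simp add: ennreal_mult[symmetric] ennreal_leI)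
    then have "ennreal (weight T s z) * ennreal ((?N z)\<^sup>2) \<le> ennreal (weight T s z) * (ennreal (L\<^sup>2) * cut_dist n \<omega> s z)"
      by (rule mult_left_mono) simp
    then show "ennreal (weight T s z) * ennreal ((?N z)\<^sup>2) \<le> ennreal (L\<^sup>2) * (ennreal (weight T s z) * cut_dist n \<omega> s z)"
      by (simp only: mult.left_commute)
  qed simp
  also have "\<dots> = ennreal smoothing_const * (ennreal (L\<^sup>2) * (\<integral>\<^sup>+z. ennreal (weight T s z) * cut_dist n \<omega> s z \<partial>lborel))"
    using w by (subst nn_integral_cmult) simp_all
  also have "\<dots> = ennreal (smoothing_const * L\<^sup>2) * (\<integral>\<^sup>+z. ennreal (weight T s z) * cut_dist n \<omega> s z \<partial>lborel)"
    using smoothing_const_pos by (simp add: ennreal_mult mult.assoc)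
  finally show ?thesis .
qed

lemma weighted_kint_time_le:
  assumes f: "admissible f" and t: "0 < t" "t < T"
  shows "(\<integral>\<^sup>+x. ennreal (weight T t x) * (\<integral>\<^sup>+\<omega>. (\<integral>\<^sup>+s\<in>{0..T}. (kint (cut_coeff f n \<omega>) t x s)\<^sup>2 \<partial>lborel) \<partial>M) \<partial>lborel)
    \<le> ennreal (smoothing_const * L\<^sup>2) * (\<integral>\<^sup>+s. indicator {0<..<t} s * total n s \<partial>lborel)"
proof -
  note [measurable (raw)] = cut_kint_measurable[OF f]
  let ?c = "ennreal (smoothing_const * L\<^sup>2)"
  have "(\<integral>\<^sup>+x. ennreal (weight T t x) * (\<integral>\<^sup>+\<omega>. (\<integral>\<^sup>+s\<in>{0..T}. (kint (cut_coeff f n \<omega>) t x s)\<^sup>2 \<partial>lborel) \<partial>M) \<partial>lborel)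
     = (\<integral>\<^sup>+\<omega>. \<integral>\<^sup>+x. ennreal (weight T t x) * (\<integral>\<^sup>+s\<in>{0..T}. (kint (cut_coeff f n \<omega>) t x s)\<^sup>2 \<partial>lborel) \<partial>lborel \<partial>M)"
    by (rule weighted_expectation) measurable
  also have "\<dots> \<le> (\<integral>\<^sup>+\<omega>. \<integral>\<^sup>+s. ?c * (indicator {0<..<t} s * (\<integral>\<^sup>+z. ennreal (weight T s z) * cut_dist n \<omega> s z \<partial>lborel)) \<partial>lborel \<partial>M)"
  proof (rule nn_integral_mono)
    fix \<omega> assume w[measurable]: "\<omega> \<in> space M"
    have "(\<integral>\<^sup>+x. ennreal (weight T t x) * (\<integral>\<^sup>+s\<in>{0..T}. (kint (cut_coeff f n \<omega>) t x s)\<^sup>2 \<partial>lborel) \<partial>lborel)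
       = (\<integral>\<^sup>+x. \<integral>\<^sup>+s. ennreal (weight T t x) * ((kint (cut_coeff f n \<omega>) t x s)\<^sup>2 * indicator {0..T} s) \<partial>lborel \<partial>lborel)"
      by (intro nn_integral_cong nn_integral_cmult[symmetric]) measurable
    also have "\<dots> = (\<integral>\<^sup>+s. \<integral>\<^sup>+x. ennreal (weight T t x) * ((kint (cut_coeff f n \<omega>) t x s)\<^sup>2 * indicator {0..T} s) \<partial>lborel \<partial>lborel)"
      by (rule lborel_pair.Fubini') measurable
    also have "\<dots> \<le> (\<integral>\<^sup>+s. ?c * (indicator {0<..<t} s * (\<integral>\<^sup>+z. ennreal (weight T s z) * cut_dist n \<omega> s z \<partial>lborel)) \<partial>lborel)"
    proof (rule nn_integral_mono_AE)
      \<comment> \<open>\<open>weighted_kint_le\<close> is stated for positive \<open>s\<close>; for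
        \<open>s >= t\<close> the kernel vanishes.\<close>
      have "AE s in lborel. s \<noteq> (0::real)" by (rule AE_lborel_singleton)
      then show "AE s in lborel. (\<integral>\<^sup>+x. ennreal (weight T t x) * ((kint (cut_coeff f n \<omega>) t x s)\<^sup>2 * indicator {0..T} s) \<partial>lborel)
          \<le> ?c * (indicator {0<..<t} s * (\<integral>\<^sup>+z. ennreal (weight T s z) * cut_dist n \<omega> s z \<partial>lborel))"
      proof eventually_elim
        case (elim s)
        consider "s < 0" | "0 < s" "s < t" | "t \<le> s" using elim by linarith
        then show ?case
        proof cases
          case 2
          then show ?thesis using weighted_kint_le[OF f w 2 t(2), of n] t by simp
        qed (simp_all add: kint_zero)
      qed
    qed
    finally show "(\<integral>\<^sup>+x. ennreal (weight T t x) * (\<integral>\<^sup>+s\<in>{0..T}. (kint (cut_coeff f n \<omega>) t x s)\<^sup>2 \<partial>lborel) \<partial>lborel)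
       \<le> (\<integral>\<^sup>+s. ?c * (indicator {0<..<t} s * (\<integral>\<^sup>+z. ennreal (weight T s z) * cut_dist n \<omega> s z \<partial>lborel)) \<partial>lborel)" .
  qed
  also have "\<dots> = (\<integral>\<^sup>+\<omega>. ?c * (\<integral>\<^sup>+s. indicator {0<..<t} s * (\<integral>\<^sup>+z. ennreal (weight T s z) * cut_dist n \<omega> s z \<partial>lborel) \<partial>lborel) \<partial>M)"
    by (intro nn_integral_cong nn_integral_cmult) measurable
  also have "\<dots> = ?c * (\<integral>\<^sup>+\<omega>. \<integral>\<^sup>+s. indicator {0<..<t} s * (\<integral>\<^sup>+z. ennreal (weight T s z) * cut_dist n \<omega> s z \<partial>lborel) \<partial>lborel \<partial>M)"
    by (rule nn_integral_cmult) measurable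
  also have "(\<integral>\<^sup>+\<omega>. \<integral>\<^sup>+s. indicator {0<..<t} s * (\<integral>\<^sup>+z. ennreal (weight T s z) * cut_dist n \<omega> s z \<partial>lborel) \<partial>lborel \<partial>M)
     = (\<integral>\<^sup>+s. indicator {0<..<t} s * total n s \<partial>lborel)"
    unfolding total_def by (rule time_weighted_expectation[symmetric]) measurable
  finally show ?thesis .
qed

text \<open>In the constant, \<open>2 * T\<close> belongs to the drift, with \<open>T\<close> from
  Cauchy-Schwarz in time, and 4 to the Ito integral.\<close>

lemma total_Gronwall:
  assumes t: "0 < t" "t < T"
  shows "total n t \<le> ennreal ((2 * T + 4) * (smoothing_const * L\<^sup>2)) * (\<integral>\<^sup>+s. indicator {0<..<t} s * total n s \<partial>lborel)"
proof -
  let ?I = "\<integral>\<^sup>+s. indicator {0<..<t} s * total n s \<partial>lborel"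
  let ?c = "smoothing_const * L\<^sup>2"
  let ?A = "\<lambda>f x. \<integral>\<^sup>+\<omega>. (\<integral>\<^sup>+s\<in>{0..T}. (kint (cut_coeff f n \<omega>) t x s)\<^sup>2 \<partial>lborel) \<partial>M"
  have c: "?c \<ge> 0" using smoothing_const_pos by simp
  have "(\<integral>\<^sup>+x. ennreal (weight T t x) * (\<integral>\<^sup>+\<omega>. (\<integral>\<^sup>+s\<in>{0..T}. kint (cut_coeff b n \<omega>) t x s \<partial>lborel)\<^sup>2 \<partial>M) \<partial>lborel)
     \<le> (\<integral>\<^sup>+x. ennreal (weight T t x) * (\<integral>\<^sup>+\<omega>. ennreal T * (\<integral>\<^sup>+s\<in>{0..T}. (kint (cut_coeff b n \<omega>) t x s)\<^sup>2 \<partial>lborel) \<partial>M) \<partial>lborel)"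
    using T_pos by (intro nn_integral_mono mult_left_mono nn_integral_time_square) simp_all
  also have "\<dots> = (\<integral>\<^sup>+x. ennreal T * (ennreal (weight T t x) * ?A b x) \<partial>lborel)"
    by (subst nn_integral_cmult) (simp_all add: mult.left_commute)
  also have "\<dots> = ennreal T * (\<integral>\<^sup>+x. ennreal (weight T t x) * ?A b x \<partial>lborel)"
    by (rule nn_integral_cmult) measurable
  also have "\<dots> \<le> ennreal T * (ennreal ?c * ?I)"
    by (intro mult_left_mono weighted_kint_time_le admissible_b t) simp
  finally have 1: "(\<integral>\<^sup>+x. ennreal (weight T t x) * (\<integral>\<^sup>+\<omega>. (\<integral>\<^sup>+s\<in>{0..T}. kint (cut_coeff b n \<omega>) t x s \<partial>lborel)\<^sup>2 \<partial>M) \<partial>lborel) \<le> ennreal T * (ennreal ?c * ?I)" .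
  have "total n t \<le> 2 * (ennreal T * (ennreal ?c * ?I)) + 4 * (ennreal ?c * ?I)"
    by (rule order_trans[OF total_le[OF t(1) less_imp_le[OF t(2)]]])
       (intro add_mono mult_left_mono 1 weighted_kint_time_le admissible_\<sigma> t, simp_all)
  also have "\<dots> = ennreal ((2 * T + 4) * ?c) * ?I"
  proof -
    have "2 * (ennreal T * (ennreal a * I)) + 4 * (ennreal a * I) = ennreal ((2 * T + 4) * a) * I" if "a \<ge> 0" for a I
    proof -
      have "ennreal ((2 * T + 4) * a) = (2 * ennreal T + 4) * ennreal a"
        using that T_pos by (simp add: ennreal_mult ennreal_plus)
      then show ?thesis by (simp add: distrib_right mult.assoc)
    qed
    from this[OF c] show ?thesis .
  qed
  finally show ?thesis .
qed

lemma total_integral_zero: "(\<integral>\<^sup>+t. indicator {0<..<T} t * total n t \<partial>lborel) = 0"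
proof (rule nn_integral_Gronwall[OF total_measurable _ total_integral_finite])
  show "0 \<le> (2 * T + 4) * (smoothing_const * L\<^sup>2)" using T_pos smoothing_const_pos by simp
qed (rule total_Gronwall)

text \<open>For almost every \<omega> the clock stays finite up to \<open>T\<close>, so some level
  \<open>n\<close>, depending on \<omega>, leaves the solutions uncut; countably many levels share
  one null set.\<close>

lemma fields_AE_equal:
  "AE \<omega> in M. AE s in lborel. s \<in> {0<..<T} \<longrightarrow> (AE z in lborel. Y s z \<omega> = Y' s z \<omega>)"
proof -
  let ?Z = "\<lambda>n \<omega>. \<integral>\<^sup>+t. indicator {0<..<T} t * (\<integral>\<^sup>+x. ennreal (weight T t x) * cut_dist n \<omega> t x \<partial>lborel) \<partial>lborel"
  have "AE \<omega> in M. ?Z n \<omega> = 0" for n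
  proof -
    have "(\<integral>\<^sup>+\<omega>. ?Z n \<omega> \<partial>M) = (\<integral>\<^sup>+t. indicator {0<..<T} t * total n t \<partial>lborel)"
      unfolding total_def by (rule time_weighted_expectation[symmetric]) measurable
    then have "(\<integral>\<^sup>+\<omega>. ?Z n \<omega> \<partial>M) = 0" using total_integral_zero by simp
    then show ?thesis by (subst (asm) nn_integral_0_iff_AE) simp_all
  qed
  then have "AE \<omega> in M. \<forall>n. ?Z n \<omega> = 0" by (subst AE_all_countable) simp
  with clock_finite AE_space show ?thesis
  proof eventually_elim
    case (elim \<omega>)
    note w[measurable] = elim(2)
    obtain c where c: "clock T \<omega> = ennreal c" "0 \<le> c" using elim(1) by (cases "clock T \<omega>") auto
    obtain n where n: "c \<le> real n" using real_arch_simple by blast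
    have cut: "cut n s \<omega> = 1" if "s \<in> {0<..<T}" for s
    proof -
      have "clock s \<omega> \<le> clock T \<omega>" using that by (intro clock_mono) simp
      also have "\<dots> \<le> ennreal (real n)" unfolding c(1) by (rule ennreal_leI[OF n])
      finally show ?thesis unfolding cut_def by simp
    qed
    have "?Z n \<omega> = 0" using elim(3) by blast
    then have "AE t in lborel. indicator {0<..<T} t * (\<integral>\<^sup>+x. ennreal (weight T t x) * cut_dist n \<omega> t x \<partial>lborel) = 0"
      by (subst (asm) nn_integral_0_iff_AE) simp_all
    then show ?case
    proof eventually_elim
      case (elim s)
      show ?case
      proof
        assume s: "s \<in> {0<..<T}"
        then have "(\<integral>\<^sup>+x. ennreal (weight T s x) * cut_dist n \<omega> s x \<partial>lborel) = 0" using elim by simp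
        then have "AE x in lborel. ennreal (weight T s x) * cut_dist n \<omega> s x = 0"
          by (subst (asm) nn_integral_0_iff_AE) simp_all
        then show "AE z in lborel. Y s z \<omega> = Y' s z \<omega>"
        proof eventually_elim
          case (elim z)
          then have "cut_dist n \<omega> s z = 0" using weight_pos[of T s z] by simp
          then have "(Y s z \<omega> - Y' s z \<omega>)\<^sup>2 \<le> 0" unfolding cut_dist_def cut[OF s] using s by simp
          then show ?case by simp
        qed
      qed
    qed
  qed
qed

lemma conv_AE_equal:
  assumes f: "admissible f" and w: "\<omega> \<in> space M" and t: "t \<le> T"
    and eq: "AE s in lborel. s \<in> {0<..<T} \<longrightarrow> (AE z in lborel. Y s z \<omega> = Y' s z \<omega>)"
  shows "AE s in lborel. s \<in> {0..t} \<longrightarrow> conv f Y t x s \<omega> = conv f Y' t x s \<omega>"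
  \<comment> \<open>The fields are compared on the open time interval only, so both end points are
    dropped.\<close>
  using eq AE_lborel_singleton[of 0] AE_lborel_singleton[of T]
proof eventually_elim
  case (elim s)
  show ?case
  proof
    assume "s \<in> {0..t}"
    then have s: "s \<in> {0<..<T}" "s \<in> {0..T}" using elim t by auto
    note [measurable] = random_field_section[OF random_field_coefficient[OF f fields(1)] w s(2)]
      random_field_section[OF random_field_coefficient[OF f fields(2)] w s(2)]
    have "AE z in lborel. Y s z \<omega> = Y' s z \<omega>" using elim s by blast
    then have "AE z in lborel. K (t - s) x z * f \<omega> s z (Y s z \<omega>) = K (t - s) x z * f \<omega> s z (Y' s z \<omega>)"
      by eventually_elim simp
    then show "conv f Y t x s \<omega> = conv f Y' t x s \<omega>"
      unfolding conv_def by (intro integral_cong_AE) measurable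
  qed
qed

text \<open>Equality for almost every \<open>(s, z)\<close> makes the integrands of both equations
  agree for almost every \<open>s\<close>. Locality with the zero process as \<open>K\<close> then
  gives equal Ito integrals, so the two solutions agree at the prescribed point
  \<open>(t, x)\<close>.\<close>

lemma equal_at:
  assumes t: "0 < t" "t \<le> T"
  shows "AE \<omega> in M. Y t x \<omega> = Y' t x \<omega>"
proof -
  have t0: "0 \<le> t" using t by simp
  obtain J where J: "has_ito_integral M F B t (conv \<sigma> Y t x) J" "AE \<omega> in M. Y t x \<omega> = initial t x + drift Y t x \<omega> + J \<omega>"
    using mild_solutionD(3)[OF sol(1) t] by blast
  obtain J' where J': "has_ito_integral M F B t (conv \<sigma> Y' t x) J'" "AE \<omega> in M. Y' t x \<omega> = initial t x + drift Y' t x \<omega> + J' \<omega>"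
    using mild_solutionD(3)[OF sol(2) t] by blast
  have [measurable]: "J \<in> borel_measurable M" "J' \<in> borel_measurable M" using J(1) J'(1) unfolding has_ito_integral_def by auto
  \<comment> \<open>Locality asks for an event, so the exceptional set is enclosed in a measurable
    null set and \<open>A\<close> is its complement.\<close>
  let ?P = "\<lambda>\<omega>. AE s in lborel. s \<in> {0<..<T} \<longrightarrow> (AE z in lborel. Y s z \<omega> = Y' s z \<omega>)"
  obtain N where N: "{\<omega>\<in>space M. \<not> ?P \<omega>} \<subseteq> N" "emeasure M N = 0" "N \<in> events"
    using AE_E[OF fields_AE_equal] by blast
  define A where "A = space M - N"
  have A[measurable]: "A \<in> events" unfolding A_def using N by simp
  have P: "?P \<omega>" "\<omega> \<in> space M" if "\<omega> \<in> A" for \<omega> using that N(1) unfolding A_def by blast+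
  have "AE \<omega> in M. \<omega> \<notin> N" using N by (intro AE_not_in) auto
  then have inA: "AE \<omega> in M. \<omega> \<in> A" using AE_space by eventually_elim (simp add: A_def)
  have "(\<integral>\<^sup>+\<omega>\<in>A. ennreal ((J \<omega> - J' \<omega>)\<^sup>2) \<partial>M) \<le> 2 * (\<integral>\<^sup>+\<omega>. energy t (\<lambda>s. 0) \<partial>M)"
  proof (rule ito_localized_bound[OF t J(1) J'(1) A])
    show "progressive t F (\<lambda>s \<omega>. 0)" unfolding progressive_def by simp
    fix \<omega> assume wA: "\<omega> \<in> A"
    from conv_AE_equal[OF admissible_\<sigma> _ t(2), OF P(2)[OF wA] P(1)[OF wA], of x]
    show "AE s in lborel. s \<in> {0..t} \<longrightarrow> 0 = conv \<sigma> Y t x s \<omega> - conv \<sigma> Y' t x s \<omega>"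
      by (simp only: eq_commute[of 0] right_minus_eq)
  qed
  then have "(\<integral>\<^sup>+\<omega>\<in>A. ennreal ((J \<omega> - J' \<omega>)\<^sup>2) \<partial>M) = 0" by (simp add: energy_def)
  then have "AE \<omega> in M. ennreal ((J \<omega> - J' \<omega>)\<^sup>2) * indicator A \<omega> = 0"
    by (subst (asm) nn_integral_0_iff_AE) simp_all
  with inA J(2) J'(2) show ?thesis
  proof eventually_elim
    case (elim \<omega>)
    note w = P[OF elim(1)]
    have "drift Y t x \<omega> = drift Y' t x \<omega>"
      unfolding drift_def set_lebesgue_integral_def
    proof (rule integral_cong_AE)
      show "(\<lambda>s. indicator {0..t} s *\<^sub>R conv b Y t x s \<omega>) \<in> borel_measurable lborel" "(\<lambda>s. indicator {0..t} s *\<^sub>R conv b Y' t x s \<omega>) \<in> borel_measurable lborel"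
        using sections_measurable_section[OF conv_sections[OF admissible_b fields(1) t0 t(2)] w(2), of x]
          sections_measurable_section[OF conv_sections[OF admissible_b fields(2) t0 t(2)] w(2), of x] by simp_all
      show "AE s in lborel. indicator {0..t} s *\<^sub>R conv b Y t x s \<omega> = indicator {0..t} s *\<^sub>R conv b Y' t x s \<omega>"
        using conv_AE_equal[OF admissible_b w(2) t(2) w(1), of x] by eventually_elim (simp add: indicator_def)
    qed
    moreover have "ennreal ((J \<omega> - J' \<omega>)\<^sup>2) = 0" using elim(1,4) by simp
    then have "(J \<omega> - J' \<omega>)\<^sup>2 \<le> 0" by simp
    then have "J \<omega> = J' \<omega>" by simp
    ultimately show ?case using elim(2,3) by simp
  qed
qed

theorem modifications: "modifications M T Y Y'"
  unfolding modifications_def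
proof (intro ballI allI)
  fix t x assume "t \<in> {0..T}"
  then consider "t = 0" | "0 < t" "t \<le> T" by fastforce
  then show "AE \<omega> in M. Y t x \<omega> = Y' t x \<omega>"
  proof cases
    case 1
    have "AE \<omega> in M. Y 0 x \<omega> = \<xi> x" "AE \<omega> in M. Y' 0 x \<omega> = \<xi> x"
      using sol unfolding mild_solution_def by blast+
    then show ?thesis unfolding 1 by eventually_elim simp
  qed (rule equal_at)
qed

end

theorem theorem12:
  fixes M :: "'a measure" and T a1 a2 \<rho>1 \<rho>2 L :: real
    and F :: "real \<Rightarrow> 'a measure" and B :: "real \<Rightarrow> 'a \<Rightarrow> real"
    and b \<sigma> :: "'a \<Rightarrow> real \<Rightarrow> real \<Rightarrow> real \<Rightarrow> real" and \<xi> :: "real \<Rightarrow> real"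
  assumes "T > 0"
    and "prob_space M" and "usual_filtration M T F" and "brownian_motion M T F B"
    and "a1 > 0" and "a2 > 0" and "\<rho>1 > 0" and "\<rho>2 > 0"
    and "progressive_coefficient T F b" and "progressive_coefficient T F \<sigma>"
    and "L > 0"
    and "\<And>\<omega> t x y y'. \<lbrakk>\<omega> \<in> space M; t \<in> {0..T}\<rbrakk> \<Longrightarrow>
           max \<bar>b \<omega> t x y - b \<omega> t x y'\<bar> \<bar>\<sigma> \<omega> t x y - \<sigma> \<omega> t x y'\<bar> \<le> L * \<bar>y - y'\<bar>"
    and "\<And>\<omega> t x y. \<lbrakk>\<omega> \<in> space M; t \<in> {0..T}\<rbrakk> \<Longrightarrow>
           max \<bar>b \<omega> t x y\<bar> \<bar>\<sigma> \<omega> t x y\<bar> \<le> L * (1 + \<bar>y\<bar>)"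
    and "\<xi> \<in> borel_measurable borel" and "bounded (range \<xi>)"
  shows "(\<exists>Y. mild_solution M T F B a1 a2 \<rho>1 \<rho>2 b \<sigma> \<xi> Y) \<and>
    (\<forall>Y Y'. mild_solution M T F B a1 a2 \<rho>1 \<rho>2 b \<sigma> \<xi> Y \<longrightarrow>
       mild_solution M T F B a1 a2 \<rho>1 \<rho>2 b \<sigma> \<xi> Y' \<longrightarrow> modifications M T Y Y')"
proof -
  interpret spde M T F B a1 a2 \<rho>1 \<rho>2 b \<sigma> \<xi> L
    using assms by (intro spde.intro brownian_setup.intro brownian_setup_axioms.intro diffusion_kernel.intro spde_axioms.intro)
  show ?thesis
  proof (intro conjI allI impI)
    show "\<exists>Y. mild_solution M T F B a1 a2 \<rho>1 \<rho>2 b \<sigma> \<xi> Y" by (rule mild_solution_exists)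
    fix Y Y'
    assume "mild_solution M T F B a1 a2 \<rho>1 \<rho>2 b \<sigma> \<xi> Y" "mild_solution M T F B a1 a2 \<rho>1 \<rho>2 b \<sigma> \<xi> Y'"
    then interpret two_solutions M T F B a1 a2 \<rho>1 \<rho>2 b \<sigma> \<xi> L Y Y' by unfold_locales
    show "modifications M T Y Y'" by (rule modifications)
  qed
qed

end
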